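(* Let $1<p<\infty$, $1\le q\le\infty$, $\varepsilon>0$ and $\vartheta>1$. Let $\mu$ be a complex measure on $\mathbb{R}$ such that $$L_1(\lambda):=\int_{\mathbb{R}}e^{\vartheta\,\log\left(\langle\lambda|\xi|^{1+\varepsilon}\rangle_*\right)\,\log\log\left(\langle\lambda|\xi|^{1+\varepsilon}\rangle_*\right)}\,d|\mu|(\xi)<\infty$$ for every $\lambda>0$, and such that $\mu(\mathbb{R})=0$. Let $f$ be the inverse Fourier transform of $\mu$, i.e. $f(t)=\frac{1}{\sqrt{2\pi}}\int_{\mathbb{R}}e^{i\xi t}\,d\mu(\xi)$ for $t\in\mathbb{R}$. Then $f\in C^\infty(\mathbb{R})$ and the composition operator $T_f:u\mapsto f\circ u$ maps $\mathcal{UM}^{p,q}(\mathbb{R}^n)$ into $\mathcal{UM}^{p,q}(\mathbb{R}^n)$; that is, $f\circ u\in\mathcal{UM}^{p,q}(\mathbb{R}^n)$ for every real-valued $u\in\mathcal{UM}^{p,q}(\mathbb{R}^n)$.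
   Context: Write $\langle x\rangle_*:=(e^{2e}+|x|^2)^{1/2}$ for $x\in\mathbb{R}^n$ or $x\in\mathbb{R}$ ($|\cdot|$ Euclidean norm). The Fourier transform is $\mathcal{F}f(\xi)=(2\pi)^{-n/2}\int_{\mathbb{R}^n}f(x)e^{-ix\cdot\xi}\,dx$, extended to tempered distributions. Fix a function $\rho\in C_0^\infty(\mathbb{R}^n)$ with $\rho:\mathbb{R}^n\to[0,1]$, $\operatorname{supp}\rho\subset[-1,1]^n$ and $\rho=1$ on $[-\tfrac12,\tfrac12]^n$. For $k\in\mathbb{Z}^n$ put $\rho_k(\xi)=\rho(\xi-k)$, $\sigma_k=\rho_k\big(\sum_{m\in\mathbb{Z}^n}\rho_m\big)^{-1}$ and $\Box_k f=\mathcal{F}^{-1}(\sigma_k\mathcal{F}f)$. For $1\le p,q\le\infty$ the space $\mathcal{UM}^{p,q}(\mathbb{R}^n)$ is the set of all $f\in L^p(\mathbb{R}^n)$ (complex-valued functions) with $$\|f\|_{\mathcal{UM}^{p,q}}=\Big(\sum_{k\in\mathbb{Z}^n}e^{q\log\langle k\rangle_*\log\log\langle k\rangle_*}\|\Box_kf\|_{L^p}^q\Big)^{1/q}<\infty$$ (supremum over $k$ if $q=\infty$). $|\mu|$ denotes the total variation measure of $\mu$. *)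

theory Defs
  imports "HOL-Probability.Probability"
begin

section \<open>Smooth functions and Schwartz functions\<close>

text \<open>
  \<open>iterated_partial [b\<^sub>1, \<dots>, b\<^sub>m] f\<close> is the iterated directional derivative of \<open>f\<close> along
  \<open>b\<^sub>1, \<dots>, b\<^sub>m\<close>, with \<open>b\<^sub>m\<close> applied first.  It is only used for lists of standard basis vectors.
\<close>

definition partial_derivative ::
    "'a::euclidean_space \<Rightarrow> ('a \<Rightarrow> 'b::real_normed_vector) \<Rightarrow> 'a \<Rightarrow> 'b" where
  "partial_derivative b f x = frechet_derivative f (at x) b"

definition iterated_partial ::
    "'a::euclidean_space list \<Rightarrow> ('a \<Rightarrow> 'b::real_normed_vector) \<Rightarrow> 'a \<Rightarrow> 'b" where
  "iterated_partial bs f = foldr partial_derivative bs f"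

definition C_infinity :: "('a::euclidean_space \<Rightarrow> 'b::real_normed_vector) \<Rightarrow> bool" where
  "C_infinity f \<longleftrightarrow>
     (\<forall>bs. set bs \<subseteq> Basis \<longrightarrow> (\<forall>x. iterated_partial bs f differentiable (at x)))"

definition schwartz :: "('a::euclidean_space \<Rightarrow> complex) set" where
  "schwartz = {\<phi>. C_infinity \<phi> \<and>
     (\<forall>bs m. set bs \<subseteq> Basis \<longrightarrow>
        bounded (range (\<lambda>x. norm x ^ m *\<^sub>R iterated_partial bs \<phi> x)))}"


section \<open>Fourier transform of Schwartz functions and of tempered distributions\<close>

definition fourier :: "('a::euclidean_space \<Rightarrow> complex) \<Rightarrow> 'a \<Rightarrow> complex" where
  "fourier \<phi> \<xi> = of_real ((2 * pi) powr (- real DIM('a) / 2)) *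
     (LINT x|lebesgue. \<phi> x * exp (- (\<i> * of_real (x \<bullet> \<xi>))))"

definition inv_fourier :: "('a::euclidean_space \<Rightarrow> complex) \<Rightarrow> 'a \<Rightarrow> complex" where
  "inv_fourier \<phi> x = of_real ((2 * pi) powr (- real DIM('a) / 2)) *
     (LINT \<xi>|lebesgue. \<phi> \<xi> * exp (\<i> * of_real (x \<bullet> \<xi>)))"

text \<open>
  A tempered distribution is represented by a functional on functions of which only the values on
  \<^term>\<open>schwartz\<close> are meaningful.  The pairing is bilinear (no complex conjugation), and the
  operations below are the usual ones defined by transposition.
\<close>

type_synonym 'a distribution = "('a \<Rightarrow> complex) \<Rightarrow> complex"

definition dist_of_fun :: "('a::euclidean_space \<Rightarrow> complex) \<Rightarrow> 'a distribution" where
  "dist_of_fun g = (\<lambda>\<phi>. LINT x|lebesgue. g x * \<phi> x)"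

definition dist_fourier :: "'a::euclidean_space distribution \<Rightarrow> 'a distribution" where
  "dist_fourier T = (\<lambda>\<phi>. T (fourier \<phi>))"

definition dist_inv_fourier :: "'a::euclidean_space distribution \<Rightarrow> 'a distribution" where
  "dist_inv_fourier T = (\<lambda>\<phi>. T (inv_fourier \<phi>))"

definition dist_mult ::
    "('a::euclidean_space \<Rightarrow> complex) \<Rightarrow> 'a distribution \<Rightarrow> 'a distribution" where
  "dist_mult s T = (\<lambda>\<phi>. T (\<lambda>x. s x * \<phi> x))"


section \<open>Lebesgue spaces\<close>

definition ennpowr :: "ennreal \<Rightarrow> real \<Rightarrow> ennreal" where
  "ennpowr x a = (if x = \<infinity> then \<infinity> else ennreal (enn2real x powr a))"  (* for a > 0 *)

definition Lp_norm :: "ennreal \<Rightarrow> ('a::euclidean_space \<Rightarrow> complex) \<Rightarrow> ennreal" where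
  "Lp_norm p g =
     (if p = \<infinity> then esssup lebesgue (\<lambda>x. ennreal (norm (g x)))
      else ennpowr (\<integral>\<^sup>+x. ennreal (norm (g x) powr enn2real p) \<partial>lebesgue) (1 / enn2real p))"

text \<open>Elements of the space are functions; no quotient by a.e. equality is taken.\<close>

definition Lp_space :: "ennreal \<Rightarrow> ('a::euclidean_space \<Rightarrow> complex) set" where
  "Lp_space p = {g \<in> borel_measurable lebesgue. Lp_norm p g < \<infinity>}"

text \<open>
  The norm of a tempered distribution is the \<open>L\<^sup>p\<close> norm of the function representing it.  That
  function is unique up to null sets, so the infimum ranges over at most one value; it is
  \<open>\<infinity>\<close> if the distribution is not represented by any \<open>L\<^sup>p\<close> function.
\<close>

definition dist_Lp_norm :: "ennreal \<Rightarrow> 'a::euclidean_space distribution \<Rightarrow> ennreal" where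
  "dist_Lp_norm p T = Inf {Lp_norm p g |g. g \<in> Lp_space p \<and> (\<forall>\<phi>\<in>schwartz. dist_of_fun g \<phi> = T \<phi>)}"


section \<open>The spaces UM\<close>

definition jap :: "'a::real_normed_vector \<Rightarrow> real" where
  "jap x = sqrt (exp (2 * exp 1) + (norm x)\<^sup>2)"

definition um_weight :: "real \<Rightarrow> 'a::real_normed_vector \<Rightarrow> real" where
  "um_weight s x = exp (s * ln (jap x) * ln (ln (jap x)))"

definition lattice_point :: "int ^ 'n \<Rightarrow> real ^ 'n" where
  "lattice_point k = (\<chi> i. of_int (k $ i))"

definition window :: "(real ^ 'n \<Rightarrow> real) \<Rightarrow> bool" where
  "window \<rho> \<longleftrightarrow>
     C_infinity \<rho> \<and>
     (\<forall>\<xi>. 0 \<le> \<rho> \<xi> \<and> \<rho> \<xi> \<le> 1) \<and>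
     closure {\<xi>. \<rho> \<xi> \<noteq> 0} \<subseteq> {\<xi>. \<forall>i. -1 \<le> \<xi> $ i \<and> \<xi> $ i \<le> 1} \<and>
     (\<forall>\<xi>. (\<forall>i. -1/2 \<le> \<xi> $ i \<and> \<xi> $ i \<le> 1/2) \<longrightarrow> \<rho> \<xi> = 1)"

text \<open>For each \<open>\<xi>\<close> only finitely many terms of the sum below are nonzero.\<close>

definition sigma :: "(real ^ 'n \<Rightarrow> real) \<Rightarrow> int ^ 'n \<Rightarrow> real ^ 'n \<Rightarrow> real" where
  "sigma \<rho> k \<xi> = \<rho> (\<xi> - lattice_point k) / (\<Sum>\<^sub>\<infinity>m\<in>UNIV. \<rho> (\<xi> - lattice_point m))"

definition box_op ::
    "(real ^ 'n \<Rightarrow> real) \<Rightarrow> int ^ 'n \<Rightarrow> (real ^ 'n \<Rightarrow> complex) \<Rightarrow> (real ^ 'n) distribution" where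
  "box_op \<rho> k g =
     dist_inv_fourier (dist_mult (\<lambda>\<xi>. of_real (sigma \<rho> k \<xi>)) (dist_fourier (dist_of_fun g)))"

definition UM_norm ::
    "(real ^ 'n \<Rightarrow> real) \<Rightarrow> ennreal \<Rightarrow> ennreal \<Rightarrow> (real ^ 'n \<Rightarrow> complex) \<Rightarrow> ennreal" where
  "UM_norm \<rho> p q g =
     (if q = \<infinity>
      then (SUP k. ennreal (um_weight 1 (lattice_point k)) * dist_Lp_norm p (box_op \<rho> k g))
      else ennpowr
        (\<Sum>\<^sub>\<infinity>k\<in>UNIV. ennreal (um_weight (enn2real q) (lattice_point k)) *
                   ennpowr (dist_Lp_norm p (box_op \<rho> k g)) (enn2real q))
        (1 / enn2real q))"

definition UM_space ::
    "(real ^ 'n \<Rightarrow> real) \<Rightarrow> ennreal \<Rightarrow> ennreal \<Rightarrow> (real ^ 'n \<Rightarrow> complex) set" where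
  "UM_space \<rho> p q = {g \<in> Lp_space p. UM_norm \<rho> p q g < \<infinity>}"


section \<open>Complex measures\<close>

text \<open>
  The measure argument \<open>M\<close> only provides the \<open>\<sigma>\<close>-algebra.
\<close>

definition complex_measure :: "'a measure \<Rightarrow> ('a set \<Rightarrow> complex) \<Rightarrow> bool" where
  "complex_measure M \<mu> \<longleftrightarrow>
     (\<forall>A::nat \<Rightarrow> 'a set. range A \<subseteq> sets M \<longrightarrow> disjoint_family A \<longrightarrow>
        (\<lambda>i. \<mu> (A i)) sums \<mu> (\<Union>i. A i))"

definition total_variation :: "'a measure \<Rightarrow> ('a set \<Rightarrow> complex) \<Rightarrow> 'a measure" where
  "total_variation M \<mu> = measure_of (space M) (sets M)
     (\<lambda>A. SUP E\<in>{E::nat \<Rightarrow> 'a set. range E \<subseteq> sets M \<and> disjoint_family E \<and> (\<Union>i. E i) = A}.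
            \<Sum>i. ennreal (norm (\<mu> (E i))))"

text \<open>
  The positive variation of a finite signed measure \<open>\<nu>\<close>, that is, the positive part of its Jordan
  decomposition; the negative part is the positive variation of \<open>-\<nu>\<close>.  Note that
  \<^const>\<open>ennreal\<close> maps negative numbers to 0.
\<close>

definition pos_variation :: "'a measure \<Rightarrow> ('a set \<Rightarrow> real) \<Rightarrow> 'a measure" where
  "pos_variation M \<nu> = measure_of (space M) (sets M)
     (\<lambda>A. SUP B\<in>{B \<in> sets M. B \<subseteq> A}. ennreal (\<nu> B))"

definition signed_integral :: "'a measure \<Rightarrow> ('a set \<Rightarrow> real) \<Rightarrow> ('a \<Rightarrow> complex) \<Rightarrow> complex" where
  "signed_integral M \<nu> g =
     (LINT x|pos_variation M \<nu>. g x) - (LINT x|pos_variation M (\<lambda>A. - \<nu> A). g x)"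

definition complex_measure_integral ::
    "'a measure \<Rightarrow> ('a set \<Rightarrow> complex) \<Rightarrow> ('a \<Rightarrow> complex) \<Rightarrow> complex" where
  "complex_measure_integral M \<mu> g =
     signed_integral M (\<lambda>A. Re (\<mu> A)) g + \<i> * signed_integral M (\<lambda>A. Im (\<mu> A)) g"

definition inv_fourier_measure :: "(real set \<Rightarrow> complex) \<Rightarrow> real \<Rightarrow> complex" where
  "inv_fourier_measure \<mu> t =
     of_real (1 / sqrt (2 * pi)) *
     complex_measure_integral borel \<mu> (\<lambda>\<xi>. exp (\<i> * of_real (\<xi> * t)))"

end

theory Submission
  imports Defs "HOL-Real_Asymp.Real_Asymp"
begin

text \<open>
  By the Jordan decomposition of \<open>\<mu>\<close> and \<open>\<mu> \<real> = 0\<close>, \<open>f t\<close> is a linear combination of the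
  integrals of \<open>exp (i \<xi> t) - 1\<close> against positive measures, so Minkowski's inequality reduces
  everything to a bound of the box pieces of \<open>exp (i \<xi> u) - 1\<close> that grows in \<open>\<xi>\<close> at most like
  the weight integrated in the hypothesis.

  Write \<open>u\<close> as the sum of its band-limited pieces. By Bernstein's inequality and the weight, which
  grows faster than any polynomial, the pieces are uniformly summable against any power of the
  frequency. A telescoping sum writes \<open>exp (i \<xi> u) - 1\<close> as a sum over \<open>k\<close> of a product of the
  piece \<open>z k\<close> with factors built from the pieces of lower frequency. Such factors are measured by
  the multiplicative gauge \<open>exp (QQ (a + r) - QQ a) (1 + r) ^ N\<close> of the frequency radius \<open>r\<close>;
  concavity of the exponent makes the gauge submultiplicative, and it is only of polynomial growth
  for \<open>r \<le> a\<close>, which is the case for frequencies below that of \<open>z k\<close>. Split the lower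
  frequencies at radius about \<open>\<bar>\<xi>\<bar> powr \<epsilon>\<close>. Above it the pieces are so small that the exponential
  series costs a constant. Below it, the exponential is bounded because \<open>u\<close> is real, and its
  series can be cut after about \<open>\<bar>\<xi>\<bar>\<close> terms; the remaining polynomial has frequency
  radius about \<open>\<bar>\<xi>\<bar> powr (1 + \<epsilon>)\<close>.
\<close>

section \<open>The weights\<close>

text \<open>The obstacle is the size of the exponential series: estimated term by term in an algebra
  norm it is exponential in \<bar>\<xi>\<bar>, whereas the hypothesis grants less than exp
  (\<bar>\<xi>\<bar> powr s) for every s > 0. The untruncated series is thus affordable only where
  its argument has bounded cost. One splitting radius has to serve both halves: the pieces beyond it
  must have total cost below 1 / \<bar>\<xi>\<bar>, and its product with the truncation order is the
  frequency of the polynomial, hence the argument of the weight. Any \<epsilon> > 0 suffices,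
  because moments of order 1 / \<epsilon> of the pieces are available. The excess of \<theta> over 1
  is a spare power of the weight that absorbs all polynomial factors. The power of 1 + r in the
  gauge is there for the sum over the lattice: it buys the summable weight \<open>cw\<close>, so
  that the pieces of f \<circ> u are dominated by a convolution of those of u with a summable
  sequence, which acts on every l^q. Spectra are expressed through vanishing filters
  (\<open>spec\<close>, \<open>freq_le\<close>) instead of supports of distributions; the link to
  the distributional box operators is \<open>dist_Lp_norm_box_op\<close>.\<close>

definition QQ :: "real \<Rightarrow> real" where "QQ x = ln x * ln (ln x)"

abbreviation "ee \<equiv> exp (exp 1) :: real"

lemma um_weight_QQ: "um_weight s x = exp (s * QQ (jap x))"
  by (simp add: um_weight_def QQ_def)

text \<open>The constant exp (2e) in \<open>jap\<close> is made for this: above \<open>ee\<close>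
  the double logarithm is at least 1, so that \<open>QQ\<close> is nonnegative, increasing and
  concave on a half-line that contains all values of \<open>jap\<close>.\<close>

lemma jap_ge_ee: "ee \<le> jap x"
proof -
  have "sqrt (exp (2 * exp 1)) \<le> jap x"
    unfolding jap_def by (intro real_sqrt_le_mono) simp
  moreover have "exp (2 * exp 1 :: real) = (exp (exp 1))^2"
    by (simp add: exp_double)
  ultimately show ?thesis by simp
qed

lemma jap_ge_norm: "norm x \<le> jap x"
  unfolding jap_def by (rule real_le_rsqrt) simp

lemma jap_add_le: "jap (x + y) \<le> jap x + norm y"
proof -
  let ?E = "exp (2 * exp 1) :: real"
  have "(jap (x + y))^2 \<le> (jap x + norm y)^2"
  proof -
    have "(jap (x+y))^2 = ?E + (norm (x + y))^2"
      unfolding jap_def by (simp add: add_nonneg_nonneg)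
    also have "\<dots> \<le> ?E + (norm x + norm y)^2"
      by (simp add: norm_triangle_ineq power_mono)
    also have "\<dots> = (?E + (norm x)^2) + 2 * norm x * norm y + (norm y)^2"
      by (simp add: power2_sum)
    also have "\<dots> = (jap x)^2 + 2 * norm x * norm y + (norm y)^2"
      unfolding jap_def by (simp add: add_nonneg_nonneg)
    also have "\<dots> \<le> (jap x)^2 + 2 * jap x * norm y + (norm y)^2"
      using jap_ge_norm[of x] by (simp add: mult_right_mono)
    finally show ?thesis by (simp add: power2_sum)
  qed
  moreover have "0 \<le> jap x + norm y"
    unfolding jap_def by (simp add: add_nonneg_nonneg)
  ultimately show ?thesis by (rule power2_le_imp_le)
qed

lemma ln_ge_e: "ee \<le> x \<Longrightarrow> exp 1 \<le> ln x"
  by (metis exp_gt_zero ln_exp ln_le_cancel_iff order_less_le_trans)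

lemma lnln_ge_1: "ee \<le> x \<Longrightarrow> 1 \<le> ln (ln x)"
  by (metis exp_gt_zero ln_exp ln_ge_e ln_le_cancel_iff order_less_le_trans)

lemma ee_pos: "ee \<le> x \<Longrightarrow> 0 < x" using exp_gt_zero order_less_le_trans by blast

lemma ee_ge_1: "1 \<le> ee" by simp

lemma QQ_deriv:
  assumes "ee \<le> x"
  shows "(QQ has_real_derivative ((ln (ln x) + 1) / x)) (at x)"
proof -
  have "0 < x" "0 < ln x" using assms ee_pos[OF assms] ln_ge_e[OF assms] exp_gt_zero[of "1::real"] by linarith+
  thus ?thesis unfolding QQ_def[abs_def]
    by (auto intro!: derivative_eq_intros simp: field_simps)
qed

text \<open>The inequality \<open>ln t \<le> t - 1\<close>, applied to \<open>ln y / ln x\<close>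
  and to \<open>y / x\<close>, bounds the growth of the double logarithm by
  \<open>y / x - 1\<close>. As \<open>ln (ln x)\<close> is nonnegative, the numerator grows at most
  by the factor \<open>y / x\<close>.\<close>

lemma QQ_deriv_antimono:
  assumes "ee \<le> x" "x \<le> y"
  shows "(ln (ln y) + 1) / y \<le> (ln (ln x) + 1) / x"
proof -
  have x: "0 < x" "exp 1 \<le> ln x" "1 \<le> ln (ln x)" using assms ee_pos ln_ge_e lnln_ge_1 by auto
  have y0: "0 < y" "exp 1 \<le> ln y" using assms ee_pos[of y] ln_ge_e[of y] by auto
  have lx1: "1 \<le> ln x" using x(2) one_le_exp_iff[of "1::real"] by linarith
  have x1: "1 < x" using lx1 x(1) ln_gt_zero_iff[of x] by linarith
  have y: "0 < y" "0 < ln y" using y0 exp_gt_zero[of "1::real"] by linarith+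
  have "ln (ln y) - ln (ln x) = ln (ln y / ln x)"
    using x y lx1 by (subst ln_div) auto
  also have "\<dots> \<le> ln y / ln x - 1"
    using x y lx1 x1 by (intro ln_le_minus_one) (auto intro!: divide_pos_pos)
  also have "\<dots> = ln (y/x) / ln x"
    using x y lx1 x1 by (simp add: ln_div diff_divide_distrib)
  also have "\<dots> \<le> ln (y/x)"
    using divide_left_mono[of 1 "ln x" "ln (y/x)"] lx1 assms(2) x x1 by simp
  also have "\<dots> \<le> y/x - 1"
    using x y by (intro ln_le_minus_one) simp
  finally have *: "ln (ln y) + 1 \<le> ln (ln x) + 1 + (y/x - 1)" by simp
  also have "\<dots> \<le> (ln (ln x) + 1) * (y/x)"
  proof -
    have "0 \<le> ln (ln x) * (y/x - 1)"
      using x assms by (intro mult_nonneg_nonneg) (auto simp: le_divide_eq)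
    thus ?thesis by (simp add: algebra_simps)
  qed
  finally show ?thesis using x y by (simp add: field_simps)
qed

lemma QQ_diff_le:
  assumes "ee \<le> a" "0 \<le> b"
  shows "QQ (a + b) - QQ a \<le> b * ((ln (ln a) + 1) / a)"
proof (cases "b = 0")
  case False
  have "\<exists>z. a < z \<and> z < a + b \<and> QQ (a+b) - QQ a = (a + b - a) * ((ln (ln z) + 1) / z)"
    by (rule MVT2) (use assms False QQ_deriv in auto)
  then obtain z where z: "a < z" "QQ (a+b) - QQ a = b * ((ln (ln z) + 1) / z)" by auto
  show ?thesis unfolding z(2)
    by (intro mult_left_mono QQ_deriv_antimono) (use assms z in auto)
qed auto

text \<open>The derivative of an increment over a fixed step is a difference of two values of the
  decreasing derivative. In this form concavity allows the base point of an increment to be lowered,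
  which is how it is used throughout.\<close>

lemma QQ_concave:
  assumes "ee \<le> a" "a \<le> a'" "0 \<le> b"
  shows "QQ (a' + b) - QQ a' \<le> QQ (a + b) - QQ a"
proof (rule DERIV_nonpos_imp_nonincreasing[OF assms(2)])
  fix x assume x: "a \<le> x" "x \<le> a'"
  have "((\<lambda>x. QQ (x + b) - QQ x) has_real_derivative
     (ln (ln (x+b)) + 1) / (x+b) * (1 + 0) - (ln (ln x) + 1) / x) (at x)"
    by (intro DERIV_diff QQ_deriv DERIV_chain2[of QQ] DERIV_add DERIV_ident DERIV_const)
      (use x assms in auto)
  moreover have "(ln (ln (x+b)) + 1) / (x+b) \<le> (ln (ln x) + 1) / x"
    by (rule QQ_deriv_antimono) (use x assms in auto)
  ultimately show "\<exists>y. ((\<lambda>x. QQ (x + b) - QQ x) has_real_derivative y) (at x) \<and> y \<le> 0"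
    by force
qed

lemma QQ_mono:
  assumes "ee \<le> a" "a \<le> b" shows "QQ a \<le> QQ b"
proof (rule DERIV_nonneg_imp_nondecreasing[OF assms(2)])
  fix x assume x: "a \<le> x" "x \<le> b"
  have "0 \<le> (ln (ln x) + 1) / x"
    using lnln_ge_1[of x] ee_pos[of x] x assms by (intro divide_nonneg_nonneg) auto
  thus "\<exists>y. (QQ has_real_derivative y) (at x) \<and> 0 \<le> y"
    using QQ_deriv[of x] x assms by auto
qed

lemma QQ_nonneg: "ee \<le> a \<Longrightarrow> 0 \<le> QQ a"
  unfolding QQ_def using lnln_ge_1[of a] ln_ge_e[of a] exp_gt_zero[of "1::real"]
  by (intro mult_nonneg_nonneg) linarith+

lemma um_weight_ge_1: "0 \<le> s \<Longrightarrow> 1 \<le> um_weight s x"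
  unfolding um_weight_QQ using QQ_nonneg[OF jap_ge_ee, of x] by simp

section \<open>The gauge of the frequency radius\<close>

text \<open>The exponential is the ratio of the weights at radii \<open>a + b\<close> and
  \<open>a\<close>, the price of shifting a frequency by \<open>b\<close>. The power, used with
  \<open>N = 2 * CARD('n)\<close>, pays for the summable lattice weight \<open>cw\<close>.\<close>

definition gauge_fun :: "nat \<Rightarrow> real \<Rightarrow> real \<Rightarrow> real" where
  "gauge_fun N a b = exp (QQ (a + b) - QQ a) * (1 + b) ^ N"

lemma gauge_fun_0 [simp]: "gauge_fun N a 0 = 1"
  by (simp add: gauge_fun_def)

lemma gauge_fun_ge_1:
  assumes "ee \<le> a" "0 \<le> b"
  shows "1 \<le> gauge_fun N a b"
proof -
  have "1 * 1 \<le> exp (QQ (a + b) - QQ a) * (1 + b) ^ N"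
    using QQ_mono[of a "a+b"] assms by (intro mult_mono) auto
  thus ?thesis by (simp add: gauge_fun_def)
qed

text \<open>The second step may be counted from \<open>a\<close> instead of \<open>a + b\<close>,
  where by concavity it costs no less; and \<open>1 + (b + b')\<close> is at most the product of
  \<open>1 + b\<close> and \<open>1 + b'\<close>.\<close>

lemma gauge_fun_mult:
  assumes "ee \<le> a" "0 \<le> b" "0 \<le> b'"
  shows "gauge_fun N a (b + b') \<le> gauge_fun N a b * gauge_fun N a b'"
proof -
  have "QQ (a + (b + b')) - QQ a \<le> (QQ (a + b) - QQ a) + (QQ (a + b') - QQ a)"
    using QQ_concave[of a "a+b" b'] assms by (simp add: add.assoc)
  moreover have "(1 + (b + b')) ^ N \<le> ((1 + b) * (1 + b')) ^ N"
    using assms by (intro power_mono) (auto simp: algebra_simps)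
  ultimately have "gauge_fun N a (b + b') \<le> exp ((QQ (a + b) - QQ a) + (QQ (a + b') - QQ a)) * ((1 + b) * (1 + b')) ^ N"
    unfolding gauge_fun_def using assms by (intro mult_mono) auto
  thus ?thesis unfolding gauge_fun_def exp_add power_mult_distrib by (simp only: mult_ac)
qed

lemma gauge_fun_mono:
  assumes "ee \<le> a" "0 \<le> b" "b \<le> b'"
  shows "gauge_fun N a b \<le> gauge_fun N a b'"
  unfolding gauge_fun_def using QQ_mono[of "a+b" "a+b'"] assms
  by (intro mult_mono power_mono) auto

lemma gauge_fun_le:
  assumes "ee \<le> a" "0 \<le> b"
  shows "gauge_fun N a b \<le> exp (QQ (ee + b)) * (1 + b) ^ N"
  unfolding gauge_fun_def using QQ_concave[of ee a b] QQ_nonneg[of ee] assms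
  by (intro mult_mono) auto

text \<open>The increment is largest at the smallest admissible base point \<open>a = r\<close>.
  There the mean value bound gives \<open>ln (ln r) + 1\<close>, whose exponential is
  \<open>exp 1 * ln r\<close>. For \<open>r\<close> below \<open>ee\<close> a constant
  suffices.\<close>

lemma gauge_fun_poly:
  assumes "ee \<le> a" "0 \<le> r" "r \<le> a"
  shows "gauge_fun N a r \<le> (exp (QQ (2*ee)) + exp 1) * (1 + r) ^ (N+1)"
proof -
  have "exp (QQ (a + r) - QQ a) \<le> (exp (QQ (2*ee)) + exp 1) * (1 + r)"
  proof (cases "r \<le> ee")
    case True
    have "QQ (a + r) - QQ a \<le> QQ (ee + r) - QQ ee" using QQ_concave[of ee a r] assms by simp
    also have "\<dots> \<le> QQ (2*ee)" using QQ_mono[of "ee+r" "2*ee"] QQ_nonneg[of ee] True assms by auto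
    finally have "exp (QQ (a + r) - QQ a) \<le> exp (QQ (2*ee)) * 1" by simp
    also have "\<dots> \<le> (exp (QQ (2*ee)) + exp 1) * (1 + r)"
      using assms by (intro mult_mono) auto
    finally show ?thesis .
  next
    case False
    hence r: "ee \<le> r" by simp
    have "QQ (a + r) - QQ a \<le> QQ (r + r) - QQ r" using QQ_concave[of r a r] assms r by simp
    also have "\<dots> \<le> r * ((ln (ln r) + 1) / r)" using QQ_diff_le[of r r] r assms by simp
    also have "\<dots> = ln (ln r) + 1" using ee_pos[OF r] by simp
    finally have "exp (QQ (a + r) - QQ a) \<le> exp 1 * ln r"
      using ln_ge_e[OF r] exp_gt_zero[of "1::real"] 
      by (metis add.commute exp_add exp_le_cancel_iff exp_ln order_less_le_trans)
    also have "\<dots> \<le> exp 1 * r" using ee_pos[OF r] ln_le_minus_one[of r] by (intro mult_left_mono) auto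
    also have "\<dots> \<le> (exp (QQ (2*ee)) + exp 1) * (1 + r)"
      using assms by (intro mult_mono) auto
    finally show ?thesis .
  qed
  thus ?thesis unfolding gauge_fun_def power_add using assms
    by (simp add: mult.commute mult.left_commute mult_left_mono)
qed

text \<open>Either \<open>M\<close> is at most \<open>ln (ln x)\<close> and \<open>x powr M\<close>
  lies below the weight itself, or \<open>ln x\<close> is at most \<open>exp M\<close> and
  \<open>x powr M\<close> lies below a constant; this is the origin of
  \<open>M * exp M\<close>.\<close>

lemma exp_QQ_superpoly:
  assumes "ee \<le> x" "0 \<le> M"
  shows "x powr M \<le> exp (M * exp M) * exp (QQ x)"
proof -
  have x: "0 < x" "exp 1 \<le> ln x" using assms ee_pos ln_ge_e by auto
  hence lx: "0 < ln x" by (meson exp_gt_zero order_less_le_trans)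
  have "M * ln x \<le> M * exp M + QQ x"
  proof (cases "M \<le> ln (ln x)")
    case True
    hence "M * ln x \<le> QQ x" unfolding QQ_def using lx by simp
    thus ?thesis using assms by (simp add: add_increasing)
  next
    case False
    hence "ln x \<le> exp M" using lx by (metis exp_le_cancel_iff exp_ln linear)
    hence "M * ln x \<le> M * exp M" using assms by (intro mult_left_mono) auto
    thus ?thesis using QQ_nonneg[OF assms(1)] by simp
  qed
  thus ?thesis using x by (simp add: powr_def exp_add[symmetric] mult.commute)
qed

text \<open>The exponent \<open>QQ (ee + y powr s)\<close> is of order
  \<open>ln y * ln (ln y)\<close>, hence negligible against \<open>y\<close>. It is needed in the
  tail of the exponential series, where the \<open>m\<close>-th power has radius at most
  \<open>m powr (1 + \<epsilon>)\<close> and its gauge must be paid with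
  \<open>exp m\<close>.\<close>

lemma exp_QQ_subexp:
  assumes "0 < s"
  shows "\<exists>C\<ge>0. \<forall>y\<ge>1. exp (QQ (ee + y powr s)) * (1 + y powr s) ^ N \<le> C * exp y"
proof -
  define f where "f = (\<lambda>y::real. exp (QQ (ee + y powr s) - y) * (1 + y powr s) ^ N)"
  have lim: "(f \<longlongrightarrow> 0) at_top"
    unfolding f_def QQ_def using assms by real_asymp
  hence "eventually (\<lambda>y. f y < 1) at_top" by (rule order_tendstoD) simp
  then obtain Y where Y: "\<And>y. y \<ge> Y \<Longrightarrow> f y < 1" by (auto simp: eventually_at_top_linorder)
  have cont: "continuous_on {1..Y} f"
  proof -
    have a: "ee \<le> ee + y powr s" for y by simp
    have "0 < ln (ee + y powr s)" for y
      using ln_ge_e[OF a[of y]] exp_gt_zero[of "1::real"] by linarith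
    moreover have "0 < ee + y powr s" for y using ee_pos[OF a] .
    ultimately have nz: "ln (ee + y powr s) \<noteq> 0" "ee + y powr s \<noteq> 0" for y
      by (metis less_irrefl)+
    show ?thesis unfolding f_def QQ_def
      by (intro continuous_intros) (use nz in auto)
  qed
  have "bounded (f ` {1..Y})"
    by (intro compact_imp_bounded compact_continuous_image cont) auto
  then obtain B where B: "\<And>y. y \<in> {1..Y} \<Longrightarrow> norm (f y) \<le> B" unfolding bounded_iff by blast
  have fb: "f y \<le> max 1 B" if "y \<ge> 1" for y
    using Y[of y] B[of y] that by (cases "y \<le> Y") auto
  show ?thesis
  proof (intro exI[of _ "max 1 B"] conjI allI impI)
    fix y :: real assume "1 \<le> y"
    from fb[OF this] have "f y * exp y \<le> max 1 B * exp y" by simp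
    thus "exp (QQ (ee + y powr s)) * (1 + y powr s) ^ N \<le> max 1 B * exp y"
      by (simp add: f_def exp_diff mult_ac)
  qed simp
qed

text \<open>The weight with exponent \<open>\<theta>\<close> is the weight with exponent 1 times one
  with exponent \<open>\<theta> - 1\<close>, and the latter dominates all powers. The dilation comes
  from \<open>c * (1 + \<bar>\<xi>\<bar>) \<le> (2*c+1) * \<bar>\<xi>\<bar>\<close> for
  \<open>\<bar>\<xi>\<bar> \<ge> 1\<close>; smaller \<open>\<xi>\<close> cost a constant.\<close>

lemma weight_dominates:
  assumes "0 < \<epsilon>" "1 < \<theta>" "0 < c"
  shows "\<exists>C\<ge>0. \<forall>\<xi> x. 0 \<le> x \<longrightarrow> x \<le> c * (1 + \<bar>\<xi>\<bar>) \<longrightarrow>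
     exp (QQ (ee + x powr (1+\<epsilon>))) * (1 + x powr (1+\<epsilon>)) ^ N * (1 + \<bar>\<xi>\<bar>)
     \<le> C * um_weight \<theta> ((2*c+1) powr (1+\<epsilon>) * \<bar>\<xi>\<bar> powr (1+\<epsilon>))"
proof -
  let ?l = "(2*c+1) powr (1+\<epsilon>)"
  define C0 where "C0 = exp (QQ (2*ee)) * (2 ^ (N+1) * exp ((real N+1) / (\<theta>-1) * exp ((real N+1)/(\<theta>-1))) powr (\<theta>-1))"
  define C1 where "C1 = exp (QQ (ee + ?l)) * (1 + ?l) ^ N * 2"
  have main: "exp (QQ (ee + t)) * (1 + t) ^ (N+1) \<le> C0 * um_weight \<theta> t" if t: "0 \<le> t" for t :: real
  proof -
    let ?j = "jap t"
    have j: "ee \<le> ?j" "t \<le> ?j" using jap_ge_ee jap_ge_norm[of t] t by auto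
    have j1: "1 \<le> ?j" using j(1) ee_ge_1 by linarith
    have "QQ (ee + t) \<le> QQ (?j + ee)" using j t by (intro QQ_mono) auto
    also have "\<dots> \<le> QQ ?j + QQ (2*ee)" using QQ_concave[of ee ?j ee] j QQ_nonneg[of ee] by simp
    finally have 1: "exp (QQ (ee + t)) \<le> exp (QQ ?j) * exp (QQ (2*ee))" by (simp add: exp_add[symmetric])
    \<comment> \<open>With this exponent, \<open>?j powr ?M\<close> raised to the power
      \<open>\<theta> - 1\<close> is \<open>?j ^ (N+1)\<close>, so that
      \<open>exp_QQ_superpoly\<close> turns the polynomial into the spare weight of exponent
      \<open>\<theta> - 1\<close>.\<close>
    let ?M = "(real N + 1)/(\<theta>-1)"
    have "(1 + t) ^ (N+1) \<le> (2 * ?j) ^ (N+1)" using j j1 t by (intro power_mono) auto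
    also have "\<dots> = 2^(N+1) * (?j powr ?M) powr (\<theta>-1)"
      using assms j1 by (simp add: powr_powr power_mult_distrib powr_add powr_realpow)
    also have "\<dots> \<le> 2^(N+1) * (exp (?M * exp ?M) * exp (QQ ?j)) powr (\<theta>-1)"
      using assms j by (intro mult_left_mono powr_mono2 exp_QQ_superpoly) auto
    also have "\<dots> = 2^(N+1) * exp (?M * exp ?M) powr (\<theta>-1) * exp ((\<theta>-1) * QQ ?j)"
      by (simp add: powr_mult powr_def[of "exp (QQ ?j)"])
    finally have 2: "(1 + t) ^ (N+1) \<le> 2^(N+1) * exp (?M * exp ?M) powr (\<theta>-1) * exp ((\<theta>-1) * QQ ?j)" .
    have "exp (QQ (ee + t)) * (1 + t) ^ (N+1) \<le> (exp (QQ ?j) * exp (QQ (2*ee))) * (2^(N+1) * exp (?M * exp ?M) powr (\<theta>-1) * exp ((\<theta>-1) * QQ ?j))"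
      using t by (intro mult_mono 1 2) auto
    also have "\<dots> = C0 * (exp (QQ ?j) * exp ((\<theta>-1) * QQ ?j))" unfolding C0_def by (simp add: mult_ac)
    also have "exp (QQ ?j) * exp ((\<theta>-1) * QQ ?j) = um_weight \<theta> t"
      unfolding um_weight_QQ by (simp add: exp_add[symmetric] algebra_simps)
    finally show ?thesis .
  qed
  have C0: "0 \<le> C0" unfolding C0_def by (intro mult_nonneg_nonneg) auto
  have C1: "0 \<le> C1" unfolding C1_def by auto
  show ?thesis
  proof (intro exI[of _ "C0 + C1"] conjI allI impI)
    show "0 \<le> C0 + C1" using C0 C1 by simp
    fix \<xi> x :: real assume x: "0 \<le> x" "x \<le> c * (1 + \<bar>\<xi>\<bar>)"
    let ?k = "x powr (1+\<epsilon>)" and ?t = "?l * \<bar>\<xi>\<bar> powr (1+\<epsilon>)"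
    have W: "1 \<le> um_weight \<theta> ?t" using assms by (intro um_weight_ge_1) auto
    show "exp (QQ (ee + ?k)) * (1 + ?k) ^ N * (1 + \<bar>\<xi>\<bar>) \<le> (C0 + C1) * um_weight \<theta> ?t"
    proof (cases "1 \<le> \<bar>\<xi>\<bar>")
      case True
      have "c * (1 + \<bar>\<xi>\<bar>) \<le> 2 * c * \<bar>\<xi>\<bar>" using True assms(3) by (simp add: algebra_simps)
      also have "\<dots> \<le> (2 * c + 1) * \<bar>\<xi>\<bar>" by (simp add: algebra_simps)
      finally have "x \<le> (2*c+1) * \<bar>\<xi>\<bar>" using x by linarith
      hence "?k \<le> ((2*c+1) * \<bar>\<xi>\<bar>) powr (1+\<epsilon>)" using x assms by (intro powr_mono2) auto
      also have "\<dots> = ?t" using assms by (simp add: powr_mult)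
      finally have kt: "?k \<le> ?t" .
      have "\<bar>\<xi>\<bar> \<le> (\<bar>\<xi>\<bar>) powr (1+\<epsilon>)" using True assms powr_mono[of 1 "1+\<epsilon>" "\<bar>\<xi>\<bar>"] by simp
      also have "\<dots> \<le> ?t" using assms ge_one_powr_ge_zero[of "2*c+1" "1+\<epsilon>"] mult_right_mono[of 1 ?l "\<bar>\<xi>\<bar> powr (1+\<epsilon>)"] by simp
      finally have xt: "\<bar>\<xi>\<bar> \<le> ?t" .
      have "exp (QQ (ee + ?k)) * (1 + ?k) ^ N * (1 + \<bar>\<xi>\<bar>) \<le> exp (QQ (ee + ?t)) * (1 + ?t) ^ N * (1 + ?t)"
        using kt xt by (intro mult_mono power_mono) (auto intro!: QQ_mono)
      also have "\<dots> \<le> C0 * um_weight \<theta> ?t" using main[of ?t] by (simp add: mult_ac)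
      also have "\<dots> \<le> (C0 + C1) * um_weight \<theta> ?t" using W C1 by (intro mult_right_mono) auto
      finally show ?thesis .
    next
      case False
      have "c * (1 + \<bar>\<xi>\<bar>) \<le> c * 2" using False assms(3) by (intro mult_left_mono) auto
      hence "x \<le> 2*c+1" using x by linarith
      hence k: "?k \<le> ?l" using x assms by (intro powr_mono2) auto
      have "exp (QQ (ee + ?k)) * (1 + ?k) ^ N * (1 + \<bar>\<xi>\<bar>) \<le> C1"
        unfolding C1_def using k False by (intro mult_mono power_mono) (auto intro!: QQ_mono)
      also have "\<dots> \<le> C1 * um_weight \<theta> ?t" using W C1 mult_left_mono[of 1 _ C1] by simp
      also have "\<dots> \<le> (C0 + C1) * um_weight \<theta> ?t" using W C0 by (intro mult_right_mono) auto
      finally show ?thesis .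
    qed
  qed
qed

section \<open>Minkowski's inequality and bounds in \<open>L\<^sup>p\<close>\<close>

text \<open>The weighted mean inequality for \<open>t powr p * m powr (1 - p)\<close> and
  \<open>m\<close> with weights 1/p and 1 - 1/p. It bounds \<open>t\<close> by an affine function of
  \<open>t powr p\<close>, sharp at \<open>t = m\<close>, and takes the place of Hoelder's
  inequality below.\<close>

lemma young_powr:
  fixes t m p :: real
  assumes "1 \<le> p" "0 < m" "0 \<le> t"
  shows "t \<le> (t powr p * m powr (1 - p) + (p - 1) * m) / p"
proof -
  consider "t = 0" | "0 < t" using assms by linarith
  thus ?thesis
  proof cases
  case 1
  thus ?thesis using assms by simp
  next
  case 2
  have "(t powr p * m powr (1 - p)) powr (1/p) * m powr (1 - 1/p)
     \<le> (1/p) * (t powr p * m powr (1 - p)) + (1 - 1/p) * m"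
    by (rule Youngs_inequality_0) (use assms 2 in auto)
  moreover have "(t powr p * m powr (1 - p)) powr (1/p) * m powr (1 - 1/p) = t"
  proof -
    have "(t powr p * m powr (1 - p)) powr (1/p) = t * m powr ((1 - p) * (1/p))"
      using assms by (simp add: powr_mult powr_powr)
    moreover have "m powr ((1 - p) * (1/p)) * m powr (1 - 1/p) = 1"
      using assms by (simp add: powr_add[symmetric] diff_divide_distrib left_diff_distrib)
    ultimately show ?thesis by (simp add: mult.assoc)
  qed
  moreover have "(1/p) * X + (1 - 1/p) * m = (X + (p - 1) * m) / p" for X
    using assms by (simp add: field_simps)
  ultimately show ?thesis by (simp only:)
  qed
qed

lemma ennreal_lincomb:
  assumes "0 \<le> c" "0 \<le> d" "0 \<le> u" "0 \<le> v"
  shows "ennreal (c * u + d * v) = ennreal c * ennreal u + ennreal d * ennreal v"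
  using assms by (simp add: ennreal_mult')

text \<open>Integrate \<open>young_powr\<close> against \<open>N\<close> and choose \<open>m\<close>
  well. Only an upper bound \<open>I\<close> of the mass enters, so \<open>N\<close> need not be
  normalised, and the right-hand side may be infinite.\<close>

lemma jensen_powr_nn:
  fixes N T :: "'b \<Rightarrow> real" and a p I :: real
  assumes p: "1 \<le> p" and meas [measurable]: "N \<in> borel_measurable \<nu>" "T \<in> borel_measurable \<nu>"
    and nn: "\<And>y. 0 \<le> N y" "\<And>y. 0 \<le> T y" and I: "0 < I" "(\<integral>\<^sup>+y. ennreal (N y) \<partial>\<nu>) \<le> ennreal I"
    and a: "0 \<le> a" "ennreal a \<le> (\<integral>\<^sup>+y. ennreal (N y * T y) \<partial>\<nu>)"
  shows "ennreal (a powr p) \<le> ennreal (I powr (p - 1)) * (\<integral>\<^sup>+y. ennreal (N y * T y powr p) \<partial>\<nu>)"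
proof (cases "a = 0 \<or> (\<integral>\<^sup>+y. ennreal (N y * T y powr p) \<partial>\<nu>) = \<infinity>")
  case True
  thus ?thesis using I p by (auto simp: ennreal_mult_eq_top_iff ennreal_mult_top)
next
  case False
  then obtain J where J: "(\<integral>\<^sup>+y. ennreal (N y * T y powr p) \<partial>\<nu>) = ennreal J" "0 \<le> J"
    by (metis ennreal_cases infinity_ennreal_def)
  from False a have a0: "0 < a" by simp
  \<comment> \<open>With this mean value the last term of \<open>young_powr\<close> integrates to at
    most \<open>(p-1) * a / p\<close>, which the left-hand side absorbs.\<close>
  let ?m = "a / I"
  have m: "0 < ?m" using a0 I by simp
  have m1: "0 \<le> ?m powr (1-p) / p" using p by simp
  have m2: "0 \<le> (p-1) * ?m / p" by (rule divide_nonneg_nonneg[OF mult_nonneg_nonneg[OF _ less_imp_le[OF m]]]) (use p in linarith)+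
  have "ennreal a \<le> (\<integral>\<^sup>+y. ennreal (N y * T y) \<partial>\<nu>)" by fact
  also have "\<dots> \<le> (\<integral>\<^sup>+y. ennreal (?m powr (1-p) / p) * ennreal (N y * T y powr p) + ennreal ((p-1) * ?m / p) * ennreal (N y) \<partial>\<nu>)"
  proof (rule nn_integral_mono)
    fix y
    have "N y * T y \<le> N y * ((T y powr p * ?m powr (1 - p) + (p - 1) * ?m) / p)"
      by (intro mult_left_mono young_powr) (use p m nn in auto)
    also have "\<dots> = (?m powr (1-p) / p) * (N y * T y powr p) + ((p-1) * ?m / p) * N y"
      by (simp only: add_divide_distrib distrib_left times_divide_eq_right times_divide_eq_left mult.commute mult.left_commute mult.assoc)
    finally have "ennreal (N y * T y) \<le> ennreal ((?m powr (1-p) / p) * (N y * T y powr p) + ((p-1) * ?m / p) * N y)"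
      by (rule ennreal_leI)
    also have "\<dots> = ennreal (?m powr (1-p) / p) * ennreal (N y * T y powr p) + ennreal ((p-1) * ?m / p) * ennreal (N y)"
      by (rule ennreal_lincomb[OF m1 m2]) (use nn[of y] in auto)
    finally show "ennreal (N y * T y) \<le> \<dots>" .
  qed
  also have "\<dots> = ennreal (?m powr (1-p) / p) * ennreal J + ennreal ((p-1) * ?m / p) * (\<integral>\<^sup>+y. ennreal (N y) \<partial>\<nu>)"
    by (subst nn_integral_add) (auto simp: nn_integral_cmult J)
  also have "\<dots> \<le> ennreal (?m powr (1-p) / p) * ennreal J + ennreal ((p-1) * ?m / p) * ennreal I"
    by (intro add_mono mult_left_mono I) auto
  also have "\<dots> = ennreal (?m powr (1-p) / p * J + (p-1) * ?m / p * I)"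
    by (rule ennreal_lincomb[OF m1 m2 J(2) less_imp_le[OF I(1)], symmetric])
  finally have "a \<le> ?m powr (1-p) / p * J + (p-1) * ?m / p * I"
    by (rule ennreal_le_iff[OF add_nonneg_nonneg[OF mult_nonneg_nonneg[OF m1 J(2)] mult_nonneg_nonneg[OF m2 less_imp_le[OF I(1)]]], THEN iffD1])
  also have "\<dots> = (?m powr (1-p) * J + (p - 1) * a) / p"
    using I by (simp add: add_divide_distrib)
  finally have "a * p \<le> ?m powr (1-p) * J + (p - 1) * a" using p by (simp add: field_simps)
  hence "a \<le> ?m powr (1-p) * J" by (simp add: algebra_simps)
  hence "a * ?m powr (p-1) \<le> ?m powr (1-p) * J * ?m powr (p-1)" by (intro mult_right_mono) auto
  also have "\<dots> = J"
  proof -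
    have "?m powr (1-p) * ?m powr (p-1) = 1" using m a0 I by (simp add: powr_add[symmetric])
    thus ?thesis by (simp only: mult.assoc mult.left_commute[of J] mult.commute[of J]) simp
  qed
  finally have "a * (a powr (p-1) / I powr (p-1)) \<le> J" using a0 I by (simp add: powr_divide)
  moreover have "a * a powr (p-1) = a powr p" using a0 powr_mult_base[of a "p-1"] by simp
  ultimately have "a powr p \<le> I powr (p-1) * J" using I by (simp add: field_simps)
  thus ?thesis unfolding J(1) using J I by (simp add: ennreal_mult'[symmetric])
qed

text \<open>Jensen's inequality at every point, then Tonelli. The slices \<open>T\<close> are
  normalised to a common bound \<open>A\<close> while their sizes sit in the weight
  \<open>N\<close>; sums, convolutions and superpositions over \<xi> all take this shape. The case
  \<open>I = 0\<close> stands apart because Jensen's inequality is applied with a positive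
  mass.\<close>

lemma minkowski_nn:
  fixes N :: "'b \<Rightarrow> real" and T :: "'a \<Rightarrow> 'b \<Rightarrow> real" and g :: "'a \<Rightarrow> real"
  assumes sf: "sigma_finite_measure M" "sigma_finite_measure \<nu>" and p: "1 \<le> p"
    and meas [measurable]: "N \<in> borel_measurable \<nu>" "(\<lambda>(x, y). T x y) \<in> borel_measurable (M \<Otimes>\<^sub>M \<nu>)"
    and nn: "\<And>y. 0 \<le> N y" "\<And>x y. 0 \<le> T x y" and A: "0 \<le> A"
    and T: "\<And>y. y \<in> space \<nu> \<Longrightarrow> (\<integral>\<^sup>+x. ennreal (T x y powr p) \<partial>M) \<le> ennreal (A powr p)"
    and I: "0 \<le> I" "(\<integral>\<^sup>+y. ennreal (N y) \<partial>\<nu>) \<le> ennreal I"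
    and g: "\<And>x. x \<in> space M \<Longrightarrow> ennreal \<bar>g x\<bar> \<le> (\<integral>\<^sup>+y. ennreal (N y * T x y) \<partial>\<nu>)"
  shows "(\<integral>\<^sup>+x. ennreal (\<bar>g x\<bar> powr p) \<partial>M) \<le> ennreal ((I * A) powr p)"
proof (cases "I = 0")
  case True
  hence "AE y in \<nu>. ennreal (N y) = 0"
    using I by (subst nn_integral_0_iff_AE[symmetric]) auto
  hence "(\<integral>\<^sup>+y. ennreal (N y * T x y) \<partial>\<nu>) = (\<integral>\<^sup>+y. 0 \<partial>\<nu>)" for x
    using nn by (intro nn_integral_cong_AE) (auto simp: ennreal_mult')
  hence z: "g x = 0" if "x \<in> space M" for x using g[OF that] by simp
  have "(\<integral>\<^sup>+x. ennreal (\<bar>g x\<bar> powr p) \<partial>M) = (\<integral>\<^sup>+x. 0 \<partial>M)"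
    by (rule nn_integral_cong) (use z in auto)
  thus ?thesis by simp
next
  case False
  hence I0: "0 < I" using I by simp
  interpret M: sigma_finite_measure M by fact
  interpret nu: sigma_finite_measure \<nu> by fact
  interpret pair_sigma_finite M \<nu> ..
  have "(\<integral>\<^sup>+x. ennreal (\<bar>g x\<bar> powr p) \<partial>M) \<le> (\<integral>\<^sup>+x. ennreal (I powr (p - 1)) * (\<integral>\<^sup>+y. ennreal (N y * T x y powr p) \<partial>\<nu>) \<partial>M)"
    by (intro nn_integral_mono jensen_powr_nn) (use p nn I0 I g in auto)
  also have "\<dots> = ennreal (I powr (p - 1)) * (\<integral>\<^sup>+x. (\<integral>\<^sup>+y. ennreal (N y * T x y powr p) \<partial>\<nu>) \<partial>M)"
    by (rule nn_integral_cmult) measurable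
  also have "(\<integral>\<^sup>+x. (\<integral>\<^sup>+y. ennreal (N y * T x y powr p) \<partial>\<nu>) \<partial>M) = (\<integral>\<^sup>+y. (\<integral>\<^sup>+x. ennreal (N y * T x y powr p) \<partial>M) \<partial>\<nu>)"
    by (rule Fubini'[symmetric]) measurable
  also have "\<dots> = (\<integral>\<^sup>+y. ennreal (N y) * (\<integral>\<^sup>+x. ennreal (T x y powr p) \<partial>M) \<partial>\<nu>)"
    using nn by (intro nn_integral_cong) (subst nn_integral_cmult[symmetric], auto simp: ennreal_mult')
  also have "\<dots> \<le> (\<integral>\<^sup>+y. ennreal (N y) * ennreal (A powr p) \<partial>\<nu>)"
    by (intro nn_integral_mono mult_left_mono T) auto
  also have "\<dots> = (\<integral>\<^sup>+y. ennreal (N y) \<partial>\<nu>) * ennreal (A powr p)"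
    by (rule nn_integral_multc) measurable
  also have "\<dots> \<le> ennreal I * ennreal (A powr p)" by (intro mult_right_mono I) auto
  also have "ennreal (I powr (p-1)) * (ennreal I * ennreal (A powr p)) = ennreal ((I * A) powr p)"
    using I0 A powr_mult_base[of I "p-1"] by (simp add: ennreal_mult'[symmetric] powr_mult mult_ac)
  finally show ?thesis by (simp add: mult_left_mono)
qed

section \<open>Upper bounds in L^p\<close>

text \<open>An upper bound in place of a norm: it is always a real number, it includes Borel
  measurability, and it can be relaxed along a chain of estimates. The spaces of the theorem, which
  refer to \<open>lebesgue\<close>, are reached through Borel representatives.\<close>

definition lp_le :: "real \<Rightarrow> ('a::euclidean_space \<Rightarrow> complex) \<Rightarrow> real \<Rightarrow> bool" where
  "lp_le p g A \<longleftrightarrow> g \<in> borel_measurable borel \<and> 0 \<le> A \<and>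
     (\<integral>\<^sup>+x. ennreal (norm (g x) powr p) \<partial>lborel) \<le> ennreal (A powr p)"

lemma lp_le_meas: "lp_le p g A \<Longrightarrow> g \<in> borel_measurable borel"
  by (simp add: lp_le_def)

lemma lp_le_mono:
  assumes "1 \<le> p" "lp_le p g A" "A \<le> B"
  shows "lp_le p g B"
proof -
  have "ennreal (A powr p) \<le> ennreal (B powr p)"
    using assms by (intro ennreal_leI powr_mono2) (auto simp: lp_le_def)
  with assms(2) have "(\<integral>\<^sup>+x. ennreal (norm (g x) powr p) \<partial>lborel) \<le> ennreal (B powr p)"
    unfolding lp_le_def by (blast intro: order_trans)
  thus ?thesis using assms by (simp add: lp_le_def)
qed

lemma lp_le_dominated:
  assumes "1 \<le> p" "lp_le p g A" "h \<in> borel_measurable borel" "0 \<le> D" "\<And>x. norm (h x) \<le> D * norm (g x)"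
  shows "lp_le p h (D * A)"
proof -
  have [measurable]: "g \<in> borel_measurable borel" using assms lp_le_meas by auto
  have "(\<integral>\<^sup>+x. ennreal (norm (h x) powr p) \<partial>lborel) \<le> (\<integral>\<^sup>+x. ennreal (D powr p) * ennreal (norm (g x) powr p) \<partial>lborel)"
    using assms by (intro nn_integral_mono) (auto simp: ennreal_mult'[symmetric] powr_mult[symmetric] intro!: ennreal_leI powr_mono2)
  also have "\<dots> = ennreal (D powr p) * (\<integral>\<^sup>+x. ennreal (norm (g x) powr p) \<partial>lborel)"
    by (rule nn_integral_cmult) measurable
  also have "\<dots> \<le> ennreal (D powr p) * ennreal (A powr p)"
    using assms by (intro mult_left_mono) (auto simp: lp_le_def)
  also have "\<dots> = ennreal ((D * A) powr p)" using assms by (simp add: ennreal_mult'[symmetric] powr_mult lp_le_def)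
  finally show ?thesis using assms by (simp add: lp_le_def)
qed

lemma lp_le_AE:
  assumes "lp_le p g A" "h \<in> borel_measurable borel" "AE x in lborel. norm (h x) = norm (g x)"
  shows "lp_le p h A"
proof -
  have "(\<integral>\<^sup>+x. ennreal (norm (h x) powr p) \<partial>lborel) = (\<integral>\<^sup>+x. ennreal (norm (g x) powr p) \<partial>lborel)"
    using assms by (intro nn_integral_cong_AE) auto
  thus ?thesis using assms by (simp add: lp_le_def)
qed

text \<open>Serves \<open>lp_le_add\<close>, where the bounds are divided by and must first be made
  positive: it is enough to prove the estimate with every larger bound.\<close>

lemma lp_le_limitI:
  assumes "g \<in> borel_measurable borel" "1 \<le> p" "0 \<le> A" "\<And>B. A < B \<Longrightarrow> lp_le p g B"
  shows "lp_le p g A"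
proof -
  have "(\<lambda>n. A + 1 / real (Suc n)) \<longlonglongrightarrow> A + 0"
    by (intro tendsto_intros LIMSEQ_Suc[OF lim_1_over_n])
  hence "(\<lambda>n. (A + 1 / real (Suc n)) powr p) \<longlonglongrightarrow> A powr p"
    using assms by (intro tendsto_powr') auto
  hence lim: "(\<lambda>n. ennreal ((A + 1 / real (Suc n)) powr p)) \<longlonglongrightarrow> ennreal (A powr p)"
    by (rule tendsto_ennrealI)
  have "(\<integral>\<^sup>+x. ennreal (norm (g x) powr p) \<partial>lborel) \<le> ennreal (A powr p)"
    by (rule LIMSEQ_le_const[OF lim]) (use assms(4) in \<open>auto simp: lp_le_def\<close>)
  thus ?thesis using assms by (simp add: lp_le_def)
qed

text \<open>Minkowski's inequality over a space of two points with masses \<open>A'\<close> and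
  \<open>B'\<close> and slices \<open>g / A'\<close> and \<open>h / B'\<close>. The slack
  \<open>d\<close> makes both masses positive.\<close>

lemma lp_le_add:
  assumes p: "1 \<le> p" and g: "lp_le p g A" and h: "lp_le p h B"
  shows "lp_le p (\<lambda>x. g x + h x) (A + B)"
proof (rule lp_le_limitI)
  have [measurable]: "g \<in> borel_measurable borel" "h \<in> borel_measurable borel"
    using g h lp_le_meas by auto
  show "(\<lambda>x. g x + h x) \<in> borel_measurable borel" by measurable
  show "1 \<le> p" by fact
  show "0 \<le> A + B" using g h by (auto simp: lp_le_def)
  fix C assume C: "A + B < C"
  define d where "d = (C - (A + B)) / 2"
  define A' B' where "A' = A + d" and "B' = B + d"
  have pos: "0 < A'" "0 < B'" "A \<le> A'" "B \<le> B'" "A' + B' = C" "0 < C"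
    using C g h by (auto simp: A'_def B'_def d_def lp_le_def field_simps)
  have g': "lp_le p g A'" and h': "lp_le p h B'" using lp_le_mono p g h pos by blast+
  have 1: "(\<integral>\<^sup>+x. ennreal ((norm (k x) / D) powr p) \<partial>lborel) \<le> ennreal (1 powr p)"
    if "lp_le p k D" "0 < D" for k :: "'a \<Rightarrow> complex" and D
  proof -
    have "lp_le p (\<lambda>x. k x / complex_of_real D) (1 / D * D)"
      using that lp_le_meas[OF that(1)] by (intro lp_le_dominated[OF p that(1)]) (auto simp: norm_divide)
    thus ?thesis using that by (simp add: lp_le_def norm_divide)
  qed
  have "(\<integral>\<^sup>+x. ennreal (\<bar>norm (g x + h x)\<bar> powr p) \<partial>lborel) \<le> ennreal ((C * 1) powr p)"
  proof (rule minkowski_nn[where \<nu> = "count_space (UNIV :: bool set)" and N = "\<lambda>b. if b then A' else B'"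
        and T = "\<lambda>x b. if b then norm (g x) / A' else norm (h x) / B'"])
    show "sigma_finite_measure (count_space (UNIV::bool set))"
      by (rule sigma_finite_measure_count_space_finite) simp
    show "(\<lambda>(x, y). if y then norm (g x) / A' else norm (h x) / B') \<in> borel_measurable (lborel \<Otimes>\<^sub>M count_space UNIV)"
      by measurable
    show "(\<integral>\<^sup>+x. ennreal ((if y then norm (g x) / A' else norm (h x) / B') powr p) \<partial>lborel) \<le> ennreal (1 powr p)" for y
      using 1[OF g'] 1[OF h'] pos by (cases y) auto
    show "(\<integral>\<^sup>+y. ennreal (if y then A' else B') \<partial>count_space UNIV) \<le> ennreal C"
      using pos by (simp add: nn_integral_count_space_finite UNIV_bool ennreal_plus[symmetric] add.commute del: ennreal_plus)
    fix x
    have "\<bar>norm (g x + h x)\<bar> \<le> norm (g x) + norm (h x)" by (simp add: norm_triangle_ineq)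
    hence "ennreal \<bar>norm (g x + h x)\<bar> \<le> ennreal (norm (h x)) + ennreal (norm (g x))"
      by (simp add: ennreal_plus[symmetric] ennreal_leI add.commute del: ennreal_plus)
    also have "\<dots> = (\<integral>\<^sup>+y. ennreal ((if y then A' else B') * (if y then norm (g x) / A' else norm (h x) / B')) \<partial>count_space UNIV)"
      using pos by (simp add: nn_integral_count_space_finite UNIV_bool)
    finally show "ennreal \<bar>norm (g x + h x)\<bar> \<le> \<dots>" .
  qed (use pos p in \<open>auto intro: sigma_finite_lborel\<close>)
  thus "lp_le p (\<lambda>x. g x + h x) C" using pos by (simp add: lp_le_def)
qed

lemma lp_le_zero: "lp_le p (\<lambda>x. 0) 0" by (simp add: lp_le_def)

lemma lp_le_sum:
  assumes "1 \<le> p" "finite F" "\<And>k. k \<in> F \<Longrightarrow> lp_le p (g k) (A k)"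
  shows "lp_le p (\<lambda>x. \<Sum>k\<in>F. g k x) (\<Sum>k\<in>F. A k)"
  using assms(2,3) by (induction F rule: finite_induct) (auto intro!: lp_le_add lp_le_zero assms(1))

lemma lp_le_Fatou:
  assumes p: "1 \<le> p" and m: "\<And>n. lp_le p (g n) A" and lim: "\<And>x. (\<lambda>n. g n x) \<longlonglongrightarrow> h x"
    and A: "0 \<le> A"
  shows "lp_le p h A"
proof -
  have [measurable]: "g n \<in> borel_measurable borel" for n using m lp_le_meas by blast
  have hm: "h \<in> borel_measurable borel" by (rule borel_measurable_LIMSEQ_metric[OF _ lim]) measurable
  have "(\<integral>\<^sup>+x. ennreal (norm (h x) powr p) \<partial>lborel) = (\<integral>\<^sup>+x. liminf (\<lambda>n. ennreal (norm (g n x) powr p)) \<partial>lborel)"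
  proof (rule nn_integral_cong)
    fix x
    have "(\<lambda>n. ennreal (norm (g n x) powr p)) \<longlonglongrightarrow> ennreal (norm (h x) powr p)"
      using p by (intro tendsto_ennrealI tendsto_powr' tendsto_norm lim) auto
    from lim_imp_Liminf[OF trivial_limit_sequentially this]
    show "ennreal (norm (h x) powr p) = liminf (\<lambda>n. ennreal (norm (g n x) powr p))"
      by (rule sym)
  qed
  also have "\<dots> \<le> liminf (\<lambda>n. (\<integral>\<^sup>+x. ennreal (norm (g n x) powr p) \<partial>lborel))"
    by (rule nn_integral_liminf) measurable
  also have "\<dots> \<le> liminf (\<lambda>n. ennreal (A powr p))"
    by (rule Liminf_mono) (use m in \<open>auto simp: lp_le_def\<close>)
  also have "\<dots> = ennreal (A powr p)" by (simp add: Liminf_const)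
  finally show ?thesis using hm A by (simp add: lp_le_def)
qed

section \<open>Oscillatory integrals\<close>

lemma integral_affine_euclidean:
  fixes f :: "'a::euclidean_space \<Rightarrow> 'b::{banach, second_countable_topology}"
  assumes c: "c \<noteq> 0" and [measurable]: "f \<in> borel_measurable borel"
  shows "(\<integral>x. f x \<partial>lborel) = \<bar>c\<bar> ^ DIM('a) *\<^sub>R (\<integral>x. f (t + c *\<^sub>R x) \<partial>lborel)"
  by (subst lborel_affine[OF c, of t]) (simp add: integral_density integral_distr)

lemma nn_integral_affine_euclidean:
  fixes f :: "'a::euclidean_space \<Rightarrow> ennreal"
  assumes c: "c \<noteq> 0" and [measurable]: "f \<in> borel_measurable borel"
  shows "(\<integral>\<^sup>+x. f x \<partial>lborel) = ennreal (\<bar>c\<bar> ^ DIM('a)) * (\<integral>\<^sup>+x. f (t + c *\<^sub>R x) \<partial>lborel)"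
  by (subst lborel_affine[OF c, of t]) (simp add: nn_integral_density nn_integral_distr nn_integral_cmult)

lemma integrable_affine_euclidean:
  fixes f :: "'a::euclidean_space \<Rightarrow> 'b::{banach, second_countable_topology}"
  assumes c: "c \<noteq> 0" and f: "integrable lborel f"
  shows "integrable lborel (\<lambda>x. f (t + c *\<^sub>R x))"
proof -
  have [measurable]: "f \<in> borel_measurable borel" using f by auto
  have "ennreal (\<bar>c\<bar> ^ DIM('a)) * (\<integral>\<^sup>+x. ennreal (norm (f (t + c *\<^sub>R x))) \<partial>lborel) < \<infinity>"
    using f nn_integral_affine_euclidean[OF c, of "\<lambda>x. ennreal (norm (f x))" t]
    by (simp add: integrable_iff_bounded)
  moreover have "0 < \<bar>c\<bar> ^ DIM('a)" using c by simp
  ultimately show ?thesis unfolding integrable_iff_bounded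
    by (auto simp: ennreal_mult_less_top)
qed

lemma
  fixes f :: "'a::euclidean_space \<Rightarrow> 'b::{banach, second_countable_topology}"
  assumes [measurable]: "f \<in> borel_measurable borel"
  shows integral_translate: "(\<integral>x. f (t + x) \<partial>lborel) = (\<integral>x. f x \<partial>lborel)"
    and integral_reflect: "(\<integral>x. f (t - x) \<partial>lborel) = (\<integral>x. f x \<partial>lborel)"
  using integral_affine_euclidean[of 1 f t] integral_affine_euclidean[of "-1" f t] by simp_all

lemma
  fixes f :: "'a::euclidean_space \<Rightarrow> 'b::{banach, second_countable_topology}"
  assumes f: "integrable lborel f"
  shows integrable_translate: "integrable lborel (\<lambda>x. f (t + x))"
    and integrable_reflect: "integrable lborel (\<lambda>x. f (t - x))"
  using integrable_affine_euclidean[OF _ f, of 1 t] integrable_affine_euclidean[OF _ f, of "-1" t] by simp_all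

lemma
  fixes f :: "'a::euclidean_space \<Rightarrow> ennreal"
  assumes [measurable]: "f \<in> borel_measurable borel"
  shows nn_integral_translate: "(\<integral>\<^sup>+x. f (t + x) \<partial>lborel) = (\<integral>\<^sup>+x. f x \<partial>lborel)"
    and nn_integral_reflect: "(\<integral>\<^sup>+x. f (t - x) \<partial>lborel) = (\<integral>\<^sup>+x. f x \<partial>lborel)"
  using nn_integral_affine_euclidean[of 1 f t] nn_integral_affine_euclidean[of "-1" f t] by simp_all

lemma integrable_continuous_supp:
  fixes f :: "'a::euclidean_space \<Rightarrow> complex"
  assumes "continuous_on UNIV f" "\<And>x. norm x > R \<Longrightarrow> f x = 0"
  shows "integrable lborel f"
proof -
  have "integrable lborel (\<lambda>x. indicator (cball 0 R) x *\<^sub>R f x)"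
    by (rule borel_integrable_compact) (auto intro: continuous_on_subset[OF assms(1)])
  moreover have "(\<lambda>x. indicator (cball 0 R) x *\<^sub>R f x) = f"
    using assms(2) by (force simp: fun_eq_iff indicator_def)
  ultimately show ?thesis by simp
qed

lemma bounded_continuous_supp:
  fixes f :: "'a::euclidean_space \<Rightarrow> complex"
  assumes "continuous_on UNIV f" "\<And>x. norm x > R \<Longrightarrow> f x = 0"
  shows "\<exists>B\<ge>0. \<forall>x. norm (f x) \<le> B"
proof -
  have "bounded (f ` cball 0 R)"
    by (intro compact_imp_bounded compact_continuous_image) (auto intro: continuous_on_subset[OF assms(1)])
  then obtain B where "\<forall>y\<in>f ` cball 0 R. norm y \<le> B" unfolding bounded_iff by blast
  hence B: "norm (f x) \<le> B" if "norm x \<le> R" for x using that by simp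
  have "norm (f x) \<le> max 0 B" for x using B[of x] assms(2)[of x] by (cases "norm x \<le> R") auto
  thus ?thesis by (intro exI[of _ "max 0 B"]) auto
qed

text \<open>Difference quotients of \<open>F\<close> along \<open>b\<close> integrate to zero by
  translation invariance. They converge to \<open>G\<close>, uniformly bounded on a fixed compact
  set, since a bounded \<open>G\<close> makes \<open>F\<close> Lipschitz along
  \<open>b\<close>.\<close>

lemma integral_directional_derivative_zero:
  fixes F G :: "'a::euclidean_space \<Rightarrow> complex" and b :: 'a
  assumes F: "continuous_on UNIV F" "\<And>x. norm x > R \<Longrightarrow> F x = 0"
    and G: "continuous_on UNIV G" "\<And>x. norm x > R \<Longrightarrow> G x = 0"
    and der: "\<And>x. ((\<lambda>t::real. F (x + t *\<^sub>R b)) has_vector_derivative G x) (at 0)"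
  shows "(\<integral>x. G x \<partial>lborel) = 0"
proof -
  obtain B where B: "0 \<le> B" "\<And>x. norm (G x) \<le> B" using bounded_continuous_supp[OF G] by blast
  have [measurable]: "F \<in> borel_measurable borel" "G \<in> borel_measurable borel"
    using F G borel_measurable_continuous_onI by auto
  have derx: "((\<lambda>t::real. F (x + t *\<^sub>R b)) has_vector_derivative G (x + s *\<^sub>R b)) (at s)" for x s
  proof -
    have "((\<lambda>t. F ((x + s *\<^sub>R b) + t *\<^sub>R b)) \<circ> (\<lambda>t. t - s) has_vector_derivative (1 *\<^sub>R G (x + s *\<^sub>R b))) (at s)"
      by (rule vector_diff_chain_at) (use der in \<open>auto intro!: derivative_eq_intros\<close>)
    moreover have "(\<lambda>t. F ((x + s *\<^sub>R b) + t *\<^sub>R b)) \<circ> (\<lambda>t. t - s) = (\<lambda>t. F (x + t *\<^sub>R b))"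
      by (auto simp: fun_eq_iff algebra_simps)
    ultimately show ?thesis by simp
  qed
  have lip: "norm (F (x + h *\<^sub>R b) - F x) \<le> \<bar>h\<bar> * (3 * B)" for x and h :: real
  proof -
    have "norm (G (x + s *\<^sub>R b) - G (x + 0 *\<^sub>R b)) \<le> 2 * B" for s
      using norm_triangle_ineq4[of "G (x + s *\<^sub>R b)" "G (x + 0 *\<^sub>R b)"] B(2)[of "x + s *\<^sub>R b"] B(2)[of "x + 0 *\<^sub>R b"]
      by linarith
    hence "norm (F (x + h *\<^sub>R b) - F (x + 0 *\<^sub>R b) - (h - 0) *\<^sub>R G (x + 0 *\<^sub>R b)) \<le> norm (h - 0) * (2 * B)"
      by (intro vector_differentiable_bound_linearization[where S = UNIV and f' = "\<lambda>s. G (x + s *\<^sub>R b)"] derx) auto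
    moreover have "norm (h *\<^sub>R G x) \<le> \<bar>h\<bar> * B" using B by (simp add: mult_left_mono)
    moreover have "norm (F (x + h *\<^sub>R b) - F x) \<le> norm (F (x + h *\<^sub>R b) - F x - h *\<^sub>R G x) + norm (h *\<^sub>R G x)"
      using norm_triangle_ineq[of "F (x + h *\<^sub>R b) - F x - h *\<^sub>R G x" "h *\<^sub>R G x"] by simp
    ultimately show ?thesis by simp
  qed
  define h where "h = (\<lambda>n::nat. 1 / real (Suc n))"
  have h: "h n > 0" "h n \<le> 1" for n by (auto simp: h_def field_simps)
  have hlim: "h \<longlonglongrightarrow> 0" unfolding h_def by (rule LIMSEQ_Suc[OF lim_1_over_n])
  define q where "q = (\<lambda>n x. (1 / h n) *\<^sub>R (F (x + h n *\<^sub>R b) - F x))"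
  have "(\<lambda>n. \<integral>x. q n x \<partial>lborel) \<longlonglongrightarrow> (\<integral>x. G x \<partial>lborel)"
  \<comment> \<open>The steps \<open>h n\<close> are at most 1, so every quotient vanishes outside
    the enlarged ball. The 3 is the linearisation error \<open>2 * B\<close> plus the derivative
    itself.\<close>
  proof (rule integral_dominated_convergence[where w = "\<lambda>x. indicator (cball 0 (R + norm b)) x *\<^sub>R (3 * B)"])
    show "integrable lborel (\<lambda>x::'a. indicator (cball 0 (R + norm b)) x *\<^sub>R (3 * B))"
      by (rule borel_integrable_compact) auto
    show "AE x in lborel. (\<lambda>n. q n x) \<longlonglongrightarrow> G x"
    proof (rule AE_I2)
      fix x
      have "((\<lambda>t. norm (F (x + (0 + t) *\<^sub>R b) - F (x + 0 *\<^sub>R b) - t *\<^sub>R G x) / norm t) \<longlongrightarrow> 0) (at 0)"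
        using der[of x] unfolding has_vector_derivative_def has_derivative_at by blast
      moreover have "norm (F (x + (0 + t) *\<^sub>R b) - F (x + 0 *\<^sub>R b) - t *\<^sub>R G x) / norm t
          = norm ((F (x + t *\<^sub>R b) - F (x + 0 *\<^sub>R b)) /\<^sub>R t - G x)" if "t \<noteq> 0" for t
      proof -
        have "(F (x + t *\<^sub>R b) - F (x + 0 *\<^sub>R b)) /\<^sub>R t - G x
            = (F (x + (0 + t) *\<^sub>R b) - F (x + 0 *\<^sub>R b) - t *\<^sub>R G x) /\<^sub>R t"
          using that by (simp add: scaleR_right_diff_distrib)
        thus ?thesis by (simp add: divide_inverse mult.commute)
      qed
      hence "\<forall>\<^sub>F t in at 0. norm (F (x + (0 + t) *\<^sub>R b) - F (x + 0 *\<^sub>R b) - t *\<^sub>R G x) / norm t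
          = norm ((F (x + t *\<^sub>R b) - F (x + 0 *\<^sub>R b)) /\<^sub>R t - G x)"
        unfolding eventually_at_filter by (intro always_eventually allI impI)
      ultimately have "((\<lambda>t. norm ((F (x + t *\<^sub>R b) - F (x + 0 *\<^sub>R b)) /\<^sub>R t - G x)) \<longlongrightarrow> 0) (at 0)"
        by (rule Lim_transform_eventually)
      hence "((\<lambda>t. (F (x + t *\<^sub>R b) - F (x + 0 *\<^sub>R b)) /\<^sub>R t) \<longlongrightarrow> G x) (at 0)"
        by (rule LIM_zero_cancel[OF tendsto_norm_zero_cancel])
      hence "(\<lambda>n. (F (x + h n *\<^sub>R b) - F (x + 0 *\<^sub>R b)) /\<^sub>R h n) \<longlonglongrightarrow> G x"
      proof (rule filterlim_compose)
        have "h n \<noteq> 0" for n using h(1)[of n] by simp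
        thus "filterlim h (at 0) sequentially" using hlim by (simp add: filterlim_at)
      qed
      thus "(\<lambda>n. q n x) \<longlonglongrightarrow> G x" by (simp add: q_def divide_inverse)
    qed
    fix n
    show "AE x in lborel. norm (q n x) \<le> indicator (cball 0 (R + norm b)) x *\<^sub>R (3 * B)"
    proof (rule AE_I2)
      fix x
      have "norm (q n x) \<le> 3 * B"
        using lip[of x "h n"] h(1)[of n] by (simp add: q_def pos_divide_le_eq mult.commute)
      moreover have "q n x = 0" if "norm x > R + norm b"
      proof -
        have 1: "norm (h n *\<^sub>R b) \<le> norm b" using h[of n] by (simp add: mult_left_le_one_le)
        have 2: "norm x \<le> norm (x + h n *\<^sub>R b) + norm (h n *\<^sub>R b)"
          using norm_triangle_ineq4[of "x + h n *\<^sub>R b" "h n *\<^sub>R b"] by simp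
        have "norm (x + h n *\<^sub>R b) > R" "norm x > R"
          using that 1 2 norm_ge_zero[of b] by linarith+
        thus ?thesis using F by (simp add: q_def)
      qed
      ultimately show "norm (q n x) \<le> indicator (cball 0 (R + norm b)) x *\<^sub>R (3 * B)"
        by (auto simp: indicator_def)
    qed
    show "q n \<in> borel_measurable lborel" unfolding q_def by measurable
  qed measurable
  moreover have "(\<integral>x. q n x \<partial>lborel) = 0" for n
  proof -
    have i: "integrable lborel F" by (rule integrable_continuous_supp[OF F])
    hence i2: "integrable lborel (\<lambda>x. F (x + h n *\<^sub>R b))"
      using integrable_translate[of F "h n *\<^sub>R b"] by (simp add: add.commute)
    have "(\<integral>x. q n x \<partial>lborel) = (1 / h n) *\<^sub>R ((\<integral>x. F (x + h n *\<^sub>R b) \<partial>lborel) - (\<integral>x. F x \<partial>lborel))"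
      unfolding q_def using i i2 by simp
    also have "(\<integral>x. F (x + h n *\<^sub>R b) \<partial>lborel) = (\<integral>x. F x \<partial>lborel)"
      using integral_translate[of F "h n *\<^sub>R b"] by (simp add: add.commute)
    finally show ?thesis by simp
  qed
  ultimately show ?thesis by (simp add: LIMSEQ_const_iff)
qed

section \<open>Smoothness in one direction\<close>

text \<open>Exactly what repeated integration by parts in one direction needs: \<open>m\<close>
  successive continuous derivatives along \<open>b\<close>. As the derivatives are only asserted to
  exist, products and reciprocals can be treated by induction on \<open>m\<close> without formulas
  for higher derivatives.\<close>

primrec smooth_along :: "'a::euclidean_space \<Rightarrow> nat \<Rightarrow> ('a \<Rightarrow> complex) \<Rightarrow> bool" where
  "smooth_along b 0 f = continuous_on UNIV f"
| "smooth_along b (Suc m) f = (continuous_on UNIV f \<and>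
     (\<exists>g. (\<forall>x. ((\<lambda>t::real. f (x + t *\<^sub>R b)) has_vector_derivative g x) (at 0)) \<and> smooth_along b m g))"

lemma smooth_along_cont: "smooth_along b m f \<Longrightarrow> continuous_on UNIV f"
  by (cases m) auto

lemma smooth_along_Suc_imp: "smooth_along b (Suc m) f \<Longrightarrow> smooth_along b m f"
proof (induction m arbitrary: f)
  case (Suc m)
  then obtain g where g: "\<forall>x. ((\<lambda>t::real. f (x + t *\<^sub>R b)) has_vector_derivative g x) (at 0)" "smooth_along b (Suc m) g"
    by auto
  hence "smooth_along b m g" using Suc.IH by blast
  thus ?case using Suc.prems g by auto
qed auto

lemma smooth_along_const: "smooth_along b m (\<lambda>x. c)"
  by (induction m arbitrary: c) (auto intro!: exI[of _ "\<lambda>x. 0"] has_vector_derivative_const)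

lemma smooth_along_add:
  "smooth_along b m f \<Longrightarrow> smooth_along b m g \<Longrightarrow> smooth_along b m (\<lambda>x. f x + g x)"
proof (induction m arbitrary: f g)
  case (Suc m)
  then obtain f' g' where "\<forall>x. ((\<lambda>t::real. f (x + t *\<^sub>R b)) has_vector_derivative f' x) (at 0)" "smooth_along b m f'"
    "\<forall>x. ((\<lambda>t::real. g (x + t *\<^sub>R b)) has_vector_derivative g' x) (at 0)" "smooth_along b m g'" by auto
  hence "\<forall>x. ((\<lambda>t::real. f (x + t *\<^sub>R b) + g (x + t *\<^sub>R b)) has_vector_derivative f' x + g' x) (at 0)"
    "smooth_along b m (\<lambda>x. f' x + g' x)"
    using Suc.IH by (auto intro: has_vector_derivative_add)
  thus ?case using Suc.prems by (auto intro!: continuous_intros exI[of _ "\<lambda>x. f' x + g' x"])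
qed (auto intro: continuous_intros)

lemma smooth_along_mult:
  "smooth_along b m f \<Longrightarrow> smooth_along b m g \<Longrightarrow> smooth_along b m (\<lambda>x. f x * g x)"
proof (induction m arbitrary: f g)
  case (Suc m)
  then obtain f' g' where *: "\<forall>x. ((\<lambda>t::real. f (x + t *\<^sub>R b)) has_vector_derivative f' x) (at 0)" "smooth_along b m f'"
    "\<forall>x. ((\<lambda>t::real. g (x + t *\<^sub>R b)) has_vector_derivative g' x) (at 0)" "smooth_along b m g'" by auto
  have "((\<lambda>t::real. f (x + t *\<^sub>R b) * g (x + t *\<^sub>R b)) has_vector_derivative f x * g' x + f' x * g x) (at 0)" for x
    using has_vector_derivative_mult[of "\<lambda>t. f (x + t *\<^sub>R b)" "f' x" 0 UNIV "\<lambda>t. g (x + t *\<^sub>R b)" "g' x"] * by simp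
  moreover have "smooth_along b m (\<lambda>x. f x * g' x + f' x * g x)"
    using Suc.IH Suc.prems[THEN smooth_along_Suc_imp] * by (intro smooth_along_add) auto
  ultimately show ?case using Suc.prems by (auto intro!: continuous_intros exI[of _ "\<lambda>x. f x * g' x + f' x * g x"])
qed (auto intro: continuous_intros)

text \<open>The derivative is minus \<open>f'\<close> times two reciprocals of \<open>f\<close>,
  each of them smooth of order \<open>m\<close> by induction.\<close>

lemma smooth_along_inverse:
  "smooth_along b m f \<Longrightarrow> (\<And>x. f x \<noteq> 0) \<Longrightarrow> smooth_along b m (\<lambda>x. inverse (f x))"
proof (induction m arbitrary: f)
  case (Suc m)
  then obtain f' where *: "\<forall>x. ((\<lambda>t::real. f (x + t *\<^sub>R b)) has_vector_derivative f' x) (at 0)" "smooth_along b m f'"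
    by auto
  have i: "smooth_along b m (\<lambda>x. inverse (f x))" using Suc smooth_along_Suc_imp by blast
  have d: "((\<lambda>t::real. inverse (f (x + t *\<^sub>R b))) has_vector_derivative (-1) * (f' x * (inverse (f x) * inverse (f x)))) (at 0)" for x
  proof -
    have "(inverse has_field_derivative (- (inverse (f (x + 0 *\<^sub>R b)) ^ Suc (Suc 0)))) (at (f (x + 0 *\<^sub>R b)))"
      using Suc.prems(2) by (intro DERIV_inverse) auto
    from field_vector_diff_chain_at[OF *(1)[rule_format, of x], OF this]
    show ?thesis by (simp add: o_def mult_ac)
  qed
  have "smooth_along b m (\<lambda>x. (-1) * (f' x * (inverse (f x) * inverse (f x))))"
    by (intro smooth_along_mult smooth_along_const i *)
  thus ?case using Suc.prems d by (auto intro!: continuous_intros exI[of _ "\<lambda>x. (-1) * (f' x * (inverse (f x) * inverse (f x)))"])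
qed (auto intro: continuous_intros)

lemma smooth_along_affine:
  fixes c :: real
  shows "smooth_along b m f \<Longrightarrow> smooth_along b m (\<lambda>x. f (c *\<^sub>R x + k))"
proof (induction m arbitrary: f)
  case 0
  thus ?case by (auto intro!: continuous_on_compose2[of UNIV f] continuous_intros)
next
  case (Suc m)
  then obtain f' where *: "\<forall>x. ((\<lambda>t::real. f (x + t *\<^sub>R b)) has_vector_derivative f' x) (at 0)" "smooth_along b m f'"
    by auto
  have d: "((\<lambda>t::real. f (c *\<^sub>R (x + t *\<^sub>R b) + k)) has_vector_derivative of_real c * f' (c *\<^sub>R x + k)) (at 0)" for x
  proof -
    have "((\<lambda>t. f ((c *\<^sub>R x + k) + t *\<^sub>R b)) \<circ> (\<lambda>t. c * t) has_vector_derivative (c *\<^sub>R f' (c *\<^sub>R x + k))) (at 0)"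
      by (rule vector_diff_chain_at) (use * in \<open>auto intro!: derivative_eq_intros\<close>)
    moreover have "(\<lambda>t. f ((c *\<^sub>R x + k) + t *\<^sub>R b)) \<circ> (\<lambda>t. c * t) = (\<lambda>t. f (c *\<^sub>R (x + t *\<^sub>R b) + k))"
      by (auto simp: fun_eq_iff algebra_simps)
    ultimately show ?thesis by (simp add: scaleR_conv_of_real)
  qed
  have "smooth_along b m (\<lambda>x. of_real c * f' (c *\<^sub>R x + k))"
    by (intro smooth_along_mult smooth_along_const Suc.IH *)
  moreover have "continuous_on UNIV (\<lambda>x. f (c *\<^sub>R x + k))"
    using Suc.prems by (auto intro!: continuous_on_compose2[of UNIV f] continuous_intros)
  ultimately show ?case using d unfolding smooth_along.simps by (intro conjI exI[of _ "\<lambda>x. of_real c * f' (c *\<^sub>R x + k)"]) auto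
qed

lemma smooth_along_sum:
  "finite S \<Longrightarrow> (\<And>k. k \<in> S \<Longrightarrow> smooth_along b m (f k)) \<Longrightarrow> smooth_along b m (\<lambda>x. \<Sum>k\<in>S. f k x)"
  by (induction S rule: finite_induct) (auto intro: smooth_along_const smooth_along_add)

lemma C_infinity_partial:
  assumes "C_infinity f" "b \<in> Basis" shows "C_infinity (partial_derivative b f)"
proof -
  have "iterated_partial bs (partial_derivative b f) = iterated_partial (bs @ [b]) f" for bs
    by (simp add: iterated_partial_def)
  thus ?thesis using assms unfolding C_infinity_def by simp
qed

lemma C_infinity_differentiable: "C_infinity f \<Longrightarrow> f differentiable (at x)"
  unfolding C_infinity_def by (drule spec[of _ "[]"]) (simp add: iterated_partial_def)

lemma has_vector_derivative_partial:
  fixes f :: "'a::euclidean_space \<Rightarrow> 'b::real_normed_vector"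
  assumes "f differentiable (at x)"
  shows "((\<lambda>t::real. f (x + t *\<^sub>R b)) has_vector_derivative partial_derivative b f x) (at 0)"
proof -
  have 1: "(f has_derivative frechet_derivative f (at x)) (at (x + 0 *\<^sub>R b))"
    using frechet_derivative_works[THEN iffD1, OF assms] by simp
  have "((\<lambda>t::real. x + t *\<^sub>R b) has_derivative (\<lambda>t. t *\<^sub>R b)) (at 0)"
    by (auto intro!: derivative_eq_intros)
  from diff_chain_at[OF this 1]
  have "((\<lambda>t::real. f (x + t *\<^sub>R b)) has_derivative (\<lambda>t. frechet_derivative f (at x) (t *\<^sub>R b))) (at 0)"
    by (simp add: o_def)
  moreover have "linear (frechet_derivative f (at x))" using 1 by (simp add: has_derivative_linear)
  ultimately show ?thesis
    by (simp add: has_vector_derivative_def partial_derivative_def linear_cmul)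
qed

lemma smooth_along_C_infinity:
  fixes r :: "'a::euclidean_space \<Rightarrow> real"
  assumes "C_infinity r" "b \<in> Basis"
  shows "smooth_along b m (\<lambda>x. complex_of_real (r x))"
  using assms(1)
proof (induction m arbitrary: r)
  case 0
  have "continuous_on UNIV r"
    using C_infinity_differentiable[OF 0] differentiable_imp_continuous_within
    by (auto simp: continuous_on_eq_continuous_at)
  thus ?case by (auto intro: continuous_intros)
next
  case (Suc m)
  have "continuous_on UNIV r"
    using C_infinity_differentiable[OF Suc.prems] differentiable_imp_continuous_within
    by (auto simp: continuous_on_eq_continuous_at)
  moreover have "((\<lambda>t::real. complex_of_real (r (x + t *\<^sub>R b))) has_vector_derivative complex_of_real (partial_derivative b r x)) (at 0)" for x
    using bounded_linear.has_vector_derivative[OF bounded_linear_of_real has_vector_derivative_partial[OF C_infinity_differentiable[OF Suc.prems]], of x b] 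
    by simp
  ultimately show ?case
    using Suc.IH[OF C_infinity_partial[OF Suc.prems assms(2)]] unfolding smooth_along.simps
    by (intro conjI exI[of _ "\<lambda>x. complex_of_real (partial_derivative b r x)"]) (auto intro: continuous_intros)
qed

section \<open>Decay of oscillatory integrals\<close>

text \<open>The inverse Fourier transform without its normalising factor.\<close>

definition oscint :: "('a::euclidean_space \<Rightarrow> complex) \<Rightarrow> 'a \<Rightarrow> complex" where
  "oscint f x = (\<integral>\<eta>. f \<eta> * exp (\<i> * of_real (x \<bullet> \<eta>)) \<partial>lborel)"

lemma oscint_cont_bound:
  assumes "integrable lborel f" shows "norm (oscint f x) \<le> (\<integral>\<eta>. norm (f \<eta>) \<partial>lborel)"
  unfolding oscint_def by (rule order_trans[OF integral_norm_bound]) (simp add: norm_mult)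

text \<open>Integration by parts: each factor \<open>x \<bullet> b\<close> becomes a derivative of
  \<open>f\<close> along \<open>b\<close>, up to a unit. For basis vectors, the ones used later, the
  power of \<open>norm b\<close> is 1.\<close>

lemma oscint_decay:
  fixes f :: "'a::euclidean_space \<Rightarrow> complex"
  assumes "smooth_along b m f" "\<And>x. norm x > R \<Longrightarrow> f x = 0"
  shows "\<exists>C\<ge>0. \<forall>x. \<bar>x \<bullet> b\<bar> ^ m * norm (oscint f x) \<le> C * norm b ^ (2*m)"
  using assms
proof (induction m arbitrary: f)
  case 0
  have "integrable lborel f" using integrable_continuous_supp[of f R] 0 by auto
  thus ?case using oscint_cont_bound[of f] by (intro exI[of _ "(\<integral>\<eta>. norm (f \<eta>) \<partial>lborel)"]) auto
next
  case (Suc m)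
  then obtain g where g: "\<And>x. ((\<lambda>t::real. f (x + t *\<^sub>R b)) has_vector_derivative g x) (at 0)" "smooth_along b m g"
    by auto
  have g0: "g x = 0" if "norm x > R" for x
  proof -
    have "open {t::real. norm (x + t *\<^sub>R b) > R}"
      by (intro open_Collect_less continuous_intros)
    note * = has_vector_derivative_transform_within_open[OF has_vector_derivative_const[of "0::complex"] this]
    have "((\<lambda>t::real. f (x + t *\<^sub>R b)) has_vector_derivative 0) (at 0)"
    proof (rule *[where g = "\<lambda>t. f (x + t *\<^sub>R b)" and x = 0])
      show "0 \<in> {t::real. R < norm (x + t *\<^sub>R b)}" using that by simp
      show "0 = f (x + t *\<^sub>R b)" if "t \<in> {t::real. R < norm (x + t *\<^sub>R b)}" for t
        using Suc.prems(2)[of "x + t *\<^sub>R b"] that by simp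
    qed
    thus ?thesis using g(1)[of x] vector_derivative_unique_at by blast
  qed
  have cf: "continuous_on UNIV f" and cg: "continuous_on UNIV g" using Suc.prems g smooth_along_cont by auto
  obtain C where C: "0 \<le> C" "\<And>x. \<bar>x \<bullet> b\<bar> ^ m * norm (oscint g x) \<le> C * norm b ^ (2*m)" using Suc.IH[OF g(2) g0] by blast
  have "of_real (x \<bullet> b) * oscint f x = \<i> * oscint g x" for x
  proof -
    let ?e = "\<lambda>\<eta>. exp (\<i> * of_real (x \<bullet> \<eta>))"
    have "(\<integral>\<eta>. g \<eta> * ?e \<eta> + \<i> * of_real (x \<bullet> b) * (f \<eta> * ?e \<eta>) \<partial>lborel) = 0"
    proof (rule integral_directional_derivative_zero[where F = "\<lambda>\<eta>. f \<eta> * ?e \<eta>" and b = b and R = R])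
      fix y
      have "((\<lambda>t::real. ?e (y + t *\<^sub>R b)) has_vector_derivative \<i> * of_real (x \<bullet> b) * ?e y) (at 0)"
      proof -
        have "((\<lambda>t::real. \<i> * of_real (x \<bullet> (y + t *\<^sub>R b))) has_vector_derivative \<i> * of_real (x \<bullet> b)) (at 0)"
          by (auto intro!: derivative_eq_intros simp: inner_add_right)
        from field_vector_diff_chain_at[OF this DERIV_exp] show ?thesis
          by (simp add: o_def)
      qed
      from has_vector_derivative_mult[OF g(1)[of y] this]
      show "((\<lambda>t::real. f (y + t *\<^sub>R b) * ?e (y + t *\<^sub>R b)) has_vector_derivative g y * ?e y + \<i> * of_real (x \<bullet> b) * (f y * ?e y)) (at 0)"
        by (simp add: mult_ac add.commute)
    qed (use Suc.prems g0 in \<open>auto intro!: continuous_intros cf cg\<close>)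
    moreover have "integrable lborel (\<lambda>\<eta>. g \<eta> * ?e \<eta>)" "integrable lborel (\<lambda>\<eta>. f \<eta> * ?e \<eta>)"
      by (auto intro!: integrable_continuous_supp[where R=R] continuous_intros cf cg simp: g0 Suc.prems)
    ultimately have "oscint g x + \<i> * of_real (x \<bullet> b) * oscint f x = 0"
      unfolding oscint_def by simp
    hence "oscint g x = - (\<i> * of_real (x \<bullet> b) * oscint f x)"
      by (simp add: add_eq_0_iff2)
    thus ?thesis by (simp add: mult.assoc[symmetric])
  qed
  hence "\<bar>x \<bullet> b\<bar> * norm (oscint f x) = norm (oscint g x)" for x
    by (metis norm_mult norm_of_real norm_ii mult_1)
  hence e: "\<bar>x \<bullet> b\<bar> ^ Suc m * norm (oscint f x) = \<bar>x \<bullet> b\<bar> ^ m * norm (oscint g x)" for x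
    by (simp add: mult.assoc mult.left_commute)
  show ?case
  proof (cases "b = 0")
    case True
    thus ?thesis by (intro exI[of _ 0]) auto
  next
    case False
    show ?thesis unfolding e using C False
      by (intro exI[of _ "C / norm b ^ 2"] conjI allI) (auto simp: power2_eq_square power_mult)
  qed
qed

text \<open>A product of one-dimensional profiles, so that integrability reduces to that of 1 / (1 +
  x^2) on the line.\<close>

definition dec :: "'a::euclidean_space \<Rightarrow> real" where
  "dec x = (\<Prod>b\<in>Basis. 1 / (1 + (x \<bullet> b)\<^sup>2))"

lemma dec_pos: "0 < dec x"
  unfolding dec_def by (intro prod_pos) (simp add: add_pos_nonneg)

lemma dec_measurable [measurable]: "dec \<in> borel_measurable borel"
  unfolding dec_def[abs_def] by measurable

text \<open>The product in \<open>dec\<close> is controlled by the largest coordinate alone, at the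
  power \<open>2 * DIM('a)\<close>. This is why that many derivatives are taken in every coordinate
  direction.\<close>

lemma dec_bound:
  fixes x :: "'a::euclidean_space"
  assumes "\<And>b. b \<in> Basis \<Longrightarrow> \<bar>x \<bullet> b\<bar> ^ (2 * DIM('a)) * y \<le> C" "0 \<le> y" "y \<le> C"
  shows "y \<le> (2 ^ (DIM('a) + 1) * C) * dec x"
proof -
  let ?n = "DIM('a)"
  define M where "M = Max ((\<lambda>b. \<bar>x \<bullet> b\<bar>) ` Basis)"
  have "M \<in> (\<lambda>b. \<bar>x \<bullet> b\<bar>) ` Basis" unfolding M_def by (rule Max_in) auto
  then obtain b0 where b0: "b0 \<in> Basis" "M = \<bar>x \<bullet> b0\<bar>" by auto
  have M: "\<bar>x \<bullet> b\<bar> \<le> M" if "b \<in> Basis" for b unfolding M_def using that by (intro Max_ge) auto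
  have "(\<Prod>b\<in>Basis. 1 + (x \<bullet> b)\<^sup>2) \<le> (\<Prod>b\<in>(Basis::'a set). 1 + M\<^sup>2)"
    using M by (intro prod_mono) (auto simp: add_nonneg_nonneg abs_le_square_iff[symmetric] b0)
  also have "\<dots> = (1 + M\<^sup>2) ^ ?n" by simp
  also have "\<dots> \<le> 2 ^ ?n * (1 + M ^ (2 * ?n))"
  proof (cases "M \<le> 1")
    case True
    have "(1 + M\<^sup>2) ^ ?n \<le> 2 ^ ?n" using True b0 by (intro power_mono) (auto simp: abs_square_le_1)
    also have "\<dots> \<le> 2 ^ ?n * (1 + M ^ (2 * ?n))" using b0 by simp
    finally show ?thesis .
  next
    case False
    have "(1 + M\<^sup>2) ^ ?n \<le> (2 * M\<^sup>2) ^ ?n" using False by (intro power_mono) auto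
    also have "\<dots> \<le> 2 ^ ?n * (1 + M ^ (2 * ?n))" by (simp add: power_mult_distrib power_mult)
    finally show ?thesis .
  qed
  finally have P: "(\<Prod>b\<in>Basis. 1 + (x \<bullet> b)\<^sup>2) \<le> 2 ^ ?n * (1 + M ^ (2 * ?n))" .
  have pos: "0 < (\<Prod>b\<in>Basis. 1 + (x \<bullet> b)\<^sup>2)" by (intro prod_pos) (simp add: add_pos_nonneg)
  have "y * (\<Prod>b\<in>Basis. 1 + (x \<bullet> b)\<^sup>2) \<le> y * (2 ^ ?n * (1 + M ^ (2 * ?n)))"
    using P assms by (intro mult_left_mono) auto
  also have "\<dots> = 2 ^ ?n * (y + M ^ (2 * ?n) * y)" by (simp add: algebra_simps)
  also have "\<dots> \<le> 2 ^ ?n * (C + C)" using assms(1)[OF b0(1)] assms b0 by (intro mult_left_mono add_mono) auto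
  finally have "y * (\<Prod>b\<in>Basis. 1 + (x \<bullet> b)\<^sup>2) \<le> 2 ^ (?n + 1) * C" by simp
  thus ?thesis using pos by (simp add: dec_def prod_dividef field_simps)
qed

lemma dec_integrable: "integrable lborel (dec :: 'a::euclidean_space \<Rightarrow> real)"
proof -
  have "integrable lborel (\<lambda>x::real. 1 / (1 + x\<^sup>2))"
    using integrable_inverse_1_plus_square by (simp add: set_integrable_def einterval_eq inverse_eq_divide)
  hence fin: "(\<integral>\<^sup>+x. ennreal (1 / (1 + x\<^sup>2)) \<partial>(lborel :: real measure)) < \<infinity>"
    by (simp add: integrable_iff_bounded add_nonneg_nonneg)
  have "(\<integral>\<^sup>+x. ennreal (dec (x::'a)) \<partial>lborel) = (\<integral>\<^sup>+x. (\<Prod>b\<in>(Basis::'a set). ennreal (1 / (1 + (x \<bullet> b)\<^sup>2))) \<partial>lborel)"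
    unfolding dec_def by (subst prod_ennreal) (auto simp: add_nonneg_nonneg)
  also have "\<dots> = (\<Prod>b\<in>(Basis::'a set). (\<integral>\<^sup>+x. ennreal (1 / (1 + x\<^sup>2)) \<partial>lborel))"
    by (rule nn_integral_lborel_prod) auto
  also have "\<dots> < \<infinity>" using fin
    by (cases "(\<integral>\<^sup>+x. ennreal (1 / (1 + x\<^sup>2)) \<partial>(lborel :: real measure))" rule: ennreal_cases) (auto simp: ennreal_power)
  finally show ?thesis
    by (simp add: integrable_iff_bounded abs_of_pos[OF dec_pos])
qed

lemma oscint_dec:
  fixes f :: "'a::euclidean_space \<Rightarrow> complex"
  assumes sm: "\<And>b. b \<in> Basis \<Longrightarrow> smooth_along b (2 * DIM('a)) f" and z: "\<And>x. norm x > R \<Longrightarrow> f x = 0"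
  shows "\<exists>C\<ge>0. \<forall>x. norm (oscint f x) \<le> C * dec x"
proof -
  let ?n = "2 * DIM('a)"
  have "\<forall>b\<in>Basis. \<exists>C\<ge>0. \<forall>x. \<bar>x \<bullet> b\<bar> ^ ?n * norm (oscint f x) \<le> C"
  proof
    fix b :: 'a assume b: "b \<in> Basis"
    from oscint_decay[OF sm[OF b] z] b show "\<exists>C\<ge>0. \<forall>x. \<bar>x \<bullet> b\<bar> ^ ?n * norm (oscint f x) \<le> C" by simp
  qed
  then obtain C where C: "\<And>b x. b \<in> Basis \<Longrightarrow> 0 \<le> C b \<and> \<bar>x \<bullet> b\<bar> ^ ?n * norm (oscint f x) \<le> C b" by metis
  have "continuous_on UNIV f" using sm[OF SOME_Basis] smooth_along_cont by blast
  hence i: "integrable lborel f" using integrable_continuous_supp z by blast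
  define D where "D = (\<Sum>b\<in>Basis. C b) + (\<integral>\<eta>. norm (f \<eta>) \<partial>lborel)"
  have D0: "0 \<le> (\<integral>\<eta>. norm (f \<eta>) \<partial>lborel)" by simp
  have s0: "0 \<le> (\<Sum>b\<in>Basis. C b)" using C by (intro sum_nonneg) auto
  have "norm (oscint f x) \<le> (2 ^ (DIM('a) + 1) * D) * dec x" for x
  proof (rule dec_bound)
    fix b :: 'a assume b: "b \<in> Basis"
    have "\<bar>x \<bullet> b\<bar> ^ ?n * norm (oscint f x) \<le> C b" using C b by blast
    also have "\<dots> \<le> (\<Sum>b\<in>Basis. C b)" using b C by (intro member_le_sum) auto
    also have "\<dots> \<le> D" using D0 by (simp add: D_def)
    finally show "\<bar>x \<bullet> b\<bar> ^ ?n * norm (oscint f x) \<le> D" .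
  next
    show "norm (oscint f x) \<le> D" using oscint_cont_bound[OF i, of x] s0 by (simp add: D_def)
  qed simp
  thus ?thesis using D0 s0 by (intro exI[of _ "2 ^ (DIM('a) + 1) * D"]) (auto simp: D_def)
qed

section \<open>Fourier inversion\<close>

lemma fubini_mult:
  fixes A :: "'a \<Rightarrow> complex" and B :: "'b \<Rightarrow> complex" and E :: "'a \<Rightarrow> 'b \<Rightarrow> complex"
  assumes sf: "sigma_finite_measure M" "sigma_finite_measure N"
    and A: "integrable M A" and B: "integrable N B"
    and E [measurable]: "(\<lambda>(x, y). E x y) \<in> borel_measurable (M \<Otimes>\<^sub>M N)" and K: "\<And>x y. norm (E x y) \<le> K"
  shows "(\<integral>x. A x * (\<integral>y. B y * E x y \<partial>N) \<partial>M) = (\<integral>y. B y * (\<integral>x. A x * E x y \<partial>M) \<partial>N)"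
    and "integrable M (\<lambda>x. A x * (\<integral>y. B y * E x y \<partial>N))"
    and "integrable N (\<lambda>y. B y * (\<integral>x. A x * E x y \<partial>M))"
proof -
  interpret M: sigma_finite_measure M by fact
  interpret N: sigma_finite_measure N by fact
  interpret pair_sigma_finite M N ..
  have [measurable]: "A \<in> borel_measurable M" "B \<in> borel_measurable N" using A B by auto
  have K0: "0 \<le> K" using K[of undefined undefined] norm_ge_zero order_trans by blast
  have AB: "integrable (M \<Otimes>\<^sub>M N) (\<lambda>(x, y). A x * B y)"
  proof (rule Fubini_integrable)
    show "integrable M (\<lambda>x. \<integral>y. norm (case (x, y) of (x, y) \<Rightarrow> A x * B y) \<partial>N)"
      using A B by (simp add: norm_mult)
    show "AE x in M. integrable N (\<lambda>y. case (x, y) of (x, y) \<Rightarrow> A x * B y)"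
      using B by auto
  qed measurable
  have int: "integrable (M \<Otimes>\<^sub>M N) (\<lambda>(x, y). A x * (B y * E x y))"
  proof (rule Bochner_Integration.integrable_bound)
    show "integrable (M \<Otimes>\<^sub>M N) (\<lambda>z. of_real K * (case z of (x, y) \<Rightarrow> A x * B y))"
      by (rule integrable_mult_right) (rule AB)
    show "AE z in M \<Otimes>\<^sub>M N. norm (case z of (x, y) \<Rightarrow> A x * (B y * E x y)) \<le> norm (of_real K * (case z of (x, y) \<Rightarrow> A x * B y))"
    proof (rule AE_I2)
      fix z :: "'a \<times> 'b"
      obtain x y where z: "z = (x, y)" by fastforce
      have "norm (A x * B y) * norm (E x y) \<le> norm (A x * B y) * K"
        by (intro mult_left_mono K) auto
      thus "norm (case z of (x, y) \<Rightarrow> A x * (B y * E x y)) \<le> norm (of_real K * (case z of (x, y) \<Rightarrow> A x * B y))"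
        using K0 by (simp add: z norm_mult mult.assoc mult.commute[of K])
    qed
  qed measurable
  from Fubini_integral[OF int] 
  have "(\<integral>y. \<integral>x. A x * (B y * E x y) \<partial>M \<partial>N) = (\<integral>x. \<integral>y. A x * (B y * E x y) \<partial>N \<partial>M)" by simp
  moreover have "(\<integral>x. A x * (B y * E x y) \<partial>M) = B y * (\<integral>x. A x * E x y \<partial>M)" for y
    by (subst integral_mult_right_zero[symmetric]) (simp add: mult_ac)
  moreover have "(\<integral>y. A x * (B y * E x y) \<partial>N) = A x * (\<integral>y. B y * E x y \<partial>N)" for x
    by (rule integral_mult_right_zero)
  ultimately show "(\<integral>x. A x * (\<integral>y. B y * E x y \<partial>N) \<partial>M) = (\<integral>y. B y * (\<integral>x. A x * E x y \<partial>M) \<partial>N)"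
    by simp
  have "integrable M (\<lambda>x. \<integral>y. A x * (B y * E x y) \<partial>N)"
    using integrable_fst'[OF int] by simp
  thus "integrable M (\<lambda>x. A x * (\<integral>y. B y * E x y \<partial>N))" by simp
  have "integrable N (\<lambda>y. \<integral>x. A x * (B y * E x y) \<partial>M)"
    using integrable_snd[OF int] by simp
  moreover have "(\<integral>x. A x * (B y * E x y) \<partial>M) = B y * (\<integral>x. A x * E x y \<partial>M)" for y
    by (subst integral_mult_right_zero[symmetric]) (simp add: mult_ac)
  ultimately show "integrable N (\<lambda>y. B y * (\<integral>x. A x * E x y \<partial>M))" by simp
qed

section \<open>Product functions and Gaussians\<close>

lemma
  fixes f :: "'a::euclidean_space \<Rightarrow> real \<Rightarrow> complex"
  assumes f: "\<And>b. b \<in> Basis \<Longrightarrow> integrable lborel (f b)"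
  shows lborel_integral_prod: "(\<integral>x. (\<Prod>b\<in>Basis. f b (x \<bullet> b)) \<partial>lborel) = (\<Prod>b\<in>Basis. \<integral>x. f b x \<partial>lborel)"
    and lborel_integrable_prod: "integrable lborel (\<lambda>x. \<Prod>b\<in>Basis. f b (x \<bullet> b))"
proof -
  interpret product_sigma_finite "\<lambda>_::'a. lborel :: real measure" ..
  have [measurable]: "f b \<in> borel_measurable borel" if "b \<in> Basis" for b using f[OF that] by auto
  have eq: "(\<Prod>b\<in>Basis. f b ((\<Sum>c\<in>Basis. x c *\<^sub>R c) \<bullet> b)) = (\<Prod>b\<in>Basis. f b (x b))" for x
    by (intro prod.cong refl) (simp add: inner_sum_left_Basis)
  show "(\<integral>x. (\<Prod>b\<in>Basis. f b (x \<bullet> b)) \<partial>lborel) = (\<Prod>b\<in>Basis. \<integral>x. f b x \<partial>lborel)"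
    by (subst lborel_eq, subst integral_distr) (simp_all add: eq product_integral_prod f)
  show "integrable lborel (\<lambda>x. \<Prod>b\<in>Basis. f b (x \<bullet> b))"
    by (subst lborel_eq, subst integrable_distr_eq) (simp_all add: eq product_integrable_prod f)
qed

definition gauss :: "'a::euclidean_space \<Rightarrow> real" where
  "gauss x = (\<Prod>b\<in>Basis. std_normal_density (x \<bullet> b))"

lemma norm_sq_sum_Basis: "(norm (x::'a::euclidean_space))\<^sup>2 = (\<Sum>b\<in>Basis. (x \<bullet> b)\<^sup>2)"
  by (subst power2_norm_eq_inner, subst euclidean_inner) (simp add: power2_eq_square)

lemma prod_exp_Basis: "(\<Prod>b\<in>Basis. exp (- ((x::'a::euclidean_space) \<bullet> b)\<^sup>2 / 2)) = exp (- (norm x)\<^sup>2 / 2)"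
proof -
  have "(\<Prod>b\<in>Basis. exp (- (x \<bullet> b)\<^sup>2 / 2)) = exp (\<Sum>b\<in>Basis. - (x \<bullet> b)\<^sup>2 / 2)"
    by (rule exp_sum[symmetric]) simp
  thus ?thesis by (simp only: norm_sq_sum_Basis sum_divide_distrib[symmetric] sum_negf)
qed

lemma gauss_eq: "gauss (x::'a::euclidean_space) = exp (- (norm x)\<^sup>2 / 2) / sqrt (2 * pi) ^ DIM('a)"
proof -
  have "gauss x = (\<Prod>b\<in>(Basis::'a set). exp (- (x \<bullet> b)\<^sup>2 / 2)) / sqrt (2 * pi) ^ DIM('a)"
    unfolding gauss_def std_normal_density_def by (simp add: prod_dividef)
  also note prod_exp_Basis
  finally show ?thesis .
qed

lemma gauss_measurable [measurable]: "gauss \<in> borel_measurable borel"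
  unfolding gauss_def[abs_def] by measurable

lemma
  shows gauss_fourier: "(\<integral>x. complex_of_real (gauss x) * exp (\<i> * of_real (x \<bullet> t)) \<partial>lborel) = of_real (exp (- (norm (t::'a::euclidean_space))\<^sup>2 / 2))"
    and gauss_integrable: "integrable lborel (\<lambda>x. complex_of_real (gauss (x::'a)))"
proof -
  have i: "integrable lborel (\<lambda>x. complex_of_real (std_normal_density x))"
    by (intro integrable_of_real) simp
  let ?f = "\<lambda>b x. complex_of_real (std_normal_density x) * exp (\<i> * of_real (x * (t \<bullet> b)))"
  have fi: "integrable lborel (?f b)" for b
    by (rule Bochner_Integration.integrable_bound[OF i]) (auto simp: norm_mult)
  have "complex_of_real (gauss x) * exp (\<i> * of_real (x \<bullet> t)) = (\<Prod>b\<in>Basis. ?f b (x \<bullet> b))" for x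
    by (simp add: gauss_def prod.distrib exp_sum[symmetric] euclidean_inner[of x t] sum_distrib_left)
  hence "(\<integral>x. complex_of_real (gauss x) * exp (\<i> * of_real (x \<bullet> t)) \<partial>lborel) = (\<Prod>b\<in>(Basis::'a set). \<integral>x. ?f b x \<partial>lborel)"
    using lborel_integral_prod[of ?f, OF fi] by simp
  also have "\<dots> = (\<Prod>b\<in>(Basis::'a set). of_real (exp (- (t \<bullet> b)\<^sup>2 / 2)))"
  proof (rule prod.cong[OF refl])
    fix b :: 'a
    have "(\<integral>x. ?f b x \<partial>lborel) = char std_normal_distribution (t \<bullet> b)"
      unfolding char_def by (subst integral_density) (auto simp: scaleR_conv_of_real mult.commute)
    thus "(\<integral>x. ?f b x \<partial>lborel) = of_real (exp (- (t \<bullet> b)\<^sup>2 / 2))"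
      by (simp add: char_std_normal_distribution)
  qed
  also have "\<dots> = of_real (exp (- (norm t)\<^sup>2 / 2))"
    by (simp only: of_real_prod[symmetric] prod_exp_Basis)
  finally show "(\<integral>x. complex_of_real (gauss x) * exp (\<i> * of_real (x \<bullet> t)) \<partial>lborel) = of_real (exp (- (norm t)\<^sup>2 / 2))" .
  show "integrable lborel (\<lambda>x. complex_of_real (gauss (x::'a)))"
    using lborel_integrable_prod[of "\<lambda>(b::'a) x. complex_of_real (std_normal_density x)", OF i]
    by (simp add: gauss_def)
qed

lemma oscint_measurable [measurable]:
  fixes f :: "'a::euclidean_space \<Rightarrow> complex"
  assumes [measurable]: "f \<in> borel_measurable borel"
  shows "oscint f \<in> borel_measurable borel"
  unfolding oscint_def[abs_def] by measurable

text \<open>Gaussian regularisation: damping by a wide Gaussian makes Fubini applicable, and the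
  transform of the Gaussian turns the damped integral into an average of \<open>f\<close> about
  \<open>a\<close> at scale \<open>\<delta> n\<close>. Continuity and boundedness of
  \<open>f\<close> let the averages tend to \<open>f a\<close>.\<close>

lemma oscint_inversion:
  fixes f :: "'a::euclidean_space \<Rightarrow> complex"
  assumes cont: "continuous_on UNIV f" and i: "integrable lborel f" and io: "integrable lborel (oscint f)"
    and bd: "\<And>x. norm (f x) \<le> B"
  shows "(\<integral>x. oscint f x * exp (- (\<i> * of_real (x \<bullet> a))) \<partial>lborel) = of_real ((2 * pi) ^ DIM('a)) * f a"
proof -
  have [measurable]: "f \<in> borel_measurable borel" using i by auto
  define \<delta> where "\<delta> = (\<lambda>n::nat. 1 / real (Suc n))"
  have \<delta>: "0 < \<delta> n" for n by (simp add: \<delta>_def)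
  have \<delta>lim: "\<delta> \<longlonglongrightarrow> 0" unfolding \<delta>_def by (rule LIMSEQ_Suc[OF lim_1_over_n])
  let ?P = "sqrt (2 * pi) ^ DIM('a)"
  have "sqrt (2 * pi) * sqrt (2 * pi) = 2 * pi" by (rule real_sqrt_mult_self[THEN trans]) simp
  hence P: "?P * ?P = (2 * pi) ^ DIM('a)" by (simp only: power_mult_distrib[symmetric])
  have P0: "0 < ?P" by simp
  define g where "g = (\<lambda>n x. complex_of_real (gauss (\<delta> n *\<^sub>R (x::'a))))"
  have gm [measurable]: "g n \<in> borel_measurable borel" for n unfolding g_def by measurable
  have gn: "norm (g n x) \<le> 1 / ?P" for n x
  proof -
    have "0 \<le> gauss (\<delta> n *\<^sub>R x)" "gauss (\<delta> n *\<^sub>R x) \<le> 1 / ?P"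
      unfolding gauss_eq using P0 by (auto intro!: divide_right_mono)
    thus ?thesis unfolding g_def norm_of_real by simp
  qed
  have gi: "integrable lborel (g n)" for n
    using integrable_affine_euclidean[OF _ gauss_integrable, of "\<delta> n" 0] \<delta>[of n] by (simp add: g_def)
  have four: "(\<integral>x. g n x * exp (\<i> * of_real (x \<bullet> t)) \<partial>lborel) = of_real (?P * gauss ((1 / \<delta> n) *\<^sub>R t) / \<delta> n ^ DIM('a))" for n t
  proof -
    let ?k = "\<lambda>y. complex_of_real (gauss y) * exp (\<i> * of_real (y \<bullet> ((1 / \<delta> n) *\<^sub>R t)))"
    have "(\<integral>y. ?k y \<partial>lborel) = \<bar>\<delta> n\<bar> ^ DIM('a) *\<^sub>R (\<integral>x. ?k (0 + \<delta> n *\<^sub>R x) \<partial>lborel)"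
      by (rule integral_affine_euclidean) (use \<delta>[of n] in auto)
    moreover have "?k (0 + \<delta> n *\<^sub>R x) = g n x * exp (\<i> * of_real (x \<bullet> t))" for x
      using \<delta>[of n] by (simp add: g_def)
    moreover have "(\<integral>y. ?k y \<partial>lborel) = of_real (?P * gauss ((1 / \<delta> n) *\<^sub>R t))"
      unfolding gauss_fourier by (simp add: gauss_eq)
    ultimately have "of_real (?P * gauss ((1 / \<delta> n) *\<^sub>R t)) = of_real (\<delta> n ^ DIM('a)) * (\<integral>x. g n x * exp (\<i> * of_real (x \<bullet> t)) \<partial>lborel)"
      using \<delta>[of n] by (simp add: scaleR_conv_of_real)
    thus ?thesis using \<delta>[of n] by (simp add: field_simps)
  qed
  \<comment> \<open>\<open>F n\<close> is computed twice: dominated convergence yields the integral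
    in question times \<open>1 / ?P\<close>, Fubini yields \<open>?P\<close> times a Gaussian
    average of \<open>f\<close>. The two factors combine to \<open>?P * ?P\<close>, that is
    \<open>(2 * pi) ^ DIM('a)\<close>.\<close>
  define F where "F = (\<lambda>n. \<integral>x. g n x * exp (- (\<i> * of_real (x \<bullet> a))) * oscint f x \<partial>lborel)"
  have "F \<longlonglongrightarrow> (\<integral>x. of_real (1 / ?P) * exp (- (\<i> * of_real (x \<bullet> a))) * oscint f x \<partial>lborel)"
    unfolding F_def
  proof (rule integral_dominated_convergence[where w = "\<lambda>x. (1 / ?P) * norm (oscint f x)"])
    show "integrable lborel (\<lambda>x. (1 / ?P) * norm (oscint f x))" using io by auto
    show "AE x in lborel. (\<lambda>n. g n x * exp (- (\<i> * of_real (x \<bullet> a))) * oscint f x) \<longlonglongrightarrow> of_real (1 / ?P) * exp (- (\<i> * of_real (x \<bullet> a))) * oscint f x"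
    proof (rule AE_I2)
      fix x :: 'a
      have "(\<lambda>n. exp (- (norm (\<delta> n *\<^sub>R x))\<^sup>2 / 2) / ?P) \<longlonglongrightarrow> exp (- (norm (0 *\<^sub>R x))\<^sup>2 / 2) / ?P"
        by (intro tendsto_intros \<delta>lim) (use P0 in auto)
      hence "(\<lambda>n. g n x) \<longlonglongrightarrow> of_real (1 / ?P)"
        unfolding g_def gauss_eq by (intro tendsto_of_real) simp
      thus "(\<lambda>n. g n x * exp (- (\<i> * of_real (x \<bullet> a))) * oscint f x) \<longlonglongrightarrow> of_real (1 / ?P) * exp (- (\<i> * of_real (x \<bullet> a))) * oscint f x"
        by (intro tendsto_intros)
    qed
    show "AE x in lborel. norm (g n x * exp (- (\<i> * of_real (x \<bullet> a))) * oscint f x) \<le> (1 / ?P) * norm (oscint f x)" for n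
      using gn[of n] by (auto intro!: AE_I2 mult_right_mono simp: norm_mult simp del: times_divide_eq_left)
  qed measurable
  also have "(\<integral>x. of_real (1 / ?P) * exp (- (\<i> * of_real (x \<bullet> a))) * oscint f x \<partial>lborel)
     = of_real (1 / ?P) * (\<integral>x. oscint f x * exp (- (\<i> * of_real (x \<bullet> a))) \<partial>lborel)"
    by (subst integral_mult_right_zero[symmetric]) (simp add: mult_ac)
  finally have L1: "F \<longlonglongrightarrow> of_real (1 / ?P) * (\<integral>x. oscint f x * exp (- (\<i> * of_real (x \<bullet> a))) \<partial>lborel)" .
  have Feq: "F n = of_real ?P * (\<integral>z. complex_of_real (gauss z) * f (a + \<delta> n *\<^sub>R z) \<partial>lborel)" for n
  proof -
    have gi': "integrable lborel (\<lambda>x. g n x * exp (- (\<i> * of_real (x \<bullet> a))))"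
      by (rule Bochner_Integration.integrable_bound[OF gi[of n]]) (auto simp: norm_mult)
    have "F n = (\<integral>\<eta>. f \<eta> * (\<integral>x. (g n x * exp (- (\<i> * of_real (x \<bullet> a)))) * exp (\<i> * of_real (x \<bullet> \<eta>)) \<partial>lborel) \<partial>lborel)"
      unfolding F_def oscint_def
      by (rule fubini_mult(1)[where K = 1]) (use gi' i in \<open>auto intro: sigma_finite_lborel\<close>)
    also have "\<dots> = (\<integral>\<eta>. f \<eta> * of_real (?P * gauss ((1 / \<delta> n) *\<^sub>R (\<eta> - a)) / \<delta> n ^ DIM('a)) \<partial>lborel)"
    proof (intro Bochner_Integration.integral_cong refl arg_cong2[where f="(*)"])
      fix \<eta> :: 'a
      have "g n x * exp (- (\<i> * of_real (x \<bullet> a))) * exp (\<i> * of_real (x \<bullet> \<eta>)) = g n x * exp (\<i> * of_real (x \<bullet> (\<eta> - a)))" for x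
        by (simp add: mult.assoc exp_add[symmetric] inner_diff_right algebra_simps)
      thus "(\<integral>x. (g n x * exp (- (\<i> * of_real (x \<bullet> a)))) * exp (\<i> * of_real (x \<bullet> \<eta>)) \<partial>lborel) = of_real (?P * gauss ((1 / \<delta> n) *\<^sub>R (\<eta> - a)) / \<delta> n ^ DIM('a))"
        using four[of n "\<eta> - a"] by (simp only:)
    qed
    also have "\<dots> = \<bar>\<delta> n\<bar> ^ DIM('a) *\<^sub>R (\<integral>z. f (a + \<delta> n *\<^sub>R z) * of_real (?P * gauss ((1 / \<delta> n) *\<^sub>R ((a + \<delta> n *\<^sub>R z) - a)) / \<delta> n ^ DIM('a)) \<partial>lborel)"
      by (rule integral_affine_euclidean) (use \<delta>[of n] in auto)
    also have "\<dots> = of_real ?P * (\<integral>z. complex_of_real (gauss z) * f (a + \<delta> n *\<^sub>R z) \<partial>lborel)"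
    proof -
      have "(\<integral>z. f (a + \<delta> n *\<^sub>R z) * of_real (?P * gauss ((1 / \<delta> n) *\<^sub>R ((a + \<delta> n *\<^sub>R z) - a)) / \<delta> n ^ DIM('a)) \<partial>lborel)
        = (\<integral>z. of_real (?P / \<delta> n ^ DIM('a)) * (complex_of_real (gauss z) * f (a + \<delta> n *\<^sub>R z)) \<partial>lborel)"
        using \<delta>[of n] by (intro Bochner_Integration.integral_cong refl) simp
      also have "\<dots> = of_real (?P / \<delta> n ^ DIM('a)) * (\<integral>z. complex_of_real (gauss z) * f (a + \<delta> n *\<^sub>R z) \<partial>lborel)"
        by (rule integral_mult_right_zero)
      finally show ?thesis using \<delta>[of n] by (simp add: scaleR_conv_of_real)
    qed
    finally show ?thesis .
  qed
  have "(\<lambda>n. \<integral>z. complex_of_real (gauss z) * f (a + \<delta> n *\<^sub>R z) \<partial>lborel) \<longlonglongrightarrow> (\<integral>z. complex_of_real (gauss (z::'a)) * f a \<partial>lborel)"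
  proof (rule integral_dominated_convergence[where w = "\<lambda>z. norm (complex_of_real (gauss z)) * B"])
    show "integrable lborel (\<lambda>z::'a. norm (complex_of_real (gauss z)) * B)"
      by (intro integrable_mult_left integrable_norm gauss_integrable)
    show "AE z in lborel. (\<lambda>n. complex_of_real (gauss z) * f (a + \<delta> n *\<^sub>R z)) \<longlonglongrightarrow> complex_of_real (gauss z) * f a"
    proof (rule AE_I2)
      fix z :: 'a
      have "(\<lambda>n. a + \<delta> n *\<^sub>R z) \<longlonglongrightarrow> a + 0 *\<^sub>R z" by (intro tendsto_intros \<delta>lim)
      hence "(\<lambda>n. f (a + \<delta> n *\<^sub>R z)) \<longlonglongrightarrow> f a"
        using continuous_on_tendsto_compose[OF cont, of "\<lambda>n. a + \<delta> n *\<^sub>R z" a sequentially] by simp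
      thus "(\<lambda>n. complex_of_real (gauss z) * f (a + \<delta> n *\<^sub>R z)) \<longlonglongrightarrow> complex_of_real (gauss z) * f a"
        by (intro tendsto_intros)
    qed
    show "AE z in lborel. norm (complex_of_real (gauss z) * f (a + \<delta> n *\<^sub>R z)) \<le> norm (complex_of_real (gauss z)) * B" for n
      using bd by (auto intro!: AE_I2 mult_left_mono simp: norm_mult)
  qed measurable
  also have "(\<integral>z. complex_of_real (gauss (z::'a)) * f a \<partial>lborel) = f a"
    using gauss_fourier[of "0::'a"] by simp
  finally have "F \<longlonglongrightarrow> of_real ?P * f a"
    unfolding Feq by (intro tendsto_intros)
  from LIMSEQ_unique[OF this L1]
  have "of_real ?P * f a = of_real (1 / ?P) * (\<integral>x. oscint f x * exp (- (\<i> * of_real (x \<bullet> a))) \<partial>lborel)" .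
  hence "of_real ?P * (of_real ?P * f a) = (\<integral>x. oscint f x * exp (- (\<i> * of_real (x \<bullet> a))) \<partial>lborel)"
    using P0 by (simp add: field_simps)
  thus ?thesis unfolding P[symmetric] by (simp add: mult.assoc)
qed

section \<open>Frequency filters and spectra\<close>

text \<open>The sum of L^1 and L^\<infinity>, encoded by a pointwise majorant. It contains the
  functions of every L^p with p \<ge> 1 as well as all bounded ones, so that \<open>u\<close>, its
  pieces and its exponentials can be filtered on the same footing.\<close>

definition l1inf :: "('a::euclidean_space \<Rightarrow> complex) \<Rightarrow> bool" where
  "l1inf g \<longleftrightarrow> g \<in> borel_measurable borel \<and>
     (\<exists>C h. 0 \<le> C \<and> integrable lborel h \<and> (\<forall>x. 0 \<le> h x) \<and> (\<forall>x. norm (g x) \<le> C + h x))"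

lemma l1inf_meas: "l1inf g \<Longrightarrow> g \<in> borel_measurable borel" by (simp add: l1inf_def)

lemma l1infE:
  assumes "l1inf g"
  obtains C h where "0 \<le> C" "integrable lborel h" "\<And>x. 0 \<le> h x" "\<And>x. norm (g x) \<le> C + h x"
  using assms unfolding l1inf_def by blast

lemma l1inf_bounded: 
  assumes "g \<in> borel_measurable borel" "\<And>x. norm (g x) \<le> C" shows "l1inf g"
proof -
  have "0 \<le> C" using assms(2)[of undefined] norm_ge_zero order_trans by blast
  thus ?thesis unfolding l1inf_def using assms by (intro conjI exI[of _ C] exI[of _ "\<lambda>x. 0"]) auto
qed

text \<open>The majorant comes from \<open>t \<le> 1 + t powr p\<close>.\<close>

lemma l1inf_lp:
  assumes "1 \<le> p" "lp_le p g A" shows "l1inf g"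
proof -
  have [measurable]: "g \<in> borel_measurable borel" using assms lp_le_meas by auto
  have "integrable lborel (\<lambda>x. norm (g x) powr p)"
    using assms by (auto simp: integrable_iff_bounded lp_le_def top_unique less_top[symmetric] elim: order_le_less_trans)
  moreover have "t \<le> 1 + t powr p" if "0 \<le> t" for t :: real
  proof (cases "t \<le> 1")
    case False
    hence "t powr 1 \<le> t powr p" using assms by (intro powr_mono) auto
    thus ?thesis using False by simp
  qed (simp add: add_increasing2)
  ultimately show ?thesis unfolding l1inf_def
    by (intro conjI exI[of _ 1] exI[of _ "\<lambda>x. norm (g x) powr p"]) auto
qed

lemma l1inf_add:
  assumes "l1inf f" "l1inf g" shows "l1inf (\<lambda>x. f x + g x)"
proof -
  from assms(1) obtain C h where 1: "0 \<le> C" "integrable lborel h" "\<And>x. 0 \<le> h x" "\<And>x. norm (f x) \<le> C + h x" by (rule l1infE) blast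
  from assms(2) obtain C' h' where 2: "0 \<le> C'" "integrable lborel h'" "\<And>x. 0 \<le> h' x" "\<And>x. norm (g x) \<le> C' + h' x" by (rule l1infE) blast
  have "norm (f x + g x) \<le> (C + C') + (h x + h' x)" for x
    using norm_triangle_ineq[of "f x" "g x"] 1(4)[of x] 2(4)[of x] by linarith
  thus ?thesis unfolding l1inf_def using 1 2 l1inf_meas[OF assms(1)] l1inf_meas[OF assms(2)]
    by (intro conjI exI[of _ "C + C'"] exI[of _ "\<lambda>x. h x + h' x"]) (auto intro: add_nonneg_nonneg)
qed

lemma l1inf_mult_bounded:
  assumes "l1inf f" "g \<in> borel_measurable borel" "\<And>x. norm (g x) \<le> B" shows "l1inf (\<lambda>x. g x * f x)"
proof -
  from assms(1) obtain C h where 1: "0 \<le> C" "integrable lborel h" "\<And>x. 0 \<le> h x" "\<And>x. norm (f x) \<le> C + h x" by (rule l1infE) blast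
  have B: "0 \<le> B" using assms(3)[of undefined] norm_ge_zero order_trans by blast
  have "norm (g x * f x) \<le> B * C + B * h x" for x
    unfolding norm_mult distrib_left[symmetric] by (intro mult_mono assms 1 B) auto
  thus ?thesis unfolding l1inf_def using 1 B l1inf_meas[OF assms(1)] assms(2)
    by (intro conjI exI[of _ "B * C"] exI[of _ "\<lambda>x. B * h x"]) auto
qed

lemma l1inf_mult_integrable:
  assumes f: "l1inf f" and A: "integrable lborel A" "\<And>x. norm (A x) \<le> K"
  shows "integrable lborel (\<lambda>x. f x * A x)"
proof -
  from f obtain C k where 1: "0 \<le> C" "integrable lborel k" "\<And>x. 0 \<le> k x" "\<And>x. norm (f x) \<le> C + k x" by (rule l1infE) blast
  have [measurable]: "f \<in> borel_measurable borel" "A \<in> borel_measurable borel" using l1inf_meas[OF f] A by auto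
  show ?thesis
  proof (rule Bochner_Integration.integrable_bound)
    show "integrable lborel (\<lambda>z. C * norm (A z) + K * k z)"
      using 1 A by (intro Bochner_Integration.integrable_add integrable_mult_right integrable_norm) auto
    show "AE z in lborel. norm (f z * A z) \<le> norm (C * norm (A z) + K * k z)"
    proof (rule AE_I2)
      fix z
      have "norm (f z) * norm (A z) \<le> (C + k z) * norm (A z)" by (intro mult_right_mono 1) auto
      also have "\<dots> \<le> C * norm (A z) + K * k z"
        using mult_right_mono[OF A(2) 1(3)[of z], of z] by (simp add: algebra_simps)
      also have "\<dots> \<le> \<bar>\<dots>\<bar>" by simp
      finally show "norm (f z * A z) \<le> norm (C * norm (A z) + K * k z)" by (simp add: norm_mult)
    qed
  qed measurable
qed

lemma l1inf_uminus: "l1inf f \<Longrightarrow> l1inf (\<lambda>x. - f x)"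
  using l1inf_mult_bounded[of f "\<lambda>x. -1" 1] by simp

lemma l1inf_diff: "l1inf f \<Longrightarrow> l1inf g \<Longrightarrow> l1inf (\<lambda>x. f x - g x)"
  using l1inf_add[of f "\<lambda>x. - g x"] l1inf_uminus[of g] by simp

lemma mult_swap_inner:
  fixes k :: "'b::comm_semiring_1"
  assumes "p * q = r * s"
  shows "k * p * (g * q) = r * (k * s * g)" "k * p * (g * q) = g * (k * (r * s))"
proof -
  have "k * p * (g * q) = (p * q) * (k * g)" by (simp only: mult_ac)
  also have "\<dots> = (r * s) * (k * g)" by (simp only: assms)
  finally show "k * p * (g * q) = r * (k * s * g)" "k * p * (g * q) = g * (k * (r * s))"
    by (simp_all only: mult_ac)
qed

lemma mult_swap_assoc: "a * b * c = a * (c * (b::'b::comm_semiring_1))"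
  by (simp only: mult_ac)

section \<open>Convolution filters\<close>

text \<open>The cutoff at the origin, with support radius \<open>d\<close>. All cutoffs of the
  decomposition are translates of it, so one kernel with a variable modulation serves for every
  lattice point.\<close>

locale kernel =
  fixes \<sigma> :: "'a::euclidean_space \<Rightarrow> real" and d :: real
  assumes \<sigma>01: "0 \<le> \<sigma> x" "\<sigma> x \<le> 1" and \<sigma>_supp: "norm x > d \<Longrightarrow> \<sigma> x = 0" and d_ge1: "1 \<le> d"
    and \<sigma>_smooth: "b \<in> Basis \<Longrightarrow> smooth_along b m (\<lambda>x. complex_of_real (\<sigma> x))"
begin

text \<open>The normalisation is such that the plain Fourier integral of \<open>\<kappa>\<close>,
  without any factor, returns \<open>\<sigma>\<close>; see
  \<open>\<kappa>_inversion\<close>.\<close>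

definition \<kappa> :: "'a \<Rightarrow> complex" where
  "\<kappa> x = of_real (1 / (2 * pi) ^ DIM('a)) * oscint (\<lambda>\<eta>. of_real (\<sigma> \<eta>)) x"

lemma \<sigma>_cont: "continuous_on UNIV (\<lambda>x. complex_of_real (\<sigma> x))"
  using \<sigma>_smooth[OF SOME_Basis] smooth_along_cont by blast

lemma \<sigma>_measC [measurable]: "(\<lambda>x. complex_of_real (\<sigma> x)) \<in> borel_measurable borel"
  using \<sigma>_cont borel_measurable_continuous_onI by blast

lemma \<sigma>_integrable: "integrable lborel (\<lambda>x. complex_of_real (\<sigma> x))"
  using integrable_continuous_supp[OF \<sigma>_cont, of d] \<sigma>_supp by auto

lemma \<kappa>_meas [measurable]: "\<kappa> \<in> borel_measurable borel"
  unfolding \<kappa>_def[abs_def] by measurable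

lemma \<kappa>_dec: "\<exists>C\<ge>0. \<forall>x. norm (\<kappa> x) \<le> C * dec x"
proof -
  obtain C where C: "0 \<le> C" "\<And>x. norm (oscint (\<lambda>\<eta>. complex_of_real (\<sigma> \<eta>)) x) \<le> C * dec x"
    using oscint_dec[of "\<lambda>\<eta>. complex_of_real (\<sigma> \<eta>)" d] \<sigma>_smooth \<sigma>_supp by auto
  let ?c = "1 / (2 * pi) ^ DIM('a)"
  have "norm (\<kappa> x) \<le> (?c * C) * dec x" for x
  proof -
    have "norm (\<kappa> x) = ?c * norm (oscint (\<lambda>\<eta>. complex_of_real (\<sigma> \<eta>)) x)"
      unfolding \<kappa>_def norm_mult norm_of_real by simp
    also have "\<dots> \<le> ?c * (C * dec x)" by (intro mult_left_mono C) auto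
    finally show ?thesis by (simp only: mult.assoc)
  qed
  thus ?thesis using C(1) by (intro exI[of _ "?c * C"]) auto
qed

lemma \<kappa>_integrable: "integrable lborel \<kappa>"
proof -
  obtain C where C: "0 \<le> C" "\<And>x. norm (\<kappa> x) \<le> C * dec x" using \<kappa>_dec by blast
  have "integrable lborel (\<lambda>x::'a. C * dec x)" by (intro integrable_mult_right dec_integrable)
  thus ?thesis by (rule Bochner_Integration.integrable_bound)
    (use C in \<open>auto intro!: AE_I2 order_trans[OF C(2)]\<close>)
qed

definition \<kappa>1 :: real where "\<kappa>1 = (\<integral>x. norm (\<kappa> x) \<partial>lborel)"
definition \<kappa>sup :: real where "\<kappa>sup = (SUP x. norm (\<kappa> x))"

lemma \<kappa>1_nonneg: "0 \<le> \<kappa>1" unfolding \<kappa>1_def by simp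

lemma \<kappa>1_nn: "(\<integral>\<^sup>+x. ennreal (norm (\<kappa> x)) \<partial>lborel) = ennreal \<kappa>1"
  unfolding \<kappa>1_def by (rule nn_integral_eq_integral) (use \<kappa>_integrable in auto)

lemma \<kappa>_le_sup: "norm (\<kappa> x) \<le> \<kappa>sup"
proof -
  have "norm (\<kappa> x) \<le> \<bar>1 / (2 * pi) ^ DIM('a)\<bar> * (\<integral>\<eta>. norm (complex_of_real (\<sigma> \<eta>)) \<partial>lborel)" for x
  proof -
    have "norm (\<kappa> x) = \<bar>1 / (2 * pi) ^ DIM('a)\<bar> * norm (oscint (\<lambda>\<eta>. complex_of_real (\<sigma> \<eta>)) x)"
      unfolding \<kappa>_def norm_mult norm_of_real by simp
    thus ?thesis using mult_left_mono[OF oscint_cont_bound[OF \<sigma>_integrable, of x] abs_ge_zero] by (simp only:)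
  qed
  hence "bdd_above (range (\<lambda>x. norm (\<kappa> x)))" by (intro bdd_aboveI2)
  thus ?thesis unfolding \<kappa>sup_def by (intro cSUP_upper) auto
qed

lemma \<kappa>sup_nonneg: "0 \<le> \<kappa>sup" using \<kappa>_le_sup[of 0] norm_ge_zero order_trans by blast

lemma \<kappa>_inversion: "(\<integral>x. \<kappa> x * exp (- (\<i> * of_real (x \<bullet> a))) \<partial>lborel) = of_real (\<sigma> a)"
proof -
  let ?c = "(2 * pi) ^ DIM('a)" and ?o = "oscint (\<lambda>\<eta>. complex_of_real (\<sigma> \<eta>))"
  have "?o = (\<lambda>x. of_real ?c * \<kappa> x)" unfolding \<kappa>_def by (auto simp: fun_eq_iff)
  hence "integrable lborel ?o" using \<kappa>_integrable by simp
  hence "(\<integral>x. ?o x * exp (- (\<i> * of_real (x \<bullet> a))) \<partial>lborel) = of_real ?c * of_real (\<sigma> a)"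
    by (intro oscint_inversion[where B = 1] \<sigma>_cont \<sigma>_integrable) (use \<sigma>01 in auto)
  moreover have "(\<integral>x. \<kappa> x * exp (- (\<i> * of_real (x \<bullet> a))) \<partial>lborel) = of_real (1 / ?c) * (\<integral>x. ?o x * exp (- (\<i> * of_real (x \<bullet> a))) \<partial>lborel)"
    unfolding \<kappa>_def by (subst integral_mult_right_zero[symmetric]) (simp only: mult.assoc)
  ultimately show ?thesis by simp
qed

text \<open>Convolution with the modulated kernel, that is the Fourier multiplier
  \<open>\<sigma> (\<xi> - a)\<close>. As an integral it makes sense on all of \<open>l1inf\<close>,
  where the Fourier transform need not be a function.\<close>

definition filt :: "'a \<Rightarrow> ('a \<Rightarrow> complex) \<Rightarrow> 'a \<Rightarrow> complex" where
  "filt a g y = (\<integral>x. \<kappa> (y - x) * exp (\<i> * of_real (a \<bullet> (y - x))) * g x \<partial>lborel)"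

lemma filt_meas [measurable]:
  assumes [measurable]: "g \<in> borel_measurable borel" shows "filt a g \<in> borel_measurable borel"
  unfolding filt_def[abs_def] by measurable

lemma \<kappa>_shift_integrable: "integrable lborel (\<lambda>x. \<kappa> (y - x))"
  by (rule integrable_reflect[OF \<kappa>_integrable])

lemma \<kappa>_shift_norm: "(\<integral>x. norm (\<kappa> (y - x)) \<partial>lborel) = \<kappa>1"
  unfolding \<kappa>1_def by (rule integral_reflect[of "\<lambda>x. norm (\<kappa> x)"]) measurable

lemma filt_dominated:
  assumes "0 \<le> C" "\<And>x. norm (g x) \<le> C + h x" "\<And>x. 0 \<le> h x"
  shows "norm (\<kappa> (y - x) * exp (\<i> * of_real (a \<bullet> (y - x))) * g x) \<le> C * norm (\<kappa> (y - x)) + \<kappa>sup * h x"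
proof -
  have "norm (\<kappa> (y - x) * exp (\<i> * of_real (a \<bullet> (y - x))) * g x) = norm (\<kappa> (y - x)) * norm (g x)"
    by (simp add: norm_mult)
  also have "\<dots> \<le> norm (\<kappa> (y - x)) * (C + h x)" by (intro mult_left_mono assms) auto
  also have "\<dots> = C * norm (\<kappa> (y - x)) + norm (\<kappa> (y - x)) * h x" by (simp add: algebra_simps)
  also have "\<dots> \<le> C * norm (\<kappa> (y - x)) + \<kappa>sup * h x"
    by (intro add_left_mono mult_right_mono \<kappa>_le_sup assms)
  finally show ?thesis .
qed

lemma filt_integrable:
  assumes "l1inf g"
  shows "integrable lborel (\<lambda>x. \<kappa> (y - x) * exp (\<i> * of_real (a \<bullet> (y - x))) * g x)"
proof -
  have [measurable]: "g \<in> borel_measurable borel" using assms l1inf_meas by auto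
  from assms obtain C h where 1: "0 \<le> C" "integrable lborel h" "\<And>x. 0 \<le> h x" "\<And>x. norm (g x) \<le> C + h x" by (rule l1infE) blast
  have "integrable lborel (\<lambda>x. C * norm (\<kappa> (y - x)) + \<kappa>sup * h x)"
    using 1 \<kappa>_shift_integrable[of y] by (intro Bochner_Integration.integrable_add integrable_mult_right integrable_norm) auto
  thus ?thesis
    by (rule Bochner_Integration.integrable_bound)
      (use filt_dominated[OF 1(1,4,3)] in \<open>auto intro!: AE_I2 order_trans[OF filt_dominated[OF 1(1,4,3)]]\<close>)
qed

lemma filt_bound_gen:
  assumes "g \<in> borel_measurable borel" "0 \<le> C" "integrable lborel h" "\<And>x. norm (g x) \<le> C + h x" "\<And>x. 0 \<le> h x"
  shows "norm (filt a g y) \<le> C * \<kappa>1 + \<kappa>sup * (\<integral>x. h x \<partial>lborel)"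
proof -
  have "norm (filt a g y) \<le> (\<integral>x. norm (\<kappa> (y - x) * exp (\<i> * of_real (a \<bullet> (y - x))) * g x) \<partial>lborel)"
    unfolding filt_def by (rule integral_norm_bound)
  also have "\<dots> \<le> (\<integral>x. C * norm (\<kappa> (y - x)) + \<kappa>sup * h x \<partial>lborel)"
  proof (rule integral_mono)
    have "l1inf g" unfolding l1inf_def using assms by blast
    thus "integrable lborel (\<lambda>x. norm (\<kappa> (y - x) * exp (\<i> * of_real (a \<bullet> (y - x))) * g x))"
      by (intro integrable_norm filt_integrable)
    show "integrable lborel (\<lambda>x. C * norm (\<kappa> (y - x)) + \<kappa>sup * h x)"
      using assms \<kappa>_shift_integrable[of y] by (intro Bochner_Integration.integrable_add integrable_mult_right integrable_norm) auto
  qed (rule filt_dominated[OF assms(2,4,5)])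
  also have "\<dots> = C * \<kappa>1 + \<kappa>sup * (\<integral>x. h x \<partial>lborel)"
    using assms \<kappa>_shift_integrable[of y] \<kappa>_shift_norm[of y] by (subst Bochner_Integration.integral_add) auto
  finally show ?thesis .
qed

lemma filt_l1inf: assumes "l1inf g" shows "l1inf (filt a g)" "\<exists>B. \<forall>y. norm (filt a g y) \<le> B"
proof -
  from assms obtain C h where 1: "0 \<le> C" "integrable lborel h" "\<And>x. 0 \<le> h x" "\<And>x. norm (g x) \<le> C + h x" by (rule l1infE) blast
  have b: "norm (filt a g y) \<le> C * \<kappa>1 + \<kappa>sup * (\<integral>x. h x \<partial>lborel)" for y
    using filt_bound_gen[OF l1inf_meas[OF assms] 1(1,2,4,3)] .
  thus "\<exists>B. \<forall>y. norm (filt a g y) \<le> B" by blast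
  show "l1inf (filt a g)" by (rule l1inf_bounded[OF _ b]) (use l1inf_meas[OF assms] in measurable)
qed

lemma filt_add: "l1inf f \<Longrightarrow> l1inf g \<Longrightarrow> filt a (\<lambda>x. f x + g x) y = filt a f y + filt a g y"
  unfolding filt_def by (simp add: distrib_left Bochner_Integration.integral_add[OF filt_integrable filt_integrable])

lemma filt_cmult: "filt a (\<lambda>x. c * g x) y = c * filt a g y"
  unfolding filt_def by (subst integral_mult_right_zero[symmetric]) (simp add: mult_ac)

lemma filt_zero: "filt a (\<lambda>x. 0) y = 0" by (simp add: filt_def)

lemma l1inf_zero: "l1inf (\<lambda>x. 0)" by (rule l1inf_bounded[of _ 0]) auto

lemma l1inf_sum: "finite F \<Longrightarrow> (\<And>k. k \<in> F \<Longrightarrow> l1inf (g k)) \<Longrightarrow> l1inf (\<lambda>x. \<Sum>k\<in>F. g k x)"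
  by (induction F rule: finite_induct) (auto intro: l1inf_zero l1inf_add)

lemma filt_sum: "finite F \<Longrightarrow> (\<And>k. k \<in> F \<Longrightarrow> l1inf (g k)) \<Longrightarrow> filt a (\<lambda>x. \<Sum>k\<in>F. g k x) y = (\<Sum>k\<in>F. filt a (g k) y)"
  by (induction F rule: finite_induct) (auto simp: filt_zero filt_add l1inf_sum)

lemma filt_cong_AE:
  assumes "AE x in lborel. f x = g x" "f \<in> borel_measurable borel" "g \<in> borel_measurable borel"
  shows "filt a f y = filt a g y"
proof -
  have [measurable]: "f \<in> borel_measurable borel" "g \<in> borel_measurable borel" by fact+
  show ?thesis unfolding filt_def
    by (rule integral_cong_AE) (use assms in \<open>auto\<close>)
qed

lemma filt_limit:
  assumes m: "\<And>n::nat. g n \<in> borel_measurable borel" and C: "0 \<le> C" "integrable lborel h" "\<And>x. 0 \<le> h x"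
    and b: "\<And>n x. norm (g n x) \<le> C + h x" and lim: "\<And>x. (\<lambda>n. g n x) \<longlonglongrightarrow> f x"
  shows "(\<lambda>n. filt a (g n) y) \<longlonglongrightarrow> filt a f y"
  unfolding filt_def
proof (rule integral_dominated_convergence[where w = "\<lambda>x. C * norm (\<kappa> (y - x)) + \<kappa>sup * h x"])
  have [measurable]: "g n \<in> borel_measurable borel" for n by fact
  have [measurable]: "f \<in> borel_measurable borel" by (rule borel_measurable_LIMSEQ_metric[OF m lim])
  show "(\<lambda>x. \<kappa> (y - x) * exp (\<i> * of_real (a \<bullet> (y - x))) * f x) \<in> borel_measurable lborel" by measurable
  show "(\<lambda>x. \<kappa> (y - x) * exp (\<i> * of_real (a \<bullet> (y - x))) * g n x) \<in> borel_measurable lborel" for n by measurable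
  show "integrable lborel (\<lambda>x. C * norm (\<kappa> (y - x)) + \<kappa>sup * h x)"
    using C \<kappa>_shift_integrable[of y] by (intro Bochner_Integration.integrable_add integrable_mult_right integrable_norm) auto
  show "AE x in lborel. (\<lambda>n. \<kappa> (y - x) * exp (\<i> * of_real (a \<bullet> (y - x))) * g n x) \<longlonglongrightarrow> \<kappa> (y - x) * exp (\<i> * of_real (a \<bullet> (y - x))) * f x"
    by (intro AE_I2 tendsto_mult tendsto_const lim)
  show "AE x in lborel. norm (\<kappa> (y - x) * exp (\<i> * of_real (a \<bullet> (y - x))) * g n x) \<le> C * norm (\<kappa> (y - x)) + \<kappa>sup * h x" for n
    by (intro AE_I2 filt_dominated C b)
qed

lemma filt_norm_le_nn:
  assumes [measurable]: "g \<in> borel_measurable borel"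
  shows "ennreal (norm (filt a g y)) \<le> (\<integral>\<^sup>+z. ennreal (norm (\<kappa> z) * norm (g (y - z))) \<partial>lborel)"
proof -
  have "ennreal (norm (filt a g y)) \<le> (\<integral>\<^sup>+x. ennreal (norm (\<kappa> (y - x) * exp (\<i> * of_real (a \<bullet> (y - x))) * g x)) \<partial>lborel)"
    unfolding filt_def
    by (cases "integrable lborel (\<lambda>x. \<kappa> (y - x) * exp (\<i> * of_real (a \<bullet> (y - x))) * g x)")
      (auto intro: integral_norm_bound_ennreal simp: not_integrable_integral_eq simp del: norm_mult)
  also have "\<dots> = (\<integral>\<^sup>+x. ennreal (norm (\<kappa> (y - x)) * norm (g (y - (y - x)))) \<partial>lborel)"
    by (simp add: norm_mult)
  also have "\<dots> = (\<integral>\<^sup>+z. ennreal (norm (\<kappa> z) * norm (g (y - z))) \<partial>lborel)"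
    by (rule nn_integral_reflect[of "\<lambda>z. ennreal (norm (\<kappa> z) * norm (g (y - z)))"]) measurable
  finally show ?thesis .
qed

text \<open>Young's inequality for convolutions as an instance of Minkowski's: translates of
  \<open>g\<close> have the same bound, and \<open>norm (\<kappa> z)\<close> is a weight of total
  mass \<open>\<kappa>1\<close>.\<close>

lemma filt_lp:
  assumes p: "1 \<le> p" and g: "lp_le p g A"
  shows "lp_le p (filt a g) (\<kappa>1 * A)"
proof -
  have [measurable]: "g \<in> borel_measurable borel" using lp_le_meas[OF g] .
  have "(\<integral>\<^sup>+y. ennreal (\<bar>norm (filt a g y)\<bar> powr p) \<partial>lborel) \<le> ennreal ((\<kappa>1 * A) powr p)"
  proof (rule minkowski_nn[where \<nu> = lborel and N = "\<lambda>z. norm (\<kappa> z)" and T = "\<lambda>y z. norm (g (y - z))"])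
    show "(\<integral>\<^sup>+x. ennreal (norm (g (x - z)) powr p) \<partial>lborel) \<le> ennreal (A powr p)" for z
    proof -
      have "(\<integral>\<^sup>+x. ennreal (norm (g (x - z)) powr p) \<partial>lborel) = (\<integral>\<^sup>+x. ennreal (norm (g x) powr p) \<partial>lborel)"
        using nn_integral_translate[of "\<lambda>x. ennreal (norm (g x) powr p)" "-z"] by simp
      thus ?thesis using g by (simp add: lp_le_def)
    qed
    show "(\<integral>\<^sup>+y. ennreal (norm (\<kappa> y)) \<partial>lborel) \<le> ennreal \<kappa>1" by (simp add: \<kappa>1_nn)
    show "ennreal \<bar>norm (filt a g x)\<bar> \<le> (\<integral>\<^sup>+y. ennreal (norm (\<kappa> y) * norm (g (x - y))) \<partial>lborel)" for x
      using filt_norm_le_nn[of g a x] by simp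
  qed (use p g \<kappa>1_nonneg in \<open>auto simp: lp_le_def intro: sigma_finite_lborel\<close>)
  thus ?thesis using g \<kappa>1_nonneg by (simp add: lp_le_def)
qed

text \<open>By \<open>young_powr\<close> at \<open>m = B\<close> the modulus of \<open>g\<close> is
  at most a constant plus a multiple of its \<open>p\<close>-th power; the constant meets the L^1
  norm of the kernel and the power its supremum. \<open>B\<close> exceeds \<open>A\<close> slightly
  in order to be positive.\<close>

lemma filt_sup_lp:
  assumes p: "1 \<le> p" and g: "lp_le p g A"
  shows "norm (filt a g y) \<le> (\<kappa>1 + \<kappa>sup) * A"
proof (rule field_le_epsilon)
  fix e :: real assume e: "0 < e"
  have [measurable]: "g \<in> borel_measurable borel" using lp_le_meas[OF g] .
  have K: "0 \<le> \<kappa>1 + \<kappa>sup" using \<kappa>1_nonneg \<kappa>sup_nonneg by simp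
  define B where "B = A + e / (\<kappa>1 + \<kappa>sup + 1)"
  have B: "0 < B" "A \<le> B" using g e K by (auto simp: B_def lp_le_def add_nonneg_pos)
  have gB: "lp_le p g B" by (rule lp_le_mono[OF p g B(2)])
  have int: "integrable lborel (\<lambda>x. norm (g x) powr p)" and I: "(\<integral>x. norm (g x) powr p \<partial>lborel) \<le> B powr p"
  proof -
    have "(\<integral>\<^sup>+x. ennreal (norm (g x) powr p) \<partial>lborel) \<le> ennreal (B powr p)" using gB by (simp add: lp_le_def)
    thus "integrable lborel (\<lambda>x. norm (g x) powr p)"
      by (auto simp: integrable_iff_bounded less_top[symmetric] top_unique elim: order_le_less_trans)
    hence "ennreal (\<integral>x. norm (g x) powr p \<partial>lborel) = (\<integral>\<^sup>+x. ennreal (norm (g x) powr p) \<partial>lborel)"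
      by (intro nn_integral_eq_integral[symmetric]) auto
    also have "\<dots> \<le> ennreal (B powr p)" using gB by (simp add: lp_le_def)
    finally show "(\<integral>x. norm (g x) powr p \<partial>lborel) \<le> B powr p" by (simp add: ennreal_le_iff)
  qed
  have "norm (filt a g y) \<le> ((p - 1) * B / p) * \<kappa>1 + \<kappa>sup * (\<integral>x. B powr (1-p) / p * (norm (g x) powr p) \<partial>lborel)"
  proof (rule filt_bound_gen)
    show "integrable lborel (\<lambda>x. B powr (1-p) / p * (norm (g x) powr p))" using int by (rule integrable_mult_right)
    show "norm (g x) \<le> (p - 1) * B / p + B powr (1-p) / p * (norm (g x) powr p)" for x
      using young_powr[OF p B(1), of "norm (g x)"] by (simp add: add_divide_distrib mult.commute)
  qed (use p B in auto)
  also have "\<dots> \<le> ((p - 1) * B / p) * \<kappa>1 + \<kappa>sup * (B powr (1-p) / p * B powr p)"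
    using p I \<kappa>sup_nonneg by (intro add_left_mono mult_left_mono) (auto intro!: divide_right_mono mult_left_mono)
  also have "B powr (1-p) / p * B powr p = B / p"
    using B by (simp add: powr_add[symmetric])
  also have "(p - 1) * B / p * \<kappa>1 + \<kappa>sup * (B / p) \<le> B * \<kappa>1 + \<kappa>sup * B"
    using p B \<kappa>1_nonneg \<kappa>sup_nonneg by (intro add_mono mult_right_mono mult_left_mono) (auto simp: field_simps)
  also have "\<dots> = (\<kappa>1 + \<kappa>sup) * B" by (simp add: algebra_simps)
  also have "\<dots> = (\<kappa>1 + \<kappa>sup) * A + (\<kappa>1 + \<kappa>sup) * (e / (\<kappa>1 + \<kappa>sup + 1))"
    unfolding B_def by (rule distrib_left)
  also have "(\<kappa>1 + \<kappa>sup) * (e / (\<kappa>1 + \<kappa>sup + 1)) \<le> e"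
    using K e by (simp add: pos_divide_le_eq)
  finally show "norm (filt a g y) \<le> (\<kappa>1 + \<kappa>sup) * A + e" by simp
qed

section \<open>Spectra and frequency radii\<close>

text \<open>The spectrum as seen by filters: only those centred in \<open>S\<close> may respond to
  \<open>h\<close>. A filter has radius \<open>d\<close>, so \<open>S\<close> is a blurred version
  of the Fourier support, and already the constant 1 is given the ball of radius \<open>d\<close>.
  The condition survives bounded pointwise limits.\<close>

definition spec :: "('a \<Rightarrow> complex) \<Rightarrow> 'a set \<Rightarrow> bool" where
  "spec h S \<longleftrightarrow> (\<forall>a y. a \<notin> S \<longrightarrow> filt a h y = 0)"

lemma filt_modulate: "filt a (\<lambda>x. g x * exp (\<i> * of_real (x \<bullet> \<eta>))) y = exp (\<i> * of_real (y \<bullet> \<eta>)) * filt (a - \<eta>) g y"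
proof -
  have "exp (\<i> * of_real (a \<bullet> (y - x))) * exp (\<i> * of_real (x \<bullet> \<eta>)) = exp (\<i> * of_real (y \<bullet> \<eta>)) * exp (\<i> * of_real ((a - \<eta>) \<bullet> (y - x)))" for x
    unfolding exp_add[symmetric]
    by (rule arg_cong[where f = exp]) (simp add: inner_diff_left inner_diff_right inner_commute algebra_simps)
  hence "\<kappa> (y - x) * exp (\<i> * of_real (a \<bullet> (y - x))) * (g x * exp (\<i> * of_real (x \<bullet> \<eta>)))
     = exp (\<i> * of_real (y \<bullet> \<eta>)) * (\<kappa> (y - x) * exp (\<i> * of_real ((a - \<eta>) \<bullet> (y - x))) * g x)" for x
    by (rule mult_swap_inner(1))
  thus ?thesis unfolding filt_def by (simp only: integral_mult_right_zero)
qed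

text \<open>The filter centred at \<open>a\<close> sends the constant 1 to
  \<open>\<sigma> (- a)\<close>, by \<open>\<kappa>_inversion\<close>.\<close>

lemma spec_one: "spec (\<lambda>x. 1) (cball 0 d)"
  unfolding spec_def
proof (intro allI impI)
  fix a y :: 'a assume a: "a \<notin> cball 0 d"
  have "filt a (\<lambda>x. 1) y = (\<integral>x. \<kappa> x * exp (\<i> * of_real (a \<bullet> x)) \<partial>lborel)"
    unfolding filt_def using integral_reflect[of "\<lambda>x. \<kappa> x * exp (\<i> * of_real (a \<bullet> x))" y] by simp
  also have "\<dots> = of_real (\<sigma> (- a))" using \<kappa>_inversion[of "-a"] by (simp add: inner_commute)
  also have "\<dots> = 0" using \<sigma>_supp[of "-a"] a by simp
  finally show "filt a (\<lambda>x. 1) y = 0" .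
qed

definition bddm :: "('a \<Rightarrow> complex) \<Rightarrow> bool" where
  "bddm h \<longleftrightarrow> h \<in> borel_measurable borel \<and> (\<exists>B. \<forall>x. norm (h x) \<le> B)"

lemma bddm_meas: "bddm h \<Longrightarrow> h \<in> borel_measurable borel" by (simp add: bddm_def)

lemma bddm_l1inf: "bddm h \<Longrightarrow> l1inf h" unfolding bddm_def using l1inf_bounded by blast

lemma bddm_mult: assumes "bddm f" "bddm g" shows "bddm (\<lambda>x. f x * g x)"
proof -
  obtain A B where "\<And>x. norm (f x) \<le> A" "\<And>x. norm (g x) \<le> B" using assms unfolding bddm_def by auto
  hence "norm (f x * g x) \<le> A * B" for x unfolding norm_mult
    by (intro mult_mono) (auto intro: order_trans[OF norm_ge_zero])
  moreover have "f \<in> borel_measurable borel" "g \<in> borel_measurable borel" using assms by (auto simp: bddm_def)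
  ultimately show ?thesis unfolding bddm_def by auto
qed

lemma bddm_add: assumes "bddm f" "bddm g" shows "bddm (\<lambda>x. f x + g x)"
proof -
  obtain A B where "\<And>x. norm (f x) \<le> A" "\<And>x. norm (g x) \<le> B" using assms unfolding bddm_def by auto
  hence "norm (f x + g x) \<le> A + B" for x by (intro order_trans[OF norm_triangle_ineq] add_mono)
  moreover have "f \<in> borel_measurable borel" "g \<in> borel_measurable borel" using assms by (auto simp: bddm_def)
  ultimately show ?thesis unfolding bddm_def by auto
qed

lemma bddm_const: "bddm (\<lambda>x. c)" unfolding bddm_def by auto

lemma bddm_filt: "l1inf v \<Longrightarrow> bddm (filt b v)"
  unfolding bddm_def using filt_l1inf[of v b] l1inf_meas by blast

text \<open>Displays a filtered function as a superposition of plane waves with frequencies in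
  \<open>b\<close> plus the support of \<open>\<sigma>\<close>. Integrability of \<open>v\<close>
  makes its Fourier integral available as amplitude.\<close>

lemma filt_fourier:
  assumes v: "integrable lborel v"
  shows "filt b v x = (\<integral>\<eta>. of_real (\<sigma> \<eta>) * (of_real (1 / (2 * pi) ^ DIM('a)) *
    ((\<integral>z. v z * exp (- (\<i> * of_real (z \<bullet> (\<eta> + b)))) \<partial>lborel) * exp (\<i> * of_real (x \<bullet> (\<eta> + b))))) \<partial>lborel)"
proof -
  have [measurable]: "v \<in> borel_measurable borel" using v by auto
  let ?c = "1 / (2 * pi) ^ DIM('a)"
  let ?e = "\<lambda>x \<eta>. exp (\<i> * of_real ((x::'a) \<bullet> (\<eta> + b)))"
  let ?V = "\<lambda>\<eta>. \<integral>z. v z * exp (- (\<i> * of_real (z \<bullet> (\<eta> + b)))) \<partial>lborel"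
  have "filt b v x = (\<integral>z. v z * (\<integral>\<eta>. of_real (\<sigma> \<eta>) * (of_real ?c * (exp (- (\<i> * of_real (z \<bullet> (\<eta> + b)))) * ?e x \<eta>)) \<partial>lborel) \<partial>lborel)"
    unfolding filt_def
  proof (intro Bochner_Integration.integral_cong refl)
    fix z
    have "\<kappa> (x - z) * exp (\<i> * of_real (b \<bullet> (x - z))) = (\<integral>\<eta>. (of_real ?c * exp (\<i> * of_real (b \<bullet> (x - z)))) * (of_real (\<sigma> \<eta>) * exp (\<i> * of_real ((x - z) \<bullet> \<eta>))) \<partial>lborel)"
      unfolding \<kappa>_def oscint_def integral_mult_right_zero by (simp only: mult_ac)
    also have "\<dots> = (\<integral>\<eta>. of_real (\<sigma> \<eta>) * (of_real ?c * (exp (- (\<i> * of_real (z \<bullet> (\<eta> + b)))) * ?e x \<eta>)) \<partial>lborel)"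
    proof (intro Bochner_Integration.integral_cong refl)
      fix \<eta>
      have "exp (\<i> * of_real (b \<bullet> (x - z))) * exp (\<i> * of_real ((x - z) \<bullet> \<eta>)) = exp (- (\<i> * of_real (z \<bullet> (\<eta> + b)))) * ?e x \<eta>"
        unfolding exp_add[symmetric]
        by (rule arg_cong[where f = exp]) (simp add: inner_diff_left inner_diff_right inner_add_right inner_commute algebra_simps)
      thus "of_real ?c * exp (\<i> * of_real (b \<bullet> (x - z))) * (of_real (\<sigma> \<eta>) * exp (\<i> * of_real ((x - z) \<bullet> \<eta>)))
        = of_real (\<sigma> \<eta>) * (of_real ?c * (exp (- (\<i> * of_real (z \<bullet> (\<eta> + b)))) * ?e x \<eta>))"
        by (rule mult_swap_inner(2))
    qed
    finally show "\<kappa> (x - z) * exp (\<i> * of_real (b \<bullet> (x - z))) * v z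
       = v z * (\<integral>\<eta>. of_real (\<sigma> \<eta>) * (of_real ?c * (exp (- (\<i> * of_real (z \<bullet> (\<eta> + b)))) * ?e x \<eta>)) \<partial>lborel)"
      by (simp only: mult.commute)
  qed
  also have "\<dots> = (\<integral>\<eta>. of_real (\<sigma> \<eta>) * (\<integral>z. v z * (of_real ?c * (exp (- (\<i> * of_real (z \<bullet> (\<eta> + b)))) * ?e x \<eta>)) \<partial>lborel) \<partial>lborel)"
    by (rule fubini_mult(1)[where K = ?c, OF sigma_finite_lborel sigma_finite_lborel v \<sigma>_integrable]) (auto simp: norm_mult norm_divide norm_power)
  also have "(\<lambda>\<eta>. \<integral>z. v z * (of_real ?c * (exp (- (\<i> * of_real (z \<bullet> (\<eta> + b)))) * ?e x \<eta>)) \<partial>lborel) = (\<lambda>\<eta>. of_real ?c * (?V \<eta> * ?e x \<eta>))"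
  proof
    fix \<eta>
    have "(\<integral>z. v z * (of_real ?c * (exp (- (\<i> * of_real (z \<bullet> (\<eta> + b)))) * ?e x \<eta>)) \<partial>lborel)
      = (\<integral>z. (of_real ?c * ?e x \<eta>) * (v z * exp (- (\<i> * of_real (z \<bullet> (\<eta> + b))))) \<partial>lborel)"
      by (intro Bochner_Integration.integral_cong refl) (simp only: mult_ac)
    also have "\<dots> = (of_real ?c * ?e x \<eta>) * ?V \<eta>" by (rule integral_mult_right_zero)
    also have "\<dots> = of_real ?c * (?V \<eta> * ?e x \<eta>)" by (rule mult_swap_assoc)
    finally show "(\<integral>z. v z * (of_real ?c * (exp (- (\<i> * of_real (z \<bullet> (\<eta> + b)))) * ?e x \<eta>)) \<partial>lborel) = of_real ?c * (?V \<eta> * ?e x \<eta>)" .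
  qed
  finally show ?thesis .
qed

text \<open>By \<open>filt_fourier\<close> the product is a superposition of modulations of
  \<open>h\<close> by frequencies \<open>\<eta> + b\<close>. Where \<open>\<sigma> \<eta>\<close>
  does not vanish, \<open>\<eta>\<close> has length at most \<open>d\<close>, and the modulated
  \<open>h\<close> is invisible to filters further than \<open>s + d\<close> from
  \<open>a + b\<close>.\<close>

lemma spec_mult_filt_integrable:
  assumes h: "bddm h" and sp: "spec h (cball a s)" and v: "integrable lborel v"
  shows "spec (\<lambda>x. h x * filt b v x) (cball (a + b) (s + d))"
  unfolding spec_def
proof (intro allI impI)
  fix a' y assume a': "a' \<notin> cball (a + b) (s + d)"
  have [measurable]: "h \<in> borel_measurable borel" "v \<in> borel_measurable borel" using bddm_meas[OF h] v by auto
  let ?c = "1 / (2 * pi) ^ DIM('a)"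
  let ?e = "\<lambda>x \<eta>. exp (\<i> * of_real ((x::'a) \<bullet> (\<eta> + b)))"
  let ?V = "\<lambda>\<eta>. \<integral>z. v z * exp (- (\<i> * of_real (z \<bullet> (\<eta> + b)))) \<partial>lborel"
  have V: "norm (?V \<eta>) \<le> (\<integral>z. norm (v z) \<partial>lborel)" for \<eta>
    by (rule order_trans[OF integral_norm_bound]) (simp add: norm_mult)
  have e1: "filt b v x = (\<integral>\<eta>. of_real (\<sigma> \<eta>) * (of_real ?c * (?V \<eta> * ?e x \<eta>)) \<partial>lborel)" for x
    by (rule filt_fourier[OF v])
  have Kh: "integrable lborel (\<lambda>x. \<kappa> (y - x) * exp (\<i> * of_real (a' \<bullet> (y - x))) * h x)"
    by (rule filt_integrable[OF bddm_l1inf[OF h]])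
  have "filt a' (\<lambda>x. h x * filt b v x) y = (\<integral>x. (\<kappa> (y - x) * exp (\<i> * of_real (a' \<bullet> (y - x))) * h x) *
      (\<integral>\<eta>. of_real (\<sigma> \<eta>) * (of_real ?c * (?V \<eta> * ?e x \<eta>)) \<partial>lborel) \<partial>lborel)"
    unfolding filt_def[of a'] e1 by (simp only: mult.assoc)
  also have "\<dots> = (\<integral>\<eta>. of_real (\<sigma> \<eta>) * (\<integral>x. (\<kappa> (y - x) * exp (\<i> * of_real (a' \<bullet> (y - x))) * h x) * (of_real ?c * (?V \<eta> * ?e x \<eta>)) \<partial>lborel) \<partial>lborel)"
  proof (rule fubini_mult(1)[OF sigma_finite_lborel sigma_finite_lborel Kh \<sigma>_integrable])
    show "(\<lambda>(x, \<eta>). of_real ?c * (?V \<eta> * ?e x \<eta>)) \<in> borel_measurable (lborel \<Otimes>\<^sub>M lborel)" by measurable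
    show "norm (of_real ?c * (?V \<eta> * ?e x \<eta>)) \<le> ?c * (\<integral>z. norm (v z) \<partial>lborel)" for x \<eta>
      using V[of \<eta>] by (simp add: norm_mult norm_divide norm_power divide_right_mono)
  qed
  also have "\<dots> = (\<integral>\<eta>. 0 \<partial>(lborel::'a measure))"
  proof (intro Bochner_Integration.integral_cong refl)
    fix \<eta>
    show "of_real (\<sigma> \<eta>) * (\<integral>x. (\<kappa> (y - x) * exp (\<i> * of_real (a' \<bullet> (y - x))) * h x) * (of_real ?c * (?V \<eta> * ?e x \<eta>)) \<partial>lborel) = 0"
    proof (cases "norm \<eta> > d")
      case True
      thus ?thesis using \<sigma>_supp by simp
    next
      case False
      have "(\<integral>x. (\<kappa> (y - x) * exp (\<i> * of_real (a' \<bullet> (y - x))) * h x) * (of_real ?c * (?V \<eta> * ?e x \<eta>)) \<partial>lborel)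
        = of_real ?c * ?V \<eta> * filt a' (\<lambda>x. h x * ?e x \<eta>) y"
        unfolding filt_def by (subst integral_mult_right_zero[symmetric]) (simp only: mult_ac)
      also have "filt a' (\<lambda>x. h x * ?e x \<eta>) y = exp (\<i> * of_real (y \<bullet> (\<eta> + b))) * filt (a' - (\<eta> + b)) h y"
        by (rule filt_modulate)
      also have "filt (a' - (\<eta> + b)) h y = 0"
      proof -
        have "s + d < norm (a' - (a + b))" using a' by (simp add: dist_norm norm_minus_commute)
        also have "\<dots> \<le> norm (a' - (\<eta> + b) - a) + norm \<eta>"
          using norm_triangle_ineq[of "a' - (\<eta> + b) - a" \<eta>] by (simp add: algebra_simps)
        finally have "a' - (\<eta> + b) \<notin> cball a s" using False by (simp add: dist_norm norm_minus_commute)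
        thus ?thesis using sp by (simp add: spec_def)
      qed
      finally show ?thesis by simp
    qed
  qed
  finally show "filt a' (\<lambda>x. h x * filt b v x) y = 0" by simp
qed

text \<open>Truncation to balls makes \<open>v\<close> integrable. The property passes to the limit
  because the filtered truncations are uniformly bounded and converge pointwise.\<close>

lemma spec_mult_filt:
  assumes h: "bddm h" and sp: "spec h (cball a s)" and v: "l1inf v"
  shows "spec (\<lambda>x. h x * filt b v x) (cball (a + b) (s + d))"
  unfolding spec_def
proof (intro allI impI)
  fix a' y assume a': "a' \<notin> cball (a + b) (s + d)"
  have [measurable]: "h \<in> borel_measurable borel" "v \<in> borel_measurable borel" using bddm_meas[OF h] l1inf_meas[OF v] by auto
  obtain H where H: "\<And>x. norm (h x) \<le> H" using h unfolding bddm_def by blast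
  have H0: "0 \<le> H" using H[of undefined] norm_ge_zero order_trans by blast
  from v obtain C g where 1: "0 \<le> C" "integrable lborel g" "\<And>x. 0 \<le> g x" "\<And>x. norm (v x) \<le> C + g x" by (rule l1infE) blast
  define w where "w = (\<lambda>(n::nat) x. if norm x \<le> real n then v x else 0)"
  have wm [measurable]: "w n \<in> borel_measurable borel" for n unfolding w_def by measurable
  have wb: "norm (w n x) \<le> C + g x" for n x
    using 1(4)[of x] 1(1,3) by (auto simp: w_def indicator_def add_nonneg_nonneg)
  have wi: "integrable lborel (w n)" for n
  proof (rule Bochner_Integration.integrable_bound)
    show "integrable lborel (\<lambda>x. indicator (cball 0 (real n)) x *\<^sub>R C + g x)"
      using 1(2) by (intro Bochner_Integration.integrable_add borel_integrable_compact) auto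
    show "AE x in lborel. norm (w n x) \<le> norm (indicator (cball 0 (real n)) x *\<^sub>R C + g x)"
      using 1 by (intro AE_I2) (auto simp: w_def indicator_def add_nonneg_nonneg abs_of_nonneg)
  qed measurable
  have wlim: "(\<lambda>n. w n x) \<longlonglongrightarrow> v x" for x
  proof (rule tendsto_eventually)
    obtain N where "norm x \<le> real N" using real_arch_simple by blast
    thus "\<forall>\<^sub>F n in sequentially. w n x = v x"
      unfolding eventually_sequentially w_def by (intro exI[of _ N]) (auto simp: indicator_def)
  qed
  have lim1: "(\<lambda>n. filt b (w n) x) \<longlonglongrightarrow> filt b v x" for x
    by (rule filt_limit[OF wm 1(1-3) wb wlim])
  let ?B = "C * \<kappa>1 + \<kappa>sup * (\<integral>x. g x \<partial>lborel)"
  have fb: "norm (filt b (w n) x) \<le> ?B" for n x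
    by (rule filt_bound_gen[OF wm 1(1,2) wb 1(3)])
  have "(\<lambda>n. filt a' (\<lambda>x. h x * filt b (w n) x) y) \<longlonglongrightarrow> filt a' (\<lambda>x. h x * filt b v x) y"
  proof (rule filt_limit[where C = "H * ?B" and h = "\<lambda>x. 0"])
    show "norm (h x * filt b (w n) x) \<le> H * ?B + 0" for n x
      using mult_mono[OF H fb H0] by (simp add: norm_mult)
    show "0 \<le> H * ?B" using mult_mono[OF H fb H0, of undefined 0 undefined] by (meson norm_ge_zero mult_nonneg_nonneg order_trans)
    show "(\<lambda>n. h x * filt b (w n) x) \<longlonglongrightarrow> h x * filt b v x" for x by (intro tendsto_intros lim1)
  qed auto
  moreover have "filt a' (\<lambda>x. h x * filt b (w n) x) y = 0" for n
    using spec_mult_filt_integrable[OF h sp wi, of b n] a' unfolding spec_def by blast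
  ultimately show "filt a' (\<lambda>x. h x * filt b v x) y = 0" by (simp add: LIMSEQ_const_iff)
qed

text \<open>Pointwise multiplication by \<open>g\<close> enlarges the spectrum by at most \<open>r\<close>. This multiplier formulation makes the additivity of the frequency radius under products immediate.\<close>

definition freq_le :: "('a \<Rightarrow> complex) \<Rightarrow> real \<Rightarrow> bool" where
  "freq_le g r \<longleftrightarrow> bddm g \<and> (\<forall>h a s. bddm h \<longrightarrow> spec h (cball a s) \<longrightarrow> spec (\<lambda>x. g x * h x) (cball a (s + r)))"

lemma spec_mono: "spec h S \<Longrightarrow> S \<subseteq> T \<Longrightarrow> spec h T" unfolding spec_def by blast

lemma freq_le_mono: "freq_le g r \<Longrightarrow> r \<le> r' \<Longrightarrow> freq_le g r'"
  unfolding freq_le_def by (auto intro: spec_mono[OF _ subset_cball[OF add_left_mono]])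

lemma freq_le_mult:
  assumes "freq_le f r" "freq_le g s"
  shows "freq_le (\<lambda>x. f x * g x) (r + s)"
  unfolding freq_le_def
proof (intro conjI allI impI)
  show "bddm (\<lambda>x. f x * g x)" using assms by (simp add: freq_le_def bddm_mult)
  fix h a t assume h: "bddm h" "spec h (cball a t)"
  have "bddm (\<lambda>x. g x * h x)" "spec (\<lambda>x. g x * h x) (cball a (t + s))"
    using assms(2) h by (auto simp: freq_le_def bddm_mult)
  hence "spec (\<lambda>x. f x * (g x * h x)) (cball a (t + s + r))"
    using assms(1) unfolding freq_le_def by blast
  thus "spec (\<lambda>x. f x * g x * h x) (cball a (t + (r + s)))"
    by (simp only: mult.assoc add.assoc add.commute[of r s])
qed

lemma freq_le_add:
  assumes "freq_le f r" "freq_le g r" shows "freq_le (\<lambda>x. f x + g x) r"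
  unfolding freq_le_def
proof (intro conjI allI impI)
  show "bddm (\<lambda>x. f x + g x)" using assms by (auto simp: freq_le_def bddm_add)
  fix h a s assume h: "bddm h" "spec h (cball a s)"
  have 1: "spec (\<lambda>x. f x * h x) (cball a (s + r))" "spec (\<lambda>x. g x * h x) (cball a (s + r))"
    using assms h by (auto simp: freq_le_def)
  have 2: "l1inf (\<lambda>x. f x * h x)" "l1inf (\<lambda>x. g x * h x)"
    using assms h by (auto simp: freq_le_def intro!: bddm_l1inf bddm_mult)
  show "spec (\<lambda>x. (f x + g x) * h x) (cball a (s + r))"
    using 1 unfolding spec_def distrib_right by (simp add: filt_add[OF 2])
qed

lemma freq_le_const: "freq_le (\<lambda>x. c) 0"
  unfolding freq_le_def by (auto simp: bddm_const spec_def filt_cmult)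

lemma freq_le_cmult: "freq_le f r \<Longrightarrow> freq_le (\<lambda>x. c * f x) r"
  using freq_le_mult[OF freq_le_const, of f r c] by simp

lemma freq_le_sum:
  "finite F \<Longrightarrow> 0 \<le> r \<Longrightarrow> (\<And>k. k \<in> F \<Longrightarrow> freq_le (f k) r) \<Longrightarrow> freq_le (\<lambda>x. \<Sum>k\<in>F. f k x) r"
  by (induction F rule: finite_induct) (auto intro: freq_le_add freq_le_mono[OF freq_le_const])

lemma freq_le_power:
  "freq_le f r \<Longrightarrow> freq_le (\<lambda>x. f x ^ m) (real m * r)"
proof (induction m)
  case (Suc m)
  from freq_le_mult[OF Suc.prems Suc.IH[OF Suc.prems]] show ?case by (simp add: algebra_simps)
qed (simp add: freq_le_const)

text \<open>Pieces are later altered on null sets so that their bounds hold everywhere; the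
  frequency radius is insensitive to that.\<close>

lemma freq_le_cong_AE:
  assumes "freq_le f r" "bddm g" "AE x in lborel. f x = g x"
  shows "freq_le g r"
  unfolding freq_le_def
proof (intro conjI allI impI)
  fix h a s assume h: "bddm h" "spec h (cball a s)"
  have 1: "spec (\<lambda>x. f x * h x) (cball a (s + r))" using assms h by (auto simp: freq_le_def)
  have [measurable]: "f \<in> borel_measurable borel" "g \<in> borel_measurable borel" "h \<in> borel_measurable borel"
    using assms h by (auto simp: freq_le_def intro: bddm_meas)
  have "filt b (\<lambda>x. g x * h x) y = filt b (\<lambda>x. f x * h x) y" for b y
    by (rule filt_cong_AE) (use assms(3) in auto)
  thus "spec (\<lambda>x. g x * h x) (cball a (s + r))" using 1 by (simp add: spec_def)
qed fact

lemma freq_le_filt: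
  assumes "l1inf v" shows "freq_le (filt b v) (norm b + d)"
  unfolding freq_le_def
proof (intro conjI allI impI)
  show "bddm (filt b v)" by (rule bddm_filt[OF assms])
  fix h a s assume h: "bddm h" "spec h (cball a s)"
  have "spec (\<lambda>x. h x * filt b v x) (cball (a + b) (s + d))" by (rule spec_mult_filt[OF h assms])
  moreover have "cball (a + b) (s + d) \<subseteq> cball a (s + (norm b + d))"
  proof
    fix x assume "x \<in> cball (a + b) (s + d)"
    thus "x \<in> cball a (s + (norm b + d))"
      using norm_triangle_ineq[of "a + b - x" "- b"] by (simp add: dist_norm)
  qed
  ultimately show "spec (\<lambda>x. filt b v x * h x) (cball a (s + (norm b + d)))"
    by (simp add: mult.commute spec_mono)
qed

text \<open>The product with the constant 1: its own radius \<open>d\<close> and the radius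
  \<open>d\<close> of the filter add up to \<open>2 * d\<close>.\<close>

lemma spec_filt:
  assumes "l1inf v" shows "spec (filt b v) (cball b (2 * d))"
proof -
  have "spec (\<lambda>x. 1 * filt b v x) (cball (0 + b) (d + d))"
    by (rule spec_mult_filt[OF bddm_const spec_one assms])
  thus ?thesis by simp
qed

end

section \<open>Approximate identities\<close>

lemma frontier_box_null: "frontier (box l u) \<in> null_sets (lborel :: 'a::euclidean_space measure)"
proof -
  have "negligible (frontier (box l u))" by (rule negligible_convex_frontier) (rule convex_box)
  hence "frontier (box l u) \<in> null_sets lebesgue" by (simp add: negligible_iff_null_sets)
  thus ?thesis by (subst (asm) null_sets_completion_iff) (simp_all add: frontier_closed)
qed

lemma l1inf_set_integrable:
  assumes D: "l1inf D" and B: "bounded B" "B \<in> sets borel"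
  shows "integrable lborel (\<lambda>x. indicator B x *\<^sub>R D x)"
proof -
  have [measurable]: "D \<in> borel_measurable borel" "B \<in> sets borel" using l1inf_meas[OF D] B by auto
  from D obtain C h where 1: "0 \<le> C" "integrable lborel h" "\<And>x. 0 \<le> h x" "\<And>x. norm (D x) \<le> C + h x" by (rule l1infE) blast
  obtain R where R: "\<And>x. x \<in> B \<Longrightarrow> norm x \<le> R" using B(1) by (auto simp: bounded_iff)
  show ?thesis
  proof (rule Bochner_Integration.integrable_bound)
    show "integrable lborel (\<lambda>x. indicator (cball 0 R) x *\<^sub>R C + h x)"
      using 1(2) by (intro Bochner_Integration.integrable_add borel_integrable_compact) auto
    show "AE x in lborel. norm (indicator B x *\<^sub>R D x) \<le> norm (indicator (cball 0 R) x *\<^sub>R C + h x)"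
      using 1 R by (intro AE_I2) (auto simp: indicator_def add_nonneg_nonneg abs_of_nonneg)
  qed measurable
qed

text \<open>Open boxes form an intersection-stable generator of the Borel sets, so vanishing
  integrals spread to all of them by the Dynkin argument. Restricting to the large boxes
  \<open>B n\<close> makes \<open>D\<close> integrable and turns boxes into boxes again.\<close>

lemma l1inf_zero_if_box_integrals_zero:
  fixes D :: "'a::euclidean_space \<Rightarrow> complex"
  assumes D: "l1inf D" and z: "\<And>l u. (\<integral>x. indicator (box l u) x *\<^sub>R D x \<partial>lborel) = 0"
  shows "AE x in lborel. D x = 0"
proof -
  have [measurable]: "D \<in> borel_measurable borel" using l1inf_meas[OF D] .
  define B where "B = (\<lambda>n::nat. box (- real n *\<^sub>R One) (real n *\<^sub>R (One::'a)))"
  have main: "AE x in lborel. indicator (B n) x *\<^sub>R D x = 0" for n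
  proof (rule sigma_finite_measure.density_zero[OF sigma_finite_lborel])
    define f where "f = (\<lambda>x. indicator (B n) x *\<^sub>R D x)"
    show i: "integrable lborel (\<lambda>x. indicator (B n) x *\<^sub>R D x)"
      unfolding B_def by (rule l1inf_set_integrable[OF D]) (auto simp: bounded_box)
    have fi: "integrable lborel f" using i by (simp add: f_def)
    have si: "set_integrable lborel A f" if "A \<in> sets borel" for A
      unfolding set_integrable_def using that by (intro integrable_mult_indicator fi) auto
    fix A :: "'a set" assume "A \<in> sets lborel"
    hence sg: "A \<in> sigma_sets UNIV (range (\<lambda>(a, b). box a (b::'a)))" by (simp add: borel_eq_box)
    have st: "Int_stable (range (\<lambda>(a, b). box a (b::'a)))"
    proof (rule Int_stableI)
      fix A B assume "A \<in> range (\<lambda>(a, b). box a (b::'a))" "B \<in> range (\<lambda>(a, b). box a (b::'a))"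
      then obtain a b c e where "A = box a b" "B = box c e" by auto
      hence "\<exists>u v. A \<inter> B = box u v" using box_Int_box[of a b c e] by blast
      thus "A \<inter> B \<in> range (\<lambda>(a, b). box a (b::'a))" by auto
    qed
    have "range (\<lambda>(a, b). box a (b::'a)) \<subseteq> Pow UNIV" by simp
    from st this sg have "set_lebesgue_integral lborel A f = 0"
    proof (induction rule: sigma_sets_induct_disjoint)
      case (basic A)
      then obtain a b where A: "A = box a b" by auto
      have "indicator A x *\<^sub>R f x = indicator (box (\<Sum>i\<in>Basis. max (a\<bullet>i) ((- real n *\<^sub>R One)\<bullet>i) *\<^sub>R i) (\<Sum>i\<in>Basis. min (b\<bullet>i) ((real n *\<^sub>R One)\<bullet>i) *\<^sub>R i)) x *\<^sub>R D x" for x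
        unfolding box_Int_box[symmetric] f_def B_def A by (simp add: indicator_def)
      thus ?case unfolding set_lebesgue_integral_def using z by simp
    next
      case empty
      show ?case by (simp add: set_lebesgue_integral_def)
    next
      case (compl A)
      have A: "A \<in> sets borel" using compl by (simp add: borel_eq_box)
      have "set_lebesgue_integral lborel (A \<union> (UNIV - A)) f = set_lebesgue_integral lborel A f + set_lebesgue_integral lborel (UNIV - A) f"
        using A by (intro set_integral_Un si) auto
      moreover have "set_lebesgue_integral lborel UNIV f = 0"
        unfolding set_lebesgue_integral_def f_def B_def using z by simp
      ultimately show ?case using compl by simp
    next
      case (union A)
      have A: "A i \<in> sets borel" for i using union by (auto simp: borel_eq_box)
      have "set_lebesgue_integral lborel (\<Union>i. A i) f = (\<Sum>i. set_lebesgue_integral lborel (A i) f)"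
      proof (rule lebesgue_integral_countable_add)
        show "A i \<in> sets lborel" for i using A by simp
        show "A i \<inter> A j = {}" if "i \<noteq> j" for i j using union that by (simp add: disjoint_family_on_def)
        show "set_integrable lborel (\<Union>i. A i) f" by (rule si) (use A in auto)
      qed
      thus ?case using union by simp
    qed
    thus "set_lebesgue_integral lborel A (\<lambda>x. indicator (B n) x *\<^sub>R D x) = 0" by (simp add: f_def)
  qed
  have "AE x in lborel. \<forall>n. indicator (B n) x *\<^sub>R D x = 0"
    unfolding AE_all_countable by (intro allI main)
  thus ?thesis
  proof (rule AE_mp, intro AE_I2 impI)
    fix x assume x: "\<forall>n. indicator (B n) x *\<^sub>R D x = 0"
    obtain n where n: "norm x < real n" using reals_Archimedean2 by blast
    have "- real n < x \<bullet> i \<and> x \<bullet> i < real n" if "i \<in> Basis" for i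
      using Basis_le_norm[OF that, of x] n by linarith
    hence "x \<in> B n" unfolding B_def mem_box by simp
    thus "D x = 0" using x[rule_format, of n] by simp
  qed
qed

text \<open>The hypothesis says that all scaled averages of \<open>D\<close> vanish. Integrated over
  \<open>y\<close> in a box they become averages of \<open>\<Phi> (\<delta> n *\<^sub>R w)\<close>
  against \<open>\<Theta>\<close>, where \<open>\<Phi> s\<close> is the integral over the box of
  \<open>D\<close> shifted by \<open>s\<close>. Continuity of \<open>\<Phi>\<close> at 0 leaves
  \<open>\<Phi> 0\<close> times the integral of \<open>\<Theta>\<close>. Box integrals take the
  place of Lebesgue points.\<close>

lemma approximate_identity_unique:
  fixes D \<Theta> :: "'a::euclidean_space \<Rightarrow> complex"
  assumes D: "l1inf D" and T: "integrable lborel \<Theta>" "(\<integral>x. \<Theta> x \<partial>lborel) \<noteq> 0"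
    and z: "\<And>n y. (\<integral>x. D x * \<Theta> (real (Suc n) *\<^sub>R (y - x)) \<partial>lborel) = 0"
  shows "AE x in lborel. D x = 0"
proof (rule l1inf_zero_if_box_integrals_zero[OF D])
  fix l u :: 'a
  let ?B = "box l u"
  have [measurable]: "D \<in> borel_measurable borel" "\<Theta> \<in> borel_measurable borel" using l1inf_meas[OF D] T by auto
  from D obtain C h where 1: "0 \<le> C" "integrable lborel h" "\<And>x. 0 \<le> h x" "\<And>x. norm (D x) \<le> C + h x" by (rule l1infE) blast
  have [measurable]: "h \<in> borel_measurable borel" using 1 by auto
  define \<delta> where "\<delta> = (\<lambda>n::nat. 1 / real (Suc n))"
  have \<delta>: "0 < \<delta> n" "\<delta> n \<le> 1" for n by (auto simp: \<delta>_def field_simps)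
  have \<delta>lim: "\<delta> \<longlonglongrightarrow> 0" unfolding \<delta>_def by (rule LIMSEQ_Suc[OF lim_1_over_n])
  have z': "(\<integral>w. \<Theta> w * D (y - \<delta> n *\<^sub>R w) \<partial>lborel) = 0" for n y
  proof -
    have "(\<integral>x. D x * \<Theta> (real (Suc n) *\<^sub>R (y - x)) \<partial>lborel)
      = \<bar>- \<delta> n\<bar> ^ DIM('a) *\<^sub>R (\<integral>w. D (y + (- \<delta> n) *\<^sub>R w) * \<Theta> (real (Suc n) *\<^sub>R (y - (y + (- \<delta> n) *\<^sub>R w))) \<partial>lborel)"
      by (rule integral_affine_euclidean) (use \<delta>[of n] in auto)
    also have "(\<lambda>w. D (y + (- \<delta> n) *\<^sub>R w) * \<Theta> (real (Suc n) *\<^sub>R (y - (y + (- \<delta> n) *\<^sub>R w)))) = (\<lambda>w. \<Theta> w * D (y - \<delta> n *\<^sub>R w))"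
      by (auto simp: fun_eq_iff \<delta>_def mult.commute)
    finally show ?thesis using z[of n y] \<delta>[of n] by simp
  qed
  have Dr: "integrable lborel (\<lambda>y. indicator ?B y *\<^sub>R D (y - s))" for s
  proof -
    have "l1inf (\<lambda>y. D (y - s))" unfolding l1inf_def
      using 1 integrable_translate[OF 1(2), of "-s"]
      by (intro conjI exI[of _ C] exI[of _ "\<lambda>y. h (y - s)"]) auto
    thus ?thesis by (rule l1inf_set_integrable) (auto simp: bounded_box)
  qed
  have "integrable lborel (indicator ?B :: 'a \<Rightarrow> real)"
    by (rule integrable_real_indicator) (use emeasure_bounded_finite[OF bounded_box] in auto)
  hence Bi: "integrable lborel (\<lambda>y. indicator ?B y * C)" by simp
  define K where "K = (\<integral>y. indicator ?B y * C \<partial>lborel) + (\<integral>y. h y \<partial>lborel)"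
  have K: "(\<integral>y. norm (indicator ?B y *\<^sub>R D (y - s)) \<partial>lborel) \<le> K" for s
  proof -
    have hi: "integrable lborel (\<lambda>y. h (y - s))" using integrable_translate[OF 1(2), of "-s"] by simp
    have "(\<integral>y. norm (indicator ?B y *\<^sub>R D (y - s)) \<partial>lborel) \<le> (\<integral>y. indicator ?B y * C + h (y - s) \<partial>lborel)"
    proof (rule integral_mono)
      show "integrable lborel (\<lambda>y. norm (indicator ?B y *\<^sub>R D (y - s)))" by (rule integrable_norm[OF Dr])
      show "integrable lborel (\<lambda>y. indicator ?B y * C + h (y - s))" by (rule Bochner_Integration.integrable_add[OF Bi hi])
      show "norm (indicator ?B y *\<^sub>R D (y - s)) \<le> indicator ?B y * C + h (y - s)" for y
        using 1(3)[of "y - s"] 1(4)[of "y - s"] by (auto simp: indicator_def)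
    qed
    also have "\<dots> = (\<integral>y. indicator ?B y * C \<partial>lborel) + (\<integral>y. h (y - s) \<partial>lborel)"
      by (rule Bochner_Integration.integral_add[OF Bi hi])
    also have "(\<integral>y. h (y - s) \<partial>lborel) = (\<integral>y. h y \<partial>lborel)"
      using integral_translate[of h "-s"] by simp
    finally show ?thesis by (simp add: K_def)
  qed
  define \<Phi> where "\<Phi> = (\<lambda>s. \<integral>y. indicator ?B y *\<^sub>R D (y - s) \<partial>lborel)"
  have [measurable]: "\<Phi> \<in> borel_measurable borel" unfolding \<Phi>_def by measurable
  have \<Phi>K: "norm (\<Phi> s) \<le> K" for s unfolding \<Phi>_def using integral_norm_bound K[of s] by (rule order_trans)
  have F: "(\<integral>w. \<Theta> w * \<Phi> (\<delta> n *\<^sub>R w) \<partial>lborel) = 0" for n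
  proof -
    let ?f = "\<lambda>w y. \<Theta> w * (indicator ?B y *\<^sub>R D (y - \<delta> n *\<^sub>R w))"
    have "integrable (lborel \<Otimes>\<^sub>M lborel) (\<lambda>(w, y). ?f w y)"
    proof (rule lborel_pair.Fubini_integrable)
      show "(\<lambda>(w, y). ?f w y) \<in> borel_measurable (lborel \<Otimes>\<^sub>M lborel)" by measurable
      show "AE w in lborel. integrable lborel (\<lambda>y. case (w, y) of (w, y) \<Rightarrow> ?f w y)"
        unfolding prod.case by (intro AE_I2 integrable_mult_right Dr)
      show "integrable lborel (\<lambda>w. \<integral>y. norm (case (w, y) of (w, y) \<Rightarrow> ?f w y) \<partial>lborel)"
      proof (rule Bochner_Integration.integrable_bound)
        show "integrable lborel (\<lambda>w. K * norm (\<Theta> w))" using T by auto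
        show "AE w in lborel. norm (\<integral>y. norm (case (w, y) of (w, y) \<Rightarrow> ?f w y) \<partial>lborel) \<le> norm (K * norm (\<Theta> w))"
        proof (rule AE_I2)
          fix w
          have "(\<integral>y. norm (case (w, y) of (w, y) \<Rightarrow> ?f w y) \<partial>lborel) = norm (\<Theta> w) * (\<integral>y. norm (indicator ?B y *\<^sub>R D (y - \<delta> n *\<^sub>R w)) \<partial>lborel)"
            unfolding prod.case norm_mult by (rule integral_mult_right_zero)
          also have "\<dots> \<le> norm (\<Theta> w) * K" by (intro mult_left_mono K) auto
          finally have "(\<integral>y. norm (case (w, y) of (w, y) \<Rightarrow> ?f w y) \<partial>lborel) \<le> K * norm (\<Theta> w)" by (simp add: mult.commute)
          moreover have "0 \<le> (\<integral>y. norm (case (w, y) of (w, y) \<Rightarrow> ?f w y) \<partial>lborel)" by (rule integral_nonneg_AE) auto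
          ultimately show "norm (\<integral>y. norm (case (w, y) of (w, y) \<Rightarrow> ?f w y) \<partial>lborel) \<le> norm (K * norm (\<Theta> w))" by simp
        qed
      qed measurable
    qed
    from lborel_pair.Fubini_integral[OF this]
    have f1: "(\<integral>y. (\<integral>w. ?f w y \<partial>lborel) \<partial>lborel) = (\<integral>w. (\<integral>y. ?f w y \<partial>lborel) \<partial>lborel)" .
    have f2: "(\<integral>y. ?f w y \<partial>lborel) = \<Theta> w * \<Phi> (\<delta> n *\<^sub>R w)" for w
      unfolding \<Phi>_def by (rule integral_mult_right_zero)
    have f3: "(\<integral>w. ?f w y \<partial>lborel) = 0" for y
    proof -
      have "?f w y = indicator ?B y *\<^sub>R (\<Theta> w * D (y - \<delta> n *\<^sub>R w))" for w by simp
      thus ?thesis using z'[of y n] by (simp only: integral_scaleR_right) simp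
    qed
    show ?thesis using f1 unfolding f2 f3 by simp
  qed
  have "(\<lambda>n. \<Phi> (\<delta> n *\<^sub>R w)) \<longlonglongrightarrow> \<Phi> 0" for w
  proof -
    \<comment> \<open>The shift is moved from \<open>D\<close> to the indicator of the box, where
      pointwise convergence can fail only on the boundary, a null set.\<close>
    have \<Phi>': "\<Phi> s = (\<integral>x. indicator ?B (x + s) *\<^sub>R D x \<partial>lborel)" for s
      unfolding \<Phi>_def using integral_translate[of "\<lambda>y. indicator ?B y *\<^sub>R D (y - s)" s] by (simp add: add.commute)
    obtain R where R: "\<And>x. x \<in> ?B \<Longrightarrow> norm x \<le> R" using bounded_box[of l u] by (auto simp: bounded_iff)
    show ?thesis unfolding \<Phi>'
    proof (rule integral_dominated_convergence[where w = "\<lambda>x. norm (indicator (cball 0 (R + norm w)) x *\<^sub>R D x)"])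
      show "integrable lborel (\<lambda>x. norm (indicator (cball 0 (R + norm w)) x *\<^sub>R D x))"
        by (intro integrable_norm l1inf_set_integrable[OF D]) auto
      show "AE x in lborel. norm (indicator ?B (x + \<delta> n *\<^sub>R w) *\<^sub>R D x) \<le> norm (indicator (cball 0 (R + norm w)) x *\<^sub>R D x)" for n
      proof (rule AE_I2)
        fix x
        have "norm x \<le> R + norm w" if "x + \<delta> n *\<^sub>R w \<in> ?B"
        proof -
          have "norm (\<delta> n *\<^sub>R w) \<le> norm w" using \<delta>[of n] by (simp add: mult_left_le_one_le)
          moreover have "norm x \<le> norm (x + \<delta> n *\<^sub>R w) + norm (\<delta> n *\<^sub>R w)"
            using norm_triangle_ineq4[of "x + \<delta> n *\<^sub>R w" "\<delta> n *\<^sub>R w"] by simp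
          ultimately show ?thesis using R[OF that] by linarith
        qed
        thus "norm (indicator ?B (x + \<delta> n *\<^sub>R w) *\<^sub>R D x) \<le> norm (indicator (cball 0 (R + norm w)) x *\<^sub>R D x)"
          by (auto simp: indicator_def)
      qed
      show "AE x in lborel. (\<lambda>n. indicator ?B (x + \<delta> n *\<^sub>R w) *\<^sub>R D x) \<longlonglongrightarrow> indicator ?B (x + 0) *\<^sub>R D x"
      proof (rule AE_mp[OF AE_not_in[OF frontier_box_null[of l u]]], intro AE_I2 impI)
        fix x :: 'a assume x: "x \<notin> frontier ?B"
        have lim: "(\<lambda>n. x + \<delta> n *\<^sub>R w) \<longlonglongrightarrow> x"
          using tendsto_add[OF tendsto_const tendsto_scaleR[OF \<delta>lim tendsto_const[of w]], of x] by simp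
        have "\<forall>\<^sub>F n in sequentially. indicator ?B (x + \<delta> n *\<^sub>R w) = (indicator ?B x :: real)"
        proof (cases "x \<in> ?B")
          case True
          have "\<forall>\<^sub>F n in sequentially. x + \<delta> n *\<^sub>R w \<in> ?B"
            by (rule topological_tendstoD[OF lim open_box True])
          thus ?thesis by eventually_elim (use True in simp)
        next
          case False
          hence "x \<in> - closure ?B" using x interior_subset[of ?B] by (auto simp: frontier_def)
          hence "\<forall>\<^sub>F n in sequentially. x + \<delta> n *\<^sub>R w \<in> - closure ?B"
            by (intro topological_tendstoD[OF lim]) auto
          thus ?thesis by eventually_elim (use False closure_subset in \<open>auto simp: indicator_def\<close>)
        qed
        hence "\<forall>\<^sub>F n in sequentially. indicator ?B (x + \<delta> n *\<^sub>R w) *\<^sub>R D x = indicator ?B (x + 0) *\<^sub>R D x"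
          by eventually_elim simp
        thus "(\<lambda>n. indicator ?B (x + \<delta> n *\<^sub>R w) *\<^sub>R D x) \<longlonglongrightarrow> indicator ?B (x + 0) *\<^sub>R D x"
          by (rule tendsto_eventually)
      qed
    qed measurable
  qed
  hence "(\<lambda>n. \<integral>w. \<Theta> w * \<Phi> (\<delta> n *\<^sub>R w) \<partial>lborel) \<longlonglongrightarrow> (\<integral>w. \<Theta> w * \<Phi> 0 \<partial>lborel)"
    by (intro integral_dominated_convergence[where w = "\<lambda>w. norm (\<Theta> w) * K"])
      (use T \<Phi>K in \<open>auto intro!: AE_I2 tendsto_intros mult_left_mono simp: norm_mult\<close>)
  hence "(\<integral>w. \<Theta> w * \<Phi> 0 \<partial>lborel) = 0" unfolding F by (simp add: LIMSEQ_const_iff)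
  hence "\<Phi> 0 = 0" using T by simp
  thus "(\<integral>x. indicator ?B x *\<^sub>R D x \<partial>lborel) = 0" by (simp add: \<Phi>_def)
qed

text \<open>The bounded part of the majorant of \<open>g\<close> is paired with the integrability of
  \<open>k\<close>, the integrable part with its boundedness.\<close>

lemma fubini_conv:
  fixes A k g :: "'a::euclidean_space \<Rightarrow> complex"
  assumes A: "integrable lborel A" and k: "integrable lborel k" "\<And>x. norm (k x) \<le> K" and g: "l1inf g"
  shows "(\<integral>x. A x * (\<integral>z. k (x - z) * g z \<partial>lborel) \<partial>lborel) = (\<integral>z. g z * (\<integral>x. A x * k (x - z) \<partial>lborel) \<partial>lborel)"
proof -
  have [measurable]: "g \<in> borel_measurable borel" "A \<in> borel_measurable borel" "k \<in> borel_measurable borel"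
    using l1inf_meas[OF g] A k by auto
  from g obtain C h where 1: "0 \<le> C" "integrable lborel h" "\<And>x. 0 \<le> h x" "\<And>x. norm (g x) \<le> C + h x" by (rule l1infE) blast
  have [measurable]: "h \<in> borel_measurable borel" using 1 by auto
  have K0: "0 \<le> K" using k(2)[of undefined] norm_ge_zero order_trans by blast
  have i1: "integrable (lborel \<Otimes>\<^sub>M lborel) (\<lambda>(x, z). norm (A x) * norm (k (x - z)))"
  proof (rule lborel_pair.Fubini_integrable)
    have kr: "(\<integral>z. norm (k (x - z)) \<partial>lborel) = (\<integral>z. norm (k z) \<partial>lborel)" for x
      by (rule integral_reflect[of "\<lambda>z. norm (k z)"]) measurable
    show "integrable lborel (\<lambda>x. \<integral>z. norm (case (x, z) of (x, z) \<Rightarrow> norm (A x) * norm (k (x - z))) \<partial>lborel)"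
      using A by (simp add: kr)
    show "AE x in lborel. integrable lborel (\<lambda>z. case (x, z) of (x, z) \<Rightarrow> norm (A x) * norm (k (x - z)))"
      using integrable_reflect[OF k(1)] by auto
  qed measurable
  have i2: "integrable (lborel \<Otimes>\<^sub>M lborel) (\<lambda>(x, z). norm (A x) * h z)"
  proof (rule lborel_pair.Fubini_integrable)
    show "integrable lborel (\<lambda>x. \<integral>z. norm (case (x, z) of (x, z) \<Rightarrow> norm (A x) * h z) \<partial>lborel)"
      using A 1 by (simp add: abs_mult)
    show "AE x in lborel. integrable lborel (\<lambda>z. case (x, z) of (x, z) \<Rightarrow> norm (A x) * h z)"
      using 1 by auto
  qed measurable
  have "integrable (lborel \<Otimes>\<^sub>M lborel) (\<lambda>(x, z). A x * (k (x - z) * g z))"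
  proof (rule Bochner_Integration.integrable_bound)
    show "integrable (lborel \<Otimes>\<^sub>M lborel) (\<lambda>w. C * (case w of (x, z) \<Rightarrow> norm (A x) * norm (k (x - z))) + K * (case w of (x, z) \<Rightarrow> norm (A x) * h z))"
      by (intro Bochner_Integration.integrable_add integrable_mult_right i1 i2)
    show "AE w in lborel \<Otimes>\<^sub>M lborel. norm (case w of (x, z) \<Rightarrow> A x * (k (x - z) * g z))
       \<le> norm (C * (case w of (x, z) \<Rightarrow> norm (A x) * norm (k (x - z))) + K * (case w of (x, z) \<Rightarrow> norm (A x) * h z))"
    proof (rule AE_I2)
      fix w :: "'a \<times> 'a"
      obtain x z where w: "w = (x, z)" by fastforce
      have "norm (k (x - z)) * norm (g z) \<le> norm (k (x - z)) * (C + h z)" by (intro mult_left_mono 1) auto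
      also have "\<dots> \<le> C * norm (k (x - z)) + K * h z"
        using mult_right_mono[OF k(2) 1(3)[of z], of "x - z"] by (simp add: algebra_simps)
      finally have "norm (A x) * (norm (k (x - z)) * norm (g z)) \<le> norm (A x) * (C * norm (k (x - z)) + K * h z)"
        by (intro mult_left_mono) auto
      also have "\<dots> = C * (norm (A x) * norm (k (x - z))) + K * (norm (A x) * h z)" by (simp add: algebra_simps)
      also have "\<dots> \<le> \<bar>\<dots>\<bar>" by simp
      finally show "norm (case w of (x, z) \<Rightarrow> A x * (k (x - z) * g z))
       \<le> norm (C * (case w of (x, z) \<Rightarrow> norm (A x) * norm (k (x - z))) + K * (case w of (x, z) \<Rightarrow> norm (A x) * h z))"
        by (simp add: w norm_mult)
    qed
  qed measurable
  from lborel_pair.Fubini_integral[OF this]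
  have "(\<integral>z. (\<integral>x. A x * (k (x - z) * g z) \<partial>lborel) \<partial>lborel) = (\<integral>x. (\<integral>z. A x * (k (x - z) * g z) \<partial>lborel) \<partial>lborel)" .
  moreover have "(\<integral>x. A x * (k (x - z) * g z) \<partial>lborel) = g z * (\<integral>x. A x * k (x - z) \<partial>lborel)" for z
    by (subst integral_mult_right_zero[symmetric]) (simp only: mult_ac)
  moreover have "(\<integral>z. A x * (k (x - z) * g z) \<partial>lborel) = A x * (\<integral>z. k (x - z) * g z \<partial>lborel)" for x
    by (rule integral_mult_right_zero)
  ultimately show ?thesis by simp
qed

section \<open>Frequency-uniform decompositions\<close>

definition cube :: "nat \<Rightarrow> (int ^ 'n) set" where
  "cube N = {k. \<forall>i. \<bar>k $ i\<bar> \<le> int N}"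

lemma finite_cube: "finite (cube N :: (int ^ 'n) set)"
proof -
  have "cube N \<subseteq> (\<lambda>f. \<chi> i. f i) ` (PiE UNIV (\<lambda>_::'n. {- int N .. int N}))"
  proof
    fix k :: "int ^ 'n" assume "k \<in> cube N"
    hence "(\<lambda>i. k $ i) \<in> PiE UNIV (\<lambda>_. {- int N .. int N})"
      by (auto simp: cube_def abs_le_iff) (metis minus_le_iff)
    moreover have "k = (\<chi> i. k $ i)" by simp
    ultimately show "k \<in> (\<lambda>f. \<chi> i. f i) ` (PiE UNIV (\<lambda>_::'n. {- int N .. int N}))" by blast
  qed
  thus ?thesis by (rule finite_subset) (auto intro!: finite_PiE)
qed

lemma lattice_point_nth [simp]: "lattice_point k $ i = of_int (k $ i)"
  by (simp add: lattice_point_def)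

lemma lattice_point_add: "lattice_point (k + l) = lattice_point k + lattice_point l"
  by (simp add: vec_eq_iff)

lemma lattice_point_diff: "lattice_point (k - l) = lattice_point k - lattice_point l"
  by (simp add: vec_eq_iff)

lemma lattice_point_0 [simp]: "lattice_point 0 = 0"
  by (simp add: vec_eq_iff)

lemma norm_lattice_cube: "norm (lattice_point k) \<le> real N \<Longrightarrow> k \<in> cube N"
proof -
  assume a: "norm (lattice_point k) \<le> real N"
  have "\<bar>k $ i\<bar> \<le> int N" for i
  proof -
    have "\<bar>real_of_int (k $ i)\<bar> \<le> real N"
      using component_le_norm_cart[of "lattice_point k" i] a by simp
    thus ?thesis by linarith
  qed
  thus "k \<in> cube N" by (simp add: cube_def)
qed

lemma integrable_dilate_reflect:
  fixes f :: "'a::euclidean_space \<Rightarrow> 'b::{banach, second_countable_topology}"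
  assumes "0 < l" "integrable lborel f"
  shows "integrable lborel (\<lambda>x. f (l *\<^sub>R (y - x)))"
  using integrable_affine_euclidean[OF _ assms(2), of "-l" "l *\<^sub>R y"] assms(1) by (simp add: scaleR_diff_right)

lemma finite_lattice_ball: "finite {k. norm (lattice_point k - x) \<le> r}"
proof -
  obtain N where N: "norm x + r \<le> real N" using real_arch_simple by blast
  have "{k. norm (lattice_point k - x) \<le> r} \<subseteq> cube N"
  proof
    fix k assume "k \<in> {k. norm (lattice_point k - x) \<le> r}"
    hence "norm (lattice_point k) \<le> real N"
      using N norm_triangle_ineq2[of "lattice_point k" x] by simp
    thus "k \<in> cube N" by (rule norm_lattice_cube)
  qed
  thus ?thesis using finite_cube finite_subset by blast
qed

text \<open>The partition of unity is stated for finite index sets that contain all lattice points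
  near \<open>\<eta>\<close>, so no infinite sums occur. \<open>\<sigma> 0\<close> is the integral
  of \<open>\<kappa>\<close> and must not vanish if \<open>\<kappa>\<close> is to serve as an
  approximate identity.\<close>

locale lattice_kernel = kernel \<sigma> d for \<sigma> :: "real ^ 'n \<Rightarrow> real" and d +
  assumes partition_unity: "finite F \<Longrightarrow> (\<And>k. norm (\<eta> - lattice_point k) \<le> d \<Longrightarrow> k \<in> F) \<Longrightarrow> (\<Sum>k\<in>F. \<sigma> (\<eta> - lattice_point k)) = 1"
    and \<sigma>_0: "\<sigma> 0 \<noteq> 0"
begin

lemma dilate_integrable:
  assumes "0 < l" shows "integrable lborel (\<lambda>t. \<kappa> (l *\<^sub>R t))"
  using integrable_affine_euclidean[OF _ \<kappa>_integrable, of l 0] assms by simp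

text \<open>The transform of the dilated kernel is a dilated cutoff up to a factor, so filtering it
  multiplies two cutoffs.\<close>

lemma filt_dilate:
  fixes l :: real
  assumes l: "0 < l"
  shows "filt a (\<lambda>t. \<kappa> (l *\<^sub>R t)) s = of_real (1 / (2 * pi) ^ CARD('n) / l ^ CARD('n)) *
     (\<integral>\<eta>. of_real (\<sigma> (\<eta> - a) * \<sigma> ((1 / l) *\<^sub>R \<eta>)) * exp (\<i> * of_real (s \<bullet> \<eta>)) \<partial>lborel)"
proof -
  let ?c = "1 / (2 * pi) ^ CARD('n)"
  have V: "(\<integral>z. \<kappa> (l *\<^sub>R z) * exp (- (\<i> * of_real (z \<bullet> (\<eta> + a)))) \<partial>lborel) = of_real (1 / l ^ CARD('n)) * of_real (\<sigma> ((1 / l) *\<^sub>R (\<eta> + a)))" for \<eta>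
  proof -
    let ?k = "\<lambda>w. \<kappa> w * exp (- (\<i> * of_real (w \<bullet> ((1 / l) *\<^sub>R (\<eta> + a)))))"
    have "of_real (\<sigma> ((1 / l) *\<^sub>R (\<eta> + a))) = (\<integral>w. ?k w \<partial>lborel)" by (rule \<kappa>_inversion[symmetric])
    also have "\<dots> = \<bar>l\<bar> ^ DIM(real^'n) *\<^sub>R (\<integral>z. ?k (0 + l *\<^sub>R z) \<partial>lborel)"
      by (rule integral_affine_euclidean) (use l in auto)
    also have "(\<lambda>z. ?k (0 + l *\<^sub>R z)) = (\<lambda>z. \<kappa> (l *\<^sub>R z) * exp (- (\<i> * of_real (z \<bullet> (\<eta> + a)))))"
      using l by (simp add: fun_eq_iff)
    finally show ?thesis using l by (simp add: scaleR_conv_of_real)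
  qed
  let ?f = "\<lambda>\<eta>. of_real (\<sigma> \<eta>) * (of_real ?c * ((of_real (1 / l ^ CARD('n)) * of_real (\<sigma> ((1 / l) *\<^sub>R (\<eta> + a)))) * exp (\<i> * of_real (s \<bullet> (\<eta> + a)))))"
  have [measurable]: "(\<lambda>x. complex_of_real (\<sigma> x)) \<in> borel_measurable borel" by (rule \<sigma>_measC)
  have "(\<lambda>x. complex_of_real (\<sigma> ((1 / l) *\<^sub>R (x + a)))) \<in> borel_measurable borel"
    by (rule measurable_compose[OF _ \<sigma>_measC]) measurable
  hence fm: "?f \<in> borel_measurable borel" by measurable
  have "filt a (\<lambda>t. \<kappa> (l *\<^sub>R t)) s = (\<integral>\<eta>. ?f \<eta> \<partial>lborel)"
    using filt_fourier[OF dilate_integrable[OF l], of a s] unfolding V by simp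
  also have "\<dots> = (\<integral>\<eta>. ?f (- a + \<eta>) \<partial>lborel)"
    by (rule integral_translate[OF fm, symmetric])
  also have "\<dots> = (\<integral>\<eta>. of_real (?c / l ^ CARD('n)) * (of_real (\<sigma> (\<eta> - a) * \<sigma> ((1 / l) *\<^sub>R \<eta>)) * exp (\<i> * of_real (s \<bullet> \<eta>))) \<partial>lborel)"
    by (intro Bochner_Integration.integral_cong refl) simp
  also have "\<dots> = of_real (?c / l ^ CARD('n)) * (\<integral>\<eta>. of_real (\<sigma> (\<eta> - a) * \<sigma> ((1 / l) *\<^sub>R \<eta>)) * exp (\<i> * of_real (s \<bullet> \<eta>)) \<partial>lborel)"
    by (rule integral_mult_right_zero)
  finally show ?thesis .
qed

text \<open>The dilated kernel has only frequencies of length at most \<open>l * d\<close>; on these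
  a finite part of the partition of unity already sums to 1.\<close>

lemma sum_filt_dilate:
  fixes l :: real
  assumes l: "0 < l" and F: "finite F" "\<And>k. norm (lattice_point k) \<le> l * d + d \<Longrightarrow> k \<in> F"
  shows "(\<Sum>k\<in>F. filt (lattice_point k) (\<lambda>t. \<kappa> (l *\<^sub>R t)) s) = \<kappa> (l *\<^sub>R s)"
proof -
  let ?c = "1 / (2 * pi) ^ CARD('n)"
  let ?G = "\<lambda>\<eta>. complex_of_real (\<sigma> ((1 / l) *\<^sub>R \<eta>)) * exp (\<i> * of_real (s \<bullet> \<eta>))"
  let ?t = "\<lambda>k \<eta>. of_real (\<sigma> (\<eta> - lattice_point k) * \<sigma> ((1 / l) *\<^sub>R \<eta>)) * exp (\<i> * of_real (s \<bullet> \<eta>))"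
  have sm: "(\<lambda>\<eta>. complex_of_real (\<sigma> ((1 / l) *\<^sub>R \<eta>))) \<in> borel_measurable borel"
    by (rule measurable_compose[OF _ \<sigma>_measC]) measurable
  have sm2: "(\<lambda>\<eta>. complex_of_real (\<sigma> (\<eta> - a))) \<in> borel_measurable borel" for a
    by (rule measurable_compose[OF _ \<sigma>_measC]) measurable
  have Gi: "integrable lborel (\<lambda>\<eta>. complex_of_real (\<sigma> ((1 / l) *\<^sub>R \<eta>)))"
    using integrable_affine_euclidean[OF _ \<sigma>_integrable, of "1/l" 0] l by simp
  have ti: "integrable lborel (?t k)" for k
  proof (rule Bochner_Integration.integrable_bound[OF Gi])
    show "?t k \<in> borel_measurable lborel" using sm sm2[of "lattice_point k"] unfolding of_real_mult by measurable
    show "AE \<eta> in lborel. norm (?t k \<eta>) \<le> norm (complex_of_real (\<sigma> ((1 / l) *\<^sub>R \<eta>)))"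
      using \<sigma>01 by (intro AE_I2) (simp add: norm_mult mult_left_le_one_le)
  qed
  have "(\<Sum>k\<in>F. filt (lattice_point k) (\<lambda>t. \<kappa> (l *\<^sub>R t)) s) = of_real (?c / l ^ CARD('n)) * (\<Sum>k\<in>F. \<integral>\<eta>. ?t k \<eta> \<partial>lborel)"
    unfolding filt_dilate[OF l] by (rule sum_distrib_left[symmetric])
  also have "(\<Sum>k\<in>F. \<integral>\<eta>. ?t k \<eta> \<partial>lborel) = (\<integral>\<eta>. (\<Sum>k\<in>F. ?t k \<eta>) \<partial>lborel)"
    by (rule Bochner_Integration.integral_sum[symmetric]) (rule ti)
  also have "\<dots> = (\<integral>\<eta>. ?G \<eta> \<partial>lborel)"
  proof (intro Bochner_Integration.integral_cong refl)
    fix \<eta>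
    have "(\<Sum>k\<in>F. ?t k \<eta>) = of_real (\<Sum>k\<in>F. \<sigma> (\<eta> - lattice_point k)) * ?G \<eta>"
      unfolding of_real_sum sum_distrib_right by (intro sum.cong refl) simp
    also have "\<dots> = ?G \<eta>"
    proof (cases "norm ((1 / l) *\<^sub>R \<eta>) > d")
      case True
      thus ?thesis using \<sigma>_supp by simp
    next
      case False
      hence n: "norm \<eta> \<le> l * d" using l by (simp add: field_simps)
      have "(\<Sum>k\<in>F. \<sigma> (\<eta> - lattice_point k)) = 1"
      proof (rule partition_unity[OF F(1)], rule F(2))
        fix k assume "norm (\<eta> - lattice_point k) \<le> d"
        thus "norm (lattice_point k) \<le> l * d + d"
          using n norm_triangle_ineq4[of \<eta> "\<eta> - lattice_point k"] by simp
      qed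
      thus ?thesis by simp
    qed
    finally show "(\<Sum>k\<in>F. ?t k \<eta>) = ?G \<eta>" .
  qed
  also have "\<dots> = \<bar>l\<bar> ^ DIM(real^'n) *\<^sub>R (\<integral>\<eta>. ?G (0 + l *\<^sub>R \<eta>) \<partial>lborel)"
    by (rule integral_affine_euclidean) (use l sm in auto)
  also have "(\<lambda>\<eta>. ?G (0 + l *\<^sub>R \<eta>)) = (\<lambda>\<eta>. of_real (\<sigma> \<eta>) * exp (\<i> * of_real ((l *\<^sub>R s) \<bullet> \<eta>)))"
    using l by (simp add: fun_eq_iff)
  finally show ?thesis using l by (simp add: \<kappa>_def oscint_def scaleR_conv_of_real)
qed

lemma filt_pairing:
  assumes A: "integrable lborel A" and g: "l1inf g"
  shows "(\<integral>x. A x * filt a g x \<partial>lborel) = (\<integral>z. g z * (\<integral>x. A x * (\<kappa> (x - z) * exp (\<i> * of_real (a \<bullet> (x - z)))) \<partial>lborel) \<partial>lborel)"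
  unfolding filt_def
proof (rule fubini_conv[where k = "\<lambda>t. \<kappa> t * exp (\<i> * of_real (a \<bullet> t))", OF A _ _ g])
  show "integrable lborel (\<lambda>t. \<kappa> t * exp (\<i> * of_real (a \<bullet> t)))"
    by (rule Bochner_Integration.integrable_bound[OF \<kappa>_integrable]) (auto simp: norm_mult)
  show "norm (\<kappa> t * exp (\<i> * of_real (a \<bullet> t))) \<le> \<kappa>sup" for t
    using \<kappa>_le_sup by (simp add: norm_mult)
qed

text \<open>Fubini moves the filters from \<open>g\<close> to the test kernel, where finitely many
  of them reproduce exactly. Convergence of the pieces of \<open>g\<close> is not involved.\<close>

lemma filt_sum_pairing:
  fixes l :: real
  assumes l: "0 < l" and g: "l1inf g" and F: "finite F" "\<And>k. norm (lattice_point k) \<le> l * d + d \<Longrightarrow> k \<in> F"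
  shows "(\<integral>x. (\<Sum>k\<in>F. filt (lattice_point k) g x) * \<kappa> (l *\<^sub>R (y - x)) \<partial>lborel) = (\<integral>x. g x * \<kappa> (l *\<^sub>R (y - x)) \<partial>lborel)"
proof -
  let ?A = "\<lambda>x. \<kappa> (l *\<^sub>R (y - x))"
  have A: "integrable lborel ?A"
    by (rule integrable_dilate_reflect[OF l \<kappa>_integrable])
  have Am [measurable]: "?A \<in> borel_measurable borel" using A by auto
  have fi: "integrable lborel (\<lambda>x. ?A x * filt a g x)" for a
  proof -
    obtain B where B: "\<And>x. norm (filt a g x) \<le> B" using filt_l1inf(2)[OF g] by blast
    have [measurable]: "filt a g \<in> borel_measurable borel" using filt_meas l1inf_meas[OF g] by blast
    show ?thesis
    proof (rule Bochner_Integration.integrable_bound)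
      show "integrable lborel (\<lambda>x. of_real B * ?A x)" by (intro integrable_mult_right A)
      show "AE x in lborel. norm (?A x * filt a g x) \<le> norm (of_real B * ?A x)"
        using mult_left_mono[OF order_trans[OF B abs_ge_self] norm_ge_zero[of "?A _"]]
        by (intro AE_I2) (simp only: norm_mult norm_of_real mult.commute[of "\<bar>B\<bar>"])
    qed measurable
  qed
  have inner: "(\<integral>x. ?A x * (\<kappa> (x - z) * exp (\<i> * of_real (a \<bullet> (x - z)))) \<partial>lborel) = filt a (\<lambda>t. \<kappa> (l *\<^sub>R t)) (y - z)" for a z
  proof -
    let ?h = "\<lambda>x. ?A x * (\<kappa> (x - z) * exp (\<i> * of_real (a \<bullet> (x - z))))"
    have "(\<integral>x. ?h (y - x) \<partial>lborel) = (\<integral>x. ?h x \<partial>lborel)" by (rule integral_reflect) measurable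
    moreover have "?h (y - x) = \<kappa> ((y - z) - x) * exp (\<i> * of_real (a \<bullet> ((y - z) - x))) * \<kappa> (l *\<^sub>R x)" for x
      by (simp add: algebra_simps)
    ultimately show ?thesis unfolding filt_def by (simp only:)
  qed
  have gi: "integrable lborel (\<lambda>z. g z * filt a (\<lambda>t. \<kappa> (l *\<^sub>R t)) (y - z))" for a
  proof -
    let ?v = "filt a (\<lambda>t. \<kappa> (l *\<^sub>R t))"
    have vl: "l1inf (\<lambda>t. \<kappa> (l *\<^sub>R t))"
      by (rule l1inf_bounded[where C = \<kappa>sup]) (auto intro: \<kappa>_le_sup)
    have lp1: "lp_le 1 (\<lambda>t. \<kappa> (l *\<^sub>R t)) (\<integral>t. norm (\<kappa> (l *\<^sub>R t)) \<partial>lborel)"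
      unfolding lp_le_def using nn_integral_eq_integral[OF integrable_norm[OF dilate_integrable[OF l]]] by simp
    have lpv: "lp_le 1 ?v (\<kappa>1 * (\<integral>t. norm (\<kappa> (l *\<^sub>R t)) \<partial>lborel))"
      by (rule filt_lp[OF _ lp1]) simp
    have vm [measurable]: "?v \<in> borel_measurable borel" using lpv lp_le_meas by blast
    have vi: "integrable lborel ?v"
      using lpv by (auto simp: integrable_iff_bounded lp_le_def less_top[symmetric] top_unique elim: order_le_less_trans)
    obtain B where B: "\<And>x. norm (?v x) \<le> B" using filt_l1inf(2)[OF vl] by blast
    from g obtain C h where 1: "0 \<le> C" "integrable lborel h" "\<And>x. 0 \<le> h x" "\<And>x. norm (g x) \<le> C + h x" by (rule l1infE) blast
    have [measurable]: "g \<in> borel_measurable borel" using l1inf_meas[OF g] .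
    show ?thesis
    proof (rule Bochner_Integration.integrable_bound)
      show "integrable lborel (\<lambda>z. C * norm (?v (y - z)) + B * h z)"
        using 1 integrable_reflect[OF vi, of y] by (intro Bochner_Integration.integrable_add integrable_mult_right integrable_norm) auto
      show "AE z in lborel. norm (g z * ?v (y - z)) \<le> norm (C * norm (?v (y - z)) + B * h z)"
      proof (rule AE_I2)
        fix z
        have "norm (g z) * norm (?v (y - z)) \<le> (C + h z) * norm (?v (y - z))" by (intro mult_right_mono 1) auto
        also have "\<dots> \<le> C * norm (?v (y - z)) + B * h z"
          using mult_right_mono[OF B 1(3)[of z], of "y - z"] by (simp add: algebra_simps)
        also have "\<dots> \<le> \<bar>\<dots>\<bar>" by simp
        finally show "norm (g z * ?v (y - z)) \<le> norm (C * norm (?v (y - z)) + B * h z)" by (simp add: norm_mult)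
      qed
    qed measurable
  qed
  have "(\<integral>x. (\<Sum>k\<in>F. filt (lattice_point k) g x) * ?A x \<partial>lborel) = (\<integral>x. (\<Sum>k\<in>F. ?A x * filt (lattice_point k) g x) \<partial>lborel)"
    by (simp add: sum_distrib_right sum_distrib_left mult.commute)
  also have "\<dots> = (\<Sum>k\<in>F. \<integral>x. ?A x * filt (lattice_point k) g x \<partial>lborel)"
    by (rule Bochner_Integration.integral_sum) (rule fi)
  also have "\<dots> = (\<Sum>k\<in>F. \<integral>z. g z * filt (lattice_point k) (\<lambda>t. \<kappa> (l *\<^sub>R t)) (y - z) \<partial>lborel)"
    unfolding filt_pairing[OF A g] inner ..
  also have "\<dots> = (\<integral>z. (\<Sum>k\<in>F. g z * filt (lattice_point k) (\<lambda>t. \<kappa> (l *\<^sub>R t)) (y - z)) \<partial>lborel)"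
    by (rule Bochner_Integration.integral_sum[symmetric]) (rule gi)
  also have "\<dots> = (\<integral>z. g z * \<kappa> (l *\<^sub>R (y - z)) \<partial>lborel)"
  proof -
    have "(\<Sum>k\<in>F. filt (lattice_point k) (\<lambda>t. \<kappa> (l *\<^sub>R t)) (y - z)) = \<kappa> (l *\<^sub>R (y - z))" for z
      by (rule sum_filt_dilate[OF l F(1)]) (rule F(2))
    thus ?thesis unfolding sum_distrib_left[symmetric] by (simp only:)
  qed
  finally show ?thesis .
qed

text \<open>Against a dilated kernel the partial sums eventually have the same integral as
  \<open>g\<close>, hence so does their limit, and \<open>approximate_identity_unique\<close>
  applies. Convergence is assumed because its reason differs between the two uses: only finitely
  many nonzero terms in Bernstein's inequality, a summable majorant for the decomposition of
  \<open>u\<close>.\<close>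

theorem lattice_reproducing:
  assumes g: "l1inf g"
    and hm [measurable]: "h \<in> borel_measurable borel" and hb: "\<And>x. norm (h x) \<le> B"
    and lim: "AE x in lborel. (\<lambda>N. \<Sum>k\<in>cube N. filt (lattice_point k) g x) \<longlonglongrightarrow> h x"
    and bd: "\<And>N. AE x in lborel. norm (\<Sum>k\<in>cube N. filt (lattice_point k) g x) \<le> B"
  shows "AE x in lborel. g x = h x"
proof -
  have [measurable]: "g \<in> borel_measurable borel" using l1inf_meas[OF g] .
  have [measurable]: "filt a g \<in> borel_measurable borel" for a by measurable
  have Sm [measurable]: "(\<lambda>x. \<Sum>k\<in>cube N. filt (lattice_point k) g x) \<in> borel_measurable borel" for N by measurable
  have hl: "l1inf h" by (rule l1inf_bounded[OF hm hb])
  have "AE x in lborel. g x - h x = 0"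
  proof (rule approximate_identity_unique[where \<Theta> = \<kappa>])
    show "l1inf (\<lambda>x. g x - h x)" by (rule l1inf_diff[OF g hl])
    show "integrable lborel \<kappa>" by (rule \<kappa>_integrable)
    show "(\<integral>x. \<kappa> x \<partial>lborel) \<noteq> 0" using \<kappa>_inversion[of 0] \<sigma>_0 by simp
    fix n :: nat and y :: "real ^ 'n"
    let ?l = "real (Suc n)" let ?A = "\<lambda>x. \<kappa> (?l *\<^sub>R (y - x))"
    have A: "integrable lborel ?A"
      by (rule integrable_dilate_reflect[OF _ \<kappa>_integrable]) simp
    have Am [measurable]: "?A \<in> borel_measurable borel" using A by auto
    obtain N0 where N0: "?l * d + d \<le> real N0" using real_arch_simple by blast
    have "(\<lambda>N. \<integral>x. (\<Sum>k\<in>cube N. filt (lattice_point k) g x) * ?A x \<partial>lborel) \<longlonglongrightarrow> (\<integral>x. h x * ?A x \<partial>lborel)"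
    proof (rule integral_dominated_convergence[where w = "\<lambda>x. B * norm (?A x)"])
      show "integrable lborel (\<lambda>x. B * norm (?A x))" by (intro integrable_mult_right integrable_norm A)
      show "AE x in lborel. (\<lambda>N. (\<Sum>k\<in>cube N. filt (lattice_point k) g x) * ?A x) \<longlonglongrightarrow> h x * ?A x"
        using lim by (rule AE_mp) (intro AE_I2 impI tendsto_mult tendsto_const)
      show "AE x in lborel. norm ((\<Sum>k\<in>cube N. filt (lattice_point k) g x) * ?A x) \<le> B * norm (?A x)" for N
        using bd by (rule AE_mp) (unfold norm_mult, intro AE_I2 impI mult_right_mono norm_ge_zero)
    qed measurable
    moreover have "\<forall>\<^sub>F N in sequentially. (\<integral>x. (\<Sum>k\<in>cube N. filt (lattice_point k) g x) * ?A x \<partial>lborel) = (\<integral>x. g x * ?A x \<partial>lborel)"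
      unfolding eventually_sequentially
    proof (intro exI[of _ N0] allI impI)
      fix N assume "N0 \<le> N"
      thus "(\<integral>x. (\<Sum>k\<in>cube N. filt (lattice_point k) g x) * ?A x \<partial>lborel) = (\<integral>x. g x * ?A x \<partial>lborel)"
        using N0 by (intro filt_sum_pairing g finite_cube norm_lattice_cube) auto
    qed
    ultimately have "(\<lambda>N. \<integral>x. g x * ?A x \<partial>lborel) \<longlonglongrightarrow> (\<integral>x. h x * ?A x \<partial>lborel)"
      by (rule Lim_transform_eventually)
    hence eq: "(\<integral>x. g x * ?A x \<partial>lborel) = (\<integral>x. h x * ?A x \<partial>lborel)" by (simp add: LIMSEQ_const_iff)
    have mi: "integrable lborel (\<lambda>x. f x * ?A x)" if "l1inf f" for f
      using that A \<kappa>_le_sup by (rule l1inf_mult_integrable)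
    show "(\<integral>x. (g x - h x) * ?A x \<partial>lborel) = 0"
      unfolding left_diff_distrib Bochner_Integration.integral_diff[OF mi[OF g] mi[OF hl]] eq by simp
  qed
  thus ?thesis by (rule AE_mp) (auto intro!: AE_I2)
qed

definition nb :: nat where "nb = card {l::int^'n. norm (lattice_point l :: real ^ 'n) \<le> 2 * d}"

text \<open>Filter the piece once more: only the \<open>nb\<close> filters centred within
  \<open>2 * d\<close> of it respond, each response is bounded by \<open>filt_sup_lp\<close>, and
  the responses add up to the piece almost everywhere. Translation invariance of the lattice makes
  \<open>nb\<close> independent of \<open>k\<close>.\<close>

lemma filt_bernstein:
  assumes p: "1 \<le> p" and v: "l1inf v" and A: "lp_le p (filt (lattice_point k) v) A"
  shows "AE x in lborel. norm (filt (lattice_point k) v x) \<le> real nb * ((\<kappa>1 + \<kappa>sup) * A)"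
proof -
  define g where "g = filt (lattice_point k) v"
  define Nk where "Nk = {l. norm (lattice_point l - lattice_point k :: real^'n) \<le> 2 * d}"
  have fin: "finite Nk" unfolding Nk_def by (rule finite_lattice_ball)
  have "card Nk = nb"
  proof -
    have "bij_betw (\<lambda>l. l + k) {l. norm (lattice_point l :: real^'n) \<le> 2 * d} Nk"
      by (rule bij_betwI[where g = "\<lambda>l. l - k"]) (auto simp: Nk_def lattice_point_add lattice_point_diff)
    thus ?thesis unfolding nb_def by (rule bij_betw_same_card[symmetric])
  qed
  have z: "filt (lattice_point l) g x = 0" if "l \<notin> Nk" for l x
    using spec_filt[OF v, of "lattice_point k"] that
    unfolding spec_def g_def Nk_def by (simp add: dist_norm norm_minus_commute)
  have g: "l1inf g" unfolding g_def by (rule filt_l1inf[OF v])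
  have b: "norm (filt (lattice_point l) g x) \<le> (\<kappa>1 + \<kappa>sup) * A" for l x
    using filt_sup_lp[OF p A] by (simp add: g_def)
  have b0: "0 \<le> (\<kappa>1 + \<kappa>sup) * A" using b norm_ge_zero order_trans by blast
  define h where "h = (\<lambda>x. \<Sum>l\<in>Nk. filt (lattice_point l) g x)"
  have hb: "norm (\<Sum>l\<in>F. filt (lattice_point l) g x) \<le> real nb * ((\<kappa>1 + \<kappa>sup) * A)" if "finite F" for F x
  proof -
    have "(\<Sum>l\<in>F. filt (lattice_point l) g x) = (\<Sum>l\<in>F \<inter> Nk. filt (lattice_point l) g x)"
      using that z by (intro sum.mono_neutral_right) auto
    also have "norm \<dots> \<le> (\<Sum>l\<in>F \<inter> Nk. (\<kappa>1 + \<kappa>sup) * A)" by (intro sum_norm_le b)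
    also have "\<dots> = real (card (F \<inter> Nk)) * ((\<kappa>1 + \<kappa>sup) * A)" by simp
    also have "\<dots> \<le> real nb * ((\<kappa>1 + \<kappa>sup) * A)"
      unfolding \<open>card Nk = nb\<close>[symmetric] using fin b0 by (intro mult_right_mono) (auto intro: card_mono)
    finally show ?thesis .
  qed
  have "AE x in lborel. g x = h x"
  proof (rule lattice_reproducing[OF g])
    have gm [measurable]: "g \<in> borel_measurable borel" by (rule l1inf_meas[OF g])
    show "h \<in> borel_measurable borel" unfolding h_def by measurable
    show "norm (h x) \<le> real nb * ((\<kappa>1 + \<kappa>sup) * A)" for x
      unfolding h_def by (rule hb[OF fin])
    show "AE x in lborel. norm (\<Sum>k\<in>cube N. filt (lattice_point k) g x) \<le> real nb * ((\<kappa>1 + \<kappa>sup) * A)" for N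
      by (rule AE_I2) (rule hb[OF finite_cube])
    show "AE x in lborel. (\<lambda>N. \<Sum>k\<in>cube N. filt (lattice_point k) g x) \<longlonglongrightarrow> h x"
    proof (rule AE_I2)
      fix x
      obtain N0 where N0: "norm (lattice_point k :: real^'n) + 2 * d \<le> real N0" using real_arch_simple by blast
      have sub: "Nk \<subseteq> cube N" if "N0 \<le> N" for N
      proof
        fix l assume "l \<in> Nk"
        hence "norm (lattice_point l :: real^'n) \<le> real N"
          using N0 that norm_triangle_ineq2[of "lattice_point l :: real^'n" "lattice_point k"] by (simp add: Nk_def)
        thus "l \<in> cube N" by (rule norm_lattice_cube)
      qed
      have "\<forall>\<^sub>F N in sequentially. (\<Sum>k\<in>cube N. filt (lattice_point k) g x) = h x"
        unfolding eventually_sequentially h_def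
        by (intro exI[of _ N0] allI impI sum.mono_neutral_right finite_cube sub) (use z in auto)
      thus "(\<lambda>N. \<Sum>k\<in>cube N. filt (lattice_point k) g x) \<longlonglongrightarrow> h x" by (rule tendsto_eventually)
    qed
  qed
  thus ?thesis unfolding g_def[symmetric]
    by (rule AE_mp) (use hb[OF fin] in \<open>auto intro!: AE_I2 simp: h_def\<close>)
qed

end

section \<open>The box operators\<close>

lemma window_range: "window \<rho> \<Longrightarrow> 0 \<le> \<rho> x" "window \<rho> \<Longrightarrow> \<rho> x \<le> 1"
  by (auto simp: window_def)

lemma window_supp: 
  assumes "window \<rho>" "\<rho> x \<noteq> 0" shows "\<bar>x $ i\<bar> \<le> 1"
proof -
  have "x \<in> closure {\<xi>. \<rho> \<xi> \<noteq> 0}" using assms(2) closure_subset[of "{\<xi>. \<rho> \<xi> \<noteq> 0}"] by auto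
  hence "-1 \<le> x $ i \<and> x $ i \<le> 1" using assms(1) unfolding window_def by blast
  thus ?thesis by (simp add: abs_le_iff)
qed

lemma window_one:
  assumes "window \<rho>" "\<And>i. \<bar>x $ i\<bar> \<le> 1/2" shows "\<rho> x = 1"
proof -
  have "-1/2 \<le> x $ i \<and> x $ i \<le> 1/2" for i using assms(2)[of i] by linarith
  thus ?thesis using assms(1) unfolding window_def by blast
qed

lemma window_supp_norm:
  fixes \<rho> :: "real ^ 'n \<Rightarrow> real"
  assumes "window \<rho>" "norm x > real CARD('n)" shows "\<rho> x = 0"
proof (rule ccontr)
  assume "\<rho> x \<noteq> 0"
  have "norm x \<le> (\<Sum>i\<in>UNIV. \<bar>x $ i\<bar>)" by (rule norm_le_l1_cart)
  also have "\<dots> \<le> (\<Sum>i\<in>(UNIV::'n set). 1)" by (intro sum_mono window_supp[OF assms(1) \<open>\<rho> x \<noteq> 0\<close>])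
  finally show False using assms(2) by simp
qed

lemma window_sum_finite:
  fixes \<rho> :: "real ^ 'n \<Rightarrow> real"
  assumes "finite F" "\<And>m. \<rho> (\<xi> - lattice_point m) \<noteq> 0 \<Longrightarrow> m \<in> F"
  shows "(\<Sum>\<^sub>\<infinity>m\<in>UNIV. \<rho> (\<xi> - lattice_point m)) = (\<Sum>m\<in>F. \<rho> (\<xi> - lattice_point m))"
proof -
  have "(\<Sum>\<^sub>\<infinity>m\<in>UNIV. \<rho> (\<xi> - lattice_point m)) = (\<Sum>\<^sub>\<infinity>m\<in>F. \<rho> (\<xi> - lattice_point m))"
    by (rule infsum_cong_neutral) (use assms in auto)
  thus ?thesis using assms(1) by simp
qed

lemma window_near:
  fixes \<xi> :: "real ^ 'n"
  shows "\<exists>m. \<forall>i. \<bar>(\<xi> - lattice_point m) $ i\<bar> \<le> 1/2"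
proof (intro exI[of _ "\<chi> i. \<lfloor>\<xi> $ i + 1/2\<rfloor>"] allI)
  fix i
  show "\<bar>(\<xi> - lattice_point (\<chi> i. \<lfloor>\<xi> $ i + 1/2\<rfloor>)) $ i\<bar> \<le> 1/2"
    unfolding vector_minus_component lattice_point_nth vec_lambda_beta
    using floor_correct[of "\<xi> $ i + 1/2"] by linarith
qed

lemma window_sum_ge_1:
  fixes \<rho> :: "real ^ 'n \<Rightarrow> real"
  assumes w: "window \<rho>" shows "1 \<le> (\<Sum>\<^sub>\<infinity>m\<in>UNIV. \<rho> (\<xi> - lattice_point m))"
proof -
  define F where "F = {m. norm (lattice_point m - \<xi>) \<le> real CARD('n)}"
  have F: "finite F" unfolding F_def by (rule finite_lattice_ball)
  have Fs: "m \<in> F" if "\<rho> (\<xi> - lattice_point m) \<noteq> 0" for m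
    using window_supp_norm[OF w, of "\<xi> - lattice_point m"] that
    by (force simp: F_def norm_minus_commute not_less)
  obtain m where m: "\<And>i. \<bar>(\<xi> - lattice_point m) $ i\<bar> \<le> 1/2" using window_near by blast
  have "\<rho> (\<xi> - lattice_point m) = 1" by (rule window_one[OF w m])
  moreover from this have "m \<in> F" by (intro Fs) simp
  ultimately have "1 \<le> (\<Sum>m\<in>F. \<rho> (\<xi> - lattice_point m))"
    using member_le_sum[of m F "\<lambda>m. \<rho> (\<xi> - lattice_point m)"] F window_range[OF w] by auto
  thus ?thesis by (subst window_sum_finite[OF F Fs]) auto
qed

lemma sigma_shift: "sigma \<rho> k \<xi> = sigma \<rho> 0 (\<xi> - lattice_point k)"
proof -
  have "(\<Sum>\<^sub>\<infinity>m\<in>UNIV. \<rho> (\<xi> - lattice_point k - lattice_point m)) = (\<Sum>\<^sub>\<infinity>m\<in>UNIV. \<rho> (\<xi> - lattice_point m))"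
    by (rule infsum_reindex_bij_witness[where i = "\<lambda>m. m - k" and j = "\<lambda>m. m + k"])
      (auto simp: lattice_point_add diff_diff_eq add.commute)
  thus ?thesis by (simp add: sigma_def)
qed

text \<open>The lattice sum in the denominator is replaced by a finite expression \<open>t\<close>
  that agrees with it wherever \<open>\<rho>\<close> does not vanish and is nonzero everywhere, so
  that its reciprocal is smooth.\<close>

lemma sigma_smooth:
  fixes \<rho> :: "real ^ 'n \<Rightarrow> real"
  assumes w: "window \<rho>" and b: "b \<in> Basis"
  shows "smooth_along b m (\<lambda>x. complex_of_real (sigma \<rho> 0 x))"
proof -
  \<comment> \<open>The last summand vanishes where all coordinates are at most 1 in modulus, hence
    on the support of \<open>\<rho>\<close>. It can be zero only if all coordinates are at most 2 in
    modulus, and then a lattice point within 1/2 in every coordinate belongs to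
    \<open>cube 3\<close> and contributes 1.\<close>
  define t where "t = (\<lambda>x. (\<Sum>m\<in>cube 3. \<rho> (x - lattice_point m)) + (1 - \<rho> ((1/2) *\<^sub>R x)))"
  have sr: "smooth_along b m (\<lambda>x. complex_of_real (\<rho> x))" for m
    using w b by (intro smooth_along_C_infinity) (auto simp: window_def)
  have t_pos: "t x \<noteq> 0" for x
  proof
    assume t0: "t x = 0"
    have s0: "0 \<le> (\<Sum>m\<in>cube 3. \<rho> (x - lattice_point m))" using window_range[OF w] by (intro sum_nonneg) auto
    have r1: "\<rho> ((1/2) *\<^sub>R x) \<le> 1" using window_range[OF w] by auto
    have "\<rho> ((1/2) *\<^sub>R x) = 1" using t0 s0 r1 by (simp add: t_def)
    hence x2: "\<bar>x $ i\<bar> \<le> 2" for i using window_supp[OF w, of "(1/2) *\<^sub>R x" i] by simp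
    obtain m where m: "\<And>i. \<bar>(x - lattice_point m) $ i\<bar> \<le> 1/2" using window_near by blast
    have "m \<in> cube 3" unfolding cube_def
    proof (intro CollectI allI)
      fix i
      have "\<bar>x $ i - real_of_int (m $ i)\<bar> \<le> 1/2" using m[of i] by simp
      hence "\<bar>real_of_int (m $ i)\<bar> \<le> 3" using x2[of i] by linarith
      thus "\<bar>m $ i\<bar> \<le> int 3" by linarith
    qed
    hence "\<rho> (x - lattice_point m) \<le> (\<Sum>m\<in>cube 3. \<rho> (x - lattice_point m))"
      using window_range[OF w] finite_cube by (intro member_le_sum) auto
    moreover have "\<rho> (x - lattice_point m) = 1" by (rule window_one[OF w m])
    ultimately show False using t0 r1 by (simp add: t_def)
  qed
  have eq: "sigma \<rho> 0 x = \<rho> x * inverse (t x)" for x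
  proof (cases "\<rho> x = 0")
    case False
    hence x1: "\<bar>x $ i\<bar> \<le> 1" for i by (rule window_supp[OF w])
    have r1: "\<rho> ((1/2) *\<^sub>R x) = 1"
    proof (rule window_one[OF w])
      show "\<bar>((1/2) *\<^sub>R x) $ i\<bar> \<le> 1/2" for i using x1[of i] by simp
    qed
    have se: "(\<Sum>\<^sub>\<infinity>m\<in>UNIV. \<rho> (x - lattice_point m)) = (\<Sum>m\<in>cube 3. \<rho> (x - lattice_point m))"
    proof (rule window_sum_finite[OF finite_cube])
      fix m assume "\<rho> (x - lattice_point m) \<noteq> 0"
      hence a: "\<bar>(x - lattice_point m) $ i\<bar> \<le> 1" for i by (rule window_supp[OF w])
      show "m \<in> cube 3" unfolding cube_def
      proof (intro CollectI allI)
        fix i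
        have "\<bar>x $ i - real_of_int (m $ i)\<bar> \<le> 1" using a[of i] by simp
        hence "\<bar>real_of_int (m $ i)\<bar> \<le> 3" using x1[of i] by linarith
        thus "\<bar>m $ i\<bar> \<le> int 3" by linarith
      qed
    qed
    show ?thesis unfolding sigma_def se lattice_point_0 t_def r1 by (simp add: divide_inverse)
  qed (simp add: sigma_def)
  have "smooth_along b m (\<lambda>x. complex_of_real (\<rho> x) * inverse ((\<Sum>m\<in>cube 3. complex_of_real (\<rho> (x - lattice_point m))) + (1 + (-1) * complex_of_real (\<rho> ((1/2) *\<^sub>R x)))))"
  proof (intro smooth_along_mult sr smooth_along_inverse smooth_along_add smooth_along_const smooth_along_sum finite_cube)
    show "smooth_along b m (\<lambda>x. complex_of_real (\<rho> (x - lattice_point k)))" for k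
      using smooth_along_affine[OF sr, of m 1 "- lattice_point k"] by simp
    show "smooth_along b m (\<lambda>x. complex_of_real (\<rho> ((1/2) *\<^sub>R x)))"
      using smooth_along_affine[OF sr, of m "1/2" 0] by simp
    fix x
    have "(\<Sum>m\<in>cube 3. complex_of_real (\<rho> (x - lattice_point m))) + (1 + (-1) * complex_of_real (\<rho> ((1/2) *\<^sub>R x))) = of_real (t x)"
      by (simp add: t_def)
    thus "(\<Sum>m\<in>cube 3. complex_of_real (\<rho> (x - lattice_point m))) + (1 + (-1) * complex_of_real (\<rho> ((1/2) *\<^sub>R x))) \<noteq> 0"
      using t_pos[of x] by simp
  qed
  also have "(\<lambda>x. complex_of_real (\<rho> x) * inverse ((\<Sum>m\<in>cube 3. complex_of_real (\<rho> (x - lattice_point m))) + (1 + (-1) * complex_of_real (\<rho> ((1/2) *\<^sub>R x)))))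
     = (\<lambda>x. complex_of_real (sigma \<rho> 0 x))"
    by (simp add: eq t_def fun_eq_iff)
  finally show ?thesis .
qed

text \<open>The window lives on the cube [-1, 1]^n, whose points have norm at most the sum of the
  moduli of their coordinates; hence the support radius \<open>CARD('n)\<close>.\<close>

lemma window_lattice_kernel:
  fixes \<rho> :: "real ^ 'n \<Rightarrow> real"
  assumes w: "window \<rho>"
  shows "lattice_kernel (sigma \<rho> 0) (real CARD('n))"
proof
  let ?S = "\<lambda>\<xi>. \<Sum>\<^sub>\<infinity>m\<in>UNIV. \<rho> (\<xi> - lattice_point m)"
  have S1: "1 \<le> ?S \<xi>" for \<xi> by (rule window_sum_ge_1[OF w])
  have s: "sigma \<rho> 0 x = \<rho> x / ?S x" for x by (simp add: sigma_def)
  show "0 \<le> sigma \<rho> 0 x" for x unfolding s using window_range(1)[OF w] S1[of x] by (intro divide_nonneg_nonneg) auto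
  show "sigma \<rho> 0 x \<le> 1" for x unfolding s using window_range(2)[OF w, of x] S1[of x] by (subst divide_le_eq) auto
  show "sigma \<rho> 0 x = 0" if "real CARD('n) < norm x" for x unfolding s using window_supp_norm[OF w that] by simp
  show "1 \<le> real CARD('n)" by (simp add: Suc_leI)
  show "smooth_along b m (\<lambda>x. complex_of_real (sigma \<rho> 0 x))" if "b \<in> Basis" for b m by (rule sigma_smooth[OF w that])
  show "sigma \<rho> 0 0 \<noteq> 0" unfolding s using window_one[OF w, of 0] S1[of 0] by simp
  fix F :: "(int ^ 'n) set" and \<eta> :: "real ^ 'n"
  assume F: "finite F" "\<And>k. norm (\<eta> - lattice_point k) \<le> real CARD('n) \<Longrightarrow> k \<in> F"
  have "?S \<eta> = (\<Sum>m\<in>F. \<rho> (\<eta> - lattice_point m))"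
  proof (rule window_sum_finite[OF F(1)])
    fix m assume "\<rho> (\<eta> - lattice_point m) \<noteq> 0"
    hence "\<not> norm (\<eta> - lattice_point m) > real CARD('n)" using window_supp_norm[OF w] by blast
    thus "m \<in> F" by (intro F(2)) simp
  qed
  moreover have "sigma \<rho> 0 (\<eta> - lattice_point k) = \<rho> (\<eta> - lattice_point k) / ?S \<eta>" for k
    unfolding sigma_shift[symmetric] by (simp add: sigma_def)
  ultimately show "(\<Sum>k\<in>F. sigma \<rho> 0 (\<eta> - lattice_point k)) = 1"
    using S1[of \<eta>] by (simp add: sum_divide_distrib[symmetric])
qed

lemma continuous_if_differentiable: "(\<And>x. f differentiable (at x)) \<Longrightarrow> continuous_on UNIV f"
  unfolding continuous_on_eq_continuous_at[OF open_UNIV]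
  using differentiable_imp_continuous_within[of f _ UNIV] by simp

section \<open>Schwartz functions as test functions\<close>

lemma schwartz_continuous: "\<phi> \<in> schwartz \<Longrightarrow> continuous_on UNIV \<phi>"
  unfolding schwartz_def by (auto intro: continuous_if_differentiable C_infinity_differentiable)

lemma schwartz_bounded_integrable:
  fixes \<phi> :: "'a::euclidean_space \<Rightarrow> complex"
  assumes s: "\<phi> \<in> schwartz"
  shows "\<exists>K. \<forall>x. norm (\<phi> x) \<le> K" "integrable lborel \<phi>"
proof -
  have b: "bounded (range (\<lambda>x. norm x ^ m *\<^sub>R \<phi> x))" for m
    using s unfolding schwartz_def iterated_partial_def by (auto dest!: spec[of _ "[]"])
  obtain K0 where K0: "\<And>x. norm (norm x ^ 0 *\<^sub>R \<phi> x) \<le> K0" using b[of 0] unfolding bounded_iff by blast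
  obtain K1 where K1: "\<And>x. norm (norm x ^ (2 * DIM('a)) *\<^sub>R \<phi> x) \<le> K1" using b[of "2 * DIM('a)"] unfolding bounded_iff by blast
  show "\<exists>K. \<forall>x. norm (\<phi> x) \<le> K" using K0 by auto
  define C where "C = \<bar>K0\<bar> + \<bar>K1\<bar>"
  have "norm (\<phi> x) \<le> (2 ^ (DIM('a) + 1) * C) * dec x" for x
  proof (rule dec_bound)
    fix b :: 'a assume b: "b \<in> Basis"
    have "\<bar>x \<bullet> b\<bar> ^ (2 * DIM('a)) * norm (\<phi> x) \<le> norm x ^ (2 * DIM('a)) * norm (\<phi> x)"
      using Basis_le_norm[OF b, of x] by (intro mult_right_mono power_mono) auto
    also have "\<dots> \<le> C" using K1[of x] by (simp add: C_def)
    finally show "\<bar>x \<bullet> b\<bar> ^ (2 * DIM('a)) * norm (\<phi> x) \<le> C" .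
  qed (use K0[of x] in \<open>auto simp: C_def\<close>)
  moreover have "integrable lborel (\<lambda>x::'a. (2 ^ (DIM('a) + 1) * C) * dec x)"
    by (intro integrable_mult_right dec_integrable)
  moreover have "\<phi> \<in> borel_measurable lborel"
    using borel_measurable_continuous_onI[OF schwartz_continuous[OF s]] by simp
  ultimately show "integrable lborel \<phi>"
    by (elim Bochner_Integration.integrable_bound) (auto intro!: AE_I2 order_trans[OF _ abs_ge_self])
qed

lemma iterated_partial_affine:
  fixes r :: "'a::euclidean_space \<Rightarrow> real"
  assumes r: "C_infinity r" and bs: "set bs \<subseteq> Basis"
  shows "iterated_partial bs (\<lambda>x. complex_of_real (r (c *\<^sub>R (y - x)))) = (\<lambda>x. of_real ((- c) ^ length bs * iterated_partial bs r (c *\<^sub>R (y - x))))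
    \<and> (\<forall>x. iterated_partial bs (\<lambda>x. complex_of_real (r (c *\<^sub>R (y - x)))) differentiable (at x))"
  using bs
proof (induction bs)
  have d: "(\<lambda>x. complex_of_real (K * q (c *\<^sub>R (y - x)))) differentiable (at x)
     \<and> partial_derivative b (\<lambda>x. complex_of_real (K * q (c *\<^sub>R (y - x)))) x = of_real (K * (- c) * partial_derivative b q (c *\<^sub>R (y - x)))"
    if q: "\<And>x. q differentiable (at x)" for q :: "'a \<Rightarrow> real" and K x b
  proof -
    let ?D = "frechet_derivative q (at (c *\<^sub>R (y - x)))"
    have D: "(q has_derivative ?D) (at (c *\<^sub>R (y - x)))" using q frechet_derivative_works by blast
    have "((\<lambda>x. c *\<^sub>R (y - x)) has_derivative (\<lambda>h. c *\<^sub>R (0 - h))) (at x)" by (auto intro!: derivative_eq_intros)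
    from diff_chain_at[OF this D]
    have "((\<lambda>x. q (c *\<^sub>R (y - x))) has_derivative (\<lambda>h. ?D (c *\<^sub>R (0 - h)))) (at x)" by (simp add: o_def)
    from bounded_linear.has_derivative[OF bounded_linear_of_real has_derivative_mult_right[OF this, of K]]
    have E: "((\<lambda>x. complex_of_real (K * q (c *\<^sub>R (y - x)))) has_derivative (\<lambda>h. complex_of_real (K * ?D (c *\<^sub>R (0 - h))))) (at x)" .
    have "linear ?D" using D by (simp add: has_derivative_linear)
    hence "?D (c *\<^sub>R (0 - b)) = - c * ?D b" by (simp add: linear_cmul linear_neg)
    hence "partial_derivative b (\<lambda>x. complex_of_real (K * q (c *\<^sub>R (y - x)))) x = of_real (K * (- c) * partial_derivative b q (c *\<^sub>R (y - x)))"
      unfolding partial_derivative_def frechet_derivative_at[OF E, symmetric] by simp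
    thus ?thesis using E by (auto simp: differentiable_def)
  qed
  have it: "iterated_partial cs r differentiable (at x)" if "set cs \<subseteq> Basis" for cs x
    using r that by (simp add: C_infinity_def)
  {
    case Nil
    show ?case using d[of r 1] C_infinity_differentiable[OF r] by (simp add: iterated_partial_def)
  next
    case (Cons b bs)
    hence IH: "iterated_partial bs (\<lambda>x. complex_of_real (r (c *\<^sub>R (y - x)))) = (\<lambda>x. of_real ((- c) ^ length bs * iterated_partial bs r (c *\<^sub>R (y - x))))"
      by simp
    have e: "iterated_partial (b # bs) f = partial_derivative b (iterated_partial bs f)" for f :: "'a \<Rightarrow> 'c::real_normed_vector"
      by (simp add: iterated_partial_def)
    have "iterated_partial (b # bs) (\<lambda>x. complex_of_real (r (c *\<^sub>R (y - x)))) = (\<lambda>x. of_real ((- c) ^ length (b # bs) * iterated_partial (b # bs) r (c *\<^sub>R (y - x))))"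
    proof
      fix x
      have "partial_derivative b (\<lambda>x. complex_of_real ((- c) ^ length bs * iterated_partial bs r (c *\<^sub>R (y - x)))) x
         = of_real ((- c) ^ length bs * (- c) * partial_derivative b (iterated_partial bs r) (c *\<^sub>R (y - x)))"
        by (rule d[THEN conjunct2]) (use it[of bs] Cons.prems in auto)
      thus "iterated_partial (b # bs) (\<lambda>x. complex_of_real (r (c *\<^sub>R (y - x)))) x = of_real ((- c) ^ length (b # bs) * iterated_partial (b # bs) r (c *\<^sub>R (y - x)))"
        unfolding e IH by (simp only: list.size power_Suc add_0_right add_Suc_right mult.commute[of "(- c) ^ _" "- c"])
    qed
    moreover have "(\<lambda>x. complex_of_real ((- c) ^ length (b # bs) * iterated_partial (b # bs) r (c *\<^sub>R (y - x)))) differentiable (at x)" for x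
      using d[of "iterated_partial (b # bs) r"] it[of "b # bs"] Cons.prems by blast
    ultimately show ?case by simp
  }
qed

lemma iterated_partial_zero_outside:
  fixes r :: "'a::euclidean_space \<Rightarrow> real"
  assumes z: "\<And>x. norm x > R \<Longrightarrow> r x = 0"
  shows "norm x > R \<Longrightarrow> iterated_partial bs r x = 0"
proof (induction bs arbitrary: x)
  case Nil
  thus ?case using z by (simp add: iterated_partial_def)
next
  case (Cons b bs)
  let ?f = "iterated_partial bs r"
  have op: "open {x::'a. R < norm x}" by (intro open_Collect_less continuous_intros)
  have "(?f has_derivative (\<lambda>h. 0)) (at x)"
  proof (rule has_derivative_transform_within_open[OF has_derivative_const op])
    show "x \<in> {x. R < norm x}" using Cons by simp
    show "0 = ?f y" if "y \<in> {x. R < norm x}" for y using Cons.IH[of y] that by simp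
  qed
  hence "frechet_derivative ?f (at x) = (\<lambda>h. 0)" by (rule frechet_derivative_at[symmetric])
  thus ?case by (simp add: iterated_partial_def partial_derivative_def)
qed

text \<open>Dilated and reflected windows are the test functions from which
  \<open>schwartz_separates\<close> builds an approximate identity.\<close>

lemma window_schwartz:
  fixes \<rho> :: "real ^ 'n \<Rightarrow> real"
  assumes w: "window \<rho>" and c: "0 < c"
  shows "(\<lambda>x. complex_of_real (\<rho> (c *\<^sub>R (y - x)))) \<in> schwartz"
proof -
  have r: "C_infinity \<rho>" using w by (simp add: window_def)
  let ?n = "real CARD('n)"
  have "bounded (range (\<lambda>x. norm x ^ m *\<^sub>R iterated_partial bs (\<lambda>x. complex_of_real (\<rho> (c *\<^sub>R (y - x)))) x))"
    if bs: "set bs \<subseteq> Basis" for bs m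
  proof -
    have "continuous_on UNIV (iterated_partial bs \<rho>)"
      using r bs unfolding C_infinity_def by (intro continuous_if_differentiable) blast
    hence cc: "continuous_on UNIV (\<lambda>x. complex_of_real (iterated_partial bs \<rho> x))" by (intro continuous_intros)
    have zz: "iterated_partial bs \<rho> x = 0" if "norm x > ?n" for x
      by (rule iterated_partial_zero_outside[OF window_supp_norm[OF w] that])
    obtain B where B: "0 \<le> B" "\<And>x. norm (complex_of_real (iterated_partial bs \<rho> x)) \<le> B"
      using bounded_continuous_supp[OF cc, of ?n] zz by auto
    let ?M = "(norm y + ?n / c) ^ m * (c ^ length bs * B)"
    have "norm (norm x ^ m *\<^sub>R iterated_partial bs (\<lambda>x. complex_of_real (\<rho> (c *\<^sub>R (y - x)))) x) \<le> ?M" for x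
    proof -
      have e: "norm (norm x ^ m *\<^sub>R iterated_partial bs (\<lambda>x. complex_of_real (\<rho> (c *\<^sub>R (y - x)))) x)
        = norm x ^ m * (c ^ length bs * \<bar>iterated_partial bs \<rho> (c *\<^sub>R (y - x))\<bar>)"
        unfolding iterated_partial_affine[OF r bs, THEN conjunct1] norm_scaleR norm_of_real abs_mult power_abs
        using c by simp
      show ?thesis
      proof (cases "norm (c *\<^sub>R (y - x)) > ?n")
        case True
        thus ?thesis unfolding e zz[OF True] using c B by simp
      next
        case False
        hence "c * norm (y - x) \<le> ?n" using c by (simp only: norm_scaleR not_less abs_of_pos)
        hence "norm (y - x) \<le> ?n / c" using c by (simp only: pos_le_divide_eq mult.commute)
        hence "norm x \<le> norm y + ?n / c" using norm_triangle_ineq4[of y "y - x"] by simp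
        thus ?thesis unfolding e using c B(1) B(2)[of "c *\<^sub>R (y - x)"]
          by (intro mult_mono power_mono mult_left_mono) auto
      qed
    qed
    thus ?thesis unfolding bounded_iff by blast
  qed
  moreover have "C_infinity (\<lambda>x. complex_of_real (\<rho> (c *\<^sub>R (y - x))))"
    unfolding C_infinity_def using iterated_partial_affine[OF r] by blast
  ultimately show ?thesis unfolding schwartz_def by blast
qed

text \<open>The window has a nonzero integral and its dilates are Schwartz functions, so testing
  against these alone meets the hypothesis of \<open>approximate_identity_unique\<close>.\<close>

lemma schwartz_separates:
  fixes g1 g2 :: "real ^ 'n \<Rightarrow> complex"
  assumes w: "window (\<rho> :: real ^ 'n \<Rightarrow> real)" and g: "l1inf g1" "l1inf g2"
    and eq: "\<And>\<phi>. \<phi> \<in> schwartz \<Longrightarrow> (\<integral>x. g1 x * \<phi> x \<partial>lborel) = (\<integral>x. g2 x * \<phi> x \<partial>lborel)"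
  shows "AE x in lborel. g1 x = g2 x"
proof -
  have rc: "continuous_on UNIV (\<lambda>x. complex_of_real (\<rho> x))"
    using w C_infinity_differentiable[of \<rho>] unfolding window_def
    by (intro continuous_on_of_real continuous_if_differentiable) blast
  have ri: "integrable lborel (\<lambda>x. complex_of_real (\<rho> x))"
    by (rule integrable_continuous_supp[OF rc, of "real CARD('n)"]) (use window_supp_norm[OF w] in simp)
  have "AE x in lborel. g1 x - g2 x = 0"
  proof (rule approximate_identity_unique[where \<Theta> = "\<lambda>x. complex_of_real (\<rho> x)"])
    show "l1inf (\<lambda>x. g1 x - g2 x)" by (rule l1inf_diff[OF g])
    show "integrable lborel (\<lambda>x. complex_of_real (\<rho> x))" by (rule ri)
    show "(\<integral>x. complex_of_real (\<rho> x) \<partial>lborel) \<noteq> 0"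
    proof
      assume "(\<integral>x. complex_of_real (\<rho> x) \<partial>lborel) = 0"
      hence z: "(\<integral>x. \<rho> x \<partial>lborel) = 0" by simp
      have ri': "integrable lborel \<rho>" using integrable_Re[OF ri] by simp
      from integral_nonneg_eq_0_iff_AE[OF ri'] z window_range(1)[OF w]
      have "AE x in lborel. \<rho> x = 0" by auto
      have nb: "x \<notin> ball 0 (1/2)" if "\<rho> x = 0" for x
      proof
        assume x: "x \<in> ball 0 (1/2)"
        have "\<rho> x = 1"
        proof (rule window_one[OF w])
          show "\<bar>x $ i\<bar> \<le> 1/2" for i using component_le_norm_cart[of x i] x by simp
        qed
        thus False using that by simp
      qed
      have "AE x in lborel. x \<notin> ball (0::real^'n) (1/2)"
        using \<open>AE x in lborel. \<rho> x = 0\<close> by eventually_elim (rule nb)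
      hence "emeasure lborel (ball (0::real^'n) (1/2)) = 0"
        using AE_iff_null_sets[of "ball (0::real^'n) (1/2)" lborel] by (simp only: null_setsD1 sets_lborel open_ball borel_open)
      moreover have "emeasure lborel (ball (0::real^'n) (1/2)) \<noteq> 0"
        using content_ball_pos[of "1/2" "0::real^'n"] by (auto simp: measure_def)
      ultimately show False by simp
    qed
    fix n :: nat and y :: "real ^ 'n"
    let ?\<phi> = "\<lambda>x. complex_of_real (\<rho> (real (Suc n) *\<^sub>R (y - x)))"
    have s: "?\<phi> \<in> schwartz" by (rule window_schwartz[OF w]) simp
    obtain K where K: "\<And>x. norm (?\<phi> x) \<le> K" using schwartz_bounded_integrable(1)[OF s] by blast
    note i = l1inf_mult_integrable[OF g(1) schwartz_bounded_integrable(2)[OF s] K]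
      l1inf_mult_integrable[OF g(2) schwartz_bounded_integrable(2)[OF s] K]
    show "(\<integral>x. (g1 x - g2 x) * ?\<phi> x \<partial>lborel) = 0"
      unfolding left_diff_distrib Bochner_Integration.integral_diff[OF i] eq[OF s] by simp
  qed
  thus ?thesis by (rule AE_mp) (auto intro!: AE_I2)
qed

section \<open>Borel representatives and the norm of a box operator\<close>

lemma borel_version_complex:
  fixes g :: "'a::euclidean_space \<Rightarrow> complex"
  assumes "g \<in> borel_measurable lebesgue"
  shows "\<exists>g0\<in>borel_measurable borel. AE x in lborel. g x = g0 x"
proof -
  have "(\<lambda>x. Re (g x)) \<in> borel_measurable lebesgue" "(\<lambda>x. Im (g x)) \<in> borel_measurable lebesgue"
    using assms by (auto intro: borel_measurable_Re borel_measurable_Im)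
  then obtain a b where ab: "a \<in> borel_measurable lborel" "AE x in lborel. Re (g x) = a x"
    "b \<in> borel_measurable lborel" "AE x in lborel. Im (g x) = b x"
    using completion_ex_borel_measurable_real[of "\<lambda>x. Re (g x)" lborel] completion_ex_borel_measurable_real[of "\<lambda>x. Im (g x)" lborel]
    by blast
  have [measurable]: "a \<in> borel_measurable borel" "b \<in> borel_measurable borel" using ab by simp_all
  have "(\<lambda>x. complex_of_real (a x) + \<i> * complex_of_real (b x)) \<in> borel_measurable borel" by measurable
  moreover have "AE x in lborel. g x = complex_of_real (a x) + \<i> * complex_of_real (b x)"
    using ab(2,4) by eventually_elim (simp add: complex_eq_iff)
  ultimately show ?thesis by (intro bexI)
qed

lemma lebesgue_integral_AE_borel:
  fixes g g0 F :: "'a::euclidean_space \<Rightarrow> complex"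
  assumes "g \<in> borel_measurable lebesgue" "g0 \<in> borel_measurable borel" "AE x in lborel. g x = g0 x" "F \<in> borel_measurable borel"
  shows "(LINT x|lebesgue. g x * F x) = (\<integral>x. g0 x * F x \<partial>lborel)"
proof -
  have F: "F \<in> borel_measurable lebesgue" by (rule measurable_completion) (use assms(4) in simp)
  have g0: "g0 \<in> borel_measurable lebesgue" by (rule measurable_completion) (use assms(2) in simp)
  have "(LINT x|lebesgue. g x * F x) = (LINT x|lebesgue. g0 x * F x)"
  proof (rule integral_cong_AE)
    show "AE x in lebesgue. g x * F x = g0 x * F x"
      by (rule AE_mp[OF AE_completion[OF assms(3)]]) (auto intro!: AE_I2)
    show "(\<lambda>x. g x * F x) \<in> borel_measurable lebesgue" by (rule borel_measurable_times[OF assms(1) F])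
    show "(\<lambda>x. g0 x * F x) \<in> borel_measurable lebesgue" by (rule borel_measurable_times[OF g0 F])
  qed
  also have "\<dots> = (\<integral>x. g0 x * F x \<partial>lborel)"
  proof (rule integral_completion)
    have [measurable]: "g0 \<in> borel_measurable borel" "F \<in> borel_measurable borel" by fact+
    show "(\<lambda>x. g0 x * F x) \<in> borel_measurable lborel" by measurable
  qed
  finally show ?thesis .
qed

text \<open>All three transpositions fall on the test function and produce \<open>F\<close>.
  Computed by Fubini, \<open>F\<close> is \<open>\<phi>\<close> integrated against the modulated
  kernel at \<open>y - x\<close>, and \<open>filt_pairing\<close> carries this back to
  \<open>g0\<close>. The two normalising factors of the transforms multiply to the one in
  \<open>\<kappa>\<close>.\<close>

lemma box_op_eq_filt:
  fixes \<rho> :: "real ^ 'n \<Rightarrow> real"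
  assumes w: "window \<rho>" and g: "g \<in> borel_measurable lebesgue" "g0 \<in> borel_measurable borel" "AE x in lborel. g x = g0 x"
    and l: "l1inf g0" and s: "\<phi> \<in> schwartz"
  shows "box_op \<rho> k g \<phi> = (\<integral>x. kernel.filt (sigma \<rho> 0) (lattice_point k) g0 x * \<phi> x \<partial>lborel)"
proof -
  interpret lattice_kernel "sigma \<rho> 0" "real CARD('n)" by (rule window_lattice_kernel[OF w])
  let ?k = "lattice_point k"
  let ?p = "(2 * pi) powr (- real DIM(real^'n) / 2)"
  have pp: "?p * ?p = 1 / (2 * pi) ^ CARD('n)"
    by (simp add: powr_add[symmetric] powr_minus powr_realpow inverse_eq_divide)
  have \<phi>m [measurable]: "\<phi> \<in> borel_measurable borel" using schwartz_bounded_integrable(2)[OF s] by auto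
  have \<phi>i: "integrable lborel \<phi>" by (rule schwartz_bounded_integrable(2)[OF s])
  define F where "F = fourier (\<lambda>\<xi>. complex_of_real (sigma \<rho> k \<xi>) * inv_fourier \<phi> \<xi>)"
  have inv: "inv_fourier \<phi> \<xi> = of_real ?p * (\<integral>y. \<phi> y * exp (\<i> * of_real (\<xi> \<bullet> y)) \<partial>lborel)" for \<xi>
    unfolding inv_fourier_def by (subst integral_completion) auto
  have Fx: "F x = (\<integral>y. \<phi> y * (\<kappa> (y - x) * exp (\<i> * of_real (?k \<bullet> (y - x)))) \<partial>lborel)" for x
  proof -
    let ?E = "\<lambda>\<xi> y. exp (\<i> * of_real (\<xi> \<bullet> y)) * exp (- (\<i> * of_real (\<xi> \<bullet> x)))"
    have sm: "(\<lambda>\<xi>. complex_of_real (sigma \<rho> k \<xi>)) \<in> borel_measurable borel"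
      unfolding sigma_shift[of _ k] by (rule measurable_compose[OF _ \<sigma>_measC]) measurable
    have si: "integrable lborel (\<lambda>\<xi>. complex_of_real (sigma \<rho> k \<xi>))"
      unfolding sigma_shift[of _ k] using integrable_translate[OF \<sigma>_integrable, of "- ?k"] by simp
    have im: "inv_fourier \<phi> \<in> borel_measurable borel" unfolding inv[abs_def] by measurable
    have "F x = of_real ?p * (\<integral>\<xi>. (of_real (sigma \<rho> k \<xi>) * inv_fourier \<phi> \<xi>) * exp (- (\<i> * of_real (\<xi> \<bullet> x))) \<partial>lborel)"
      unfolding F_def fourier_def using sm im by (subst integral_completion) auto
    also have "\<dots> = of_real (?p * ?p) * (\<integral>\<xi>. of_real (sigma \<rho> k \<xi>) * (\<integral>y. \<phi> y * ?E \<xi> y \<partial>lborel) \<partial>lborel)"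
    proof -
      have "(of_real (sigma \<rho> k \<xi>) * inv_fourier \<phi> \<xi>) * exp (- (\<i> * of_real (\<xi> \<bullet> x))) = of_real ?p * (of_real (sigma \<rho> k \<xi>) * (\<integral>y. \<phi> y * ?E \<xi> y \<partial>lborel))" for \<xi>
      proof -
        have "(\<integral>y. \<phi> y * ?E \<xi> y \<partial>lborel) = exp (- (\<i> * of_real (\<xi> \<bullet> x))) * (\<integral>y. \<phi> y * exp (\<i> * of_real (\<xi> \<bullet> y)) \<partial>lborel)"
          by (subst integral_mult_right_zero[symmetric]) (simp only: mult_ac)
        thus ?thesis unfolding inv by (simp only: mult_ac)
      qed
      thus ?thesis by (simp only: integral_mult_right_zero of_real_mult mult.assoc)
    qed
    also have "(\<integral>\<xi>. of_real (sigma \<rho> k \<xi>) * (\<integral>y. \<phi> y * ?E \<xi> y \<partial>lborel) \<partial>lborel) = (\<integral>y. \<phi> y * (\<integral>\<xi>. of_real (sigma \<rho> k \<xi>) * ?E \<xi> y \<partial>lborel) \<partial>lborel)"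
      by (rule fubini_mult(1)[where K = 1, OF sigma_finite_lborel sigma_finite_lborel si \<phi>i]) (auto simp: norm_mult)
    also have "of_real (?p * ?p) * (\<integral>y. \<phi> y * (\<integral>\<xi>. of_real (sigma \<rho> k \<xi>) * ?E \<xi> y \<partial>lborel) \<partial>lborel)
       = (\<integral>y. \<phi> y * (of_real (1 / (2 * pi) ^ CARD('n)) * (\<integral>\<xi>. of_real (sigma \<rho> k \<xi>) * ?E \<xi> y \<partial>lborel)) \<partial>lborel)"
      unfolding pp by (subst integral_mult_right_zero[symmetric]) (simp only: mult.left_commute)
    also have "\<dots> = (\<integral>y. \<phi> y * (\<kappa> (y - x) * exp (\<i> * of_real (?k \<bullet> (y - x)))) \<partial>lborel)"
    proof (rule Bochner_Integration.integral_cong[OF refl])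
      fix y
      let ?G = "\<lambda>\<xi>. complex_of_real (sigma \<rho> k \<xi>) * ?E \<xi> y"
      have "(\<integral>\<xi>. ?G \<xi> \<partial>lborel) = (\<integral>\<xi>. ?G (?k + \<xi>) \<partial>lborel)"
        by (rule integral_translate[symmetric]) (use sm in measurable)
      also have "\<dots> = (\<integral>\<xi>. exp (\<i> * of_real (?k \<bullet> (y - x))) * (of_real (sigma \<rho> 0 \<xi>) * exp (\<i> * of_real ((y - x) \<bullet> \<xi>))) \<partial>lborel)"
      proof (intro Bochner_Integration.integral_cong refl)
        fix \<xi>
        have "?E (?k + \<xi>) y = exp (\<i> * of_real (?k \<bullet> (y - x))) * exp (\<i> * of_real ((y - x) \<bullet> \<xi>))"
          unfolding exp_add[symmetric]
          by (rule arg_cong[where f = exp]) (simp add: inner_diff_left inner_diff_right inner_add_left inner_commute algebra_simps)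
        moreover have "sigma \<rho> k (?k + \<xi>) = sigma \<rho> 0 \<xi>" by (subst sigma_shift) simp
        ultimately show "?G (?k + \<xi>) = exp (\<i> * of_real (?k \<bullet> (y - x))) * (of_real (sigma \<rho> 0 \<xi>) * exp (\<i> * of_real ((y - x) \<bullet> \<xi>)))"
          by (simp only: mult.left_commute)
      qed
      also have "\<dots> = exp (\<i> * of_real (?k \<bullet> (y - x))) * oscint (\<lambda>\<eta>. of_real (sigma \<rho> 0 \<eta>)) (y - x)"
        unfolding oscint_def by (rule integral_mult_right_zero)
      finally have "of_real (1 / (2 * pi) ^ CARD('n)) * (\<integral>\<xi>. ?G \<xi> \<partial>lborel) = \<kappa> (y - x) * exp (\<i> * of_real (?k \<bullet> (y - x)))"
        unfolding \<kappa>_def by (simp only: mult_ac DIM_cart DIM_real mult_1)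
      thus "\<phi> y * (of_real (1 / (2 * pi) ^ CARD('n)) * (\<integral>\<xi>. ?G \<xi> \<partial>lborel)) = \<phi> y * (\<kappa> (y - x) * exp (\<i> * of_real (?k \<bullet> (y - x))))"
        by (simp only:)
    qed
    finally show ?thesis .
  qed
  have Fm: "F \<in> borel_measurable borel" unfolding Fx[abs_def] by measurable
  have "box_op \<rho> k g \<phi> = (LINT x|lebesgue. g x * F x)"
    by (simp add: box_op_def dist_inv_fourier_def dist_mult_def dist_fourier_def dist_of_fun_def F_def)
  also have "\<dots> = (\<integral>x. g0 x * F x \<partial>lborel)" by (rule lebesgue_integral_AE_borel[OF g Fm])
  also have "\<dots> = (\<integral>y. \<phi> y * filt ?k g0 y \<partial>lborel)"
    unfolding Fx by (rule filt_pairing[OF \<phi>i l, symmetric])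
  finally show ?thesis by (simp only: mult.commute)
qed

lemma Lp_norm_borel:
  fixes g g0 :: "'a::euclidean_space \<Rightarrow> complex"
  assumes "p < \<infinity>" "AE x in lborel. g x = g0 x"
  shows "Lp_norm p g = ennpowr (\<integral>\<^sup>+x. ennreal (norm (g0 x) powr enn2real p) \<partial>lborel) (1 / enn2real p)"
proof -
  have "(\<integral>\<^sup>+x. ennreal (norm (g x) powr enn2real p) \<partial>lebesgue) = (\<integral>\<^sup>+x. ennreal (norm (g0 x) powr enn2real p) \<partial>lborel)"
    unfolding nn_integral_completion by (rule nn_integral_cong_AE) (use assms(2) in auto)
  moreover have "p \<noteq> \<infinity>" using assms(1) by auto
  ultimately show ?thesis unfolding Lp_norm_def by (simp only: if_False)
qed

lemma lp_le_Lp_norm: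
  fixes g g0 :: "'a::euclidean_space \<Rightarrow> complex"
  assumes p: "1 \<le> enn2real p" "p < \<infinity>" and fin: "Lp_norm p g < \<infinity>" and g0: "g0 \<in> borel_measurable borel" "AE x in lborel. g x = g0 x"
  shows "lp_le (enn2real p) g0 (enn2real (Lp_norm p g))"
proof -
  let ?p = "enn2real p" and ?I = "\<integral>\<^sup>+x. ennreal (norm (g0 x) powr enn2real p) \<partial>lborel"
  have n: "Lp_norm p g = ennpowr ?I (1 / ?p)" by (rule Lp_norm_borel[OF p(2) g0(2)])
  hence "?I \<noteq> \<infinity>" using fin by (auto simp: ennpowr_def)
  then obtain J where J: "?I = ennreal J" "0 \<le> J" by (cases ?I rule: ennreal_cases) auto
  hence "enn2real (Lp_norm p g) = J powr (1 / ?p)" unfolding n by (simp add: ennpowr_def)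
  hence "enn2real (Lp_norm p g) powr ?p = J" using p J by (simp add: powr_powr)
  thus ?thesis using g0 J by (simp add: lp_le_def)
qed

lemma Lp_norm_lp_le:
  fixes g g0 :: "'a::euclidean_space \<Rightarrow> complex"
  assumes p: "1 \<le> enn2real p" "p < \<infinity>" and l: "lp_le (enn2real p) g0 A" and ae: "AE x in lborel. g x = g0 x"
  shows "Lp_norm p g \<le> ennreal A"
proof -
  let ?p = "enn2real p" and ?I = "\<integral>\<^sup>+x. ennreal (norm (g0 x) powr enn2real p) \<partial>lborel"
  have I: "?I \<le> ennreal (A powr ?p)" and A: "0 \<le> A" using l by (auto simp: lp_le_def)
  then obtain J where J: "?I = ennreal J" "0 \<le> J" by (cases ?I rule: ennreal_cases) (auto simp: top_unique)
  hence "J \<le> A powr ?p" using I by simp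
  hence "J powr (1 / ?p) \<le> (A powr ?p) powr (1 / ?p)" using J p by (intro powr_mono2) auto
  also have "\<dots> = A" using A p by (simp add: powr_powr)
  finally have "ennreal (J powr (1 / ?p)) \<le> ennreal A" by (rule ennreal_leI)
  thus ?thesis unfolding Lp_norm_borel[OF p(2) ae] J(1) using J(2) by (simp add: ennpowr_def)
qed

text \<open>The filtered function represents the box operator, and since Schwartz functions
  separate, every other representative in L^p has the same norm; the infimum thus runs over a
  singleton. After this identification the estimates deal with filters only.\<close>

theorem dist_Lp_norm_box_op:
  fixes \<rho> :: "real ^ 'n \<Rightarrow> real"
  assumes w: "window \<rho>" and p: "1 \<le> enn2real p" "p < \<infinity>"
    and g: "g \<in> Lp_space p" "g0 \<in> borel_measurable borel" "AE x in lborel. g x = g0 x"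
  shows "dist_Lp_norm p (box_op \<rho> k g) = Lp_norm p (kernel.filt (sigma \<rho> 0) (lattice_point k) g0)"
proof -
  interpret lattice_kernel "sigma \<rho> 0" "real CARD('n)" by (rule window_lattice_kernel[OF w])
  let ?G = "filt (lattice_point k) g0"
  have gl: "g \<in> borel_measurable lebesgue" "Lp_norm p g < \<infinity>" using g by (auto simp: Lp_space_def)
  have lp: "lp_le (enn2real p) g0 (enn2real (Lp_norm p g))" by (rule lp_le_Lp_norm[OF p gl(2) g(2,3)])
  have l0: "l1inf g0" by (rule l1inf_lp[OF p(1) lp])
  have Gm: "?G \<in> borel_measurable borel" and Gl: "l1inf ?G"
    using filt_meas[OF g(2)] filt_l1inf(1)[OF l0] by auto
  have "Lp_norm p ?G \<le> ennreal (\<kappa>1 * enn2real (Lp_norm p g))"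
    by (rule Lp_norm_lp_le[OF p filt_lp[OF p(1) lp, of "lattice_point k"]]) simp
  hence "Lp_norm p ?G < \<infinity>" by (rule order_le_less_trans) simp
  moreover have "?G \<in> borel_measurable lebesgue" by (rule measurable_completion) (use Gm in simp)
  ultimately have Gin: "?G \<in> Lp_space p" by (simp add: Lp_space_def)
  have rep: "dist_of_fun ?G \<phi> = box_op \<rho> k g \<phi>" if s: "\<phi> \<in> schwartz" for \<phi>
  proof -
    have "\<phi> \<in> borel_measurable borel" using schwartz_bounded_integrable(2)[OF s] by auto
    hence "dist_of_fun ?G \<phi> = (\<integral>x. ?G x * \<phi> x \<partial>lborel)"
      unfolding dist_of_fun_def using Gm by (intro integral_completion) auto
    thus ?thesis by (simp add: box_op_eq_filt[OF w gl(1) g(2,3) l0 s])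
  qed
  have uniq: "Lp_norm p h = Lp_norm p ?G" if h: "h \<in> Lp_space p" "\<forall>\<phi>\<in>schwartz. dist_of_fun h \<phi> = box_op \<rho> k g \<phi>" for h
  proof -
    have hl: "h \<in> borel_measurable lebesgue" "Lp_norm p h < \<infinity>" using h by (auto simp: Lp_space_def)
    obtain h0 where h0: "h0 \<in> borel_measurable borel" "AE x in lborel. h x = h0 x"
      using borel_version_complex[OF hl(1)] by blast
    have h0l: "l1inf h0" by (rule l1inf_lp[OF p(1) lp_le_Lp_norm[OF p hl(2) h0]])
    have "AE x in lborel. h0 x = ?G x"
    proof (rule schwartz_separates[OF w h0l Gl])
      fix \<phi> :: "real ^ 'n \<Rightarrow> complex" assume s: "\<phi> \<in> schwartz"
      have \<phi>m: "\<phi> \<in> borel_measurable borel" using schwartz_bounded_integrable(2)[OF s] by auto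
      have "(\<integral>x. h0 x * \<phi> x \<partial>lborel) = dist_of_fun h \<phi>"
        unfolding dist_of_fun_def by (rule lebesgue_integral_AE_borel[OF hl(1) h0 \<phi>m, symmetric])
      also have "\<dots> = box_op \<rho> k g \<phi>" using h s by blast
      also have "\<dots> = (\<integral>x. ?G x * \<phi> x \<partial>lborel)" by (rule box_op_eq_filt[OF w gl(1) g(2,3) l0 s])
      finally show "(\<integral>x. h0 x * \<phi> x \<partial>lborel) = (\<integral>x. ?G x * \<phi> x \<partial>lborel)" .
    qed
    hence "AE x in lborel. h x = ?G x" using h0(2) by auto
    thus ?thesis unfolding Lp_norm_borel[OF p(2) \<open>AE x in lborel. h x = ?G x\<close>]
      by (subst Lp_norm_borel[OF p(2), of ?G ?G]) auto
  qed
  have "{Lp_norm p h |h. h \<in> Lp_space p \<and> (\<forall>\<phi>\<in>schwartz. dist_of_fun h \<phi> = box_op \<rho> k g \<phi>)} = {Lp_norm p ?G}"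
    using uniq rep Gin by blast
  thus ?thesis by (simp add: dist_Lp_norm_def)
qed

section \<open>Multipliers weighted by frequency\<close>

text \<open>The entire function (exp z - 1) / z. It splits \<open>exp z - 1\<close> into the factor
  \<open>z\<close>, which carries the L^p bound, and a multiplier.\<close>

definition expm1_quot :: "complex \<Rightarrow> complex" where
  "expm1_quot z = (if z = 0 then 1 else (exp z - 1) / z)"

lemma expm1_quot_mult: "z * expm1_quot z = exp z - 1"
  by (simp add: expm1_quot_def)

lemma exp_sums: "(\<lambda>m. (1 / of_real (fact m)) * z ^ m) sums exp (z::complex)"
  using exp_converges[of z] by (simp add: scaleR_conv_of_real inverse_eq_divide)

lemma expm1_quot_sums: "(\<lambda>m. (1 / of_real (fact (Suc m))) * z ^ m) sums expm1_quot z"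
proof (cases "z = 0")
  case True
  have "(\<lambda>m. (1 / of_real (fact (Suc m))) * 0 ^ m) sums (1 / of_real (fact (Suc 0)) :: complex)"
    by (rule powser_sums_zero)
  thus ?thesis using True by (simp add: expm1_quot_def)
next
  case False
  have "(\<lambda>m. (1 / of_real (fact (Suc m))) * z ^ Suc m) sums (exp z - 1)"
    using exp_sums[of z] sums_Suc_iff[of "\<lambda>m. (1 / of_real (fact m)) * z ^ m" "exp z - 1"] by simp
  hence "(\<lambda>m. ((1 / of_real (fact (Suc m))) * z ^ Suc m) / z) sums ((exp z - 1) / z)" by (rule sums_divide)
  moreover have "((1 / of_real (fact (Suc m))) * z ^ Suc m) / z = (1 / of_real (fact (Suc m))) * z ^ m" for m
    using False by simp
  ultimately show ?thesis using False by (simp add: expm1_quot_def)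
qed

lemma norm_exp_complex_le: "\<bar>Re z\<bar> \<le> 1 \<Longrightarrow> norm (exp z) \<le> exp 1"
  by simp

text \<open>Mean value bound along the segment from 0 to \<open>z\<close>, where the real part stays
  in [-1, 1]. It is uniform in the imaginary part, which will be of size \<bar>\<xi>\<bar>.\<close>

lemma norm_expm1_quot_le:
  assumes "\<bar>Re z\<bar> \<le> 1" shows "norm (expm1_quot z) \<le> exp 1"
proof (cases "z = 0")
  case False
  have "norm (exp z - exp 0) \<le> exp 1 * norm (z - 0)"
  proof (rule field_differentiable_bound[of "closed_segment 0 z"])
    show "(exp has_field_derivative exp x) (at x within closed_segment 0 z)" if "x \<in> closed_segment 0 z" for x
      by (rule DERIV_exp[THEN DERIV_subset]) simp
    show "norm (exp x) \<le> exp 1" if x: "x \<in> closed_segment 0 z" for x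
    proof (rule norm_exp_complex_le)
      obtain t where t: "0 \<le> t" "t \<le> 1" "x = t *\<^sub>R z" using x by (auto simp: in_segment)
      have "\<bar>Re x\<bar> = t * \<bar>Re z\<bar>" using t by (simp add: abs_mult)
      also have "\<dots> \<le> 1 * 1" using t assms by (intro mult_mono) auto
      finally show "\<bar>Re x\<bar> \<le> 1" by simp
    qed
  qed auto
  thus ?thesis using False by (simp add: expm1_quot_def norm_divide pos_divide_le_eq)
qed (simp add: expm1_quot_def)

text \<open>One term of the series of \<open>exp m\<close> shows that \<open>fact m\<close> is at
  least (m / e) ^ m. The constant \<open>exp 3\<close> leaves \<open>exp (- 2 * m)\<close>: one half
  of the exponent will pay for the gauge, the other keeps the tail summable.\<close>

lemma power_div_fact_le:
  fixes B :: real
  assumes "0 \<le> B" "1 \<le> m" "exp 3 * B \<le> real m"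
  shows "B ^ m / fact m \<le> exp (- 2 * real m)"
proof -
  have "real m ^ m / fact m \<le> exp (real m)"
  proof -
    have "(\<lambda>n. real m ^ n /\<^sub>R fact n) sums exp (real m)" by (rule exp_converges)
    hence "(\<Sum>n\<in>{m}. real m ^ n /\<^sub>R fact n) \<le> exp (real m)"
      by (metis (no_types, lifting) sum_le_suminf finite.emptyI finite.insertI sums_iff scaleR_nonneg_nonneg zero_le_power of_nat_0_le_iff inverse_nonnegative_iff_nonnegative fact_ge_zero)
    thus ?thesis by (simp add: divide_inverse mult.commute)
  qed
  hence f: "1 / fact m \<le> exp (real m) / real m ^ m" using assms by (simp add: field_simps)
  have "B ^ m / fact m = B ^ m * (1 / fact m)" by simp
  also have "\<dots> \<le> (real m / exp 3) ^ m * (exp (real m) / real m ^ m)"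
    using assms f by (intro mult_mono power_mono) (auto simp: field_simps)
  also have "\<dots> = exp (real m) / exp 3 ^ m" using assms by (simp add: power_divide)
  also have "\<dots> = exp (- 2 * real m)"
    by (simp add: exp_of_nat_mult[symmetric] exp_diff[symmetric] mult.commute)
  finally show ?thesis .
qed

lemma sum_exp_neg_le: "(\<Sum>m\<in>{S..<N}. exp (- real m)) \<le> 2"
proof -
  have e: "exp (-1::real) \<le> 1/2"
  proof -
    have "(2::real) \<le> exp 1" using exp_ge_add_one_self[of 1] by simp
    hence "inverse (exp (1::real)) \<le> inverse 2" by (intro le_imp_inverse_le) auto
    thus ?thesis by (simp add: exp_minus)
  qed
  have "(\<Sum>m\<in>{S..<N}. exp (- real m)) \<le> (\<Sum>m<N. exp (- real m))"
    by (intro sum_mono2) auto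
  also have "\<dots> \<le> (\<Sum>m<N. (1/2) ^ m)"
  proof (rule sum_mono)
    fix m
    have "exp (- real m) = exp (-1) ^ m" by (simp add: exp_of_nat_mult[symmetric])
    also have "\<dots> \<le> (1/2) ^ m" using e by (intro power_mono) auto
    finally show "exp (- real m) \<le> (1/2) ^ m" .
  qed
  also have "\<dots> \<le> 2" by (simp add: sum_gp_strict)
  finally show ?thesis .
qed

section \<open>Normed algebras of multipliers\<close>

definition submult :: "(real \<Rightarrow> real) \<Rightarrow> bool" where
  "submult v \<longleftrightarrow> v 0 = 1 \<and> (\<forall>r\<ge>0. 1 \<le> v r) \<and> (\<forall>r\<ge>0. \<forall>s\<ge>0. v (r + s) \<le> v r * v s) \<and>
     (\<forall>r\<ge>0. \<forall>s\<ge>r. v r \<le> v s)"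

lemma submult_gauge: "ee \<le> a \<Longrightarrow> submult (gauge_fun N a)"
  unfolding submult_def using gauge_fun_mult gauge_fun_ge_1 gauge_fun_mono by auto

text \<open>\<open>alg v g \<beta>\<close> says that \<open>g\<close> is a limit of finite sums of pieces \<open>h\<close> of frequency radius
  \<open>r\<close> with total cost \<open>\<Sum> \<parallel>h\<parallel>\<^sub>\<infinity> v(r) \<le> \<beta>\<close>; for submultiplicative \<open>v\<close> this is a Banach algebra.\<close>

inductive (in kernel) alg :: "(real \<Rightarrow> real) \<Rightarrow> ('a \<Rightarrow> complex) \<Rightarrow> real \<Rightarrow> bool" for v where
  alg_piece: "freq_le g r \<Longrightarrow> 0 \<le> r \<Longrightarrow> (\<And>x. norm (g x) \<le> D) \<Longrightarrow> D * v r \<le> \<beta> \<Longrightarrow> alg v g \<beta>"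
| alg_add: "alg v g \<beta> \<Longrightarrow> alg v h \<gamma> \<Longrightarrow> alg v (\<lambda>x. g x + h x) (\<beta> + \<gamma>)"
| alg_limit: "(\<And>n::nat. alg v (s n) \<beta>) \<Longrightarrow> (\<And>x. (\<lambda>n. s n x) \<longlonglongrightarrow> h x) \<Longrightarrow> alg v h \<beta>"

context kernel
begin

lemma alg_props:
  assumes v: "submult v"
  shows "alg v g \<beta> \<Longrightarrow> g \<in> borel_measurable borel \<and> (\<forall>x. norm (g x) \<le> \<beta>)"
proof (induction rule: alg.induct)
  case (alg_piece g r D \<beta>)
  have D: "0 \<le> D" using alg_piece(3)[of undefined] norm_ge_zero order_trans by blast
  have "D * 1 \<le> D * v r" using v alg_piece(2) D by (intro mult_left_mono) (auto simp: submult_def)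
  hence "D \<le> \<beta>" using alg_piece(4) by simp
  thus ?case using alg_piece by (auto simp: freq_le_def bddm_def intro: order_trans)
next
  case (alg_add g \<beta> h \<gamma>)
  thus ?case by (auto intro!: order_trans[OF norm_triangle_ineq] add_mono)
next
  case (alg_limit s \<beta> h)
  have "h \<in> borel_measurable borel"
    by (rule borel_measurable_LIMSEQ_metric[OF _ alg_limit.hyps(2)]) (use alg_limit.IH in auto)
  moreover have "norm (h x) \<le> \<beta>" for x
    by (rule LIMSEQ_le_const2[OF tendsto_norm[OF alg_limit.hyps(2)[of x]]]) (use alg_limit.IH in auto)
  ultimately show ?case by blast
qed

lemma alg_nonneg: "submult v \<Longrightarrow> alg v g \<beta> \<Longrightarrow> 0 \<le> \<beta>"
  using alg_props[of v g \<beta>] norm_ge_zero order_trans by blast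

lemma alg_zero: "submult v \<Longrightarrow> 0 \<le> \<delta> \<Longrightarrow> alg v (\<lambda>x. 0) \<delta>"
  by (rule alg_piece[where r = 0 and D = 0]) (auto simp: freq_le_const)

lemma alg_mono: 
  assumes "submult v" "alg v g \<beta>" "\<beta> \<le> \<gamma>" shows "alg v g \<gamma>"
  using alg_add[OF assms(2) alg_zero[OF assms(1), of "\<gamma> - \<beta>"]] assms(3) by simp

lemma alg_const: "submult v \<Longrightarrow> alg v (\<lambda>x. c) (norm c)"
  by (rule alg_piece[where r = 0 and D = "norm c"]) (auto simp: freq_le_const submult_def)

text \<open>Nested induction over the two derivations. The essential case is that of two pieces:
  radii add, suprema multiply, and submultiplicativity of \<open>v\<close> closes the estimate. Sums
  and limits are compatible with a fixed second factor.\<close>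

lemma alg_mult:
  assumes v: "submult v" and g: "alg v g \<beta>" and h: "alg v h \<gamma>"
  shows "alg v (\<lambda>x. g x * h x) (\<beta> * \<gamma>)"
  using g
proof (induction rule: alg.induct)
  case (alg_piece g r D \<beta>)
  have D: "0 \<le> D" using alg_piece(3)[of undefined] norm_ge_zero order_trans by blast
  have vr: "1 \<le> v r" using v alg_piece by (simp add: submult_def)
  have b0: "0 \<le> \<beta>" using mult_nonneg_nonneg[of D "v r"] D vr alg_piece(4) by linarith
  from h show ?case
  proof (induction rule: alg.induct)
    case (alg_piece h s E \<gamma>)
    have E: "0 \<le> E" using alg_piece(3)[of undefined] norm_ge_zero order_trans by blast
    have vs: "1 \<le> v s" using v alg_piece by (simp add: submult_def)
    show ?case
    proof (rule alg.alg_piece[where r = "r + s" and D = "D * E"])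
      show "freq_le (\<lambda>x. g x * h x) (r + s)" by (rule freq_le_mult) fact+
      show "0 \<le> r + s" using \<open>0 \<le> r\<close> \<open>0 \<le> s\<close> by simp
      show "norm (g x * h x) \<le> D * E" for x unfolding norm_mult
        by (intro mult_mono) (use D \<open>\<And>x. norm (g x) \<le> D\<close> alg_piece(3) in auto)
      have "D * E * v (r + s) \<le> D * E * (v r * v s)"
        using v D E \<open>0 \<le> r\<close> \<open>0 \<le> s\<close> by (intro mult_left_mono) (auto simp: submult_def)
      also have "\<dots> = (D * v r) * (E * v s)" by (simp only: mult_ac)
      also have "\<dots> \<le> \<beta> * \<gamma>"
        using \<open>D * v r \<le> \<beta>\<close> alg_piece(4) b0 E vs by (intro mult_mono) auto
      finally show "D * E * v (r + s) \<le> \<beta> * \<gamma>" .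
    qed
  next
    case (alg_add h \<gamma> h' \<gamma>')
    from alg.alg_add[OF alg_add.IH] show ?case by (simp only: distrib_left)
  next
    case (alg_limit s \<gamma> h)
    show ?case
      by (rule alg.alg_limit[of v "\<lambda>n x. g x * s n x"]) (use alg_limit in \<open>auto intro!: tendsto_intros\<close>)
  qed
next
  case (alg_add g \<beta> g' \<beta>')
  from alg.alg_add[OF alg_add.IH] show ?case by (simp only: distrib_right)
next
  case (alg_limit s \<beta> g)
  show ?case
    by (rule alg.alg_limit[of v "\<lambda>n x. s n x * h x"]) (use alg_limit in \<open>auto intro!: tendsto_intros\<close>)
qed

lemma alg_sum:
  assumes v: "submult v" and "finite F" "\<And>k. k \<in> F \<Longrightarrow> alg v (g k) (\<beta> k)"
  shows "alg v (\<lambda>x. \<Sum>k\<in>F. g k x) (\<Sum>k\<in>F. \<beta> k)"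
  using assms(2,3) by (induction F rule: finite_induct) (auto intro: alg_zero[OF v] alg_add)

lemma alg_power:
  assumes v: "submult v" and g: "alg v g \<beta>"
  shows "alg v (\<lambda>x. g x ^ m) (\<beta> ^ m)"
proof (induction m)
  case 0 show ?case using alg_const[OF v, of 1] by simp
next
  case (Suc m) from alg_mult[OF v g Suc.IH] show ?case by simp
qed

text \<open>If the coefficients are dominated by those of the exponential series, all partial sums
  cost at most \<open>exp \<beta>\<close>, and limits keep the cost. This treats \<open>exp\<close>
  and \<open>expm1_quot\<close> at once.\<close>

lemma alg_power_series:
  assumes v: "submult v" and g: "alg v g \<beta>"
    and s: "\<And>z. (\<lambda>m. c m * z ^ m) sums f z" and c: "\<And>m. norm (c m) \<le> 1 / fact m"
  shows "alg v (\<lambda>x. f (g x)) (exp \<beta>)"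
proof (rule alg_limit)
  have b0: "0 \<le> \<beta>" by (rule alg_nonneg[OF v g])
  show "(\<lambda>n. \<Sum>m<n. c m * g x ^ m) \<longlonglongrightarrow> f (g x)" for x using s[of "g x"] by (simp add: sums_def)
  fix n
  have "alg v (\<lambda>x. \<Sum>m<n. c m * g x ^ m) (\<Sum>m<n. norm (c m) * \<beta> ^ m)"
    by (intro alg_sum[OF v] alg_mult[OF v] alg_const[OF v] alg_power[OF v g]) auto
  moreover have "(\<Sum>m<n. norm (c m) * \<beta> ^ m) \<le> exp \<beta>"
  proof -
    have e: "(\<lambda>m. \<beta> ^ m /\<^sub>R fact m) sums exp \<beta>" by (rule exp_converges)
    have "(\<Sum>m<n. norm (c m) * \<beta> ^ m) \<le> (\<Sum>m<n. \<beta> ^ m /\<^sub>R fact m)"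
    proof (rule sum_mono)
      fix m
      have "norm (c m) * \<beta> ^ m \<le> (1 / fact m) * \<beta> ^ m" using b0 c by (intro mult_right_mono) auto
      thus "norm (c m) * \<beta> ^ m \<le> \<beta> ^ m /\<^sub>R fact m" by (simp add: inverse_eq_divide)
    qed
    also have "\<dots> \<le> exp \<beta>"
      using sum_le_suminf[OF sums_summable[OF e], of "{..<n}"] sums_unique[OF e] b0 by simp
    finally show ?thesis .
  qed
  ultimately show "alg v (\<lambda>x. \<Sum>m<n. c m * g x ^ m) (exp \<beta>)" by (rule alg_mono[OF v])
qed

lemma alg_exp: "submult v \<Longrightarrow> alg v g \<beta> \<Longrightarrow> alg v (\<lambda>x. exp (g x)) (exp \<beta>)"
  by (rule alg_power_series[where c = "\<lambda>m. 1 / of_real (fact m)", OF _ _ exp_sums]) (auto simp: norm_divide)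

lemma norm_inverse_fact_Suc: "norm (1 / of_real (fact (Suc m)) :: complex) \<le> 1 / fact m"
proof -
  have "(fact m :: real) \<le> fact (Suc m)" by (rule fact_mono) simp
  thus ?thesis unfolding norm_divide norm_of_real by (intro frac_le) auto
qed

lemma alg_expm1_quot: "submult v \<Longrightarrow> alg v g \<beta> \<Longrightarrow> alg v (\<lambda>x. expm1_quot (g x)) (exp \<beta>)"
  by (rule alg_power_series[where c = "\<lambda>m. 1 / of_real (fact (Suc m))", OF _ _ expm1_quot_sums norm_inverse_fact_Suc])

text \<open>For a low-frequency \<open>g\<close> the crude bound \<open>exp \<parallel>g\<parallel>\<close> is too large. The first \<open>S\<close> terms
  of the series are summed up and estimated by the supremum \<open>D\<close> of \<open>f \<circ> g\<close> instead; the remaining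
  terms are small.\<close>

lemma alg_band_limited:
  assumes v: "submult v" and g: "freq_le g R" "\<And>x. norm (g x) \<le> B" and R: "0 \<le> R"
    and s: "\<And>z. (\<lambda>m. c m * z ^ m) sums f z" and c: "\<And>m. norm (c m) \<le> 1 / fact m"
    and D: "\<And>x. norm (f (g x)) \<le> D"
    and tail: "\<And>N. (\<Sum>m\<in>{S..<N}. B ^ m / fact m * v (real m * R)) \<le> \<tau>"
  shows "alg v (\<lambda>x. f (g x)) ((D + \<tau>) * v (real S * R) + \<tau>)"
proof (rule alg_limit)
  have B0: "0 \<le> B" using g(2)[of undefined] norm_ge_zero order_trans by blast
  have v1: "1 \<le> v (real m * R)" for m using v R by (simp add: submult_def)
  \<comment> \<open>As \<open>v\<close> is at least 1, the weighted tail also controls the plain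
    supremum of the tail; this is what bounds \<open>P\<close> by \<open>D + \<tau>\<close>.\<close>
  have tb: "norm (\<Sum>m\<in>{S..<N}. c m * g x ^ m) \<le> \<tau>" for N x
  proof -
    have "norm (\<Sum>m\<in>{S..<N}. c m * g x ^ m) \<le> (\<Sum>m\<in>{S..<N}. B ^ m / fact m * v (real m * R))"
    proof (rule sum_norm_le)
      fix m
      have "norm (c m * g x ^ m) \<le> (1 / fact m) * B ^ m"
        unfolding norm_mult norm_power using c g(2) by (intro mult_mono power_mono) auto
      also have "\<dots> = (B ^ m / fact m) * 1" by simp
      also have "\<dots> \<le> B ^ m / fact m * v (real m * R)" using v1 B0 by (intro mult_left_mono) auto
      finally show "norm (c m * g x ^ m) \<le> B ^ m / fact m * v (real m * R)" .
    qed
    thus ?thesis using tail[of N] by linarith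
  qed
  define P where "P = (\<lambda>x. \<Sum>m<S. c m * g x ^ m)"
  have Pb: "norm (P x) \<le> D + \<tau>" for x
  proof -
    have lim: "(\<lambda>n. \<Sum>m<n. c m * g x ^ m) \<longlonglongrightarrow> f (g x)" using s[of "g x"] by (simp add: sums_def)
    have "(\<lambda>n. norm ((\<Sum>m<n. c m * g x ^ m) - P x)) \<longlonglongrightarrow> norm (f (g x) - P x)"
      by (intro tendsto_intros lim)
    moreover have "norm ((\<Sum>m<n. c m * g x ^ m) - P x) \<le> \<tau>" if "S \<le> n" for n
    proof -
      have u: "{..<n} = {..<S} \<union> {S..<n}" using that by auto
      have "(\<Sum>m<n. c m * g x ^ m) = P x + (\<Sum>m\<in>{S..<n}. c m * g x ^ m)"
        unfolding P_def u by (rule sum.union_disjoint) auto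
      thus ?thesis using tb[of x n] by simp
    qed
    ultimately have "norm (f (g x) - P x) \<le> \<tau>" by (intro LIMSEQ_le_const2) auto
    moreover have "norm (P x) \<le> norm (f (g x)) + norm (f (g x) - P x)"
      using norm_triangle_ineq4[of "f (g x)" "f (g x) - P x"] by simp
    ultimately show ?thesis using D[of x] by linarith
  qed
  have Pa: "alg v P ((D + \<tau>) * v (real S * R))"
  proof (rule alg_piece)
    show "freq_le P (real S * R)" unfolding P_def
    proof (rule freq_le_sum)
      fix m assume "m \<in> {..<S}"
      hence "real m * R \<le> real S * R" using R by (intro mult_right_mono) auto
      thus "freq_le (\<lambda>x. c m * g x ^ m) (real S * R)"
        by (rule freq_le_mono[OF freq_le_cmult[OF freq_le_power[OF g(1)]]])
    qed (use R in auto)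
  qed (use R Pb in auto)
  show "(\<lambda>n. P x + (\<Sum>m\<in>{S..<S + n}. c m * g x ^ m)) \<longlonglongrightarrow> f (g x)" for x
  proof -
    have "(\<lambda>n. \<Sum>m<n. c m * g x ^ m) \<longlonglongrightarrow> f (g x)" using s[of "g x"] by (simp add: sums_def)
    hence "(\<lambda>n. \<Sum>m<n + S. c m * g x ^ m) \<longlonglongrightarrow> f (g x)" by (rule LIMSEQ_ignore_initial_segment)
    moreover have "(\<Sum>m<n + S. c m * g x ^ m) = P x + (\<Sum>m\<in>{S..<S + n}. c m * g x ^ m)" for n
    proof -
      have u: "{..<n + S} = {..<S} \<union> {S..<S + n}" by auto
      show ?thesis unfolding P_def u by (rule sum.union_disjoint) auto
    qed
    ultimately show ?thesis by simp
  qed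
  fix n
  have "alg v (\<lambda>x. \<Sum>m\<in>{S..<S + n}. c m * g x ^ m) (\<Sum>m\<in>{S..<S + n}. B ^ m / fact m * v (real m * R))"
  proof (rule alg_sum[OF v])
    fix m
    show "alg v (\<lambda>x. c m * g x ^ m) (B ^ m / fact m * v (real m * R))"
    proof (rule alg_piece)
      show "freq_le (\<lambda>x. c m * g x ^ m) (real m * R)" by (rule freq_le_cmult[OF freq_le_power[OF g(1)]])
      have "norm (c m * g x ^ m) \<le> (1 / fact m) * B ^ m" for x
        unfolding norm_mult norm_power using c g(2) by (intro mult_mono power_mono) auto
      thus "norm (c m * g x ^ m) \<le> B ^ m / fact m" for x by simp
    qed (use R in auto)
  qed simp
  from alg_add[OF Pa alg_mono[OF v this tail]]
  show "alg v (\<lambda>x. P x + (\<Sum>m\<in>{S..<S + n}. c m * g x ^ m)) ((D + \<tau>) * v (real S * R) + \<tau>)" .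
qed

end

section \<open>Weights on the lattice\<close>

text \<open>The discrete analogue of \<open>dec\<close>: a summable sequence, which becomes the
  convolution kernel between the weighted pieces of \<open>u\<close> and those of the composed
  function.\<close>

definition cw :: "int ^ 'n \<Rightarrow> real" where
  "cw h = (\<Prod>i\<in>UNIV. 1 / (1 + (real_of_int (h $ i))\<^sup>2))"

lemma cw_pos: "0 < cw h"
  unfolding cw_def by (intro prod_pos) (simp add: add_pos_nonneg)

text \<open>Each of the \<open>CARD('n)\<close> factors is at least (1 + r) ^ (-2); this fixes the
  exponent of the power in the gauge.\<close>

lemma cw_lower:
  fixes h :: "int ^ 'n"
  assumes "norm (lattice_point h) \<le> r"
  shows "1 \<le> (1 + r) ^ (2 * CARD('n)) * cw h"
proof -
  have r0: "0 \<le> r" using assms norm_ge_zero order_trans by blast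
  have "(\<Prod>i\<in>UNIV. 1 + (real_of_int (h $ i))\<^sup>2) \<le> (\<Prod>i\<in>(UNIV::'n set). (1 + r)\<^sup>2)"
  proof (intro prod_mono conjI)
    fix i
    show "0 \<le> 1 + (real_of_int (h $ i))\<^sup>2" by (simp add: add_nonneg_nonneg)
    have "\<bar>real_of_int (h $ i)\<bar> \<le> r" using component_le_norm_cart[of "lattice_point h" i] assms by simp
    hence "(real_of_int (h $ i))\<^sup>2 \<le> r\<^sup>2" using abs_le_square_iff[of "real_of_int (h $ i)" r] r0 by simp
    thus "1 + (real_of_int (h $ i))\<^sup>2 \<le> (1 + r)\<^sup>2" using r0 by (simp add: power2_sum)
  qed
  also have "\<dots> = (1 + r) ^ (2 * CARD('n))" by (simp add: power_mult)
  finally have "(\<Prod>i\<in>UNIV. 1 + (real_of_int (h $ i))\<^sup>2) \<le> (1 + r) ^ (2 * CARD('n))" .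
  moreover have "0 < (\<Prod>i\<in>UNIV. 1 + (real_of_int (h $ i))\<^sup>2)" by (intro prod_pos) (simp add: add_pos_nonneg)
  ultimately show ?thesis by (simp add: cw_def prod_dividef field_simps)
qed

abbreviation latw :: "int ^ 'n \<Rightarrow> real" where "latw k \<equiv> um_weight 1 (lattice_point k)"

lemma latw_pos: "0 < latw k" by (simp add: um_weight_def)

text \<open>The step from \<open>k\<close> to \<open>j\<close> is split into a fixed slack
  \<open>s\<close>, paid with a constant, and the radius \<open>r\<close>, paid with the gauge at a
  base point below \<open>jap (lattice_point k)\<close>. The power in the gauge is exchanged for
  \<open>cw (j - k)\<close>, which makes the comparison summable over \<open>k\<close>.\<close>

lemma latw_compare:
  fixes j k :: "int ^ 'n"
  assumes a: "ee \<le> a" "a \<le> jap (lattice_point k)" and r: "0 \<le> r" "0 \<le> s"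
    and near: "norm (lattice_point j - lattice_point k) \<le> s + r"
  shows "latw j \<le> (exp (QQ (ee + s)) * (1 + s) ^ (2 * CARD('n))) * gauge_fun (2 * CARD('n)) a r * cw (j - k) * latw k"
proof -
  let ?N = "2 * CARD('n)" and ?J = "jap (lattice_point k)"
  have J: "ee \<le> ?J" by (rule jap_ge_ee)
  have "jap (lattice_point j) \<le> ?J + norm (lattice_point j - lattice_point k)"
    using jap_add_le[of "lattice_point k" "lattice_point j - lattice_point k"] by simp
  also have "\<dots> \<le> ?J + s + r" using near by simp
  finally have "QQ (jap (lattice_point j)) \<le> QQ (?J + s + r)" by (intro QQ_mono jap_ge_ee)
  also have "\<dots> \<le> QQ ?J + QQ (ee + s) + (QQ (a + r) - QQ a)"
    using QQ_concave[of a "?J + s" r] QQ_concave[of ee ?J s] QQ_nonneg[of ee] a r J by auto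
  finally have 1: "latw j \<le> latw k * exp (QQ (ee + s)) * exp (QQ (a + r) - QQ a)"
    by (simp add: um_weight_QQ exp_add[symmetric])
  have "norm (lattice_point (j - k) :: real ^ 'n) \<le> s + r" using near by (simp add: lattice_point_diff)
  hence "1 \<le> (1 + (s + r)) ^ ?N * cw (j - k)" by (rule cw_lower)
  also have "\<dots> \<le> ((1 + s) * (1 + r)) ^ ?N * cw (j - k)"
    using r cw_pos[of "j - k"] by (intro mult_right_mono power_mono) (auto simp: algebra_simps)
  finally have 2: "1 \<le> (1 + s) ^ ?N * (1 + r) ^ ?N * cw (j - k)" by (simp add: power_mult_distrib)
  have "latw j * 1 \<le> (latw k * exp (QQ (ee + s)) * exp (QQ (a + r) - QQ a)) * ((1 + s) ^ ?N * (1 + r) ^ ?N * cw (j - k))"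
    using 1 2 latw_pos[of k] by (intro mult_mono) auto
  also have "\<dots> = (exp (QQ (ee + s)) * (1 + s) ^ ?N) * gauge_fun ?N a r * cw (j - k) * latw k"
    unfolding gauge_fun_def by (simp only: mult_ac)
  finally show ?thesis by simp
qed

context lattice_kernel
begin

definition Cd :: real where "Cd = exp (QQ (ee + 2 * d)) * (1 + 2 * d) ^ (2 * CARD('n))"

lemma Cd_nonneg: "0 \<le> Cd" using d_ge1 by (simp add: Cd_def)

text \<open>For a multiplier piece of radius \<open>r\<close> the filter at \<open>j\<close> gives
  zero unless \<open>j\<close> is within \<open>2 * d + r\<close> of \<open>k\<close>, and then the
  weights at \<open>j\<close> and \<open>k\<close> compare at the price of the gauge. The bound is
  linear in \<open>\<beta>\<close>, so sums inherit it; limits do by Fatou's lemma.\<close>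

lemma alg_filt_lp:
  assumes a: "ee \<le> a" "a \<le> jap (lattice_point k)" and p: "1 \<le> p"
    and z: "lp_le p z A" "spec z (cball (lattice_point k) (2 * d))" "bddm z"
    and g: "alg (gauge_fun (2 * CARD('n)) a) g \<beta>"
  shows "lp_le p (filt (lattice_point j) (\<lambda>x. g x * z x)) (\<kappa>1 * Cd * \<beta> * (A * cw (j - k) * latw k / latw j))"
  using g
proof (induction rule: alg.induct)
  case (alg_piece g r D \<beta>)
  let ?N = "2 * CARD('n)" and ?v = "gauge_fun (2 * CARD('n)) a"
  have v: "submult ?v" by (rule submult_gauge[OF a(1)])
  have D: "0 \<le> D" using alg_piece(3)[of undefined] norm_ge_zero order_trans by blast
  have A: "0 \<le> A" using z(1) by (simp add: lp_le_def)
  have vr: "1 \<le> ?v r" using v alg_piece by (simp add: submult_def)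
  have b0: "0 \<le> \<beta>" using mult_nonneg_nonneg[of D "?v r"] D vr alg_piece(4) by linarith
  let ?R = "\<kappa>1 * Cd * \<beta> * (A * cw (j - k) * latw k / latw j)"
  have gm: "(\<lambda>x. g x * z x) \<in> borel_measurable borel"
    using alg_piece(1) z(3) by (auto simp: freq_le_def bddm_def)
  have R0: "0 \<le> ?R" using \<kappa>1_nonneg Cd_nonneg b0 A cw_pos[of "j - k"] latw_pos[of k] latw_pos[of j] by simp
  show ?case
  proof (cases "norm (lattice_point j - lattice_point k) \<le> 2 * d + r")
    case False
    have "spec (\<lambda>x. g x * z x) (cball (lattice_point k) (2 * d + r))"
      using alg_piece(1) z by (simp add: freq_le_def)
    hence "filt (lattice_point j) (\<lambda>x. g x * z x) = (\<lambda>x. 0)"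
      using False by (auto simp: spec_def dist_norm norm_minus_commute fun_eq_iff)
    thus ?thesis using lp_le_mono[OF p lp_le_zero R0] by simp
  next
    case True
    have "lp_le p (\<lambda>x. g x * z x) (D * A)"
      by (rule lp_le_dominated[OF p z(1) gm D]) (use alg_piece(3) in \<open>simp add: norm_mult mult_right_mono\<close>)
    hence "lp_le p (filt (lattice_point j) (\<lambda>x. g x * z x)) (\<kappa>1 * (D * A))" by (rule filt_lp[OF p])
    moreover have "\<kappa>1 * (D * A) \<le> ?R"
    proof -
      have "latw j \<le> Cd * ?v r * cw (j - k) * latw k"
        unfolding Cd_def using latw_compare[OF a alg_piece(2) _ True] d_ge1 by simp
      hence "D * latw j \<le> D * (Cd * ?v r * cw (j - k) * latw k)" using D by (intro mult_left_mono)
      also have "\<dots> = (D * ?v r) * (Cd * cw (j - k) * latw k)" by (simp only: mult_ac)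
      also have "\<dots> \<le> \<beta> * (Cd * cw (j - k) * latw k)"
        using alg_piece(4) Cd_nonneg cw_pos[of "j - k"] latw_pos[of k] by (intro mult_right_mono) auto
      finally have "D \<le> \<beta> * (Cd * cw (j - k) * latw k) / latw j"
        using latw_pos[of j] by (simp add: pos_le_divide_eq)
      hence "(\<kappa>1 * A) * D \<le> (\<kappa>1 * A) * (\<beta> * (Cd * cw (j - k) * latw k) / latw j)"
        using \<kappa>1_nonneg A by (intro mult_left_mono) auto
      thus ?thesis by (simp add: mult_ac)
    qed
    ultimately show ?thesis by (rule lp_le_mono[OF p])
  qed
next
  case (alg_add g \<beta> h \<gamma>)
  have v: "submult (gauge_fun (2 * CARD('n)) a)" by (rule submult_gauge[OF a(1)])
  have l: "l1inf (\<lambda>x. f x * z x)" if "alg (gauge_fun (2 * CARD('n)) a) f \<gamma>" for f \<gamma>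
    using alg_props[OF v that] z(3) by (intro bddm_l1inf bddm_mult) (auto simp: bddm_def)
  have "filt (lattice_point j) (\<lambda>x. (g x + h x) * z x) = (\<lambda>y. filt (lattice_point j) (\<lambda>x. g x * z x) y + filt (lattice_point j) (\<lambda>x. h x * z x) y)"
    unfolding distrib_right using filt_add[OF l[OF alg_add.hyps(1)] l[OF alg_add.hyps(2)]] by (simp add: fun_eq_iff)
  thus ?case using lp_le_add[OF p alg_add.IH] by (simp only: distrib_left distrib_right)
next
  case (alg_limit s \<beta> h)
  have v: "submult (gauge_fun (2 * CARD('n)) a)" by (rule submult_gauge[OF a(1)])
  have sp: "s n \<in> borel_measurable borel" "norm (s n x) \<le> \<beta>" for n x
    using alg_props[OF v alg_limit.hyps(1)] by auto
  obtain Z where Z: "\<And>x. norm (z x) \<le> Z" using z(3) unfolding bddm_def by blast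
  have Z0: "0 \<le> Z" using Z[of undefined] norm_ge_zero order_trans by blast
  have b0: "0 \<le> \<beta>" using sp(2)[of 0 undefined] norm_ge_zero order_trans by blast
  have zm: "z \<in> borel_measurable borel" using z(3) by (simp add: bddm_def)
  show ?case
  proof (rule lp_le_Fatou[OF p])
    show "lp_le p (filt (lattice_point j) (\<lambda>x. s n x * z x)) (\<kappa>1 * Cd * \<beta> * (A * cw (j - k) * latw k / latw j))" for n
      by (rule alg_limit.IH)
    show "(\<lambda>n. filt (lattice_point j) (\<lambda>x. s n x * z x) y) \<longlonglongrightarrow> filt (lattice_point j) (\<lambda>x. h x * z x) y" for y
    proof (rule filt_limit[where C = "\<beta> * Z" and h = "\<lambda>x. 0"])
      show "norm (s n x * z x) \<le> \<beta> * Z + 0" for n x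
        using mult_mono[OF sp(2) Z b0] by (simp add: norm_mult)
      show "(\<lambda>n. s n x * z x) \<longlonglongrightarrow> h x * z x" for x by (intro tendsto_mult tendsto_const alg_limit.hyps(2))
      show "(\<lambda>x. s n x * z x) \<in> borel_measurable borel" for n using sp(1) zm by measurable
    qed (use b0 Z0 in auto)
    show "0 \<le> \<kappa>1 * Cd * \<beta> * (A * cw (j - k) * latw k / latw j)"
      using alg_limit.IH[of 0] by (simp add: lp_le_def)
  qed
qed

end

section \<open>The exponential of a decomposed function\<close>

text \<open>The bounds of the pieces and the convergence of their sums hold at every point;
  \<open>exists_decomposition\<close> achieves this by altering functions on a null set.
  \<open>A k\<close> bounds a piece in L^p and, thanks to Bernstein's inequality, in the supremum as
  well. Single pieces may be complex, only the sum is real.\<close>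

locale decomposition = lattice_kernel \<sigma> d for \<sigma> :: "real ^ 'n \<Rightarrow> real" and d +
  fixes p :: real and z :: "int ^ 'n \<Rightarrow> real ^ 'n \<Rightarrow> complex" and A :: "int ^ 'n \<Rightarrow> real" and u :: "real ^ 'n \<Rightarrow> real"
  assumes p: "1 \<le> p"
    and zfreq: "freq_le (z k) (norm (lattice_point k :: real ^ 'n) + d)"
    and zspec: "spec (z k) (cball (lattice_point k) (2 * d))"
    and zlp: "lp_le p (z k) (A k)"
    and zbd: "norm (z k x) \<le> A k"
    and Apoly: "\<exists>C. \<forall>F. finite F \<longrightarrow> (\<Sum>k\<in>F. A k * (1 + norm (lattice_point k :: real ^ 'n)) ^ M) \<le> C"
    and ulim: "(\<lambda>N. \<Sum>k\<in>cube N. z k x) \<longlonglongrightarrow> of_real (u x)"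
begin

abbreviation nm :: "int ^ 'n \<Rightarrow> real" where "nm k \<equiv> norm (lattice_point k :: real ^ 'n)"

lemma A_nonneg: "0 \<le> A k" using zlp by (simp add: lp_le_def)

lemma z_bddm: "bddm (z k)" using zfreq by (simp add: freq_le_def)

lemma z_meas [measurable]: "z k \<in> borel_measurable borel" using z_bddm by (simp add: bddm_def)

definition Cv :: real where
  "Cv = (exp (QQ (2 * ee)) + exp 1) * (exp (QQ (ee + d)) * (1 + d) ^ (2 * CARD('n)))"

lemma Cv_ge_1: "1 \<le> Cv"
proof -
  have e: "1 \<le> exp (QQ (ee + d))" using QQ_nonneg[of "ee + d"] d_ge1 by simp
  have "1 * (1 * 1) \<le> Cv" unfolding Cv_def
    using e d_ge1 exp_ge_add_one_self[of 1] by (intro mult_mono) (auto intro!: one_le_power add_increasing)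
  thus ?thesis by simp
qed

text \<open>The radius of \<open>z k\<close> is split into \<open>nm k\<close>, which is at most
  \<open>a\<close> so that the gauge is polynomial, and the constant \<open>d\<close>.\<close>

lemma gauge_radius:
  assumes a: "ee \<le> a" "nm k \<le> a"
  shows "gauge_fun (2 * CARD('n)) a (nm k + d) \<le> Cv * (1 + nm k) ^ (2 * CARD('n) + 1)"
proof -
  let ?N = "2 * CARD('n)"
  have "gauge_fun ?N a (nm k + d) \<le> gauge_fun ?N a (nm k) * gauge_fun ?N a d"
    using a d_ge1 by (intro gauge_fun_mult) auto
  also have "\<dots> \<le> ((exp (QQ (2*ee)) + exp 1) * (1 + nm k) ^ (?N + 1)) * (exp (QQ (ee + d)) * (1 + d) ^ ?N)"
    using a d_ge1 gauge_fun_ge_1[of a d ?N]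
    by (intro mult_mono gauge_fun_poly gauge_fun_le) (auto intro!: mult_nonneg_nonneg add_nonneg_nonneg)
  also have "\<dots> = Cv * (1 + nm k) ^ (?N + 1)" unfolding Cv_def by (simp only: mult_ac)
  finally show ?thesis .
qed

text \<open>The splitting radius \<open>R\<close> and the truncation order \<open>S\<close> are
  still free: \<open>hi\<close> keeps the exponent made of high pieces at cost at most 1,
  \<open>tail\<close> controls the series beyond \<open>S\<close>. In the bound, \<open>V\<close>
  majorises the gauge at radius \<open>S * R\<close> for every base point; one factor
  \<open>exp 1\<close> is the exponential of the high pieces already added, the other is
  \<open>expm1_quot\<close> of the current one.\<close>

lemma exp_estimate_fixed:
  fixes \<xi> R \<tau> A0 Y :: real and S :: nat
  defines "V \<equiv> exp (QQ (ee + real S * R)) * (1 + real S * R) ^ (2 * CARD('n))"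
  assumes R: "0 \<le> R"
    and hi: "\<And>F. finite F \<Longrightarrow> (\<And>k. k \<in> F \<Longrightarrow> R < nm k + d) \<Longrightarrow>
      \<bar>\<xi>\<bar> * (\<Sum>k\<in>F. A k * (Cv * (1 + nm k) ^ (2 * CARD('n) + 1))) \<le> 1"
    and A0: "\<And>F. finite F \<Longrightarrow> (\<Sum>k\<in>F. A k) \<le> A0"
    and tail: "\<And>a M. ee \<le> a \<Longrightarrow> (\<Sum>m\<in>{S..<M}. (\<bar>\<xi>\<bar> * A0) ^ m / fact m * gauge_fun (2 * CARD('n)) a (real m * R)) \<le> \<tau>"
    and Y: "\<And>F. finite F \<Longrightarrow> (\<Sum>k\<in>F. cw (j - k) * latw k * A k) \<le> Y"
  shows "lp_le p (filt (lattice_point j) (\<lambda>x. exp (\<i> * of_real (\<xi> * u x)) - 1))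
     (\<kappa>1 * Cd * (\<bar>\<xi>\<bar> * ((exp 1 + 2 * \<tau>) * V) * exp 1 * exp 1) * (Y / latw j))"
proof -
  let ?N = "2 * CARD('n)"
  let ?q = "\<lambda>k. A k * (Cv * (1 + nm k) ^ (?N + 1))"
  let ?v = "gauge_fun ?N"
  define B where "B = \<bar>\<xi>\<bar> * A0"
  define L where "L = {k. nm k + d \<le> R}"
  define G where "G = (\<lambda>x. \<i> * of_real \<xi> * (\<Sum>k\<in>L. z k x))"
  define \<beta> where "\<beta> = (exp 1 + 2 * \<tau>) * V"
  define t where "t = (\<lambda>k. A k * cw (j - k) * latw k / latw j)"
  have sm: "submult (?v a)" if "ee \<le> a" for a by (rule submult_gauge[OF that])
  have finL: "finite L"
  proof (rule finite_subset[OF _ finite_lattice_ball[of 0 R]])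
    show "L \<subseteq> {k. norm (lattice_point k - 0 :: real^'n) \<le> R}" using d_ge1 by (auto simp: L_def)
  qed
  have qA: "A k \<le> ?q k" for k
  proof -
    have "1 * 1 \<le> Cv * (1 + nm k) ^ (?N + 1)" using Cv_ge_1 by (intro mult_mono one_le_power) auto
    thus ?thesis using A_nonneg[of k] by (simp add: mult_le_cancel_left1)
  qed
  have A0_nonneg: "0 \<le> A0" using A0[of "{}"] by simp
  have \<tau>0: "0 \<le> \<tau>" using tail[of ee S] by simp
  have V1: "1 \<le> V"
  proof -
    have "1 * 1 \<le> V" unfolding V_def using R QQ_nonneg[of "ee + real S * R"] by (intro mult_mono one_le_power) auto
    thus ?thesis by simp
  qed
  have \<beta>0: "0 \<le> \<beta>" unfolding \<beta>_def using \<tau>0 V1 by (intro mult_nonneg_nonneg) auto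
  have zsum: "norm (\<Sum>k\<in>F. z k x) \<le> A0" if "finite F" for F x
    using order_trans[OF sum_norm_le[of F "\<lambda>k. z k x" A] A0[OF that]] zbd by blast
  have Gf: "freq_le G R" unfolding G_def
    by (intro freq_le_cmult freq_le_sum finL R) (use zfreq in \<open>auto simp: L_def intro: freq_le_mono\<close>)
  have GB: "norm (G x) \<le> B" for x
    unfolding G_def B_def norm_mult using zsum[OF finL, of x] by (simp add: mult_left_mono)
  \<comment> \<open>\<open>G\<close> need not be imaginary, as the pieces are complex. But
    \<open>\<i> * \<xi> * u\<close> is imaginary because \<open>u\<close> is real, and it differs
    from \<open>G\<close> by high pieces only, whose total modulus is at most 1 by
    \<open>hi\<close>.\<close>
  have GRe: "\<bar>Re (G x)\<bar> \<le> 1" for x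
  proof -
    obtain N0 where N0: "R \<le> real N0" using real_arch_simple by blast
    have "(\<lambda>N. \<bar>\<xi>\<bar> * norm ((\<Sum>k\<in>cube N. z k x) - (\<Sum>k\<in>L. z k x))) \<longlonglongrightarrow> \<bar>\<xi>\<bar> * norm (of_real (u x) - (\<Sum>k\<in>L. z k x))"
      by (intro tendsto_intros ulim)
    moreover have "\<bar>\<xi>\<bar> * norm ((\<Sum>k\<in>cube N. z k x) - (\<Sum>k\<in>L. z k x)) \<le> 1" if N: "N0 \<le> N" for N
    proof -
      have sub: "L \<subseteq> cube N" using N N0 d_ge1 by (auto simp: L_def intro!: norm_lattice_cube)
      have "(\<Sum>k\<in>cube N. z k x) - (\<Sum>k\<in>L. z k x) = (\<Sum>k\<in>cube N - L. z k x)"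
        by (rule sum_diff[OF finite_cube sub, symmetric])
      also have "norm \<dots> \<le> (\<Sum>k\<in>cube N - L. ?q k)"
        by (rule sum_norm_le) (use order_trans[OF zbd qA] in auto)
      finally have "\<bar>\<xi>\<bar> * norm ((\<Sum>k\<in>cube N. z k x) - (\<Sum>k\<in>L. z k x)) \<le> \<bar>\<xi>\<bar> * (\<Sum>k\<in>cube N - L. ?q k)"
        by (intro mult_left_mono) auto
      also have "\<dots> \<le> 1" by (rule hi) (auto simp: finite_cube L_def)
      finally show ?thesis .
    qed
    ultimately have "\<bar>\<xi>\<bar> * norm (of_real (u x) - (\<Sum>k\<in>L. z k x)) \<le> 1"
      by (intro LIMSEQ_le_const2) blast+
    moreover have "\<bar>Re (G x)\<bar> = \<bar>\<xi>\<bar> * \<bar>Im (of_real (u x) - (\<Sum>k\<in>L. z k x))\<bar>"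
      by (simp add: G_def abs_mult)
    moreover have "\<bar>\<xi>\<bar> * \<bar>Im (of_real (u x) - (\<Sum>k\<in>L. z k x))\<bar> \<le> \<bar>\<xi>\<bar> * norm (of_real (u x) - (\<Sum>k\<in>L. z k x))"
      by (intro mult_left_mono abs_Im_le_cmod) auto
    ultimately show ?thesis by linarith
  qed
  have vV: "?v a (real S * R) \<le> V" if "ee \<le> a" for a unfolding V_def using that R by (intro gauge_fun_le) auto
  \<comment> \<open>Since \<open>V\<close> does not depend on the base point, functions of
    \<open>G\<close> have the same cost \<open>\<beta>\<close> in all the algebras that occur
    below.\<close>
  have band: "alg (?v a) (\<lambda>x. f (G x)) \<beta>"
    if a: "ee \<le> a" and f: "\<And>w. (\<lambda>m. c m * w ^ m) sums f w" "\<And>m. norm (c m) \<le> 1 / fact m" "\<And>w. \<bar>Re w\<bar> \<le> 1 \<Longrightarrow> norm (f w) \<le> exp 1" for a f c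
  proof (rule alg_mono[OF sm[OF a]])
    show "alg (?v a) (\<lambda>x. f (G x)) ((exp 1 + \<tau>) * ?v a (real S * R) + \<tau>)"
      by (rule alg_band_limited[OF sm[OF a] Gf GB R f(1,2)]) (use f(3)[OF GRe] tail[OF a] in \<open>auto simp: B_def\<close>)
    have "(exp 1 + \<tau>) * ?v a (real S * R) + \<tau> \<le> (exp 1 + \<tau>) * V + \<tau> * V"
      using vV[OF a] V1 \<tau>0 by (intro add_mono mult_left_mono) (auto simp: mult_le_cancel_left1)
    also have "\<dots> = \<beta>" unfolding \<beta>_def by (simp add: algebra_simps)
    finally show "(exp 1 + \<tau>) * ?v a (real S * R) + \<tau> \<le> \<beta>" .
  qed
  have E1: "alg (?v a) (\<lambda>x. exp (G x)) \<beta>" if "ee \<le> a" for a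
    by (rule band[OF that exp_sums]) (auto simp: norm_divide)
  have E2: "alg (?v a) (\<lambda>x. expm1_quot (G x)) \<beta>" if "ee \<le> a" for a
    by (rule band[OF that expm1_quot_sums norm_inverse_fact_Suc norm_expm1_quot_le])
  let ?B2 = "\<bar>\<xi>\<bar> * \<beta> * exp 1 * exp 1"
  have t0: "0 \<le> t k" for k unfolding t_def
    using A_nonneg[of k] cw_pos[of "j - k"] latw_pos[of k] latw_pos[of j] by simp
  have Gm [measurable]: "G \<in> borel_measurable borel" using Gf by (simp add: freq_le_def bddm_def)
  have algl: "l1inf (\<lambda>x. g x * z k x)" if "ee \<le> a" "alg (?v a) g \<gamma>" for a g \<gamma> k
    using alg_props[OF sm[OF that(1)] that(2)] z_bddm[of k] by (intro bddm_l1inf bddm_mult) (auto simp: bddm_def)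
  have low: "lp_le p (filt (lattice_point j) (\<lambda>x. exp (G x) - 1)) (\<Sum>k\<in>L. \<kappa>1 * Cd * ?B2 * t k)"
  proof -
    have ge: "ee \<le> ee" by simp
    have al: "alg (?v ee) (\<lambda>x. \<i> * of_real \<xi> * expm1_quot (G x)) (\<bar>\<xi>\<bar> * \<beta>)"
      using alg_mult[OF sm[OF ge] alg_const[OF sm[OF ge], of "\<i> * of_real \<xi>"] E2[OF ge]] by (simp add: norm_mult)
    have "exp (G x) - 1 = (\<Sum>k\<in>L. \<i> * of_real \<xi> * expm1_quot (G x) * z k x)" for x
      unfolding expm1_quot_mult[symmetric] sum_distrib_left[symmetric] by (simp add: G_def mult_ac)
    hence "filt (lattice_point j) (\<lambda>x. exp (G x) - 1) = (\<lambda>y. \<Sum>k\<in>L. filt (lattice_point j) (\<lambda>x. \<i> * of_real \<xi> * expm1_quot (G x) * z k x) y)"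
      using filt_sum[OF finL, of "\<lambda>k x. \<i> * of_real \<xi> * expm1_quot (G x) * z k x"] algl[OF ge al] by (simp add: fun_eq_iff)
    moreover have "lp_le p (\<lambda>y. \<Sum>k\<in>L. filt (lattice_point j) (\<lambda>x. \<i> * of_real \<xi> * expm1_quot (G x) * z k x) y) (\<Sum>k\<in>L. \<kappa>1 * Cd * ?B2 * t k)"
    proof (rule lp_le_sum[OF p finL])
      fix k
      have "lp_le p (filt (lattice_point j) (\<lambda>x. \<i> * of_real \<xi> * expm1_quot (G x) * z k x)) (\<kappa>1 * Cd * (\<bar>\<xi>\<bar> * \<beta>) * t k)"
        unfolding t_def by (rule alg_filt_lp[OF ge jap_ge_ee p zlp zspec z_bddm al])
      \<comment> \<open>The factor \<open>exp 1 * exp 1\<close> is inserted so that low and high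
        terms carry the same constant.\<close>
      moreover have "\<kappa>1 * Cd * (\<bar>\<xi>\<bar> * \<beta>) * t k \<le> \<kappa>1 * Cd * ?B2 * t k"
      proof -
        have "(\<bar>\<xi>\<bar> * \<beta>) * (1 * 1) \<le> (\<bar>\<xi>\<bar> * \<beta>) * (exp 1 * exp 1)"
          using \<beta>0 by (intro mult_left_mono mult_mono) auto
        hence "\<bar>\<xi>\<bar> * \<beta> \<le> ?B2" by (simp add: mult.assoc)
        thus ?thesis using \<kappa>1_nonneg Cd_nonneg t0[of k] by (intro mult_right_mono mult_left_mono) auto
      qed
      ultimately show "lp_le p (filt (lattice_point j) (\<lambda>x. \<i> * of_real \<xi> * expm1_quot (G x) * z k x)) (\<kappa>1 * Cd * ?B2 * t k)"
        by (rule lp_le_mono[OF p])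
    qed
    ultimately show ?thesis by simp
  qed
  have piece: "alg (?v a) (\<lambda>x. \<i> * of_real \<xi> * z k x) (\<bar>\<xi>\<bar> * ?q k)" if a: "ee \<le> a" "nm k \<le> a" for a k
  proof (rule alg_piece)
    show "freq_le (\<lambda>x. \<i> * of_real \<xi> * z k x) (nm k + d)" by (rule freq_le_cmult[OF zfreq])
    show "0 \<le> nm k + d" using d_ge1 by (simp add: add_nonneg_nonneg)
    show "norm (\<i> * of_real \<xi> * z k x) \<le> \<bar>\<xi>\<bar> * A k" for x
      using zbd[of k x] by (simp add: norm_mult mult_left_mono)
    show "\<bar>\<xi>\<bar> * A k * ?v a (nm k + d) \<le> \<bar>\<xi>\<bar> * ?q k"
      using gauge_radius[OF a] A_nonneg[of k] by (simp add: mult.assoc mult_left_mono)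
  qed
  have bdd_exp: "bddm (\<lambda>x. exp (\<i> * of_real \<xi> * (\<Sum>k\<in>F. z k x)))" if F: "finite F" for F
    unfolding bddm_def
  proof (intro conjI exI allI)
    show "(\<lambda>x. exp (\<i> * of_real \<xi> * (\<Sum>k\<in>F. z k x))) \<in> borel_measurable borel" by measurable
    fix x
    have "norm (\<i> * of_real \<xi> * (\<Sum>k\<in>F. z k x)) \<le> B"
      unfolding norm_mult B_def using zsum[OF F, of x] by (simp add: mult_left_mono)
    thus "norm (exp (\<i> * of_real \<xi> * (\<Sum>k\<in>F. z k x))) \<le> exp B"
      using norm_exp[of "\<i> * of_real \<xi> * (\<Sum>k\<in>F. z k x)"] by (meson exp_le_cancel_iff order_trans)
  qed
  \<comment> \<open>High pieces are added in the order of increasing frequency, \<open>x0\<close>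
    being the largest so far. The base point \<open>jap (lattice_point x0)\<close> then dominates
    the centre frequencies of all high pieces in the new multiplier, which keeps their gauge
    polynomial.\<close>
  have high: "T \<inter> L = {} \<longrightarrow> lp_le p (filt (lattice_point j) (\<lambda>x. exp (\<i> * of_real \<xi> * (\<Sum>k\<in>L \<union> T. z k x)) - 1)) (\<Sum>k\<in>L \<union> T. \<kappa>1 * Cd * ?B2 * t k)"
    if "finite T" for T
    using that
  proof (induction T rule: finite_ranking_induct[where f = nm])
    case empty
    show ?case using low by (simp add: G_def)
  next
    case (insert x0 T)
    show ?case
    proof (cases "x0 \<in> T")
      case True
      thus ?thesis using insert.IH by (simp add: insert_absorb)
    next
      case False
      show ?thesis
      proof
        assume dis: "insert x0 T \<inter> L = {}"
        hence dis': "T \<inter> L = {}" "x0 \<notin> L" by auto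
        let ?a = "jap (lattice_point x0 :: real ^ 'n)"
        have a: "ee \<le> ?a" by (rule jap_ge_ee)
        have na: "nm k \<le> ?a" if "k \<in> insert x0 T" for k
        proof -
          have "nm k \<le> nm x0" using that insert.hyps(2) by auto
          thus ?thesis using jap_ge_norm[of "lattice_point x0 :: real ^ 'n"] by linarith
        qed
        have hiT: "\<bar>\<xi>\<bar> * (\<Sum>k\<in>F. ?q k) \<le> 1" if "F \<subseteq> insert x0 T" "finite F" for F
          by (rule hi[OF that(2)]) (use dis that in \<open>auto simp: L_def not_le[symmetric]\<close>)
        let ?U = "\<lambda>x. \<Sum>k\<in>T. \<i> * of_real \<xi> * z k x"
        let ?g = "\<lambda>x. exp (G x) * (exp (?U x) * (\<i> * of_real \<xi> * expm1_quot (\<i> * of_real \<xi> * z x0 x)))"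
        have aU: "alg (?v ?a) ?U 1"
        proof (rule alg_mono[OF sm[OF a]])
          show "alg (?v ?a) ?U (\<Sum>k\<in>T. \<bar>\<xi>\<bar> * ?q k)"
            by (rule alg_sum[OF sm[OF a] insert.hyps(1)], rule piece[OF a na]) simp
          show "(\<Sum>k\<in>T. \<bar>\<xi>\<bar> * ?q k) \<le> 1"
            unfolding sum_distrib_left[symmetric] by (rule hiT) (use insert.hyps in auto)
        qed
        have az: "alg (?v ?a) (\<lambda>x. \<i> * of_real \<xi> * z x0 x) 1"
          by (rule alg_mono[OF sm[OF a] piece[OF a na]]) (use hiT[of "{x0}"] in auto)
        have ag: "alg (?v ?a) ?g (\<beta> * (exp 1 * (\<bar>\<xi>\<bar> * exp 1)))"
        proof (rule alg_mult[OF sm[OF a] E1[OF a]], rule alg_mult[OF sm[OF a] alg_exp[OF sm[OF a] aU]])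
          show "alg (?v ?a) (\<lambda>x. \<i> * of_real \<xi> * expm1_quot (\<i> * of_real \<xi> * z x0 x)) (\<bar>\<xi>\<bar> * exp 1)"
            using alg_mult[OF sm[OF a] alg_const[OF sm[OF a], of "\<i> * of_real \<xi>"] alg_expm1_quot[OF sm[OF a] az]] by (simp add: norm_mult)
        qed
        have est: "lp_le p (filt (lattice_point j) (\<lambda>x. ?g x * z x0 x)) (\<kappa>1 * Cd * ?B2 * t x0)"
        proof -
          have "\<beta> * (exp 1 * (\<bar>\<xi>\<bar> * exp 1)) = ?B2" by (simp only: mult_ac)
          thus ?thesis using alg_filt_lp[OF a order_refl p zlp zspec z_bddm ag, of j] by (simp only: t_def)
        qed
        \<comment> \<open>The telescoping step: the increment is the previous exponential times
          \<open>exp ?w - 1\<close>, which equals \<open>?w * expm1_quot ?w\<close>. The factor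
          \<open>z x0 x\<close> is set apart, since it carries the L^p bound, and the rest is the
          multiplier \<open>?g\<close>.\<close>
        have dec: "exp (\<i> * of_real \<xi> * (\<Sum>k\<in>L \<union> insert x0 T. z k x)) - 1
          = (exp (\<i> * of_real \<xi> * (\<Sum>k\<in>L \<union> T. z k x)) - 1) + ?g x * z x0 x" for x
        proof -
          let ?w = "\<i> * of_real \<xi> * z x0 x"
          have s1: "\<i> * of_real \<xi> * (\<Sum>k\<in>L \<union> T. z k x) = G x + ?U x"
            unfolding G_def sum_distrib_left[symmetric]
            using dis' finL insert.hyps(1) by (subst sum.union_disjoint) (auto simp: distrib_left)
          have "(\<Sum>k\<in>L \<union> insert x0 T. z k x) = z x0 x + (\<Sum>k\<in>L \<union> T. z k x)"
            using dis' False finL insert.hyps(1) by simp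
          hence s2: "\<i> * of_real \<xi> * (\<Sum>k\<in>L \<union> insert x0 T. z k x) = (G x + ?U x) + ?w"
            using s1 by (simp add: distrib_left)
          have "?g x * z x0 x = exp (G x) * exp (?U x) * (?w * expm1_quot ?w)" by (simp only: mult_ac)
          also have "\<dots> = exp (G x) * exp (?U x) * (exp ?w - 1)" by (simp only: expm1_quot_mult)
          finally show ?thesis unfolding s1 s2 exp_add by (simp add: algebra_simps)
        qed
        have l1: "l1inf (\<lambda>x. exp (\<i> * of_real \<xi> * (\<Sum>k\<in>L \<union> T. z k x)) - 1)"
          using insert.hyps(1) finL by (intro l1inf_diff bddm_l1inf bdd_exp bddm_const) auto
        have l2: "l1inf (\<lambda>x. ?g x * z x0 x)" by (rule algl[OF a ag])
        have fe: "filt (lattice_point j) (\<lambda>x. exp (\<i> * of_real \<xi> * (\<Sum>k\<in>L \<union> insert x0 T. z k x)) - 1)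
          = (\<lambda>y. filt (lattice_point j) (\<lambda>x. exp (\<i> * of_real \<xi> * (\<Sum>k\<in>L \<union> T. z k x)) - 1) y + filt (lattice_point j) (\<lambda>x. ?g x * z x0 x) y)"
          unfolding dec using filt_add[OF l1 l2] by (simp only: fun_eq_iff) simp
        have "(\<Sum>k\<in>L \<union> insert x0 T. \<kappa>1 * Cd * ?B2 * t k) = (\<Sum>k\<in>L \<union> T. \<kappa>1 * Cd * ?B2 * t k) + \<kappa>1 * Cd * ?B2 * t x0"
          using dis' False finL insert.hyps(1) by simp
        thus "lp_le p (filt (lattice_point j) (\<lambda>x. exp (\<i> * of_real \<xi> * (\<Sum>k\<in>L \<union> insert x0 T. z k x)) - 1)) (\<Sum>k\<in>L \<union> insert x0 T. \<kappa>1 * Cd * ?B2 * t k)"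
          unfolding fe using lp_le_add[OF p insert.IH[rule_format, OF dis'(1)] est] by (simp only:)
      qed
    qed
  qed
  let ?C = "\<kappa>1 * Cd * ?B2 * (Y / latw j)"
  have tY: "(\<Sum>k\<in>F. \<kappa>1 * Cd * ?B2 * t k) \<le> ?C" if "finite F" for F
  proof -
    have "(\<Sum>k\<in>F. t k) = (\<Sum>k\<in>F. cw (j - k) * latw k * A k) / latw j"
      unfolding t_def sum_divide_distrib by (intro sum.cong refl) (simp add: mult_ac)
    also have "\<dots> \<le> Y / latw j" using Y[OF that] latw_pos[of j] by (intro divide_right_mono) auto
    finally have "(\<Sum>k\<in>F. t k) \<le> Y / latw j" .
    hence "\<kappa>1 * Cd * ?B2 * (\<Sum>k\<in>F. t k) \<le> ?C"
      using \<kappa>1_nonneg Cd_nonneg \<beta>0 by (intro mult_left_mono) auto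
    thus ?thesis by (simp only: sum_distrib_left)
  qed
  obtain N0 where N0: "R \<le> real N0" using real_arch_simple by blast
  have sub: "L \<subseteq> cube (N0 + n)" for n using N0 d_ge1 by (auto simp: L_def intro!: norm_lattice_cube)
  have main: "lp_le p (filt (lattice_point j) (\<lambda>x. exp (\<i> * of_real \<xi> * (\<Sum>k\<in>cube (N0 + n). z k x)) - 1)) ?C" for n
  proof -
    have "L \<union> (cube (N0 + n) - L) = cube (N0 + n)" using sub[of n] by blast
    thus ?thesis
      using high[of "cube (N0 + n) - L"] finite_cube[of "N0 + n"] lp_le_mono[OF p _ tY[OF finite_cube[of "N0 + n"]]] by auto
  qed
  have "lp_le p (filt (lattice_point j) (\<lambda>x. exp (\<i> * of_real (\<xi> * u x)) - 1)) ?C"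
  proof (rule lp_le_Fatou[OF p main])
    show "0 \<le> ?C" using main[of 0] by (simp add: lp_le_def)
    fix y
    show "(\<lambda>n. filt (lattice_point j) (\<lambda>x. exp (\<i> * of_real \<xi> * (\<Sum>k\<in>cube (N0 + n). z k x)) - 1) y) \<longlonglongrightarrow> filt (lattice_point j) (\<lambda>x. exp (\<i> * of_real (\<xi> * u x)) - 1) y"
    proof (rule filt_limit[where C = "exp B + 1" and h = "\<lambda>x. 0"])
      show "(\<lambda>x. exp (\<i> * of_real \<xi> * (\<Sum>k\<in>cube (N0 + n). z k x)) - 1) \<in> borel_measurable borel" for n by measurable
      show "norm (exp (\<i> * of_real \<xi> * (\<Sum>k\<in>cube (N0 + n). z k x)) - 1) \<le> exp B + 1 + 0" for n x
      proof -
        have "norm (\<i> * of_real \<xi> * (\<Sum>k\<in>cube (N0 + n). z k x)) \<le> B"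
          unfolding norm_mult B_def using zsum[OF finite_cube[of "N0 + n"], of x] by (simp add: mult_left_mono)
        hence "norm (exp (\<i> * of_real \<xi> * (\<Sum>k\<in>cube (N0 + n). z k x))) \<le> exp B"
          using norm_exp[of "\<i> * of_real \<xi> * (\<Sum>k\<in>cube (N0 + n). z k x)"] by (meson exp_le_cancel_iff order_trans)
        moreover have "norm (exp (\<i> * of_real \<xi> * (\<Sum>k\<in>cube (N0 + n). z k x)) - 1) \<le> norm (exp (\<i> * of_real \<xi> * (\<Sum>k\<in>cube (N0 + n). z k x))) + 1"
          using norm_triangle_ineq4[of "exp (\<i> * of_real \<xi> * (\<Sum>k\<in>cube (N0 + n). z k x))" 1] by (simp only: norm_one)
        ultimately show ?thesis by linarith
      qed
      fix x
      have "(\<lambda>n. \<Sum>k\<in>cube (n + N0). z k x) \<longlonglongrightarrow> of_real (u x)" by (rule LIMSEQ_ignore_initial_segment[OF ulim])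
      hence "(\<lambda>n. exp (\<i> * of_real \<xi> * (\<Sum>k\<in>cube (N0 + n). z k x)) - 1) \<longlonglongrightarrow> exp (\<i> * of_real \<xi> * of_real (u x)) - 1"
        by (intro tendsto_intros) (simp add: add.commute)
      thus "(\<lambda>n. exp (\<i> * of_real \<xi> * (\<Sum>k\<in>cube (N0 + n). z k x)) - 1) \<longlonglongrightarrow> exp (\<i> * of_real (\<xi> * u x)) - 1"
        by (simp add: mult.assoc)
    qed auto
  qed
  thus ?thesis by (simp only: \<beta>_def)
qed

text \<open>The choice of parameters: \<open>S\<close> is of size \<bar>\<xi>\<bar> and
  \<open>R = S powr \<epsilon>\<close>, so that \<open>S * R\<close> is
  \<open>S powr (1 + \<epsilon>)\<close>, the argument of the weight up to a dilation. Then
  \<open>weight_dominates\<close> absorbs the power in \<open>V\<close> and the factor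
  \<bar>\<xi>\<bar>.\<close>

theorem exp_estimate:
  assumes \<epsilon>: "0 < \<epsilon>" and \<theta>: "1 < \<theta>"
  shows "\<exists>C\<ge>0. \<exists>l>0. \<forall>\<xi> j Y. (\<forall>F. finite F \<longrightarrow> (\<Sum>k\<in>F. cw (j - k) * latw k * A k) \<le> Y) \<longrightarrow>
     lp_le p (filt (lattice_point j) (\<lambda>x. exp (\<i> * of_real (\<xi> * u x)) - 1)) (C * um_weight \<theta> (l * \<bar>\<xi>\<bar> powr (1 + \<epsilon>)) * (Y / latw j))"
proof -
  let ?N = "2 * CARD('n)"
  obtain A0 where A0: "\<And>F. finite F \<Longrightarrow> (\<Sum>k\<in>F. A k) \<le> A0" using Apoly[of 0] by auto
  have A0_nonneg: "0 \<le> A0" using A0[of "{}"] by simp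
  \<comment> \<open>For a piece beyond \<open>R\<close> one gets
    \<open>S \<le> D * (1 + nm k) ^ q\<close>; thus \<open>q\<close> additional moments gain the
    factor \<open>1 / S\<close> that compensates \<bar>\<xi>\<bar>.\<close>
  obtain q :: nat where q: "1 / \<epsilon> \<le> real q" using real_arch_simple by blast
  obtain C1 where C1: "\<And>F. finite F \<Longrightarrow> (\<Sum>k\<in>F. A k * (1 + nm k) ^ (?N + 1 + q)) \<le> C1" using Apoly[of "?N + 1 + q"] by blast
  have C1_nonneg: "0 \<le> C1" using C1[of "{}"] by simp
  obtain Cs where Cs: "0 \<le> Cs" "\<And>y. 1 \<le> y \<Longrightarrow> exp (QQ (ee + y powr (1 + \<epsilon>))) * (1 + y powr (1 + \<epsilon>)) ^ ?N \<le> Cs * exp y"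
    using exp_QQ_subexp[of "1 + \<epsilon>" ?N] \<epsilon> by auto
  \<comment> \<open>Each weighted term of the tail is at most \<open>Cs * exp (- m)\<close>, and
    these exponentials sum to at most 2.\<close>
  define \<tau> where "\<tau> = 2 * Cs"
  define D where "D = (1 + d) powr (1 / \<epsilon>)"
  \<comment> \<open>One summand for each demand on \<open>S\<close>: at least 1, at least
    \<open>exp 3 * \<bar>\<xi>\<bar> * A0\<close> for the tail of the series, and at least
    \<open>Cv * C1 * D * \<bar>\<xi>\<bar>\<close> for the high pieces.\<close>
  define c0 where "c0 = 1 + exp 3 * A0 + Cv * C1 * D"
  have D0: "0 \<le> D" by (simp add: D_def)
  have CvC: "0 \<le> Cv * C1 * D" using Cv_ge_1 C1_nonneg D0 by simp
  have c0: "1 \<le> c0" "exp 3 * A0 \<le> c0" "Cv * C1 * D \<le> c0" using A0_nonneg CvC by (auto simp: c0_def)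
  obtain C2 where C2: "0 \<le> C2" "\<And>\<xi> x. 0 \<le> x \<Longrightarrow> x \<le> (c0 + 1) * (1 + \<bar>\<xi>\<bar>) \<Longrightarrow>
     exp (QQ (ee + x powr (1+\<epsilon>))) * (1 + x powr (1+\<epsilon>)) ^ ?N * (1 + \<bar>\<xi>\<bar>)
     \<le> C2 * um_weight \<theta> ((2*(c0+1)+1) powr (1+\<epsilon>) * \<bar>\<xi>\<bar> powr (1+\<epsilon>))"
    using weight_dominates[OF \<epsilon> \<theta>, of "c0 + 1" ?N] c0 by auto
  let ?l = "(2*(c0+1)+1) powr (1+\<epsilon>)"
  let ?K = "\<kappa>1 * Cd * ((exp 1 + 2 * \<tau>) * exp 1 * exp 1)"
  have K0: "0 \<le> ?K" using \<kappa>1_nonneg Cd_nonneg Cs by (simp add: \<tau>_def)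
  show ?thesis
  proof (rule exI[of _ "?K * C2"], rule conjI, use K0 C2 in simp, rule exI[of _ ?l], intro conjI allI impI)
    show "0 < ?l" using c0 by simp
    fix \<xi> j Y assume Y: "\<forall>F. finite F \<longrightarrow> (\<Sum>k\<in>F. cw (j - k) * latw k * A k) \<le> Y"
    define S where "S = nat \<lceil>c0 * (1 + \<bar>\<xi>\<bar>)\<rceil>"
    define R where "R = real S powr \<epsilon>"
    have cx: "1 \<le> c0 * (1 + \<bar>\<xi>\<bar>)" using mult_mono[of 1 c0 1 "1 + \<bar>\<xi>\<bar>"] c0 by simp
    have S: "c0 * (1 + \<bar>\<xi>\<bar>) \<le> real S" "real S \<le> c0 * (1 + \<bar>\<xi>\<bar>) + 1" using cx by (auto simp: S_def)
    have S1: "1 \<le> real S" using S cx by linarith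
    have SR: "real S * R = real S powr (1 + \<epsilon>)" using S1 by (simp add: R_def powr_add)
    have Y0: "0 \<le> Y" using Y[rule_format, of "{}"] by simp
    let ?V = "exp (QQ (ee + real S * R)) * (1 + real S * R) ^ ?N"
    have est: "lp_le p (filt (lattice_point j) (\<lambda>x. exp (\<i> * of_real (\<xi> * u x)) - 1))
       (\<kappa>1 * Cd * (\<bar>\<xi>\<bar> * ((exp 1 + 2 * \<tau>) * ?V) * exp 1 * exp 1) * (Y / latw j))"
    proof (rule exp_estimate_fixed[where ?A0.0 = A0])
      show "(\<Sum>k\<in>F. A k) \<le> A0" if "finite F" for F by (rule A0[OF that])
      show "0 \<le> R" by (simp add: R_def)
      show "(\<Sum>k\<in>F. cw (j - k) * latw k * A k) \<le> Y" if "finite F" for F using Y that by blast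
    next
      fix F assume F: "finite F" "\<And>k. k \<in> F \<Longrightarrow> R < nm k + d"
      have "A k * (Cv * (1 + nm k) ^ (?N + 1)) \<le> (Cv * D / real S) * (A k * (1 + nm k) ^ (?N + 1 + q))" if k: "k \<in> F" for k
      proof -
        have "0 \<le> nm k * d" using d_ge1 by (intro mult_nonneg_nonneg) auto
        moreover have "(1 + nm k) * (1 + d) = 1 + d + nm k + nm k * d" by (simp add: algebra_simps)
        ultimately have "R \<le> (1 + nm k) * (1 + d)" using F(2)[OF k] by linarith
        hence "R powr (1/\<epsilon>) \<le> ((1 + nm k) * (1 + d)) powr (1/\<epsilon>)" using \<epsilon> by (intro powr_mono2) (auto simp: R_def)
        also have "R powr (1/\<epsilon>) = real S" using \<epsilon> by (simp add: R_def powr_powr)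
        also have "((1 + nm k) * (1 + d)) powr (1/\<epsilon>) = (1 + nm k) powr (1/\<epsilon>) * D" unfolding D_def using d_ge1 by (simp add: powr_mult)
        also have "\<dots> \<le> (1 + nm k) ^ q * D"
        proof (rule mult_right_mono[OF _ D0])
          have "(1 + nm k) powr (1/\<epsilon>) \<le> (1 + nm k) powr (real q)" using q by (intro powr_mono) auto
          thus "(1 + nm k) powr (1/\<epsilon>) \<le> (1 + nm k) ^ q" by (simp add: powr_realpow add_pos_nonneg)
        qed
        finally have "1 \<le> (1 + nm k) ^ q * D / real S" using S1 by (simp add: le_divide_eq)
        hence "(A k * (Cv * (1 + nm k) ^ (?N + 1))) * 1 \<le> (A k * (Cv * (1 + nm k) ^ (?N + 1))) * ((1 + nm k) ^ q * D / real S)"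
          using A_nonneg[of k] Cv_ge_1 by (intro mult_left_mono) auto
        thus ?thesis by (simp add: power_add mult_ac)
      qed
      hence "(\<Sum>k\<in>F. A k * (Cv * (1 + nm k) ^ (?N + 1))) \<le> (Cv * D / real S) * (\<Sum>k\<in>F. A k * (1 + nm k) ^ (?N + 1 + q))"
        unfolding sum_distrib_left by (rule sum_mono)
      also have "\<dots> \<le> (Cv * D / real S) * C1"
        using Cv_ge_1 D0 S1 by (intro mult_left_mono C1 F(1)) auto
      finally have "\<bar>\<xi>\<bar> * (\<Sum>k\<in>F. A k * (Cv * (1 + nm k) ^ (?N + 1))) \<le> \<bar>\<xi>\<bar> * ((Cv * D / real S) * C1)"
        by (intro mult_left_mono) auto
      also have "\<dots> = (\<bar>\<xi>\<bar> * (Cv * C1 * D)) / real S" by (simp add: mult_ac)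
      also have "\<dots> \<le> 1"
      proof -
        have "\<bar>\<xi>\<bar> * (Cv * C1 * D) \<le> (1 + \<bar>\<xi>\<bar>) * c0" using c0(3) CvC by (intro mult_mono) auto
        also have "\<dots> \<le> real S" using S(1) by (simp add: mult.commute)
        finally show ?thesis using S1 by simp
      qed
      finally show "\<bar>\<xi>\<bar> * (\<Sum>k\<in>F. A k * (Cv * (1 + nm k) ^ (?N + 1))) \<le> 1" .
    next
      fix a :: real and M assume a: "ee \<le> a"
      have "(\<Sum>m\<in>{S..<M}. (\<bar>\<xi>\<bar> * A0) ^ m / fact m * gauge_fun ?N a (real m * R)) \<le> (\<Sum>m\<in>{S..<M}. Cs * exp (- real m))"
      proof (rule sum_mono)
        fix m assume m: "m \<in> {S..<M}"
        hence mS: "real S \<le> real m" by simp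
        have m1: "1 \<le> real m" using mS S1 by linarith
        have mR: "real m * R \<le> real m powr (1 + \<epsilon>)"
        proof -
          have "R \<le> real m powr \<epsilon>" unfolding R_def using mS \<epsilon> by (intro powr_mono2) auto
          hence "real m * R \<le> real m * real m powr \<epsilon>" by (intro mult_left_mono) auto
          also have "\<dots> = real m powr (1 + \<epsilon>)" using m1 by (simp add: powr_add)
          finally show ?thesis .
        qed
        have mR0: "0 \<le> real m * R" by (simp add: R_def)
        have "gauge_fun ?N a (real m * R) \<le> gauge_fun ?N a (real m powr (1 + \<epsilon>))" by (rule gauge_fun_mono[OF a mR0 mR])
        also have "\<dots> \<le> exp (QQ (ee + real m powr (1 + \<epsilon>))) * (1 + real m powr (1 + \<epsilon>)) ^ ?N" by (rule gauge_fun_le[OF a]) simp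
        also have "\<dots> \<le> Cs * exp (real m)" by (rule Cs(2)[OF m1])
        finally have g: "gauge_fun ?N a (real m * R) \<le> Cs * exp (real m)" .
        have "exp 3 * (\<bar>\<xi>\<bar> * A0) \<le> real m"
        proof -
          have "\<bar>\<xi>\<bar> * (exp 3 * A0) \<le> (1 + \<bar>\<xi>\<bar>) * c0" using c0(2) A0_nonneg by (intro mult_mono) auto
          also have "\<dots> \<le> real m" using S(1) mS by (simp add: mult.commute)
          finally show ?thesis by (simp add: mult_ac)
        qed
        hence f: "(\<bar>\<xi>\<bar> * A0) ^ m / fact m \<le> exp (- 2 * real m)"
          using A0_nonneg m1 by (intro power_div_fact_le) auto
        have "(\<bar>\<xi>\<bar> * A0) ^ m / fact m * gauge_fun ?N a (real m * R) \<le> exp (- 2 * real m) * (Cs * exp (real m))"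
          using gauge_fun_ge_1[OF a mR0, of ?N] by (intro mult_mono f g) auto
        also have "\<dots> = Cs * exp (- real m)" by (simp add: exp_add[symmetric])
        finally show "(\<bar>\<xi>\<bar> * A0) ^ m / fact m * gauge_fun ?N a (real m * R) \<le> Cs * exp (- real m)" .
      qed
      also have "\<dots> \<le> Cs * 2" unfolding sum_distrib_left[symmetric] by (intro mult_left_mono sum_exp_neg_le Cs)
      finally show "(\<Sum>m\<in>{S..<M}. (\<bar>\<xi>\<bar> * A0) ^ m / fact m * gauge_fun ?N a (real m * R)) \<le> \<tau>" by (simp add: \<tau>_def)
    qed
    have V0: "0 \<le> ?V" by (simp add: R_def)
    have "\<bar>\<xi>\<bar> * ?V \<le> ?V * (1 + \<bar>\<xi>\<bar>)" using V0 by (simp add: algebra_simps)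
    also have "\<dots> \<le> C2 * um_weight \<theta> (?l * \<bar>\<xi>\<bar> powr (1 + \<epsilon>))"
      unfolding SR using S(2) by (intro C2) (auto simp: algebra_simps)
    finally have xV: "\<bar>\<xi>\<bar> * ?V \<le> C2 * um_weight \<theta> (?l * \<bar>\<xi>\<bar> powr (1 + \<epsilon>))" .
    have "\<kappa>1 * Cd * (\<bar>\<xi>\<bar> * ((exp 1 + 2 * \<tau>) * ?V) * exp 1 * exp 1) * (Y / latw j) = ?K * (\<bar>\<xi>\<bar> * ?V) * (Y / latw j)"
      by (simp only: mult_ac)
    also have "\<dots> \<le> ?K * (C2 * um_weight \<theta> (?l * \<bar>\<xi>\<bar> powr (1 + \<epsilon>))) * (Y / latw j)"
      using xV K0 Y0 latw_pos[of j] by (intro mult_right_mono mult_left_mono) auto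
    also have "\<dots> = ?K * C2 * um_weight \<theta> (?l * \<bar>\<xi>\<bar> powr (1 + \<epsilon>)) * (Y / latw j)" by (simp only: mult.assoc)
    finally show "lp_le p (filt (lattice_point j) (\<lambda>x. exp (\<i> * of_real (\<xi> * u x)) - 1)) (?K * C2 * um_weight \<theta> (?l * \<bar>\<xi>\<bar> powr (1 + \<epsilon>)) * (Y / latw j))"
      by (rule lp_le_mono[OF p est])
  qed
qed

end

section \<open>Variation measures and Fourier transforms of measures\<close>

text \<open>For set functions defined as suprema these are the two accessible halves.
  Superadditivity yields monotonicity and bounds finite partial sums by the value of the union; the
  countable upper bound is the other inequality.\<close>

lemma countably_additive_if_sub_super:
  fixes f :: "'a set \<Rightarrow> ennreal"
  assumes sub: "\<And>A::nat \<Rightarrow> 'a set. range A \<subseteq> sets M \<Longrightarrow> disjoint_family A \<Longrightarrow> f (\<Union>i. A i) \<le> (\<Sum>i. f (A i))"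
    and super: "\<And>A B. A \<in> sets M \<Longrightarrow> B \<in> sets M \<Longrightarrow> A \<inter> B = {} \<Longrightarrow> f A + f B \<le> f (A \<union> B)"
    and e: "f {} = 0"
  shows "countably_additive (sets M) f"
  unfolding countably_additive_def
proof (intro allI impI)
  fix A :: "nat \<Rightarrow> 'a set" assume A: "range A \<subseteq> sets M" "disjoint_family A" "(\<Union>i. A i) \<in> sets M"
  have Ai: "A i \<in> sets M" for i using A by auto
  have mono: "f B \<le> f C" if "B \<in> sets M" "C \<in> sets M" "B \<subseteq> C" for B C
  proof -
    have "f B \<le> f B + f (C - B)" by simp
    also have "\<dots> \<le> f (B \<union> (C - B))" using that by (intro super) auto
    also have "B \<union> (C - B) = C" using that by auto
    finally show ?thesis .
  qed
  have fin: "(\<Sum>i<n. f (A i)) \<le> f (\<Union>i<n. A i)" for n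
  proof (induction n)
    case 0 show ?case by (simp add: e)
  next
    case (Suc n)
    have "(\<Sum>i<Suc n. f (A i)) \<le> f (\<Union>i<n. A i) + f (A n)" using Suc by (simp add: add_mono)
    also have "\<dots> \<le> f ((\<Union>i<n. A i) \<union> A n)"
    proof (rule super)
      show "(\<Union>i<n. A i) \<inter> A n = {}"
        using A(2) by (auto simp: disjoint_family_on_def) (metis IntI empty_iff less_irrefl)
    qed (use Ai in auto)
    also have "(\<Union>i<n. A i) \<union> A n = (\<Union>i<Suc n. A i)" by (auto simp: less_Suc_eq)
    finally show ?case .
  qed
  have "(\<Sum>i. f (A i)) \<le> f (\<Union>i. A i)"
    unfolding suminf_eq_SUP
  proof (rule SUP_least)
    fix n
    have "f (\<Union>i<n. A i) \<le> f (\<Union>i. A i)" by (rule mono) (use Ai A(3) in auto)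
    thus "(\<Sum>i<n. f (A i)) \<le> f (\<Union>i. A i)" using fin[of n] by (rule order_trans[rotated])
  qed
  thus "(\<Sum>i. f (A i)) = f (\<Union>i. A i)" using sub[OF A(1,2)] by (rule antisym)
qed

lemma ennreal_sum_le:
  fixes f :: "nat \<Rightarrow> real"
  shows "ennreal (\<Sum>i<n. f i) \<le> (\<Sum>i<n. ennreal (f i))"
proof (induction n)
  case (Suc n)
  have "ennreal (sum f {..<n} + f n) \<le> ennreal (max 0 (sum f {..<n}) + max 0 (f n))" by (intro ennreal_leI) auto
  also have "\<dots> = ennreal (max 0 (sum f {..<n})) + ennreal (max 0 (f n))" by (rule ennreal_plus) auto
  also have "\<dots> = ennreal (sum f {..<n}) + ennreal (f n)" by (simp add: max_def ennreal_neg)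
  also have "\<dots> \<le> (\<Sum>i<n. ennreal (f i)) + ennreal (f n)" using Suc by (rule add_right_mono)
  finally show ?case by simp
qed simp

lemma sums_ennreal_le:
  fixes f :: "nat \<Rightarrow> real"
  assumes "f sums s" shows "ennreal s \<le> (\<Sum>i. ennreal (f i))"
proof (rule LIMSEQ_le_const2)
  show "(\<lambda>n. ennreal (\<Sum>i<n. f i)) \<longlonglongrightarrow> ennreal s"
    using assms by (intro tendsto_ennrealI) (simp add: sums_def)
  show "\<exists>N. \<forall>n\<ge>N. ennreal (\<Sum>i<n. f i) \<le> (\<Sum>i. ennreal (f i))"
    using order_trans[OF ennreal_sum_le sum_le_suminf[OF summableI]] by auto
qed

lemma sums_norm_ennreal_le:
  fixes f :: "nat \<Rightarrow> complex"
  assumes "f sums s" shows "ennreal (norm s) \<le> (\<Sum>i. ennreal (norm (f i)))"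
proof (rule LIMSEQ_le_const2)
  show "(\<lambda>n. ennreal (norm (\<Sum>i<n. f i))) \<longlonglongrightarrow> ennreal (norm s)"
    using assms by (intro tendsto_ennrealI tendsto_norm) (simp add: sums_def)
  have "ennreal (norm (\<Sum>i<n. f i)) \<le> (\<Sum>i. ennreal (norm (f i)))" for n
  proof -
    have "ennreal (norm (\<Sum>i<n. f i)) \<le> ennreal (\<Sum>i<n. norm (f i))" by (intro ennreal_leI norm_sum)
    also have "\<dots> \<le> (\<Sum>i<n. ennreal (norm (f i)))" by (rule ennreal_sum_le)
    also have "\<dots> \<le> (\<Sum>i. ennreal (norm (f i)))" by (rule sum_le_suminf[OF summableI]) auto
    finally show ?thesis .
  qed
  thus "\<exists>N. \<forall>n\<ge>N. ennreal (norm (\<Sum>i<n. f i)) \<le> (\<Sum>i. ennreal (norm (f i)))" by blast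
qed

lemma suminf_swap_ennreal:
  fixes f :: "nat \<Rightarrow> nat \<Rightarrow> ennreal"
  shows "(\<Sum>i. \<Sum>j. f i j) = (\<Sum>j. \<Sum>i. f i j)"
proof -
  have "(\<Sum>i. \<Sum>j. f i j) = (\<integral>\<^sup>+i. (\<Sum>j. f i j) \<partial>count_space UNIV)" by (simp add: nn_integral_count_space_nat)
  also have "\<dots> = (\<Sum>j. \<integral>\<^sup>+i. f i j \<partial>count_space UNIV)" by (rule nn_integral_suminf) simp
  finally show ?thesis by (simp add: nn_integral_count_space_nat)
qed

lemma additive_from_sums:
  fixes \<nu> :: "'a set \<Rightarrow> 'b::real_normed_vector"
  assumes s: "\<And>A::nat \<Rightarrow> 'a set. range A \<subseteq> sets M \<Longrightarrow> disjoint_family A \<Longrightarrow> (\<lambda>i. \<nu> (A i)) sums \<nu> (\<Union>i. A i)"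
  shows "\<nu> {} = 0" and "A \<in> sets M \<Longrightarrow> B \<in> sets M \<Longrightarrow> A \<inter> B = {} \<Longrightarrow> \<nu> (A \<union> B) = \<nu> A + \<nu> B"
proof -
  have "(\<lambda>i::nat. \<nu> {}) sums \<nu> (\<Union>i::nat. {})" by (rule s) (auto simp: disjoint_family_on_def)
  hence "(\<lambda>i::nat. \<nu> {}) \<longlonglongrightarrow> 0" by (intro summable_LIMSEQ_zero) (simp add: sums_iff)
  thus e: "\<nu> {} = 0" by (simp add: LIMSEQ_const_iff)
  assume AB: "A \<in> sets M" "B \<in> sets M" "A \<inter> B = {}"
  let ?E = "binaryset A B"
  have "(\<lambda>i. \<nu> (?E i)) sums \<nu> (\<Union>i. ?E i)"
    by (rule s) (use AB in \<open>auto simp: binaryset_def disjoint_family_on_def\<close>)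
  hence 1: "(\<lambda>i. \<nu> (?E i)) sums \<nu> (A \<union> B)" by (simp add: UN_binaryset_eq)
  have "(\<lambda>i. \<nu> (?E i)) sums (\<Sum>i\<in>{0,1}. \<nu> (?E i))"
    by (rule sums_finite) (auto simp: binaryset_def e)
  hence "(\<lambda>i. \<nu> (?E i)) sums (\<nu> A + \<nu> B)" by (simp add: binaryset_def)
  from sums_unique2[OF 1 this] show "\<nu> (A \<union> B) = \<nu> A + \<nu> B" .
qed

section \<open>Variations as measures\<close>

definition tvar :: "'a measure \<Rightarrow> ('a set \<Rightarrow> complex) \<Rightarrow> 'a set \<Rightarrow> ennreal" where
  "tvar M \<mu> A = (SUP E\<in>{E::nat \<Rightarrow> 'a set. range E \<subseteq> sets M \<and> disjoint_family E \<and> (\<Union>i. E i) = A}. \<Sum>i. ennreal (norm (\<mu> (E i))))"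

lemma tvar_upper:
  "range E \<subseteq> sets M \<Longrightarrow> disjoint_family E \<Longrightarrow> (\<Union>i. E i) = A \<Longrightarrow> (\<Sum>i. ennreal (norm (\<mu> (E i)))) \<le> tvar M \<mu> A"
  unfolding tvar_def by (rule SUP_upper) auto

lemma interleave_sum:
  fixes a b :: "nat \<Rightarrow> 'b::comm_monoid_add"
  shows "(\<Sum>n<2 * N. if even n then a (n div 2) else b (n div 2)) = (\<Sum>i<N. a i + b i)"
proof (induction N)
  case (Suc N)
  have "2 * Suc N = Suc (Suc (2 * N))" by simp
  thus ?case using Suc by (simp add: add.assoc)
qed simp

text \<open>A partition of \<open>A\<close> and a partition of \<open>B\<close> are interleaved at
  even and odd indices into a single sequence that partitions the union.\<close>

lemma tvar_superadditive:
  assumes AB: "A \<inter> B = {}" and ne: "A \<in> sets M" "B \<in> sets M"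
  shows "tvar M \<mu> A + tvar M \<mu> B \<le> tvar M \<mu> (A \<union> B)"
proof -
  let ?P = "\<lambda>A. {E::nat \<Rightarrow> 'a set. range E \<subseteq> sets M \<and> disjoint_family E \<and> (\<Union>i. E i) = A}"
  let ?s = "\<lambda>E. \<Sum>i. ennreal (norm (\<mu> (E i)))"
  have nonempty: "?P C \<noteq> {}" if "C \<in> sets M" for C
  proof -
    have "binaryset C {} \<in> ?P C"
      using that by (auto simp: binaryset_def disjoint_family_on_def UN_binaryset_eq split: if_splits)
    thus ?thesis by blast
  qed
  have main: "?s E + ?s F \<le> tvar M \<mu> (A \<union> B)" if E: "E \<in> ?P A" and F: "F \<in> ?P B" for E F
  proof -
    define H where "H = (\<lambda>n. if even n then E (n div 2) else F (n div 2))"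
    have EF: "E i \<inter> F j = {}" for i j using E F AB by blast
    have dE: "E i \<inter> E j = {}" if "i \<noteq> j" for i j using E that by (auto simp: disjoint_family_on_def)
    have dF: "F i \<inter> F j = {}" if "i \<noteq> j" for i j using F that by (auto simp: disjoint_family_on_def)
    have dH: "disjoint_family H"
      unfolding disjoint_family_on_def
    proof (intro ballI impI)
      fix m n :: nat assume mn: "m \<noteq> n"
      have ne: "m div 2 \<noteq> n div 2" if "even m = even n" using mn that by presburger
      consider "even m" "even n" | "even m" "odd n" | "odd m" "even n" | "odd m" "odd n" by blast
      thus "H m \<inter> H n = {}"
      proof cases
        case 1 thus ?thesis using dE[OF ne] by (simp only: H_def if_True)
      next
        case 2 thus ?thesis using EF[of "m div 2" "n div 2"] by (simp only: H_def if_True if_False)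
      next
        case 3 thus ?thesis using EF[of "n div 2" "m div 2"] by (simp only: H_def if_True if_False Int_commute)
      next
        case 4 thus ?thesis using dF[OF ne] by (simp only: H_def if_False)
      qed
    qed
    have rH: "range H \<subseteq> sets M" using E F by (auto simp: H_def)
    have A: "A = (\<Union>i. E i)" and B: "B = (\<Union>i. F i)" using E F by blast+
    have uH: "(\<Union>i. H i) = A \<union> B"
    proof (rule set_eqI, rule iffI)
      fix x assume "x \<in> (\<Union>i. H i)"
      then obtain n where x: "x \<in> H n" by blast
      show "x \<in> A \<union> B"
      proof (cases "even n")
        case True
        hence "x \<in> E (n div 2)" using x by (simp only: H_def if_True)
        thus ?thesis unfolding A by blast
      next
        case False
        hence "x \<in> F (n div 2)" using x by (simp only: H_def if_False)
        thus ?thesis unfolding B by blast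
      qed
    next
      fix x assume "x \<in> A \<union> B"
      then consider i where "x \<in> E i" | i where "x \<in> F i" unfolding A B by blast
      thus "x \<in> (\<Union>i. H i)"
      proof cases
        case 1
        hence "x \<in> H (2 * i)" by (simp add: H_def)
        thus ?thesis by blast
      next
        case 2
        hence "x \<in> H (Suc (2 * i))" by (simp add: H_def)
        thus ?thesis by blast
      qed
    qed
    have "?s E + ?s F = (\<Sum>i. ennreal (norm (\<mu> (E i))) + ennreal (norm (\<mu> (F i))))"
      by (rule suminf_add) (auto intro: summableI)
    also have "\<dots> \<le> ?s H"
      unfolding suminf_eq_SUP[of "\<lambda>i. ennreal (norm (\<mu> (E i))) + ennreal (norm (\<mu> (F i)))"]
    proof (rule SUP_least)
      fix N
      have "(\<Sum>i<N. ennreal (norm (\<mu> (E i))) + ennreal (norm (\<mu> (F i)))) = (\<Sum>n<2 * N. ennreal (norm (\<mu> (H n))))"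
        unfolding interleave_sum[symmetric] H_def by (intro sum.cong refl) auto
      also have "\<dots> \<le> ?s H" by (rule sum_le_suminf[OF summableI]) auto
      finally show "(\<Sum>i<N. ennreal (norm (\<mu> (E i))) + ennreal (norm (\<mu> (F i)))) \<le> ?s H" .
    qed
    also have "\<dots> \<le> tvar M \<mu> (A \<union> B)" by (rule tvar_upper[OF rH dH uH])
    finally show ?thesis .
  qed
  have "?s E + tvar M \<mu> B \<le> tvar M \<mu> (A \<union> B)" if E: "E \<in> ?P A" for E
    unfolding tvar_def[of M \<mu> B] ennreal_SUP_add_right[OF nonempty[OF ne(2)]]
    by (rule SUP_least) (rule main[OF E])
  thus ?thesis
    unfolding tvar_def[of M \<mu> A] ennreal_SUP_add_left[OF nonempty[OF ne(1)], symmetric]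
    by (intro SUP_least)
qed

text \<open>For subadditivity a partition of the union is refined by the sets \<open>A i\<close>,
  and the resulting double series is summed in the other order.\<close>

lemma emeasure_total_variation:
  assumes cm: "complex_measure M \<mu>" and A: "A \<in> sets M"
  shows "emeasure (total_variation M \<mu>) A = tvar M \<mu> A"
proof -
  have s: "range A \<subseteq> sets M \<Longrightarrow> disjoint_family A \<Longrightarrow> (\<lambda>i. \<mu> (A i)) sums \<mu> (\<Union>i. A i)" for A :: "nat \<Rightarrow> 'a set"
    using cm by (simp add: complex_measure_def)
  have e: "tvar M \<mu> {} = 0"
  proof -
    have "tvar M \<mu> {} \<le> 0" unfolding tvar_def
      by (rule SUP_least) (auto simp: additive_from_sums(1)[OF s])
    thus ?thesis by simp
  qed
  have ca: "countably_additive (sets M) (tvar M \<mu>)"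
  proof (rule countably_additive_if_sub_super)
    show "tvar M \<mu> {} = 0" by (rule e)
    show "tvar M \<mu> A + tvar M \<mu> B \<le> tvar M \<mu> (A \<union> B)" if "A \<in> sets M" "B \<in> sets M" "A \<inter> B = {}" for A B
      by (rule tvar_superadditive[OF that(3,1,2)])
    fix A :: "nat \<Rightarrow> 'a set" assume A: "range A \<subseteq> sets M" "disjoint_family A"
    show "tvar M \<mu> (\<Union>i. A i) \<le> (\<Sum>i. tvar M \<mu> (A i))"
      unfolding tvar_def[of M \<mu> "\<Union>i. A i"]
    proof (rule SUP_least)
      fix E :: "nat \<Rightarrow> 'a set"
      assume "E \<in> {E. range E \<subseteq> sets M \<and> disjoint_family E \<and> (\<Union>i. E i) = (\<Union>i. A i)}"
      hence E: "range E \<subseteq> sets M" "disjoint_family E" "(\<Union>i. E i) = (\<Union>i. A i)" by auto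
      have "ennreal (norm (\<mu> (E j))) \<le> (\<Sum>i. ennreal (norm (\<mu> (E j \<inter> A i))))" for j
      proof -
        have "(\<lambda>i. \<mu> (E j \<inter> A i)) sums \<mu> (\<Union>i. E j \<inter> A i)"
          by (rule s) (use A E in \<open>auto simp: disjoint_family_on_def\<close>)
        moreover have "(\<Union>i. E j \<inter> A i) = E j" using E(3) by blast
        ultimately show ?thesis using sums_norm_ennreal_le by force
      qed
      hence "(\<Sum>j. ennreal (norm (\<mu> (E j)))) \<le> (\<Sum>j. \<Sum>i. ennreal (norm (\<mu> (E j \<inter> A i))))"
        by (intro suminf_le summableI)
      also have "\<dots> = (\<Sum>i. \<Sum>j. ennreal (norm (\<mu> (E j \<inter> A i))))" by (rule suminf_swap_ennreal)
      also have "\<dots> \<le> (\<Sum>i. tvar M \<mu> (A i))"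
      proof (intro suminf_le summableI tvar_upper)
        fix i
        show "range (\<lambda>j. E j \<inter> A i) \<subseteq> sets M" using A E by auto
        show "disjoint_family (\<lambda>j. E j \<inter> A i)" using E(2) by (auto simp: disjoint_family_on_def)
        show "(\<Union>j. E j \<inter> A i) = A i" using E(3) by blast
      qed
      finally show "(\<Sum>j. ennreal (norm (\<mu> (E j)))) \<le> (\<Sum>i. tvar M \<mu> (A i))" .
    qed
  qed
  show ?thesis unfolding total_variation_def tvar_def[symmetric]
    by (rule emeasure_measure_of_sigma[OF sets.sigma_algebra_axioms _ ca A]) (simp add: positive_def e)
qed

definition pvar :: "'a measure \<Rightarrow> ('a set \<Rightarrow> real) \<Rightarrow> 'a set \<Rightarrow> ennreal" where
  "pvar M \<nu> A = (SUP B\<in>{B \<in> sets M. B \<subseteq> A}. ennreal (\<nu> B))"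

lemma pvar_upper: "B \<in> sets M \<Longrightarrow> B \<subseteq> A \<Longrightarrow> ennreal (\<nu> B) \<le> pvar M \<nu> A"
  unfolding pvar_def by (rule SUP_upper) auto

text \<open>Subadditivity comes from cutting a subset of the union along the sets
  \<open>A i\<close>, superadditivity from uniting subsets of the two parts.\<close>

lemma emeasure_pos_variation:
  assumes s: "\<And>A::nat \<Rightarrow> 'a set. range A \<subseteq> sets M \<Longrightarrow> disjoint_family A \<Longrightarrow> (\<lambda>i. \<nu> (A i)) sums \<nu> (\<Union>i. A i)" and A: "A \<in> sets M"
  shows "emeasure (pos_variation M \<nu>) A = pvar M \<nu> A"
proof -
  note ad = additive_from_sums[of M \<nu>, OF s]
  have e: "pvar M \<nu> {} = 0"
  proof -
    have "pvar M \<nu> {} \<le> 0" unfolding pvar_def by (rule SUP_least) (auto simp: ad(1))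
    thus ?thesis by simp
  qed
  have ca: "countably_additive (sets M) (pvar M \<nu>)"
  proof (rule countably_additive_if_sub_super)
    show "pvar M \<nu> {} = 0" by (rule e)
  next
    fix A B assume AB: "A \<in> sets M" "B \<in> sets M" "A \<inter> B = {}"
    have main: "ennreal (\<nu> C) + ennreal (\<nu> D) \<le> pvar M \<nu> (A \<union> B)" if CD: "C \<in> sets M" "C \<subseteq> A" "D \<in> sets M" "D \<subseteq> B" for C D
    proof -
      \<comment> \<open>\<open>ennreal\<close> truncates negative values, so sets of negative
        measure are replaced by the empty set before the values are added.\<close>
      define C' D' where "C' = (if 0 \<le> \<nu> C then C else {})" and "D' = (if 0 \<le> \<nu> D then D else {})"
      have C': "C' \<in> sets M" "C' \<subseteq> A" "0 \<le> \<nu> C'" "ennreal (\<nu> C) = ennreal (\<nu> C')"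
        using CD ad(1) by (auto simp: C'_def ennreal_neg)
      have D': "D' \<in> sets M" "D' \<subseteq> B" "0 \<le> \<nu> D'" "ennreal (\<nu> D) = ennreal (\<nu> D')"
        using CD ad(1) by (auto simp: D'_def ennreal_neg)
      have "ennreal (\<nu> C) + ennreal (\<nu> D) = ennreal (\<nu> C' + \<nu> D')"
        unfolding C'(4) D'(4) using C' D' by (intro ennreal_plus[symmetric]) auto
      also have "\<nu> C' + \<nu> D' = \<nu> (C' \<union> D')" using C' D' AB by (intro ad(2)[symmetric]) auto
      also have "ennreal (\<nu> (C' \<union> D')) \<le> pvar M \<nu> (A \<union> B)" using C' D' by (intro pvar_upper) auto
      finally show ?thesis .
    qed
    have ne: "{B \<in> sets M. B \<subseteq> C} \<noteq> {}" for C by auto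
    have "ennreal (\<nu> C) + pvar M \<nu> B \<le> pvar M \<nu> (A \<union> B)" if "C \<in> sets M" "C \<subseteq> A" for C
      unfolding pvar_def[of M \<nu> B] ennreal_SUP_add_right[OF ne]
      by (rule SUP_least) (use main that in auto)
    thus "pvar M \<nu> A + pvar M \<nu> B \<le> pvar M \<nu> (A \<union> B)"
      unfolding pvar_def[of M \<nu> A] ennreal_SUP_add_left[OF ne, symmetric] by (intro SUP_least) auto
  next
    fix A :: "nat \<Rightarrow> 'a set" assume A: "range A \<subseteq> sets M" "disjoint_family A"
    show "pvar M \<nu> (\<Union>i. A i) \<le> (\<Sum>i. pvar M \<nu> (A i))"
      unfolding pvar_def[of M \<nu> "\<Union>i. A i"]
    proof (rule SUP_least)
      fix B assume "B \<in> {B \<in> sets M. B \<subseteq> (\<Union>i. A i)}"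
      hence B: "B \<in> sets M" "B \<subseteq> (\<Union>i. A i)" by auto
      have "(\<lambda>i. \<nu> (B \<inter> A i)) sums \<nu> (\<Union>i. B \<inter> A i)"
        by (rule s) (use A B in \<open>auto simp: disjoint_family_on_def\<close>)
      moreover have "(\<Union>i. B \<inter> A i) = B" using B by blast
      ultimately have "ennreal (\<nu> B) \<le> (\<Sum>i. ennreal (\<nu> (B \<inter> A i)))" using sums_ennreal_le by force
      also have "\<dots> \<le> (\<Sum>i. pvar M \<nu> (A i))"
        by (intro suminf_le summableI pvar_upper) (use A B in auto)
      finally show "ennreal (\<nu> B) \<le> (\<Sum>i. pvar M \<nu> (A i))" .
    qed
  qed
  show ?thesis unfolding pos_variation_def pvar_def[symmetric]
    by (rule emeasure_measure_of_sigma[OF sets.sigma_algebra_axioms _ ca A]) (simp add: positive_def e)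
qed

lemma sets_pos_variation [simp]: "sets (pos_variation M \<nu>) = sets M"
  unfolding pos_variation_def by (simp add: sets.sets_measure_of_eq)

lemma space_pos_variation [simp]: "space (pos_variation M \<nu>) = space M"
  unfolding pos_variation_def by (simp add: space_measure_of_conv)

lemma sets_total_variation [simp]: "sets (total_variation M \<mu>) = sets M"
  unfolding total_variation_def by (simp add: sets.sets_measure_of_eq)

lemma space_total_variation [simp]: "space (total_variation M \<mu>) = space M"
  unfolding total_variation_def by (simp add: space_measure_of_conv)

lemma norm_le_tvar:
  assumes cm: "complex_measure M \<mu>" and B: "B \<in> sets M" "A \<in> sets M" "B \<subseteq> A"
  shows "ennreal (norm (\<mu> B)) \<le> tvar M \<mu> A"
proof -
  let ?E = "binaryset B (A - B)"
  have "ennreal (norm (\<mu> B)) = (\<Sum>i\<in>{0}. ennreal (norm (\<mu> (?E i))))" by (simp add: binaryset_def)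
  also have "\<dots> \<le> (\<Sum>i. ennreal (norm (\<mu> (?E i))))" by (rule sum_le_suminf[OF summableI]) auto
  also have "\<dots> \<le> tvar M \<mu> A"
  proof (rule tvar_upper)
    show "range ?E \<subseteq> sets M" using B by (auto simp: binaryset_def)
    show "disjoint_family ?E" by (auto simp: disjoint_family_on_def binaryset_def)
    show "(\<Union>i. ?E i) = A" using B by (auto simp: UN_binaryset_eq)
  qed
  finally show ?thesis .
qed

lemma pos_variation_le_total_variation:
  assumes cm: "complex_measure M \<mu>"
    and s: "\<And>A::nat \<Rightarrow> 'a set. range A \<subseteq> sets M \<Longrightarrow> disjoint_family A \<Longrightarrow> (\<lambda>i. \<nu> (A i)) sums \<nu> (\<Union>i. A i)"
    and le: "\<And>B. B \<in> sets M \<Longrightarrow> \<nu> B \<le> norm (\<mu> B)"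
  shows "pos_variation M \<nu> \<le> total_variation M \<mu>"
proof -
  have "emeasure (pos_variation M \<nu>) A \<le> emeasure (total_variation M \<mu>) A" for A
  proof (cases "A \<in> sets M")
    case True
    have "pvar M \<nu> A \<le> tvar M \<mu> A" unfolding pvar_def
      by (rule SUP_least) (use order_trans[OF ennreal_leI[OF le] norm_le_tvar[OF cm _ True]] in auto)
    thus ?thesis by (simp add: emeasure_pos_variation[OF s True] emeasure_total_variation[OF cm True])
  next
    case False
    thus ?thesis by (simp add: emeasure_notin_sets)
  qed
  thus ?thesis by (simp add: le_measure_iff le_fun_def)
qed

text \<open>The value at \<open>B\<close> is the total minus the value at the complement, hence at
  most the total plus the negative variation. The supremum over \<open>B\<close>, and the same
  argument for \<open>- \<nu>\<close>, give two opposite inequalities; no Hahn decomposition is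
  constructed.\<close>

lemma jordan_total:
  assumes s: "\<And>A::nat \<Rightarrow> 'a set. range A \<subseteq> sets M \<Longrightarrow> disjoint_family A \<Longrightarrow> (\<lambda>i. \<nu> (A i)) sums \<nu> (\<Union>i. A i)"
    and fin: "pvar M \<nu> (space M) < \<infinity>" "pvar M (\<lambda>A. - \<nu> A) (space M) < \<infinity>"
  shows "measure (pos_variation M \<nu>) (space M) - measure (pos_variation M (\<lambda>A. - \<nu> A)) (space M) = \<nu> (space M)"
proof -
  have s': "range A \<subseteq> sets M \<Longrightarrow> disjoint_family A \<Longrightarrow> (\<lambda>i. - \<nu> (A i)) sums - \<nu> (\<Union>i. A i)" for A :: "nat \<Rightarrow> 'a set"
    using s[of A] by (intro sums_minus)
  have half: "P \<le> \<nu>' (space M) + N"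
    if s: "\<And>A::nat \<Rightarrow> 'a set. range A \<subseteq> sets M \<Longrightarrow> disjoint_family A \<Longrightarrow> (\<lambda>i. \<nu>' (A i)) sums \<nu>' (\<Union>i. A i)"
    and P: "pvar M \<nu>' (space M) = ennreal P" "0 \<le> P" and N: "pvar M (\<lambda>A. - \<nu>' A) (space M) = ennreal N" "0 \<le> N" for \<nu>' :: "'a set \<Rightarrow> real" and P N
  proof -
    have b: "- \<nu>' B \<le> N" if "B \<in> sets M" for B
      using pvar_upper[OF that sets.sets_into_space[OF that], of "\<lambda>A. - \<nu>' A"] N by simp
    have "ennreal P \<le> ennreal (\<nu>' (space M) + N)" unfolding P(1)[symmetric] pvar_def
    proof (rule SUP_least)
      fix B assume "B \<in> {B \<in> sets M. B \<subseteq> space M}"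
      hence B: "B \<in> sets M" "B \<subseteq> space M" by auto
      have "\<nu>' (B \<union> (space M - B)) = \<nu>' B + \<nu>' (space M - B)"
        by (rule additive_from_sums(2)[of M, OF s]) (use B in auto)
      moreover have "B \<union> (space M - B) = space M" using B by auto
      ultimately have "\<nu>' B = \<nu>' (space M) - \<nu>' (space M - B)" by simp
      also have "\<dots> \<le> \<nu>' (space M) + N" using b[of "space M - B"] B by simp
      finally show "ennreal (\<nu>' B) \<le> ennreal (\<nu>' (space M) + N)" by (rule ennreal_leI)
    qed
    moreover have "0 \<le> \<nu>' (space M) + N" using b[of "space M"] by simp
    ultimately show ?thesis by (simp add: ennreal_le_iff)
  qed
  obtain P where P: "pvar M \<nu> (space M) = ennreal P" "0 \<le> P" using fin(1) by (cases "pvar M \<nu> (space M)" rule: ennreal_cases) auto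
  obtain N where N: "pvar M (\<lambda>A. - \<nu> A) (space M) = ennreal N" "0 \<le> N" using fin(2) by (cases "pvar M (\<lambda>A. - \<nu> A) (space M)" rule: ennreal_cases) auto
  have "P \<le> \<nu> (space M) + N" by (rule half[OF s P N])
  moreover have "N \<le> - \<nu> (space M) + P" by (rule half[OF s' N]) (use P in auto)
  moreover have "measure (pos_variation M \<nu>) (space M) = P"
    using emeasure_pos_variation[of M \<nu>, OF s sets.top] P by (simp add: measure_def)
  moreover have "measure (pos_variation M (\<lambda>A. - \<nu> A)) (space M) = N"
    using emeasure_pos_variation[of M "\<lambda>A. - \<nu> A", OF s' sets.top] N by (simp add: measure_def)
  ultimately show ?thesis by linarith
qed

section \<open>Fourier integrals of positive measures\<close>

text \<open>The \<open>m\<close>-th derivative of the unnormalised inverse Fourier transform of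
  \<open>\<nu>\<close>; the transform itself is the case \<open>m = 0\<close>.\<close>

definition mexp :: "real measure \<Rightarrow> nat \<Rightarrow> real \<Rightarrow> complex" where
  "mexp \<nu> m t = (\<integral>\<xi>. (\<i> * of_real \<xi>) ^ m * exp (\<i> * of_real (\<xi> * t)) \<partial>\<nu>)"

lemma mexp_integrable:
  assumes sb: "sets \<nu> = sets borel" and i: "integrable \<nu> (\<lambda>\<xi>. \<bar>\<xi>\<bar> ^ m)"
  shows "integrable \<nu> (\<lambda>\<xi>. (\<i> * of_real \<xi>) ^ m * exp (\<i> * of_real (\<xi> * t)))"
proof (rule Bochner_Integration.integrable_bound[OF i])
  have [measurable_cong]: "sets \<nu> = sets borel" by fact
  show "(\<lambda>\<xi>. (\<i> * of_real \<xi>) ^ m * exp (\<i> * of_real (\<xi> * t))) \<in> borel_measurable \<nu>" by measurable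
qed (auto simp: norm_mult norm_power)

lemma exp_i_diff_le: "norm (exp (\<i> * of_real s) - 1) \<le> \<bar>s\<bar>"
proof -
  have "norm (exp (\<i> * of_real s) - exp (\<i> * of_real 0)) \<le> 1 * norm (s - 0)"
  proof (rule differentiable_bound[of UNIV "\<lambda>s. exp (\<i> * of_real s)" "\<lambda>s h. h *\<^sub>R (\<i> * exp (\<i> * of_real s))"])
    fix x :: real
    have "((\<lambda>s. \<i> * of_real s) has_vector_derivative \<i>) (at x)" by (auto intro!: derivative_eq_intros)
    from field_vector_diff_chain_at[OF this DERIV_exp]
    show "((\<lambda>s. exp (\<i> * of_real s)) has_derivative (\<lambda>h. h *\<^sub>R (\<i> * exp (\<i> * of_real x)))) (at x within UNIV)"
      by (simp add: o_def has_vector_derivative_def)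
    show "onorm (\<lambda>h. h *\<^sub>R (\<i> * exp (\<i> * of_real x))) \<le> 1"
      by (rule onorm_bound) (auto simp: norm_mult)
  qed auto
  thus ?thesis by simp
qed

lemma has_vector_derivative_quotient:
  fixes f :: "real \<Rightarrow> 'b::real_normed_vector"
  assumes "(f has_vector_derivative f') (at t)"
  shows "((\<lambda>h. (f (t + h) - f t) /\<^sub>R h) \<longlongrightarrow> f') (at 0)"
proof -
  have "((\<lambda>h. norm (f (t + h) - f t - h *\<^sub>R f') / norm h) \<longlongrightarrow> 0) (at 0)"
    using assms unfolding has_vector_derivative_def has_derivative_at by blast
  moreover have "\<forall>\<^sub>F h in at 0. norm (f (t + h) - f t - h *\<^sub>R f') / norm h = norm ((f (t + h) - f t) /\<^sub>R h - f')"
    unfolding eventually_at_filter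
  proof (intro always_eventually allI impI)
    fix h :: real assume "h \<noteq> 0"
    hence "(f (t + h) - f t) /\<^sub>R h - f' = (f (t + h) - f t - h *\<^sub>R f') /\<^sub>R h" by (simp add: scaleR_right_diff_distrib)
    thus "norm (f (t + h) - f t - h *\<^sub>R f') / norm h = norm ((f (t + h) - f t) /\<^sub>R h - f')"
      by (simp add: divide_inverse mult.commute)
  qed
  ultimately have "((\<lambda>h. norm ((f (t + h) - f t) /\<^sub>R h - f')) \<longlongrightarrow> 0) (at 0)" by (rule Lim_transform_eventually)
  thus ?thesis by (rule LIM_zero_cancel[OF tendsto_norm_zero_cancel])
qed

lemma has_vector_derivative_from_quotient:
  fixes f :: "real \<Rightarrow> 'b::real_normed_vector"
  assumes "((\<lambda>h. (f (t + h) - f t) /\<^sub>R h) \<longlongrightarrow> f') (at 0)"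
  shows "(f has_vector_derivative f') (at t)"
  unfolding has_vector_derivative_def has_derivative_at
proof
  show "bounded_linear (\<lambda>h. h *\<^sub>R f')" by (rule bounded_linear_scaleR_left)
  have "((\<lambda>h. norm ((f (t + h) - f t) /\<^sub>R h - f')) \<longlongrightarrow> 0) (at 0)"
    by (rule tendsto_norm_zero[OF LIM_zero[OF assms]])
  moreover have "\<forall>\<^sub>F h in at 0. norm ((f (t + h) - f t) /\<^sub>R h - f') = norm (f (t + h) - f t - h *\<^sub>R f') / norm h"
    unfolding eventually_at_filter
  proof (intro always_eventually allI impI)
    fix h :: real assume "h \<noteq> 0"
    hence "(f (t + h) - f t) /\<^sub>R h - f' = (f (t + h) - f t - h *\<^sub>R f') /\<^sub>R h" by (simp add: scaleR_right_diff_distrib)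
    thus "norm ((f (t + h) - f t) /\<^sub>R h - f') = norm (f (t + h) - f t - h *\<^sub>R f') / norm h"
      by (simp add: divide_inverse mult.commute)
  qed
  ultimately show "((\<lambda>h. norm (f (t + h) - f t - h *\<^sub>R f') / norm h) \<longlongrightarrow> 0) (at 0)" by (rule Lim_transform_eventually)
qed

text \<open>Difference quotients of the integrand are dominated by
  \<open>\<bar>\<xi>\<bar> ^ Suc m\<close>, so the finite moments permit differentiation under the
  integral sign.\<close>

lemma mexp_deriv:
  assumes sb: "sets \<nu> = sets borel" and i: "\<And>m. integrable \<nu> (\<lambda>\<xi>. \<bar>\<xi>\<bar> ^ m)"
  shows "(mexp \<nu> m has_vector_derivative mexp \<nu> (Suc m) t) (at t)"
proof -
  have [measurable_cong]: "sets \<nu> = sets borel" by fact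
  let ?f = "\<lambda>t \<xi>. (\<i> * complex_of_real \<xi>) ^ m * exp (\<i> * of_real (\<xi> * t))"
  let ?D = "\<lambda>h \<xi>. (?f (t + h) \<xi> - ?f t \<xi>) /\<^sub>R h"
  have lim: "((\<lambda>h. (mexp \<nu> m (t + h) - mexp \<nu> m t) /\<^sub>R h) \<longlongrightarrow> mexp \<nu> (Suc m) t) (at 0)"
    unfolding tendsto_at_iff_sequentially
  proof (intro allI impI)
    fix h :: "nat \<Rightarrow> real" assume h0: "\<forall>n. h n \<in> UNIV - {0}" and hl: "h \<longlonglongrightarrow> 0"
    have L1: "(\<lambda>n. \<integral>\<xi>. ?D (h n) \<xi> \<partial>\<nu>) \<longlonglongrightarrow> (\<integral>\<xi>. (\<i> * complex_of_real \<xi>) ^ Suc m * exp (\<i> * of_real (\<xi> * t)) \<partial>\<nu>)"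
    proof (rule integral_dominated_convergence[where w = "\<lambda>\<xi>. \<bar>\<xi>\<bar> ^ Suc m"])
      show "integrable \<nu> (\<lambda>\<xi>. \<bar>\<xi>\<bar> ^ Suc m)" by (rule i)
      show "AE \<xi> in \<nu>. norm (?D (h n) \<xi>) \<le> \<bar>\<xi>\<bar> ^ Suc m" for n
      proof (rule AE_I2)
        fix \<xi>
        have "?f (t + h n) \<xi> - ?f t \<xi> = ?f t \<xi> * (exp (\<i> * of_real (\<xi> * h n)) - 1)"
          by (simp add: distrib_left exp_add right_diff_distrib mult.assoc)
        hence "norm (?D (h n) \<xi>) = \<bar>\<xi>\<bar> ^ m * norm (exp (\<i> * of_real (\<xi> * h n)) - 1) / \<bar>h n\<bar>"
          by (simp add: norm_mult norm_power divide_inverse mult_ac)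
        also have "\<dots> \<le> \<bar>\<xi>\<bar> ^ m * \<bar>\<xi> * h n\<bar> / \<bar>h n\<bar>"
          by (intro divide_right_mono mult_left_mono exp_i_diff_le) auto
        also have "\<dots> = \<bar>\<xi>\<bar> ^ Suc m" using h0 by (simp add: abs_mult mult.commute)
        finally show "norm (?D (h n) \<xi>) \<le> \<bar>\<xi>\<bar> ^ Suc m" .
      qed
      show "AE \<xi> in \<nu>. (\<lambda>n. ?D (h n) \<xi>) \<longlonglongrightarrow> (\<i> * complex_of_real \<xi>) ^ Suc m * exp (\<i> * of_real (\<xi> * t))"
      proof (rule AE_I2)
        fix \<xi>
        have "((\<lambda>s. \<i> * of_real (\<xi> * s)) has_vector_derivative \<i> * of_real \<xi>) (at t)" by (auto intro!: derivative_eq_intros)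
        from has_vector_derivative_mult_right[OF field_vector_diff_chain_at[OF this DERIV_exp], of "(\<i> * complex_of_real \<xi>) ^ m"]
        have "((\<lambda>s. ?f s \<xi>) has_vector_derivative (\<i> * complex_of_real \<xi>) ^ Suc m * exp (\<i> * of_real (\<xi> * t))) (at t)"
          by (simp add: o_def mult_ac)
        hence "((\<lambda>h. ?D h \<xi>) \<longlongrightarrow> (\<i> * complex_of_real \<xi>) ^ Suc m * exp (\<i> * of_real (\<xi> * t))) (at 0)"
          by (rule has_vector_derivative_quotient)
        thus "(\<lambda>n. ?D (h n) \<xi>) \<longlonglongrightarrow> (\<i> * complex_of_real \<xi>) ^ Suc m * exp (\<i> * of_real (\<xi> * t))"
          unfolding tendsto_at_iff_sequentially using h0 hl by (simp add: o_def)
      qed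
    qed measurable
    have e2: "(\<integral>\<xi>. ?D (h n) \<xi> \<partial>\<nu>) = (mexp \<nu> m (t + h n) - mexp \<nu> m t) /\<^sub>R h n" for n
      unfolding mexp_def by (simp only: integral_scaleR_right Bochner_Integration.integral_diff[OF mexp_integrable[OF sb i] mexp_integrable[OF sb i]])
    show "((\<lambda>h. (mexp \<nu> m (t + h) - mexp \<nu> m t) /\<^sub>R h) \<circ> h) \<longlonglongrightarrow> mexp \<nu> (Suc m) t"
      using L1 unfolding e2 o_def mexp_def[of \<nu> "Suc m"] .
  qed
  show ?thesis by (rule has_vector_derivative_from_quotient[OF lim])
qed

lemma C_infinity_chain:
  fixes F :: "nat \<Rightarrow> real \<Rightarrow> 'b::real_normed_vector"
  assumes d: "\<And>m t. (F m has_vector_derivative F (Suc m) t) (at t)"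
  shows "C_infinity (F 0)"
proof -
  have it: "iterated_partial bs (F 0) = F (length bs)" if "set bs \<subseteq> Basis" for bs
    using that
  proof (induction bs)
    case (Cons b bs)
    have b: "b = 1" using Cons.prems by simp
    have "partial_derivative b (F (length bs)) t = F (Suc (length bs)) t" for t
    proof -
      have "frechet_derivative (F (length bs)) (at t) = (\<lambda>h. h *\<^sub>R F (Suc (length bs)) t)"
        using d[of "length bs" t] unfolding has_vector_derivative_def by (rule frechet_derivative_at[symmetric])
      thus ?thesis by (simp add: partial_derivative_def b)
    qed
    hence "partial_derivative b (F (length bs)) = F (length (b # bs))" by (simp add: fun_eq_iff)
    moreover have "iterated_partial (b # bs) (F 0) = partial_derivative b (iterated_partial bs (F 0))"
      by (simp add: iterated_partial_def)
    ultimately show ?case using Cons by simp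
  qed (simp add: iterated_partial_def)
  show ?thesis unfolding C_infinity_def
  proof (intro allI impI)
    fix bs :: "real list" and x assume "set bs \<subseteq> Basis"
    thus "iterated_partial bs (F 0) differentiable (at x)"
      using d[of "length bs" x] unfolding it[OF \<open>set bs \<subseteq> Basis\<close>] has_vector_derivative_def differentiable_def by blast
  qed
qed

section \<open>Lattice sums and decompositions of functions in \<open>L\<^sup>p\<close>\<close>

text \<open>The right-hand side telescopes, with equality at \<open>N = 0\<close>. Each step adds
  two equal terms, bounded through \<open>x * (x + 1) \<le> 2 * (1 + x\<^sup>2)\<close>.\<close>

lemma sum_inverse_squares_le: "(\<Sum>m\<in>{- int N..int N}. 1 / (1 + (real_of_int m)\<^sup>2)) \<le> 5 - 4 / (real N + 1)"
proof (induction N)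
  case (Suc N)
  let ?g = "\<lambda>m. 1 / (1 + (real_of_int m)\<^sup>2)" and ?x = "real N + 1"
  have half: "2 / y = 4 / (2 * y)" for y :: real by simp
  have e: "{- int (Suc N)..int (Suc N)} = insert (- int (Suc N)) (insert (int (Suc N)) {- int N..int N})" by auto
  have "(\<Sum>m\<in>{- int (Suc N)..int (Suc N)}. ?g m) = ?g (- int (Suc N)) + (?g (int (Suc N)) + (\<Sum>m\<in>{- int N..int N}. ?g m))"
    unfolding e by (subst sum.insert; auto)+
  also have "\<dots> = 2 / (1 + ?x\<^sup>2) + (\<Sum>m\<in>{- int N..int N}. ?g m)" by (simp add: power2_eq_square algebra_simps)
  also have "\<dots> \<le> 2 / (1 + ?x\<^sup>2) + (5 - 4 / ?x)" using Suc by simp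
  finally have 1: "(\<Sum>m\<in>{- int (Suc N)..int (Suc N)}. ?g m) \<le> 2 / (1 + ?x\<^sup>2) + (5 - 4 / ?x)" .
  have x: "0 < ?x" "0 < ?x + 1" "0 < 1 + ?x\<^sup>2" using zero_le_power2[of ?x] by linarith+
  have "2 / (1 + ?x\<^sup>2) = 4 / (2 * (1 + ?x\<^sup>2))" using half[of "1 + ?x\<^sup>2"] .
  also have "\<dots> \<le> 4 / (?x * (?x + 1))"
  proof (rule divide_left_mono)
    show "?x * (?x + 1) \<le> 2 * (1 + ?x\<^sup>2)"
      using sum_squares_ge_zero[of "?x - 1" 0] by (simp add: power2_eq_square algebra_simps)
    show "0 < 2 * (1 + ?x\<^sup>2) * (?x * (?x + 1))" using x by (intro mult_pos_pos) simp_all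
  qed simp
  also have "4 / (?x * (?x + 1)) = 4 / ?x - 4 / (?x + 1)" by (simp add: field_simps)
  finally have 2: "2 / (1 + ?x\<^sup>2) \<le> 4 / ?x - 4 / (?x + 1)" .
  have "real (Suc N) + 1 = ?x + 1" by simp
  thus ?case using 1 2 by (simp only:)
qed simp

lemma finite_subset_cube:
  fixes F :: "(int ^ 'n) set"
  assumes "finite F" shows "\<exists>N0. \<forall>N\<ge>N0. F \<subseteq> cube N"
proof -
  obtain N0 where N0: "(\<Sum>k\<in>F. norm (lattice_point k :: real ^ 'n)) \<le> real N0" using real_arch_simple by blast
  have "k \<in> cube N" if "k \<in> F" "N0 \<le> N" for k N
  proof (rule norm_lattice_cube)
    have "norm (lattice_point k :: real ^ 'n) \<le> (\<Sum>k\<in>F. norm (lattice_point k :: real ^ 'n))"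
      by (rule member_le_sum) (use that assms in auto)
    thus "norm (lattice_point k :: real ^ 'n) \<le> real N" using N0 that by simp
  qed
  thus ?thesis by blast
qed

text \<open>Over a cube the sum factors into one-dimensional sums, each at most 5.\<close>

lemma cw_sum_bounded: "\<exists>S>0. \<forall>F :: (int ^ 'n) set. finite F \<longrightarrow> (\<Sum>k\<in>F. cw k) \<le> S"
proof (intro exI[of _ "5 ^ CARD('n)"] conjI allI impI)
  fix F :: "(int ^ 'n) set" assume F: "finite F"
  then obtain N where N: "F \<subseteq> cube N" using finite_subset_cube by blast
  let ?g = "\<lambda>m. 1 / (1 + (real_of_int m)\<^sup>2)" and ?P = "PiE UNIV (\<lambda>_::'n. {- int N..int N})"
  have inj: "inj_on vec_nth (cube N :: (int ^ 'n) set)" by (auto simp: inj_on_def vec_nth_inject)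
  have sub: "vec_nth ` (cube N :: (int ^ 'n) set) \<subseteq> ?P"
    by (auto simp: cube_def abs_le_iff PiE_def Pi_def minus_le_iff)
  have "(\<Sum>k\<in>F. cw k) \<le> (\<Sum>k\<in>(cube N :: (int ^ 'n) set). cw k)"
    by (rule sum_mono2[OF finite_cube N]) (simp add: less_imp_le cw_pos)
  also have "\<dots> = (\<Sum>h\<in>vec_nth ` (cube N :: (int ^ 'n) set). \<Prod>i\<in>UNIV. ?g (h i))"
    unfolding sum.reindex[OF inj] by (simp add: cw_def)
  also have "\<dots> \<le> (\<Sum>h\<in>?P. \<Prod>i\<in>UNIV. ?g (h i))"
    by (rule sum_mono2[OF _ sub]) (auto intro!: finite_PiE prod_nonneg)
  also have "\<dots> = (\<Prod>i\<in>(UNIV::'n set). \<Sum>m\<in>{- int N..int N}. ?g m)"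
    by (rule prod_sum_PiE[symmetric]) auto
  also have "\<dots> \<le> (\<Prod>i\<in>(UNIV::'n set). 5)"
  proof (rule prod_mono)
    fix i :: 'n
    have "0 \<le> 4 / (real N + 1)" by simp
    hence "(\<Sum>m\<in>{- int N..int N}. ?g m) \<le> 5" using sum_inverse_squares_le[of N] by linarith
    thus "0 \<le> (\<Sum>m\<in>{- int N..int N}. ?g m) \<and> (\<Sum>m\<in>{- int N..int N}. ?g m) \<le> 5"
      by (intro conjI sum_nonneg) auto
  qed
  finally show "(\<Sum>k\<in>F. cw k) \<le> 5 ^ CARD('n)" by simp
qed simp

lemma cw_minus: "cw (- h) = cw h" by (simp add: cw_def)

text \<open>Of the power \<open>m = M + 2 * CARD('n)\<close> that the weight dominates, the part
  \<open>2 * CARD('n)\<close> is spent on \<open>cw\<close>, so that the moments of the pieces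
  become summable.\<close>

lemma latw_superpoly:
  fixes M :: nat
  shows "\<exists>K\<ge>0. \<forall>k :: int ^ 'n. (1 + norm (lattice_point k :: real ^ 'n)) ^ M \<le> K * cw k * latw k"
proof -
  define m where "m = M + 2 * CARD('n)"
  have "(1 + norm (lattice_point k :: real ^ 'n)) ^ M \<le> (2 ^ m * exp (real m * exp (real m))) * cw k * latw k" for k :: "int ^ 'n"
  proof -
    let ?r = "norm (lattice_point k :: real ^ 'n)" and ?J = "jap (lattice_point k :: real ^ 'n)"
    have J: "ee \<le> ?J" by (rule jap_ge_ee)
    hence J1: "1 \<le> ?J" using ee_ge_1 by linarith
    have "(1 + ?r) ^ M * 1 \<le> (1 + ?r) ^ M * ((1 + ?r) ^ (2 * CARD('n)) * cw k)"
      by (intro mult_left_mono cw_lower) auto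
    also have "\<dots> = (1 + ?r) ^ m * cw k" by (simp add: m_def power_add)
    also have "\<dots> \<le> (2 * ?J) ^ m * cw k"
    proof (intro mult_right_mono power_mono)
      show "1 + ?r \<le> 2 * ?J" using J1 jap_ge_norm[of "lattice_point k :: real ^ 'n"] by linarith
    qed (auto simp: less_imp_le cw_pos)
    also have "\<dots> = 2 ^ m * cw k * ?J powr real m" using J1 by (simp add: power_mult_distrib powr_realpow)
    also have "\<dots> \<le> 2 ^ m * cw k * (exp (real m * exp (real m)) * exp (QQ ?J))"
      by (intro mult_left_mono exp_QQ_superpoly J) (auto simp: less_imp_le cw_pos)
    finally show ?thesis by (simp add: um_weight_QQ mult.assoc mult.commute mult.left_commute)
  qed
  thus ?thesis by (intro exI[of _ "2 ^ m * exp (real m * exp (real m))"]) auto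
qed

text \<open>A discrete Young inequality, with \<open>Y\<close> the limit of the convolution over
  growing cubes. The same \<open>Y\<close> serves all exponents: the bound \<open>S * X\<close>
  covers q = \<infinity>, and for finite q Jensen's inequality with weights
  \<open>cw (j - k)\<close> is followed by an interchange of sums.\<close>

lemma young_cw:
  fixes x :: "int ^ 'n \<Rightarrow> real"
  assumes x: "\<And>k. 0 \<le> x k" "\<And>k. x k \<le> X"
    and S: "0 < S" "\<And>F :: (int ^ 'n) set. finite F \<Longrightarrow> (\<Sum>k\<in>F. cw k) \<le> S"
  shows "\<exists>Y. (\<forall>j. 0 \<le> Y j \<and> Y j \<le> S * X) \<and> (\<forall>j F. finite F \<longrightarrow> (\<Sum>k\<in>F. cw (j - k) * x k) \<le> Y j) \<and>
    (\<forall>q B. 1 \<le> q \<longrightarrow> (\<forall>F. finite F \<longrightarrow> (\<Sum>k\<in>F. x k powr q) \<le> B) \<longrightarrow>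
      (\<forall>G. finite G \<longrightarrow> (\<Sum>j\<in>G. Y j powr q) \<le> S powr q * B))"
proof -
  define s where "s j N = (\<Sum>k\<in>cube N. cw (j - k) * x k)" for j N
  have c0: "0 \<le> cw h" for h :: "int ^ 'n" using cw_pos[of h] by simp
  have X0: "0 \<le> X" using x(1)[of undefined] x(2)[of undefined] by simp
  have S1: "(\<Sum>k\<in>F. cw (j - k)) \<le> S" if "finite F" for F and j :: "int ^ 'n"
  proof -
    have "(\<Sum>k\<in>F. cw (j - k)) = (\<Sum>h\<in>(\<lambda>k. j - k) ` F. cw h)"
      by (subst sum.reindex) (auto simp: inj_on_def)
    also have "\<dots> \<le> S" using that by (intro S) auto
    finally show ?thesis .
  qed
  have S2: "(\<Sum>j\<in>F. cw (j - k)) \<le> S" if "finite F" for F and k :: "int ^ 'n"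
  proof -
    have "(\<Sum>j\<in>F. cw (j - k)) = (\<Sum>j\<in>F. cw (k - j))" using cw_minus[of "k - j" for j] by simp
    thus ?thesis using S1[OF that] by simp
  qed
  have bd: "(\<Sum>k\<in>F. cw (j - k) * x k) \<le> S * X" if "finite F" for F j
  proof -
    have "(\<Sum>k\<in>F. cw (j - k) * x k) \<le> (\<Sum>k\<in>F. cw (j - k) * X)" by (intro sum_mono mult_left_mono x c0)
    also have "\<dots> = (\<Sum>k\<in>F. cw (j - k)) * X" by (simp add: sum_distrib_right)
    also have "\<dots> \<le> S * X" by (intro mult_right_mono S1 that X0)
    finally show ?thesis .
  qed
  have cm: "cube M \<subseteq> (cube N :: (int ^ 'n) set)" if "M \<le> N" for M N
    using that by (auto simp: cube_def intro: order_trans)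
  have inc: "incseq (s j)" for j
    unfolding s_def by (intro incseq_SucI sum_mono2 finite_cube cm) (auto intro!: mult_nonneg_nonneg c0 x)
  have "\<exists>L. s j \<longlonglongrightarrow> L" for j
    using incseq_convergent[OF inc, of j "S * X"] bd[OF finite_cube] by (metis s_def)
  then obtain Y where Y: "\<And>j. s j \<longlonglongrightarrow> Y j" by metis
  have sY: "s j N \<le> Y j" for j N by (rule incseq_le[OF inc Y])
  have s0: "0 \<le> s j N" for j N unfolding s_def by (intro sum_nonneg mult_nonneg_nonneg c0 x)
  have Y0: "0 \<le> Y j" for j using order_trans[OF s0 sY] .
  have FY: "(\<Sum>k\<in>F. cw (j - k) * x k) \<le> Y j" if F: "finite F" for F j
  proof -
    obtain N where N: "F \<subseteq> cube N" using finite_subset_cube[OF F] by blast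
    have "(\<Sum>k\<in>F. cw (j - k) * x k) \<le> s j N" unfolding s_def
      by (rule sum_mono2[OF finite_cube N]) (auto intro!: mult_nonneg_nonneg c0 x)
    thus ?thesis using sY order_trans by blast
  qed
  have YX: "Y j \<le> S * X" for j
    by (rule LIMSEQ_le_const2[OF Y]) (use bd[OF finite_cube] in \<open>auto simp: s_def\<close>)
  have jen: "s j N powr q \<le> S powr (q - 1) * (\<Sum>k\<in>cube N. cw (j - k) * x k powr q)" if q: "1 \<le> q" for j N q
  proof -
    let ?C = "cube N :: (int ^ 'n) set"
    have "ennreal (s j N powr q) \<le> ennreal (S powr (q - 1)) * (\<integral>\<^sup>+k. ennreal (cw (j - k) * x k powr q) \<partial>count_space ?C)"
    proof (rule jensen_powr_nn[OF q])
      show "(\<integral>\<^sup>+k. ennreal (cw (j - k)) \<partial>count_space ?C) \<le> ennreal S"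
        using S1[OF finite_cube[of N], of j]
        by (simp add: nn_integral_count_space_finite finite_cube sum_ennreal c0 ennreal_leI)
      show "ennreal (s j N) \<le> (\<integral>\<^sup>+k. ennreal (cw (j - k) * x k) \<partial>count_space ?C)"
        by (simp add: nn_integral_count_space_finite finite_cube sum_ennreal c0 x s_def)
    qed (auto simp: c0 x S s0)
    also have "\<dots> = ennreal (S powr (q - 1) * (\<Sum>k\<in>?C. cw (j - k) * x k powr q))"
      unfolding nn_integral_count_space_finite[OF finite_cube] ennreal_mult'[OF powr_ge_zero]
      by (subst sum_ennreal) (auto intro!: mult_nonneg_nonneg c0)
    finally show ?thesis
      by (subst (asm) ennreal_le_iff) (auto intro!: mult_nonneg_nonneg sum_nonneg c0)
  qed
  have Lq: "(\<Sum>j\<in>G. Y j powr q) \<le> S powr q * B"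
    if q: "1 \<le> q" and B: "\<And>F. finite F \<Longrightarrow> (\<Sum>k\<in>F. x k powr q) \<le> B" and G: "finite G" for q B G
  proof (rule LIMSEQ_le_const2)
    show "(\<lambda>N. \<Sum>j\<in>G. s j N powr q) \<longlonglongrightarrow> (\<Sum>j\<in>G. Y j powr q)"
      by (intro tendsto_sum tendsto_powr2 Y tendsto_const always_eventually allI s0) (use q in auto)
    have "(\<Sum>j\<in>G. s j N powr q) \<le> S powr q * B" for N
    proof -
      have "(\<Sum>j\<in>G. s j N powr q) \<le> (\<Sum>j\<in>G. S powr (q - 1) * (\<Sum>k\<in>cube N. cw (j - k) * x k powr q))"
        by (intro sum_mono jen q)
      also have "\<dots> = S powr (q - 1) * (\<Sum>k\<in>cube N. (\<Sum>j\<in>G. cw (j - k)) * x k powr q)"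
        unfolding sum_distrib_left[symmetric] sum_distrib_right by (subst sum.swap) simp
      also have "\<dots> \<le> S powr (q - 1) * (\<Sum>k\<in>cube N. S * x k powr q)"
        by (intro mult_left_mono sum_mono mult_right_mono S2 G) auto
      also have "\<dots> = S powr q * (\<Sum>k\<in>cube N. x k powr q)"
        using S(1) by (simp add: sum_distrib_left[symmetric] powr_diff)
      also have "\<dots> \<le> S powr q * B" by (intro mult_left_mono B finite_cube) simp
      finally show ?thesis .
    qed
    thus "\<exists>N. \<forall>n\<ge>N. (\<Sum>j\<in>G. s j n powr q) \<le> S powr q * B" by blast
  qed
  show ?thesis by (intro exI[of _ Y] conjI allI impI) (simp_all add: Y0 FY YX Lq)
qed

context lattice_kernel
begin

text \<open>The pieces are the filters of \<open>v\<close>. Bernstein's inequality and the identity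
  of \<open>v\<close> with the sum of its pieces hold almost everywhere; setting everything to zero
  off a common Borel set \<open>G'\<close> of full measure makes them hold everywhere and changes no
  filter. The superpolynomial weight turns the single bound \<open>X\<close> into all moments of
  \<open>A\<close>.\<close>

lemma exists_decomposition:
  fixes u' :: "real ^ 'n \<Rightarrow> real"
  defines "v \<equiv> \<lambda>x. complex_of_real (u' x)"
  assumes p: "1 \<le> p" and v: "lp_le p v A'"
    and a: "\<And>k. lp_le p (filt (lattice_point k) v) (a k)"
    and X: "\<And>k. latw k * a k \<le> X"
  shows "\<exists>z Cb u. 0 \<le> Cb \<and> decomposition \<sigma> d p z (\<lambda>k. Cb * a k) u \<and> (AE x in lborel. u x = u' x)"
proof -
  have vl: "l1inf v" by (rule l1inf_lp[OF p v])
  have vm [measurable]: "v \<in> borel_measurable borel" by (rule lp_le_meas[OF v])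
  \<comment> \<open>At least 1, so that \<open>A k\<close> bounds the L^p norm of the piece in
    addition to its supremum.\<close>
  define Cb where "Cb = max 1 (real nb * (\<kappa>1 + \<kappa>sup))"
  have Cb1: "1 \<le> Cb" by (simp add: Cb_def)
  define A where "A k = Cb * a k" for k
  have a0: "0 \<le> a k" for k using a[of k] by (simp add: lp_le_def)
  have aA: "a k \<le> A k" for k using mult_right_mono[OF Cb1 a0[of k]] by (simp add: A_def)
  have A0: "0 \<le> A k" for k using a0 aA order_trans by blast
  let ?w = "\<lambda>k. filt (lattice_point k) v"
  have wm [measurable]: "?w k \<in> borel_measurable borel" for k by measurable
  have "AE x in lborel. norm (?w k x) \<le> A k" for k
  proof (rule AE_mp[OF filt_bernstein[OF p vl a]], intro AE_I2 impI)
    fix x assume "norm (?w k x) \<le> real nb * ((\<kappa>1 + \<kappa>sup) * a k)"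
    also have "\<dots> \<le> A k" using mult_right_mono[OF max.cobounded2[of "real nb * (\<kappa>1 + \<kappa>sup)" 1] a0[of k]]
      by (simp add: A_def Cb_def mult.assoc)
    finally show "norm (?w k x) \<le> A k" .
  qed
  hence AEG: "AE x in lborel. \<forall>k. norm (?w k x) \<le> A k" by (simp add: AE_all_countable)
  define G where "G = {x. \<forall>k. norm (?w k x) \<le> A k}"
  have Gm [measurable]: "G \<in> sets borel"
  proof -
    have "G = (\<Inter>k. {x \<in> space borel. norm (?w k x) \<le> A k})" by (auto simp: G_def)
    also have "\<dots> \<in> sets borel" by (intro sets.countable_INT'') auto
    finally show ?thesis .
  qed
  obtain S :: real where S: "0 < S" "\<And>F :: (int ^ 'n) set. finite F \<Longrightarrow> (\<Sum>k\<in>F. cw k) \<le> S" using cw_sum_bounded by blast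
  have Apoly: "\<exists>C. \<forall>F. finite F \<longrightarrow> (\<Sum>k\<in>F. A k * (1 + norm (lattice_point k :: real ^ 'n)) ^ M) \<le> C" for M
  proof -
    obtain K where K: "0 \<le> K" "\<And>k :: int ^ 'n. (1 + norm (lattice_point k :: real ^ 'n)) ^ M \<le> K * cw k * latw k"
      using latw_superpoly by blast
    have CX: "0 \<le> Cb * X" using Cb1 order_trans[OF mult_nonneg_nonneg[OF less_imp_le[OF latw_pos] a0] X] by simp
    have 1: "A k * (1 + norm (lattice_point k :: real ^ 'n)) ^ M \<le> (Cb * X * K) * cw k" for k
    proof -
      have "A k * (1 + norm (lattice_point k :: real ^ 'n)) ^ M \<le> A k * (K * cw k * latw k)"
        by (intro mult_left_mono K A0)
      also have "\<dots> = Cb * (K * cw k) * (latw k * a k)" by (simp add: A_def)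
      also have "\<dots> \<le> Cb * (K * cw k) * X" using Cb1 K(1) cw_pos[of k] by (intro mult_left_mono X) auto
      finally show ?thesis by (simp add: mult.commute mult.left_commute)
    qed
    have "(\<Sum>k\<in>F. A k * (1 + norm (lattice_point k :: real ^ 'n)) ^ M) \<le> (Cb * X * K) * S" if F: "finite F" for F
    proof -
      have "(\<Sum>k\<in>F. A k * (1 + norm (lattice_point k :: real ^ 'n)) ^ M) \<le> (\<Sum>k\<in>F. (Cb * X * K) * cw k)" by (intro sum_mono 1)
      also have "\<dots> = (Cb * X * K) * (\<Sum>k\<in>F. cw k)" by (simp add: sum_distrib_left)
      also have "\<dots> \<le> (Cb * X * K) * S" using CX K(1) by (intro mult_left_mono S F) auto
      finally show ?thesis .
    qed
    thus ?thesis by blast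
  qed
  obtain C0 where C0: "\<And>F. finite F \<Longrightarrow> (\<Sum>k\<in>F. A k) \<le> C0" using Apoly[of 0] by auto
  have Asum: "A summable_on UNIV"
  proof (rule nonneg_bdd_above_summable_on[OF A0])
    show "bdd_above (sum A ` {F. F \<subseteq> UNIV \<and> finite F})"
    proof (rule bdd_aboveI2[where M = C0])
      fix F :: "(int ^ 'n) set" assume "F \<in> {F. F \<subseteq> UNIV \<and> finite F}"
      hence "finite F" by simp
      thus "sum A F \<le> C0" by (rule C0)
    qed
  qed
  \<comment> \<open>Summability of \<open>A\<close> makes the series converge absolutely on
    \<open>G\<close>, hence along the cubes, which are cofinal among the finite index sets.\<close>
  have conv: "(\<lambda>N. \<Sum>k\<in>cube N. ?w k x) \<longlonglongrightarrow> (\<Sum>\<^sub>\<infinity>k\<in>UNIV. ?w k x)" if x: "x \<in> G" for x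
  proof -
    have "(\<lambda>k. norm (?w k x)) summable_on UNIV"
      by (rule summable_on_comparison_test[OF Asum]) (use x in \<open>simp_all add: G_def\<close>)
    hence "((\<lambda>k. ?w k x) has_sum (\<Sum>\<^sub>\<infinity>k\<in>UNIV. ?w k x)) UNIV" by (rule has_sum_infsum[OF abs_summable_summable])
    hence l: "(sum (\<lambda>k. ?w k x) \<longlongrightarrow> (\<Sum>\<^sub>\<infinity>k\<in>UNIV. ?w k x)) (finite_subsets_at_top UNIV)" by (simp add: has_sum_def)
    have "filterlim (cube :: nat \<Rightarrow> (int ^ 'n) set) (finite_subsets_at_top UNIV) sequentially"
      unfolding filterlim_finite_subsets_at_top eventually_sequentially
    proof (intro allI impI)
      fix F :: "(int ^ 'n) set" assume "finite F \<and> F \<subseteq> UNIV"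
      then obtain N0 where "\<forall>N\<ge>N0. F \<subseteq> cube N" using finite_subset_cube by blast
      thus "\<exists>N. \<forall>n\<ge>N. finite (cube n :: (int ^ 'n) set) \<and> F \<subseteq> cube n \<and> cube n \<subseteq> (UNIV :: (int ^ 'n) set)"
        by (intro exI[of _ N0]) (simp add: finite_cube)
    qed
    from filterlim_compose[OF l this] show ?thesis by simp
  qed
  define h where "h x = (if x \<in> G then (\<Sum>\<^sub>\<infinity>k\<in>UNIV. ?w k x) else 0)" for x
  have hlim: "(\<lambda>N. if x \<in> G then (\<Sum>k\<in>cube N. ?w k x) else 0) \<longlonglongrightarrow> h x" for x
    using conv[of x] by (cases "x \<in> G") (auto simp: h_def)
  have hm [measurable]: "h \<in> borel_measurable borel"
    by (rule borel_measurable_LIMSEQ_metric[OF _ hlim]) measurable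
  have sb: "norm (\<Sum>k\<in>cube N. ?w k x) \<le> C0" if "x \<in> G" for N x
  proof -
    have "norm (\<Sum>k\<in>cube N. ?w k x) \<le> (\<Sum>k\<in>cube N. A k)" by (rule sum_norm_le) (use that in \<open>auto simp: G_def\<close>)
    also have "\<dots> \<le> C0" by (rule C0[OF finite_cube])
    finally show ?thesis .
  qed
  have C00: "0 \<le> C0" using C0[of "{}"] by simp
  have AEvh: "AE x in lborel. v x = h x"
  proof (rule lattice_reproducing[OF vl hm])
    show "norm (h x) \<le> C0" for x
    proof (cases "x \<in> G")
      case True
      have "norm (\<Sum>k\<in>cube N. ?w k x) \<le> C0" for N by (rule sb[OF True])
      hence "norm (\<Sum>\<^sub>\<infinity>k\<in>UNIV. ?w k x) \<le> C0" by (intro LIMSEQ_le_const2[OF tendsto_norm[OF conv[OF True]]]) auto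
      thus ?thesis using True by (simp add: h_def)
    qed (simp add: h_def C00)
    show "AE x in lborel. (\<lambda>N. \<Sum>k\<in>cube N. ?w k x) \<longlonglongrightarrow> h x"
      using AEG by (rule AE_mp) (intro AE_I2 impI, use conv in \<open>auto simp: h_def G_def\<close>)
    show "AE x in lborel. norm (\<Sum>k\<in>cube N. ?w k x) \<le> C0" for N
      using AEG by (rule AE_mp) (intro AE_I2 impI, use sb in \<open>auto simp: G_def\<close>)
  qed
  define G' where "G' = G \<inter> {x. h x = v x}"
  have G'm [measurable]: "G' \<in> sets borel"
  proof -
    have "{x \<in> space borel. h x = v x} \<in> sets borel" by measurable
    thus ?thesis by (simp add: G'_def)
  qed
  have AEG': "AE x in lborel. x \<in> G'"
    using AEG AEvh by eventually_elim (simp add: G'_def G_def)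
  define z where "z k x = (if x \<in> G' then ?w k x else 0)" for k x
  define u where "u x = (if x \<in> G' then u' x else 0)" for x
  have zm [measurable]: "z k \<in> borel_measurable borel" for k unfolding z_def by measurable
  have zw: "AE x in lborel. z k x = ?w k x" for k using AEG' by eventually_elim (simp add: z_def)
  have zA: "norm (z k x) \<le> A k" for k x using A0[of k] by (auto simp: z_def G'_def G_def)
  have zb: "bddm (z k)" for k unfolding bddm_def using zm zA by blast
  have dec: "decomposition \<sigma> d p z A u"
  proof unfold_locales
    fix k :: "int ^ 'n" and x and M :: nat
    show "1 \<le> p" by fact
    have wz: "AE x in lborel. ?w k x = z k x" using zw[of k] by eventually_elim simp
    show "freq_le (z k) (norm (lattice_point k :: real ^ 'n) + d)"
      by (rule freq_le_cong_AE[OF freq_le_filt[OF vl] zb wz])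
    have "filt b (z k) y = filt b (?w k) y" for b y by (rule filt_cong_AE[OF zw]) measurable
    thus "spec (z k) (cball (lattice_point k) (2 * d))"
      using spec_filt[OF vl, of "lattice_point k"] unfolding spec_def by simp
    have "AE x in lborel. norm (z k x) = norm (?w k x)" using zw[of k] by eventually_elim simp
    from lp_le_AE[OF a zm this] show "lp_le p (z k) (A k)" by (rule lp_le_mono[OF p _ aA])
    show "norm (z k x) \<le> A k" by (rule zA)
    show "\<exists>C. \<forall>F. finite F \<longrightarrow> (\<Sum>k\<in>F. A k * (1 + norm (lattice_point k :: real ^ 'n)) ^ M) \<le> C" by (rule Apoly)
    show "(\<lambda>N. \<Sum>k\<in>cube N. z k x) \<longlonglongrightarrow> of_real (u x)"
    proof (cases "x \<in> G'")
      case True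
      hence "x \<in> G" "h x = v x" by (auto simp: G'_def)
      thus ?thesis using conv[of x] True by (simp add: z_def u_def h_def v_def)
    qed (simp add: z_def u_def)
  qed
  have "AE x in lborel. u x = u' x" using AEG' by eventually_elim (simp add: u_def)
  thus ?thesis using dec Cb1 unfolding A_def by (intro exI[of _ z] exI[of _ Cb] exI[of _ u]) auto
qed

end

section \<open>Composition operators\<close>

text \<open>The argument \<open>1 * \<bar>\<xi>\<bar> powr (1 + \<epsilon>)\<close> matches the
  hypothesis on \<open>\<mu>\<close> with dilation 1, which therefore bounds all absolute moments;
  smoothness of \<open>f\<close> rests on this.\<close>

lemma power_le_weight:
  assumes \<epsilon>: "0 < \<epsilon>" and \<theta>: "1 < \<theta>"
  shows "\<bar>\<xi>\<bar> ^ m \<le> exp (real m * exp (real m)) * um_weight \<theta> (1 * \<bar>\<xi>\<bar> powr (1 + \<epsilon>))"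
proof -
  let ?J = "jap (1 * \<bar>\<xi>\<bar> powr (1 + \<epsilon>))"
  have J: "ee \<le> ?J" by (rule jap_ge_ee)
  hence J1: "1 \<le> ?J" using ee_ge_1 by linarith
  have "\<bar>\<xi>\<bar> \<le> ?J"
  proof (cases "\<bar>\<xi>\<bar> \<le> 1")
    case False
    hence "\<bar>\<xi>\<bar> powr 1 \<le> \<bar>\<xi>\<bar> powr (1 + \<epsilon>)" using \<epsilon> by (intro powr_mono) auto
    moreover have "\<bar>\<xi>\<bar> powr (1 + \<epsilon>) \<le> ?J" using jap_ge_norm[of "1 * \<bar>\<xi>\<bar> powr (1 + \<epsilon>)"] by simp
    ultimately show ?thesis by (simp del: abs_le_iff)
  qed (use J1 in linarith)
  hence "\<bar>\<xi>\<bar> ^ m \<le> ?J ^ m" by (intro power_mono) auto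
  also have "\<dots> = ?J powr real m" using J1 by (simp add: powr_realpow)
  also have "\<dots> \<le> exp (real m * exp (real m)) * exp (QQ ?J)" by (rule exp_QQ_superpoly[OF J]) simp
  also have "\<dots> \<le> exp (real m * exp (real m)) * exp (\<theta> * QQ ?J)"
    using mult_right_mono[OF less_imp_le[OF \<theta>] QQ_nonneg[OF J]] by simp
  finally show ?thesis by (simp only: um_weight_QQ)
qed

lemma um_weight_measurable [measurable]: "um_weight s \<in> borel_measurable (borel :: real measure)"
  unfolding um_weight_def jap_def by measurable

section \<open>Four positive parts of a complex measure\<close>

text \<open>For \<open>w\<close> in \<open>units4\<close> these are the Jordan parts of the real and
  imaginary parts of \<open>\<mu>\<close>: \<open>w\<close> and \<open>- w\<close> give the positive
  and the negative variation of the same component.\<close>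

abbreviation part_measure :: "(real set \<Rightarrow> complex) \<Rightarrow> complex \<Rightarrow> real measure" where
  "part_measure \<mu> w \<equiv> pos_variation borel (\<lambda>A. Re (cnj w * \<mu> A))"

abbreviation units4 :: "complex set" where "units4 \<equiv> {1, -1, \<i>, -\<i>}"

lemma units4_norm: "w \<in> units4 \<Longrightarrow> norm w = 1" by auto

lemma sum_units4: "(\<Sum>w\<in>units4. g w) = g 1 + g (- 1) + g \<i> + (g (- \<i>) :: complex)"
proof -
  have "(1::complex) \<notin> {-1, \<i>, -\<i>}" "(-1::complex) \<notin> {\<i>, -\<i>}" "\<i> \<notin> {-\<i>}" by (auto simp: complex_eq_iff)
  thus ?thesis by (simp add: add.assoc)
qed

lemma part_measure_sums:
  assumes cm: "complex_measure borel \<mu>" and A: "range A \<subseteq> sets borel" "disjoint_family A"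
  shows "(\<lambda>i. Re (cnj w * \<mu> (A i))) sums Re (cnj w * \<mu> (\<Union>i. A i))"
  using cm A by (intro sums_Re sums_mult) (simp add: complex_measure_def)

lemma part_measure_nn_le:
  assumes cm: "complex_measure borel \<mu>" and w: "w \<in> units4"
  shows "(\<integral>\<^sup>+\<xi>. g \<xi> \<partial>part_measure \<mu> w) \<le> (\<integral>\<^sup>+\<xi>. g \<xi> \<partial>total_variation borel \<mu>)"
proof (rule nn_integral_mono_measure)
  have "part_measure \<mu> w \<le> total_variation borel \<mu>"
  proof (rule pos_variation_le_total_variation[OF cm])
    fix B :: "real set"
    have "Re (cnj w * \<mu> B) \<le> norm (cnj w * \<mu> B)" by (rule complex_Re_le_cmod)
    thus "Re (cnj w * \<mu> B) \<le> norm (\<mu> B)" using units4_norm[OF w] by (simp add: norm_mult)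
  qed (rule part_measure_sums[OF cm])
  thus "part_measure \<mu> w \<le> total_variation borel \<mu>" .
qed simp

lemma part_measure_finite:
  assumes cm: "complex_measure borel \<mu>" and w: "w \<in> units4" and \<theta>: "1 < \<theta>"
    and fin: "(\<integral>\<^sup>+\<xi>. ennreal (um_weight \<theta> (l * \<bar>\<xi>\<bar> powr (1 + \<epsilon>))) \<partial>total_variation borel \<mu>) < \<infinity>"
  shows "finite_measure (part_measure \<mu> w)"
proof (rule finite_measureI)
  have "emeasure (part_measure \<mu> w) (space (part_measure \<mu> w)) = (\<integral>\<^sup>+\<xi>. 1 \<partial>part_measure \<mu> w)" by simp
  also have "\<dots> \<le> (\<integral>\<^sup>+\<xi>. 1 \<partial>total_variation borel \<mu>)" by (rule part_measure_nn_le[OF cm w])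
  also have "\<dots> \<le> (\<integral>\<^sup>+\<xi>. ennreal (um_weight \<theta> (l * \<bar>\<xi>\<bar> powr (1 + \<epsilon>))) \<partial>total_variation borel \<mu>)"
    using \<theta> by (intro nn_integral_mono) (simp add: um_weight_ge_1)
  also note fin
  finally show "emeasure (part_measure \<mu> w) (space (part_measure \<mu> w)) \<noteq> \<infinity>" by simp
qed

lemma inv_fourier_measure_units4:
  "inv_fourier_measure \<mu> t = (\<Sum>w\<in>units4. (of_real (1 / sqrt (2 * pi)) * w) * mexp (part_measure \<mu> w) 0 t)"
  unfolding sum_units4 inv_fourier_measure_def complex_measure_integral_def signed_integral_def mexp_def
  by (simp add: algebra_simps)

text \<open>As the total mass of \<open>\<mu>\<close> is zero, the parts for \<open>w\<close> and
  \<open>- w\<close> have equal mass and the constants cancel in pairs. This permits subtracting 1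
  from the exponentials, necessary because nonzero constants are not in L^p.\<close>

lemma part_measure_total_balance:
  assumes cm: "complex_measure borel \<mu>" and z: "\<mu> UNIV = 0" and fin: "\<And>w. w \<in> units4 \<Longrightarrow> finite_measure (part_measure \<mu> w)"
  shows "(\<Sum>w\<in>units4. c * w * of_real (measure (part_measure \<mu> w) UNIV)) = 0"
proof -
  have f: "pvar borel (\<lambda>A. Re (cnj w * \<mu> A)) UNIV < \<infinity>" if w: "w \<in> units4" for w
  proof -
    have "emeasure (part_measure \<mu> w) UNIV = pvar borel (\<lambda>A. Re (cnj w * \<mu> A)) UNIV"
      by (rule emeasure_pos_variation[OF part_measure_sums[OF cm]]) auto
    moreover have "emeasure (part_measure \<mu> w) UNIV < \<infinity>"
      using finite_measure.emeasure_finite[OF fin[OF w], of UNIV] by (simp add: top.not_eq_extremum)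
    ultimately show ?thesis by simp
  qed
  have j: "measure (part_measure \<mu> w) UNIV = measure (part_measure \<mu> (- w)) UNIV" if w: "w \<in> units4" for w
  proof -
    have m: "(\<lambda>A. - Re (cnj w * \<mu> A)) = (\<lambda>A. Re (cnj (- w) * \<mu> A))" by simp
    have w': "- w \<in> units4" using w by auto
    have "measure (part_measure \<mu> w) (space borel) - measure (pos_variation borel (\<lambda>A. - Re (cnj w * \<mu> A))) (space borel)
      = Re (cnj w * \<mu> (space borel))"
    proof (rule jordan_total)
      show "pvar borel (\<lambda>A. Re (cnj w * \<mu> A)) (space borel) < \<infinity>" using f[OF w] by simp
      show "pvar borel (\<lambda>A. - Re (cnj w * \<mu> A)) (space borel) < \<infinity>" unfolding m using f[OF w'] by simp
    qed (rule part_measure_sums[OF cm])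
    thus ?thesis unfolding m using z by simp
  qed
  show ?thesis unfolding sum_units4 using j[of 1] j[of \<i>] by simp
qed

lemma expm1_integrable:
  assumes fm: "finite_measure M" and sb: "sets M = sets borel"
  shows "integrable M (\<lambda>\<xi>. exp (\<i> * of_real (\<xi> * t)) - 1)"
proof (rule finite_measure.integrable_const_bound[OF fm, of _ 2])
  have [measurable_cong]: "sets M = sets borel" by fact
  show "(\<lambda>\<xi>. exp (\<i> * of_real (\<xi> * t)) - 1) \<in> borel_measurable M" by measurable
  have "norm (exp (\<i> * of_real (\<xi> * t)) - 1) \<le> 2" for \<xi>
    by (rule order_trans[OF norm_triangle_ineq4]) simp
  thus "AE \<xi> in M. norm (exp (\<i> * of_real (\<xi> * t)) - 1) \<le> 2" by simp
qed

definition dexp :: "real measure \<Rightarrow> real \<Rightarrow> complex" where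
  "dexp \<nu> t = (\<integral>\<xi>. (exp (\<i> * of_real (\<xi> * t)) - 1) \<partial>\<nu>)"

lemma dexp_eq:
  assumes "finite_measure \<nu>" "sets \<nu> = sets borel"
  shows "dexp \<nu> t = mexp \<nu> 0 t - of_real (measure \<nu> UNIV)"
proof -
  interpret finite_measure \<nu> by fact
  have i: "integrable \<nu> (\<lambda>\<xi>. (\<i> * of_real \<xi>) ^ 0 * exp (\<i> * of_real (\<xi> * t)))"
    by (rule mexp_integrable) (use assms in auto)
  have sp: "space \<nu> = UNIV" using sets_eq_imp_space_eq[OF assms(2)] by simp
  have "dexp \<nu> t = (\<integral>\<xi>. exp (\<i> * of_real (\<xi> * t)) \<partial>\<nu>) - (\<integral>\<xi>. 1 \<partial>\<nu>)"
    unfolding dexp_def by (rule Bochner_Integration.integral_diff) (use i in auto)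
  thus ?thesis by (simp add: mexp_def sp scaleR_conv_of_real)
qed

lemma dexp_bound:
  assumes "finite_measure \<nu>" "sets \<nu> = sets borel" and i: "integrable \<nu> (\<lambda>\<xi>. \<bar>\<xi>\<bar>)"
  shows "norm (dexp \<nu> t) \<le> (\<integral>\<xi>. \<bar>\<xi>\<bar> \<partial>\<nu>) * \<bar>t\<bar>"
proof -
  interpret finite_measure \<nu> by fact
  have "norm (dexp \<nu> t) \<le> (\<integral>\<xi>. \<bar>\<xi>\<bar> * \<bar>t\<bar> \<partial>\<nu>)"
    unfolding dexp_def
  proof (rule Bochner_Integration.integral_norm_bound_integral[OF expm1_integrable[OF assms(1,2)]])
    show "integrable \<nu> (\<lambda>\<xi>. \<bar>\<xi>\<bar> * \<bar>t\<bar>)" using i by simp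
    show "norm (exp (\<i> * of_real (\<xi> * t)) - 1) \<le> \<bar>\<xi>\<bar> * \<bar>t\<bar>" for \<xi>
      using exp_i_diff_le[of "\<xi> * t"] by (simp only: abs_mult)
  qed
  thus ?thesis by simp
qed

lemma dexp_measurable:
  assumes "finite_measure \<nu>" "sets \<nu> = sets borel"
  shows "dexp \<nu> \<in> borel_measurable borel"
proof -
  interpret finite_measure \<nu> by fact
  have [measurable_cong]: "sets \<nu> = sets borel" by fact
  show ?thesis unfolding dexp_def by measurable
qed

context decomposition
begin

lemma u_measurable [measurable]: "u \<in> borel_measurable borel"
proof -
  have "(\<lambda>x. complex_of_real (u x)) \<in> borel_measurable borel"
    by (rule borel_measurable_LIMSEQ_metric[OF _ ulim]) measurable
  hence "(\<lambda>x. Re (complex_of_real (u x))) \<in> borel_measurable borel" by measurable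
  thus ?thesis by simp
qed

text \<open>Fubini exchanges the filter with the integral over \<xi>; Minkowski's inequality then
  takes the weight \<open>W\<close> as masses and the filtered exponentials divided by
  \<open>W\<close> as slices of uniform size. The dilation \<open>l\<close> comes from
  \<open>exp_estimate\<close> and depends on the decomposition of \<open>u\<close>, hence the
  hypothesis for all dilations.\<close>

lemma composition_estimate:
  fixes \<epsilon> \<theta> :: real
  assumes \<epsilon>: "0 < \<epsilon>" and \<theta>: "1 < \<theta>" and fm: "finite_measure \<nu>" and sb: "sets \<nu> = sets borel"
    and fin: "\<And>l. 0 < l \<Longrightarrow> (\<integral>\<^sup>+\<xi>. ennreal (um_weight \<theta> (l * \<bar>\<xi>\<bar> powr (1 + \<epsilon>))) \<partial>\<nu>) < \<infinity>"
  shows "\<exists>K\<ge>0. \<forall>j Y. (\<forall>F. finite F \<longrightarrow> (\<Sum>k\<in>F. cw (j - k) * latw k * A k) \<le> Y) \<longrightarrow>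
    lp_le p (filt (lattice_point j) (\<lambda>x. dexp \<nu> (u x))) (K * (Y / latw j))"
proof -
  interpret finite_measure \<nu> by fact
  have [measurable_cong]: "sets \<nu> = sets borel" by fact
  from exp_estimate[OF \<epsilon> \<theta>] obtain C l where C: "0 \<le> C" and l: "0 < l"
    and est: "\<And>\<xi> j Y. (\<And>F. finite F \<Longrightarrow> (\<Sum>k\<in>F. cw (j - k) * latw k * A k) \<le> Y) \<Longrightarrow>
      lp_le p (filt (lattice_point j) (\<lambda>x. exp (\<i> * of_real (\<xi> * u x)) - 1)) (C * um_weight \<theta> (l * \<bar>\<xi>\<bar> powr (1 + \<epsilon>)) * (Y / latw j))"
    by meson
  define W where "W \<xi> = um_weight \<theta> (l * \<bar>\<xi>\<bar> powr (1 + \<epsilon>))" for \<xi>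
  have W1: "1 \<le> W \<xi>" for \<xi> unfolding W_def using \<theta> by (intro um_weight_ge_1) simp
  have Wm [measurable]: "W \<in> borel_measurable borel" unfolding W_def by measurable
  have Wf: "(\<integral>\<^sup>+\<xi>. ennreal (W \<xi>) \<partial>\<nu>) < \<infinity>" unfolding W_def by (rule fin[OF l])
  define I where "I = enn2real (\<integral>\<^sup>+\<xi>. ennreal (W \<xi>) \<partial>\<nu>)"
  have I: "0 \<le> I" "(\<integral>\<^sup>+\<xi>. ennreal (W \<xi>) \<partial>\<nu>) \<le> ennreal I" using Wf by (auto simp: I_def)
  define E where "E \<xi> x = exp (\<i> * of_real (\<xi> * u x)) - 1" for \<xi> x
  have E2: "norm (E \<xi> x) \<le> 2" for \<xi> x unfolding E_def
    by (rule order_trans[OF norm_triangle_ineq4]) simp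
  have Em [measurable]: "(\<lambda>(\<xi>, x). E \<xi> x) \<in> borel_measurable (borel \<Otimes>\<^sub>M borel)" unfolding E_def by measurable
  show ?thesis
  proof (intro exI[of _ "I * C"] conjI allI impI)
    show "0 \<le> I * C" using I C by simp
    fix j Y assume Y: "\<forall>F. finite F \<longrightarrow> (\<Sum>k\<in>F. cw (j - k) * latw k * A k) \<le> Y"
    let ?a = "lattice_point j :: real ^ 'n" and ?B = "C * (Y / latw j)"
    have Y0: "0 \<le> Y" using Y[rule_format, of "{}"] by simp
    have B0: "0 \<le> ?B" using C Y0 latw_pos[of j] by simp
    have fE: "lp_le p (filt ?a (E \<xi>)) (W \<xi> * ?B)" for \<xi>
      using est[of j Y \<xi>] Y unfolding E_def W_def by (simp add: mult_ac)
    have fm2 [measurable]: "(\<lambda>(y, \<xi>). filt ?a (E \<xi>) y) \<in> borel_measurable (lborel \<Otimes>\<^sub>M \<nu>)"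
      unfolding filt_def by measurable
    have um [measurable]: "(\<lambda>x. dexp \<nu> (u x)) \<in> borel_measurable borel"
      using measurable_compose[OF u_measurable dexp_measurable[OF fm sb]] .
    have fub: "filt ?a (\<lambda>x. dexp \<nu> (u x)) y = (\<integral>\<xi>. filt ?a (E \<xi>) y \<partial>\<nu>)"
      and fui: "integrable \<nu> (\<lambda>\<xi>. filt ?a (E \<xi>) y)" for y
    proof -
      let ?k = "\<lambda>x. \<kappa> (y - x) * exp (\<i> * of_real (?a \<bullet> (y - x)))"
      have ki: "integrable lborel ?k"
      proof (rule Bochner_Integration.integrable_bound[OF \<kappa>_shift_integrable[of y]])
        show "AE x in lborel. norm (?k x) \<le> norm (\<kappa> (y - x))" by (simp add: norm_mult)
      qed measurable
      have Em': "(\<lambda>(x, \<xi>). E \<xi> x) \<in> borel_measurable (lborel \<Otimes>\<^sub>M \<nu>)" by measurable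
      note fb = fubini_mult[OF sigma_finite_lborel sigma_finite_measure_axioms ki integrable_const[of "1::complex"] Em' E2]
      show "filt ?a (\<lambda>x. dexp \<nu> (u x)) y = (\<integral>\<xi>. filt ?a (E \<xi>) y \<partial>\<nu>)"
        using fb(1) by (simp only: filt_def dexp_def E_def mult_1_left)
      show "integrable \<nu> (\<lambda>\<xi>. filt ?a (E \<xi>) y)"
        using fb(3) by (simp only: filt_def mult_1_left)
    qed
    have "(\<integral>\<^sup>+y. ennreal (\<bar>norm (filt ?a (\<lambda>x. dexp \<nu> (u x)) y)\<bar> powr p) \<partial>lborel) \<le> ennreal ((I * ?B) powr p)"
    proof (rule minkowski_nn[OF sigma_finite_lborel sigma_finite_measure_axioms p, where N = W and T = "\<lambda>y \<xi>. norm (filt ?a (E \<xi>) y) / W \<xi>"])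
      show "W \<in> borel_measurable \<nu>" by measurable
      show "(\<lambda>(y, \<xi>). norm (filt ?a (E \<xi>) y) / W \<xi>) \<in> borel_measurable (lborel \<Otimes>\<^sub>M \<nu>)" by measurable
      show "0 \<le> W \<xi>" for \<xi> using W1[of \<xi>] by simp
      show "0 \<le> norm (filt ?a (E \<xi>) y) / W \<xi>" for y \<xi> using W1[of \<xi>] by simp
      show "0 \<le> ?B" by (rule B0)
      show "0 \<le> I" "(\<integral>\<^sup>+\<xi>. ennreal (W \<xi>) \<partial>\<nu>) \<le> ennreal I" by (rule I)+
      show "(\<integral>\<^sup>+y. ennreal ((norm (filt ?a (E \<xi>) y) / W \<xi>) powr p) \<partial>lborel) \<le> ennreal (?B powr p)" for \<xi>
      proof -
        have W0: "0 < W \<xi>" using W1[of \<xi>] by simp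
        have "lp_le p (\<lambda>y. of_real (1 / W \<xi>) * filt ?a (E \<xi>) y) ((1 / W \<xi>) * (W \<xi> * ?B))"
        proof (rule lp_le_dominated[OF p fE])
          show "(\<lambda>y. of_real (1 / W \<xi>) * filt ?a (E \<xi>) y) \<in> borel_measurable borel"
            using lp_le_meas[OF fE[of \<xi>]] by measurable
        qed (use W0 in \<open>auto simp: norm_mult norm_divide\<close>)
        moreover have "norm (of_real (1 / W \<xi>) * filt ?a (E \<xi>) y) = norm (filt ?a (E \<xi>) y) / W \<xi>" for y
          using W0 by (simp add: norm_mult norm_divide)
        ultimately show ?thesis using W0 unfolding lp_le_def by simp
      qed
      show "ennreal \<bar>norm (filt ?a (\<lambda>x. dexp \<nu> (u x)) y)\<bar> \<le> (\<integral>\<^sup>+\<xi>. ennreal (W \<xi> * (norm (filt ?a (E \<xi>) y) / W \<xi>)) \<partial>\<nu>)" for y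
      proof -
        have "W \<xi> * (norm (filt ?a (E \<xi>) y) / W \<xi>) = norm (filt ?a (E \<xi>) y)" for \<xi>
          using W1[of \<xi>] by simp
        thus ?thesis unfolding fub using integral_norm_bound_ennreal[OF fui] by simp
      qed
    qed
    moreover have "filt ?a (\<lambda>x. dexp \<nu> (u x)) \<in> borel_measurable borel" by measurable
    ultimately show "lp_le p (filt ?a (\<lambda>x. dexp \<nu> (u x))) (I * C * (Y / latw j))"
      using mult_nonneg_nonneg[OF I(1) B0] unfolding lp_le_def abs_norm_cancel mult.assoc[of I C] by blast
  qed
qed

lemma composition_estimate_sum:
  fixes \<epsilon> \<theta> :: real and \<nu> :: "'i \<Rightarrow> real measure"
  assumes \<epsilon>: "0 < \<epsilon>" and \<theta>: "1 < \<theta>" and U: "finite U" and fm: "\<And>w. w \<in> U \<Longrightarrow> finite_measure (\<nu> w)" and sb: "\<And>w. sets (\<nu> w) = sets borel"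
    and fin: "\<And>w l. w \<in> U \<Longrightarrow> 0 < l \<Longrightarrow> (\<integral>\<^sup>+\<xi>. ennreal (um_weight \<theta> (l * \<bar>\<xi>\<bar> powr (1 + \<epsilon>))) \<partial>\<nu> w) < \<infinity>"
  shows "\<exists>K\<ge>0. \<forall>j Y. (\<forall>F. finite F \<longrightarrow> (\<Sum>k\<in>F. cw (j - k) * latw k * A k) \<le> Y) \<longrightarrow>
    lp_le p (filt (lattice_point j) (\<lambda>x. \<Sum>w\<in>U. c w * dexp (\<nu> w) (u x))) (K * (Y / latw j))"
proof -
  have "\<forall>w\<in>U. \<exists>K\<ge>0. \<forall>j Y. (\<forall>F. finite F \<longrightarrow> (\<Sum>k\<in>F. cw (j - k) * latw k * A k) \<le> Y) \<longrightarrow>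
    lp_le p (filt (lattice_point j) (\<lambda>x. dexp (\<nu> w) (u x))) (K * (Y / latw j))"
    using composition_estimate[OF \<epsilon> \<theta> fm sb fin] by blast
  then obtain K where K: "\<And>w. w \<in> U \<Longrightarrow> 0 \<le> K w" "\<And>w j Y. w \<in> U \<Longrightarrow> (\<forall>F. finite F \<longrightarrow> (\<Sum>k\<in>F. cw (j - k) * latw k * A k) \<le> Y) \<Longrightarrow>
    lp_le p (filt (lattice_point j) (\<lambda>x. dexp (\<nu> w) (u x))) (K w * (Y / latw j))" by (metis (no_types))
  show ?thesis
  proof (intro exI[of _ "\<Sum>w\<in>U. norm (c w) * K w"] conjI allI impI)
    show "0 \<le> (\<Sum>w\<in>U. norm (c w) * K w)" by (intro sum_nonneg mult_nonneg_nonneg K) auto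
    fix j Y assume Y: "\<forall>F. finite F \<longrightarrow> (\<Sum>k\<in>F. cw (j - k) * latw k * A k) \<le> Y"
    have dl: "l1inf (\<lambda>x. c w * dexp (\<nu> w) (u x))" if w: "w \<in> U" for w
    proof (rule l1inf_bounded)
      interpret finite_measure "\<nu> w" by (rule fm[OF w])
      show "(\<lambda>x. c w * dexp (\<nu> w) (u x)) \<in> borel_measurable borel"
        using measurable_compose[OF u_measurable dexp_measurable[OF fm[OF w] sb]] by measurable
      show "norm (c w * dexp (\<nu> w) (u x)) \<le> norm (c w) * (measure (\<nu> w) UNIV + measure (\<nu> w) UNIV)" for x
      proof -
        have sp: "space (\<nu> w) = UNIV" using sets_eq_imp_space_eq[OF sb[of w]] by simp
        have "norm (mexp (\<nu> w) 0 (u x)) \<le> (\<integral>\<xi>. norm ((\<i> * of_real \<xi>) ^ 0 * exp (\<i> * of_real (\<xi> * u x))) \<partial>\<nu> w)"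
          unfolding mexp_def by (rule integral_norm_bound)
        also have "\<dots> = measure (\<nu> w) UNIV" by (simp add: norm_mult sp)
        finally have "norm (dexp (\<nu> w) (u x)) \<le> measure (\<nu> w) UNIV + measure (\<nu> w) UNIV"
          unfolding dexp_eq[OF fm[OF w] sb] by (intro order_trans[OF norm_triangle_ineq4] add_mono) auto
        thus ?thesis unfolding norm_mult by (rule mult_left_mono) simp
      qed
    qed
    have "filt (lattice_point j) (\<lambda>x. \<Sum>w\<in>U. c w * dexp (\<nu> w) (u x)) = (\<lambda>y. \<Sum>w\<in>U. c w * filt (lattice_point j) (\<lambda>x. dexp (\<nu> w) (u x)) y)"
    proof
      fix y
      show "filt (lattice_point j) (\<lambda>x. \<Sum>w\<in>U. c w * dexp (\<nu> w) (u x)) y = (\<Sum>w\<in>U. c w * filt (lattice_point j) (\<lambda>x. dexp (\<nu> w) (u x)) y)"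
        using filt_sum[OF U dl] by (simp add: filt_cmult)
    qed
    moreover have "lp_le p (\<lambda>y. \<Sum>w\<in>U. c w * filt (lattice_point j) (\<lambda>x. dexp (\<nu> w) (u x)) y) (\<Sum>w\<in>U. norm (c w) * (K w * (Y / latw j)))"
    proof (rule lp_le_sum[OF p U])
      fix w assume w: "w \<in> U"
      note l = K(2)[OF w Y]
      show "lp_le p (\<lambda>y. c w * filt (lattice_point j) (\<lambda>x. dexp (\<nu> w) (u x)) y) (norm (c w) * (K w * (Y / latw j)))"
      proof (rule lp_le_dominated[OF p l])
        show "(\<lambda>y. c w * filt (lattice_point j) (\<lambda>x. dexp (\<nu> w) (u x)) y) \<in> borel_measurable borel"
          using lp_le_meas[OF l] by measurable
      qed (simp_all add: norm_mult)
    qed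
    ultimately show "lp_le p (filt (lattice_point j) (\<lambda>x. \<Sum>w\<in>U. c w * dexp (\<nu> w) (u x))) ((\<Sum>w\<in>U. norm (c w) * K w) * (Y / latw j))"
      by (simp only: sum_distrib_right mult.assoc)
  qed
qed

end

section \<open>The norm as a norm of sequences\<close>

lemma um_weight_powr: "um_weight s x = um_weight 1 x powr s"
  by (simp add: um_weight_QQ exp_powr_real mult.commute)

lemma infsum_ennreal_eq_SUP: "(\<Sum>\<^sub>\<infinity>k\<in>UNIV. h k :: ennreal) = (SUP F\<in>{F. finite F}. sum h F)"
  by (subst nonneg_infsum_complete) auto

text \<open>Replaces the extended norm by a real sequence that is bounded and, for finite q,
  summable to the power q. In the latter case boundedness is the inclusion of l^q in the bounded
  sequences: a term above 1 is at most its own q-th power.\<close>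

lemma UM_norm_finiteD:
  fixes \<rho> :: "real ^ 'n \<Rightarrow> real"
  defines "D \<equiv> \<lambda>g p k. dist_Lp_norm p (box_op \<rho> k g)"
  assumes fin: "UM_norm \<rho> p q g < \<infinity>" and q: "1 \<le> q"
  shows "(\<forall>k. D g p k < \<infinity>) \<and> (\<exists>X. \<forall>k. latw k * enn2real (D g p k) \<le> X) \<and>
    (q \<noteq> \<infinity> \<longrightarrow> (\<exists>B. \<forall>F. finite F \<longrightarrow> (\<Sum>k\<in>F. (latw k * enn2real (D g p k)) powr enn2real q) \<le> B))"
proof (cases "q = \<infinity>")
  case True
  define S where "S = (SUP k. ennreal (latw k) * D g p k)"
  have S: "S < \<infinity>" using fin True by (simp add: UM_norm_def S_def D_def)
  have le: "ennreal (latw k) * D g p k \<le> S" for k unfolding S_def by (rule SUP_upper) simp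
  have 1: "D g p k < \<infinity>" for k
  proof (rule ccontr)
    assume "\<not> D g p k < \<infinity>"
    hence "ennreal (latw k) * D g p k = \<infinity>" using latw_pos[of k] by (simp add: ennreal_mult_eq_top_iff top.not_eq_extremum[symmetric])
    thus False using le[of k] S by (simp add: top_unique)
  qed
  have "latw k * enn2real (D g p k) \<le> enn2real S" for k
    using enn2real_mono[OF le[of k]] S latw_pos[of k] by (simp add: enn2real_mult)
  thus ?thesis using 1 True by blast
next
  case False
  let ?q = "enn2real q"
  have q1: "1 \<le> ?q" using q False by (cases q) auto
  define h where "h k = ennreal (um_weight ?q (lattice_point k :: real ^ 'n)) * ennpowr (D g p k) ?q" for k
  define T where "T = (\<Sum>\<^sub>\<infinity>k\<in>UNIV. h k)"
  have "ennpowr T (1 / ?q) < \<infinity>" using fin False by (simp add: UM_norm_def T_def h_def D_def)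
  hence T: "T < \<infinity>" by (auto simp: ennpowr_def top.not_eq_extremum split: if_splits)
  have le: "sum h F \<le> T" if "finite F" for F
    unfolding T_def infsum_ennreal_eq_SUP by (rule SUP_upper) (use that in simp)
  have 1: "D g p k < \<infinity>" for k
  proof (rule ccontr)
    assume "\<not> D g p k < \<infinity>"
    hence "D g p k = \<infinity>" by (simp add: top.not_eq_extremum[symmetric])
    hence "h k = \<infinity>" by (simp add: h_def ennpowr_def ennreal_mult_eq_top_iff um_weight_def)
    thus False using le[of "{k}"] T by (simp add: top_unique)
  qed
  have h: "h k = ennreal ((latw k * enn2real (D g p k)) powr ?q)" for k
  proof -
    have "ennpowr (D g p k) ?q = ennreal (enn2real (D g p k) powr ?q)" using 1[of k] by (simp add: ennpowr_def)
    thus ?thesis using latw_pos[of k]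
      by (simp add: h_def um_weight_powr[of ?q] powr_mult ennreal_mult')
  qed
  have B: "(\<Sum>k\<in>F. (latw k * enn2real (D g p k)) powr ?q) \<le> enn2real T" if F: "finite F" for F
  proof -
    have "ennreal (\<Sum>k\<in>F. (latw k * enn2real (D g p k)) powr ?q) = sum h F" by (simp add: h sum_ennreal)
    also have "\<dots> \<le> T" by (rule le[OF F])
    also have "\<dots> = ennreal (enn2real T)" using T by simp
    finally show ?thesis by (subst (asm) ennreal_le_iff) auto
  qed
  have "latw k * enn2real (D g p k) \<le> max 1 (enn2real T)" for k
  proof (cases "latw k * enn2real (D g p k) \<le> 1")
    case False
    hence "(latw k * enn2real (D g p k)) powr 1 \<le> (latw k * enn2real (D g p k)) powr ?q" by (intro powr_mono q1) auto
    thus ?thesis using B[of "{k}"] False by simp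
  qed simp
  thus ?thesis using 1 B by blast
qed

lemma UM_norm_finiteI:
  fixes \<rho> :: "real ^ 'n \<Rightarrow> real"
  assumes q: "1 \<le> q" and D: "\<And>k. dist_Lp_norm p (box_op \<rho> k g) \<le> ennreal (y k / latw k)"
    and y: "\<And>k. 0 \<le> y k" "\<And>k. y k \<le> X"
    and B: "q \<noteq> \<infinity> \<Longrightarrow> \<exists>B. \<forall>F. finite F \<longrightarrow> (\<Sum>k\<in>F. y k powr enn2real q) \<le> B"
  shows "UM_norm \<rho> p q g < \<infinity>"
proof (cases "q = \<infinity>")
  case True
  have "ennreal (latw k) * dist_Lp_norm p (box_op \<rho> k g) \<le> ennreal X" for k
  proof -
    have "ennreal (latw k) * dist_Lp_norm p (box_op \<rho> k g) \<le> ennreal (latw k) * ennreal (y k / latw k)"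
      by (intro mult_left_mono D) simp
    also have "\<dots> = ennreal (y k)" using latw_pos[of k] by (simp add: ennreal_mult'[symmetric])
    also have "\<dots> \<le> ennreal X" by (intro ennreal_leI y)
    finally show ?thesis .
  qed
  hence "UM_norm \<rho> p q g \<le> ennreal X" using True by (simp add: UM_norm_def SUP_le_iff)
  also have "\<dots> < \<infinity>" by simp
  finally show ?thesis .
next
  case False
  let ?q = "enn2real q"
  have q1: "1 \<le> ?q" using q False by (cases q) auto
  obtain B where B: "\<And>F. finite F \<Longrightarrow> (\<Sum>k\<in>F. y k powr ?q) \<le> B" using assms(5)[OF False] by blast
  define h where "h k = ennreal (um_weight ?q (lattice_point k :: real ^ 'n)) * ennpowr (dist_Lp_norm p (box_op \<rho> k g)) ?q" for k
  have h: "h k \<le> ennreal (y k powr ?q)" for k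
  proof -
    have yl: "0 \<le> y k / latw k" using y(1)[of k] latw_pos[of k] by simp
    have f: "dist_Lp_norm p (box_op \<rho> k g) < \<infinity>" using D[of k] by (rule order_le_less_trans) simp
    have "enn2real (dist_Lp_norm p (box_op \<rho> k g)) \<le> y k / latw k"
      using enn2real_mono[OF D[of k]] yl by simp
    hence "ennpowr (dist_Lp_norm p (box_op \<rho> k g)) ?q \<le> ennreal ((y k / latw k) powr ?q)"
      using less_imp_neq[OF f] q1 by (simp add: ennpowr_def powr_mono2 ennreal_leI)
    hence "h k \<le> ennreal (um_weight ?q (lattice_point k :: real ^ 'n)) * ennreal ((y k / latw k) powr ?q)"
      unfolding h_def by (rule mult_left_mono) simp
    also have "\<dots> = ennreal ((latw k * (y k / latw k)) powr ?q)"
      using latw_pos[of k] yl by (simp add: um_weight_powr[of ?q] powr_mult ennreal_mult'[symmetric] del: times_divide_eq_right)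
    also have "latw k * (y k / latw k) = y k" using latw_pos[of k] by simp
    finally show ?thesis .
  qed
  have "(\<Sum>\<^sub>\<infinity>k\<in>UNIV. h k) \<le> ennreal B" unfolding infsum_ennreal_eq_SUP
  proof (rule SUP_least)
    fix F :: "(int ^ 'n) set" assume "F \<in> {F. finite F}"
    hence F: "finite F" by simp
    have "sum h F \<le> (\<Sum>k\<in>F. ennreal (y k powr ?q))" by (intro sum_mono h)
    also have "\<dots> = ennreal (\<Sum>k\<in>F. y k powr ?q)" by (simp add: sum_ennreal)
    also have "\<dots> \<le> ennreal B" by (intro ennreal_leI B F)
    finally show "sum h F \<le> ennreal B" .
  qed
  hence "(\<Sum>\<^sub>\<infinity>k\<in>UNIV. h k) < \<infinity>" by (rule order_le_less_trans) simp
  thus ?thesis using False by (simp add: UM_norm_def h_def ennpowr_def top.not_eq_extremum[symmetric])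
qed

theorem theorem4p10:
  fixes \<rho> :: "real ^ 'n \<Rightarrow> real"
    and p q :: ennreal
    and \<epsilon> \<theta> :: real
    and \<mu> :: "real set \<Rightarrow> complex"
    and f :: "real \<Rightarrow> complex"
  assumes "window \<rho>"
    and "1 < p" and "p < \<infinity>"
    and "1 \<le> q"
    and "0 < \<epsilon>"
    and "1 < \<theta>"
    and "complex_measure borel \<mu>"
    and "\<And>l::real. 0 < l \<Longrightarrow>
           (\<integral>\<^sup>+\<xi>. ennreal (um_weight \<theta> (l * \<bar>\<xi>\<bar> powr (1 + \<epsilon>))) \<partial>total_variation borel \<mu>) < \<infinity>"
    and "\<mu> UNIV = 0"
    and "f = inv_fourier_measure \<mu>"
  shows "C_infinity f \<and>
         (\<forall>u :: real ^ 'n \<Rightarrow> real.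
            (\<lambda>x. of_real (u x)) \<in> UM_space \<rho> p q \<longrightarrow> f \<circ> u \<in> UM_space \<rho> p q)"
proof -
  let ?U = units4 and ?\<nu> = "part_measure \<mu>"
  \<comment> \<open>The factor \<open>w\<close> restores the phase of the component that
    \<open>part_measure\<close> has made positive; the square root is the normalisation in
    \<open>inv_fourier_measure\<close>.\<close>
  define c where "c w = of_real (1 / sqrt (2 * pi)) * w" for w :: complex
  note cm = assms(7)
  have fin: "(\<integral>\<^sup>+\<xi>. ennreal (um_weight \<theta> (l * \<bar>\<xi>\<bar> powr (1 + \<epsilon>))) \<partial>?\<nu> w) < \<infinity>" if "w \<in> ?U" "0 < l" for w l
    using part_measure_nn_le[OF cm that(1)] assms(8)[OF that(2)] by (rule order_le_less_trans)
  have fm: "finite_measure (?\<nu> w)" if "w \<in> ?U" for w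
    by (rule part_measure_finite[OF cm that assms(6) assms(8)[of 1]]) simp
  have sb: "sets (?\<nu> w) = sets borel" for w by simp
  have mom: "integrable (?\<nu> w) (\<lambda>\<xi>. \<bar>\<xi>\<bar> ^ m)" if w: "w \<in> ?U" for w m
  proof (rule integrableI_bounded)
    have [measurable_cong]: "sets (?\<nu> w) = sets borel" by (rule sb)
    show "(\<lambda>\<xi>. \<bar>\<xi>\<bar> ^ m) \<in> borel_measurable (?\<nu> w)" by measurable
    have "(\<integral>\<^sup>+\<xi>. ennreal (norm (\<bar>\<xi>\<bar> ^ m)) \<partial>?\<nu> w)
      \<le> (\<integral>\<^sup>+\<xi>. ennreal (exp (real m * exp (real m))) * ennreal (um_weight \<theta> (1 * \<bar>\<xi>\<bar> powr (1 + \<epsilon>))) \<partial>?\<nu> w)"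
      using power_le_weight[OF assms(5,6), of _ m]
      by (intro nn_integral_mono) (simp add: ennreal_mult'[symmetric] ennreal_leI)
    also have "\<dots> = ennreal (exp (real m * exp (real m))) * (\<integral>\<^sup>+\<xi>. ennreal (um_weight \<theta> (1 * \<bar>\<xi>\<bar> powr (1 + \<epsilon>))) \<partial>?\<nu> w)"
      by (rule nn_integral_cmult) measurable
    also have "\<dots> < \<infinity>" using fin[OF w zero_less_one] by (simp add: ennreal_mult_less_top)
    finally show "(\<integral>\<^sup>+\<xi>. ennreal (norm (\<bar>\<xi>\<bar> ^ m)) \<partial>?\<nu> w) < \<infinity>" .
  qed
  define F where "F m t = (\<Sum>w\<in>?U. c w * mexp (?\<nu> w) m t)" for m t
  have dF: "(F m has_vector_derivative F (Suc m) t) (at t)" for m t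
    unfolding F_def
    by (rule has_vector_derivative_sum) (rule has_vector_derivative_mult_right, rule mexp_deriv[OF sb mom])
  have fF: "f = F 0"
    unfolding assms(10) F_def c_def by (rule ext) (rule inv_fourier_measure_units4)
  have smooth: "C_infinity f" unfolding fF by (rule C_infinity_chain[of F], rule dF)
  have fd: "f t = (\<Sum>w\<in>?U. c w * dexp (?\<nu> w) t)" for t
  proof -
    have "(\<Sum>w\<in>?U. c w * dexp (?\<nu> w) t) = (\<Sum>w\<in>?U. c w * mexp (?\<nu> w) 0 t - c w * of_real (measure (?\<nu> w) UNIV))"
      by (intro sum.cong refl) (simp only: dexp_eq[OF fm sb] right_diff_distrib)
    also have "\<dots> = f t - (\<Sum>w\<in>?U. c w * of_real (measure (?\<nu> w) UNIV))"
      unfolding fF F_def by (rule sum_subtractf)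
    also have "(\<Sum>w\<in>?U. c w * of_real (measure (?\<nu> w) UNIV)) = 0"
      unfolding c_def by (rule part_measure_total_balance[OF cm assms(9) fm])
    finally show ?thesis by simp
  qed
  have fcont: "continuous_on UNIV f" unfolding fF
    by (intro continuous_at_imp_continuous_on ballI has_vector_derivative_continuous[OF dF])
  hence fmeas [measurable]: "f \<in> borel_measurable borel" by (rule borel_measurable_continuous_onI)
  define K0 where "K0 = (\<Sum>w\<in>?U. norm (c w) * (\<integral>\<xi>. \<bar>\<xi>\<bar> \<partial>?\<nu> w))"
  have K0: "0 \<le> K0" unfolding K0_def by (intro sum_nonneg mult_nonneg_nonneg Bochner_Integration.integral_nonneg) auto
  \<comment> \<open>Finite first moments and the subtracted constant give a linear bound by
    \<bar>t\<bar>, so that composition with \<open>f\<close> stays in L^p.\<close>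
  have flip: "norm (f t) \<le> K0 * \<bar>t\<bar>" for t
  proof -
    have "norm (f t) \<le> (\<Sum>w\<in>?U. norm (c w) * ((\<integral>\<xi>. \<bar>\<xi>\<bar> \<partial>?\<nu> w) * \<bar>t\<bar>))"
      unfolding fd
    proof (rule sum_norm_le)
      fix w assume w: "w \<in> ?U"
      show "norm (c w * dexp (?\<nu> w) t) \<le> norm (c w) * ((\<integral>\<xi>. \<bar>\<xi>\<bar> \<partial>?\<nu> w) * \<bar>t\<bar>)"
        unfolding norm_mult using mom[OF w, of 1] by (intro mult_left_mono dexp_bound fm w sb) auto
    qed
    thus ?thesis by (simp only: K0_def sum_distrib_right mult.assoc)
  qed
  define r where "r = enn2real p"
  have r1: "1 \<le> r" using assms(2,3) unfolding r_def by (cases p) auto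
  interpret lattice_kernel "sigma \<rho> 0" "real CARD('n)" by (rule window_lattice_kernel[OF assms(1)])
  have "f \<circ> u \<in> UM_space \<rho> p q" if u: "(\<lambda>x. of_real (u x)) \<in> UM_space \<rho> p q" for u :: "real ^ 'n \<Rightarrow> real"
  proof -
    let ?g = "\<lambda>x. complex_of_real (u x)"
    have gL: "?g \<in> Lp_space p" and gU: "UM_norm \<rho> p q ?g < \<infinity>" using u by (auto simp: UM_space_def)
    have gm: "?g \<in> borel_measurable lebesgue" and gf: "Lp_norm p ?g < \<infinity>" using gL by (auto simp: Lp_space_def)
    have um: "u \<in> borel_measurable lebesgue"
    proof -
      have "(\<lambda>x. Re (?g x)) \<in> borel_measurable lebesgue" using gm by measurable
      thus ?thesis by simp
    qed
    obtain g0 where g0 [measurable]: "g0 \<in> borel_measurable borel" and g0e: "AE x in lborel. ?g x = g0 x"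
      using borel_version_complex[OF gm] by blast
    \<comment> \<open>The real part of a Borel representative, since
      \<open>exists_decomposition\<close> needs a function that is real everywhere.\<close>
    define u' where "u' x = Re (g0 x)" for x
    let ?v = "\<lambda>x. complex_of_real (u' x)"
    have vm: "?v \<in> borel_measurable borel" unfolding u'_def by measurable
    have gv: "AE x in lborel. ?g x = ?v x"
      using g0e by eventually_elim (metis Re_complex_of_real u'_def)
    define A' where "A' = enn2real (Lp_norm p ?g)"
    have vlp: "lp_le r ?v A'" unfolding r_def A'_def
      by (rule lp_le_Lp_norm[OF r1[unfolded r_def] assms(3) gf vm gv])
    define D where "D k = dist_Lp_norm p (box_op \<rho> k ?g)" for k
    have D: "D k = Lp_norm p (filt (lattice_point k) ?v)" for k
      unfolding D_def by (rule dist_Lp_norm_box_op[OF assms(1) r1[unfolded r_def] assms(3) gL vm gv])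
    obtain X where Dfin: "\<And>k. D k < \<infinity>" and X: "\<And>k. latw k * enn2real (D k) \<le> X"
      and qB: "q \<noteq> \<infinity> \<Longrightarrow> \<exists>B. \<forall>F. finite F \<longrightarrow> (\<Sum>k\<in>F. (latw k * enn2real (D k)) powr enn2real q) \<le> B"
      using UM_norm_finiteD[OF gU assms(4)] unfolding D_def by blast
    have alp: "lp_le r (filt (lattice_point k) ?v) (enn2real (D k))" for k
      unfolding r_def D
      by (rule lp_le_Lp_norm[OF r1[unfolded r_def] assms(3)]) (use Dfin[of k] vm in \<open>simp_all add: D filt_meas\<close>)
    obtain z Cb u0 where Cb: "0 \<le> Cb" and dec: "decomposition (sigma \<rho> 0) (real CARD('n)) r z (\<lambda>k. Cb * enn2real (D k)) u0"
      and u0: "AE x in lborel. u0 x = u' x"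
      using exists_decomposition[OF r1 vlp alp X] by blast
    interpret dc: decomposition "sigma \<rho> 0" "real CARD('n)" r z "\<lambda>k. Cb * enn2real (D k)" u0 by (rule dec)
    \<comment> \<open>The weighted bounds of the pieces of \<open>u\<close>, a sequence in l^q. Its
      convolution with \<open>cw\<close> is majorised by \<open>Y\<close>, which in turn bounds the
      weighted pieces of \<open>f \<circ> u\<close> up to the constant \<open>K\<close>.\<close>
    define x where "x k = latw k * (Cb * enn2real (D k))" for k
    have x0: "0 \<le> x k" for k using Cb latw_pos[of k] by (simp add: x_def)
    have xe: "x k = Cb * (latw k * enn2real (D k))" for k by (simp add: x_def)
    have xX: "x k \<le> Cb * X" for k unfolding xe by (intro mult_left_mono X Cb)
    obtain S :: real where S: "0 < S" "\<And>F :: (int ^ 'n) set. finite F \<Longrightarrow> (\<Sum>k\<in>F. cw k) \<le> S" using cw_sum_bounded by blast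
    obtain Y
      where Y: "\<forall>j. 0 \<le> Y j \<and> Y j \<le> S * (Cb * X)" "\<forall>j F. finite F \<longrightarrow> (\<Sum>k\<in>F. cw (j - k) * x k) \<le> Y j"
        "\<forall>q B. 1 \<le> q \<longrightarrow> (\<forall>F. finite F \<longrightarrow> (\<Sum>k\<in>F. x k powr q) \<le> B) \<longrightarrow>
          (\<forall>G. finite G \<longrightarrow> (\<Sum>j\<in>G. Y j powr q) \<le> S powr q * B)"
      by (rule exE[OF young_cw[of x "Cb * X" S, OF x0 xX S(1)]], erule S(2), elim conjE, rule that)
    have Y0: "0 \<le> Y j" and YX: "Y j \<le> S * (Cb * X)" for j using Y(1) by blast+
    have Yq: "(\<Sum>j\<in>G. Y j powr enn2real q) \<le> S powr enn2real q * B"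
      if "1 \<le> enn2real q" "\<forall>F. finite F \<longrightarrow> (\<Sum>k\<in>F. x k powr enn2real q) \<le> B" "finite G" for B G
      using Y(3)[rule_format, OF that(1) that(2)[rule_format] that(3)] .
    have U: "finite ?U" by simp
    have "\<exists>K\<ge>0. \<forall>j Y. (\<forall>F. finite F \<longrightarrow> (\<Sum>k\<in>F. cw (j - k) * latw k * (Cb * enn2real (D k))) \<le> Y) \<longrightarrow>
        lp_le r (filt (lattice_point j) (\<lambda>x. \<Sum>w\<in>?U. c w * dexp (?\<nu> w) (u0 x))) (K * (Y / latw j))"
      by (rule dc.composition_estimate_sum[OF assms(5,6) U]) (erule fm, rule sb, erule (1) fin)
    then obtain K where K: "0 \<le> K"
        "\<forall>j Y. (\<forall>F. finite F \<longrightarrow> (\<Sum>k\<in>F. cw (j - k) * latw k * (Cb * enn2real (D k))) \<le> Y) \<longrightarrow>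
          lp_le r (filt (lattice_point j) (\<lambda>x. \<Sum>w\<in>?U. c w * dexp (?\<nu> w) (u0 x))) (K * (Y / latw j))"
      by (elim exE conjE) (rule that)
    have est: "lp_le r (filt (lattice_point j) (\<lambda>x. f (u0 x))) (K * (Y j / latw j))" for j
      unfolding fd by (rule K(2)[rule_format]) (use Y(2) in \<open>simp add: x_def mult.assoc\<close>)
    have u0m [measurable]: "u0 \<in> borel_measurable borel" by (rule dc.u_measurable)
    have fum: "(\<lambda>x. f (u0 x)) \<in> borel_measurable borel" by measurable
    have gu: "AE x in lborel. u x = u0 x" using gv u0
      by eventually_elim (metis of_real_eq_iff)
    have fe: "AE x in lborel. (f \<circ> u) x = f (u0 x)" using gu by eventually_elim simp
    have u0lp: "lp_le r (\<lambda>x. complex_of_real (u0 x)) A'"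
    proof (rule lp_le_AE[OF vlp])
      show "AE x in lborel. norm (complex_of_real (u0 x)) = norm (?v x)" using u0 by eventually_elim simp
    qed measurable
    have flp: "lp_le r (\<lambda>x. f (u0 x)) (K0 * A')"
      by (rule lp_le_dominated[OF r1 u0lp fum K0]) (simp add: flip)
    have fL: "f \<circ> u \<in> Lp_space p"
    proof -
      have "Lp_norm p (f \<circ> u) \<le> ennreal (K0 * A')"
        by (rule Lp_norm_lp_le[OF r1[unfolded r_def] assms(3) flp[unfolded r_def] fe])
      hence "Lp_norm p (f \<circ> u) < \<infinity>" by (rule order_le_less_trans) simp
      moreover have "f \<circ> u \<in> borel_measurable lebesgue" using um fmeas by (rule measurable_comp)
      ultimately show ?thesis by (simp add: Lp_space_def)
    qed
    have "UM_norm \<rho> p q (f \<circ> u) < \<infinity>"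
    proof (rule UM_norm_finiteI[OF assms(4), where y = "\<lambda>j. K * Y j" and X = "K * (S * (Cb * X))"])
      fix j
      have "dist_Lp_norm p (box_op \<rho> j (f \<circ> u)) = Lp_norm p (filt (lattice_point j) (\<lambda>x. f (u0 x)))"
        by (rule dist_Lp_norm_box_op[OF assms(1) r1[unfolded r_def] assms(3) fL fum fe])
      also have "\<dots> \<le> ennreal (K * (Y j / latw j))"
        by (rule Lp_norm_lp_le[OF r1[unfolded r_def] assms(3) est[unfolded r_def]]) simp
      finally show "dist_Lp_norm p (box_op \<rho> j (f \<circ> u)) \<le> ennreal (K * Y j / latw j)" by simp
      show "0 \<le> K * Y j" using K(1) Y0 by simp
      show "K * Y j \<le> K * (S * (Cb * X))" by (intro mult_left_mono YX K(1))
    next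
      assume q: "q \<noteq> \<infinity>"
      have q1: "1 \<le> enn2real q" using q assms(4) by (cases q) auto
      obtain B where B: "\<And>F. finite F \<Longrightarrow> (\<Sum>k\<in>F. (latw k * enn2real (D k)) powr enn2real q) \<le> B" using qB[OF q] by blast
      have xB: "\<forall>F. finite F \<longrightarrow> (\<Sum>k\<in>F. x k powr enn2real q) \<le> Cb powr enn2real q * B"
      proof (intro allI impI)
        fix F :: "(int ^ 'n) set" assume F: "finite F"
        have "(\<Sum>k\<in>F. x k powr enn2real q) = Cb powr enn2real q * (\<Sum>k\<in>F. (latw k * enn2real (D k)) powr enn2real q)"
          unfolding xe sum_distrib_left using Cb latw_pos by (intro sum.cong refl powr_mult)
        also have "\<dots> \<le> Cb powr enn2real q * B" by (intro mult_left_mono B F) simp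
        finally show "(\<Sum>k\<in>F. x k powr enn2real q) \<le> Cb powr enn2real q * B" .
      qed
      have "(\<Sum>j\<in>G. (K * Y j) powr enn2real q) \<le> K powr enn2real q * (S powr enn2real q * (Cb powr enn2real q * B))" if G: "finite G" for G
      proof -
        have "(\<Sum>j\<in>G. (K * Y j) powr enn2real q) = K powr enn2real q * (\<Sum>j\<in>G. Y j powr enn2real q)"
          unfolding sum_distrib_left by (intro sum.cong refl powr_mult K(1) Y0)
        also have "\<dots> \<le> K powr enn2real q * (S powr enn2real q * (Cb powr enn2real q * B))"
          by (intro mult_left_mono Yq[OF q1 xB G]) simp_all
        finally show ?thesis .
      qed
      thus "\<exists>B. \<forall>F. finite F \<longrightarrow> (\<Sum>j\<in>F. (K * Y j) powr enn2real q) \<le> B" by blast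
    qed
    thus ?thesis using fL by (simp add: UM_space_def)
  qed
  thus ?thesis using smooth by blast
qed

end
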